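(* Let $L$ be the universal constant of the three circle lemma for biharmonic functions (one may take $L=3$). There is a constant $\eta_0>0$ such that the following holds. Let $l_1>l_2$ be integers, $\Sigma=\bigcup_{i=l_2}^{l_1}A_i$, and let $u:\Sigma\to\mathbb R^K$ be an $\eta_0$-approximate biharmonic function satisfying $$\int_{\partial B_r}u\,d\theta=0\quad\text{for } r\in[e^{-l_1L},e^{-(l_2-1)L}].$$ Then for every integer $i$ with $l_1>i>l_2$: (a) if $F_{i+1}(u)\le e^{-L}F_i(u)$, then $F_i(u)\le e^{-L}F_{i-1}(u)$; (b) if $F_{i-1}(u)\le e^{-L}F_i(u)$, then $F_i(u)\le e^{-L}F_{i+1}(u)$; (c) either $F_i(u)\le e^{-L}F_{i-1}(u)$ or $F_i(u)\le e^{-L}F_{i+1}(u)$.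
   Context: In $\mathbb R^4$ with polar coordinates $(r,\theta)$: $A_i=B_{e^{-(i-1)L}}\setminus B_{e^{-iL}}$ and $F_i(u)=\int_{A_i}|x|^{-4}|u|^2\,dx$. For $\eta>0$, a smooth $u$ on an annular region $\Omega$ is an $\eta$-approximate biharmonic function if $$\Delta^2u(r,\theta)=a_1\nabla\Delta u+a_2\nabla^2u+a_3\nabla u+a_4u+\frac{1}{|\partial B_r|}\int_{\partial B_r}\big(b_1\nabla\Delta u+b_2\nabla^2u+b_3\nabla u+b_4u\big)d\sigma$$ on $\Omega$, with smooth coefficients satisfying $|a_j(x)|+|b_j(x)|\le\eta|x|^{-j}$ on $\Omega$ for $j=1,\dots,4$. *)

theory Defs
  imports "HOL-Analysis.Analysis"
begin

text \<open>The three circle constant L (the paper allows L = 3).\<close>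
definition Lc :: real where "Lc = 3"

definition pd :: "4 \<Rightarrow> (real^4 \<Rightarrow> 'b::real_normed_vector) \<Rightarrow> real^4 \<Rightarrow> 'b" where
  "pd \<alpha> f x = frechet_derivative f (at x) (axis \<alpha> 1)"

definition smooth_on :: "(real^4) set \<Rightarrow> (real^4 \<Rightarrow> 'b::real_normed_vector) \<Rightarrow> bool" where
  "smooth_on U f \<longleftrightarrow> (\<forall>\<alpha>s :: 4 list. \<forall>x\<in>U. (fold pd \<alpha>s f) differentiable (at x))"

definition grad :: "(real^4 \<Rightarrow> real^'k) \<Rightarrow> real^4 \<Rightarrow> real^4^'k" where
  "grad f x = (\<chi> j \<alpha>. pd \<alpha> f x $ j)"

definition hess :: "(real^4 \<Rightarrow> real^'k) \<Rightarrow> real^4 \<Rightarrow> real^4^4^'k" where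
  "hess f x = (\<chi> j \<alpha> \<beta>. pd \<alpha> (pd \<beta> f) x $ j)"

definition lap :: "(real^4 \<Rightarrow> real^'k) \<Rightarrow> real^4 \<Rightarrow> real^'k" where
  "lap f x = (\<Sum>\<alpha>\<in>UNIV. pd \<alpha> (pd \<alpha> f) x)"

text \<open>Integral over the unit sphere S^3 of g(r theta) with respect to the standard surface
  measure d theta.  Since the library has no surface measure, we use the classical
  identity  int_{S^{n-1}} h d sigma = n * int_{B_1} h(y/|y|) dy  (n = 4) as definition.\<close>
definition ang_int :: "real \<Rightarrow> (real^4 \<Rightarrow> 'b::{banach,second_countable_topology}) \<Rightarrow> 'b" where
  "ang_int r g = 4 *\<^sub>R set_lebesgue_integral lborel (ball 0 1) (\<lambda>y. g (r *\<^sub>R (y /\<^sub>R norm y)))"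

definition surf_int :: "real \<Rightarrow> (real^4 \<Rightarrow> 'b::{banach,second_countable_topology}) \<Rightarrow> 'b" where
  "surf_int r g = (r ^ 3) *\<^sub>R ang_int r g"

definition sphere_area :: "real \<Rightarrow> real" where
  "sphere_area r = r ^ 3 * (4 * measure lborel (ball (0::real^4) 1))"

definition app :: "'t^'k \<Rightarrow> 't::real_inner \<Rightarrow> real^'k" where
  "app c T = (\<chi> i. (c $ i) \<bullet> T)"

definition Ann :: "int \<Rightarrow> (real^4) set" where
  "Ann i = ball 0 (exp (- (real_of_int i - 1) * Lc)) - ball 0 (exp (- real_of_int i * Lc))"

definition F :: "int \<Rightarrow> (real^4 \<Rightarrow> real^'k) \<Rightarrow> real" where
  "F i u = set_lebesgue_integral lborel (Ann i) (\<lambda>x. norm x powr (-4) * (norm (u x))\<^sup>2)"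

definition approx_biharmonic ::
  "real \<Rightarrow> (real^4) set \<Rightarrow> (real^4) set \<Rightarrow> (real^4 \<Rightarrow> real^'k)
   \<Rightarrow> (real^4 \<Rightarrow> real^4^'k^'k) \<Rightarrow> (real^4 \<Rightarrow> real^4^4^'k^'k) \<Rightarrow> (real^4 \<Rightarrow> real^4^'k^'k) \<Rightarrow> (real^4 \<Rightarrow> real^'k^'k)
   \<Rightarrow> (real^4 \<Rightarrow> real^4^'k^'k) \<Rightarrow> (real^4 \<Rightarrow> real^4^4^'k^'k) \<Rightarrow> (real^4 \<Rightarrow> real^4^'k^'k) \<Rightarrow> (real^4 \<Rightarrow> real^'k^'k)
   \<Rightarrow> bool" where
  "approx_biharmonic \<eta> U \<Omega> u a1 a2 a3 a4 b1 b2 b3 b4 \<longleftrightarrow>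
     open U \<and> \<Omega> \<subseteq> U \<and> smooth_on U u \<and>
     smooth_on U a1 \<and> smooth_on U a2 \<and> smooth_on U a3 \<and> smooth_on U a4 \<and>
     smooth_on U b1 \<and> smooth_on U b2 \<and> smooth_on U b3 \<and> smooth_on U b4 \<and>
     (\<forall>x\<in>\<Omega>. norm (a1 x) + norm (b1 x) \<le> \<eta> / norm x ^ 1 \<and>
              norm (a2 x) + norm (b2 x) \<le> \<eta> / norm x ^ 2 \<and>
              norm (a3 x) + norm (b3 x) \<le> \<eta> / norm x ^ 3 \<and>
              norm (a4 x) + norm (b4 x) \<le> \<eta> / norm x ^ 4) \<and>
     (\<forall>x\<in>\<Omega>. lap (lap u) x =
        app (a1 x) (grad (lap u) x) + app (a2 x) (hess u x) + app (a3 x) (grad u x) + app (a4 x) (u x)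
        + (1 / sphere_area (norm x)) *\<^sub>R
          surf_int (norm x) (\<lambda>y. app (b1 y) (grad (lap u) y) + app (b2 y) (hess u y)
                                  + app (b3 y) (grad u y) + app (b4 y) (u y)))"

end

theory Submission
  imports Defs
begin

text \<open>
  With \<open>t = ln |x|\<close>, the radial field \<open>D = x \<bullet> \<nabla>\<close>, the fields \<open>X\<^sub>2, X\<^sub>3, X\<^sub>4\<close> generated by
  left multiplication with the imaginary quaternion units and \<open>S = - X\<^sub>2\<^sup>2 - X\<^sub>3\<^sup>2 - X\<^sub>4\<^sup>2\<close>, one has
  \<open>|x|\<^sup>2 \<Delta> = D\<^sup>2 + 2 D - S\<close>, and \<open>F\<^sub>i\<close> is the integral of the spherical mean of \<open>|u|\<^sup>2\<close> over a
  \<open>t\<close>-interval of length 3. All three claims follow from the single convexity inequality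
  \<open>2 e\<^sup>3 F\<^sub>i \<le> F\<^sub>i\<^sub>-\<^sub>1 + F\<^sub>i\<^sub>+\<^sub>1\<close>, which is proved directly with an error of size \<open>\<eta>\<close>.

  The spherical mean terms of the equation are constant on spheres, hence orthogonal to \<open>u\<close>, to
  \<open>|x|\<^sup>2 \<Delta> u\<close> and to the coordinates, so that only the local terms enter; these are absorbed by
  weighted interior estimates. The component of \<open>u\<close> along the coordinates (the first mode) solves
  \<open>c'''' - 10 c'' + 9 c = g\<close> and is treated by explicit solution. On the orthogonal complement
  \<open>S \<ge> 6\<close>, and testing the equation with a polynomial weight times \<open>u\<close> gives the inequality:
  the coefficients of the weight are chosen such that the resulting quadratic form is
  positive, which is a finite check on polynomials in one variable.
\<close>

section \<open>Smooth functions\<close>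

text \<open>On harmonics of degree k the operator \<open>Pf\<close>, |x|^4 times the bilaplacian,
  has the exponents k, -k, k + 2, -k - 2 in t. The mean condition removes k = 0, whose solutions 1
  and t violate the convexity; for k = 1 the slowest growth exp t would give 2 cosh 6 in place of 2
  e^3, and this gap pays for all errors. Beyond the first mode no harmonics are used. S^3 is the
  group of unit quaternions, and left translations give a global orthogonal frame of isometric
  flows: integration by parts is invariance of the measure, and the spectral gap comes from
  Wirtinger's inequality on one-parameter groups, averaged over the group. This yields 6 where the
  true gap is 8, which suffices. The local terms contain the gradient of the Laplacian, one order
  more than testing with u controls; a second test, with |x|^2 times the Laplacian, supplies it.
  Everything takes place on three consecutive annuli, an interval of length 9 in t, with weights
  that vanish at both ends, so that no boundary data enter.\<close>

lemma pd_cong: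
  assumes "open U" "x \<in> U" "\<And>y. y \<in> U \<Longrightarrow> f y = g y"
  shows "pd \<alpha> f x = pd \<alpha> g x"
proof -
  have "(f has_derivative D) (at x) \<longleftrightarrow> (g has_derivative D) (at x)" for D
    using has_derivative_transform_within_open[OF _ assms(1,2)] assms(3) by metis
  then show ?thesis
    unfolding pd_def frechet_derivative_def by simp
qed

lemma pd_eqI: "(f has_derivative D) (at x) \<Longrightarrow> pd \<alpha> f x = D (axis \<alpha> 1)"
  unfolding pd_def by (metis frechet_derivative_at)

lemma smooth_onD:
  assumes "smooth_on U f"
  shows "x \<in> U \<Longrightarrow> f differentiable (at x)" "smooth_on U (pd \<alpha> f)"
proof -
  show "x \<in> U \<Longrightarrow> f differentiable (at x)"
    using assms[unfolded smooth_on_def, rule_format, of x "[]"] by simp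
  show "smooth_on U (pd \<alpha> f)"
    unfolding smooth_on_def
  proof (intro allI ballI)
    fix \<alpha>s x assume "x \<in> U"
    then show "fold pd \<alpha>s (pd \<alpha> f) differentiable at x"
      using assms[unfolded smooth_on_def, rule_format, of x "\<alpha> # \<alpha>s"] by simp
  qed
qed

text \<open>\<open>smooth_on\<close> quantifies over all lists of derivatives; a class of
  differentiable functions that is closed under \<open>pd\<close> witnesses it, which replaces
  inductions over such lists.\<close>

lemma smooth_on_coinduct:
  assumes "P f"
    and "\<And>g x. P g \<Longrightarrow> x \<in> U \<Longrightarrow> g differentiable (at x)"
    and "\<And>g \<alpha>. P g \<Longrightarrow> P (pd \<alpha> g)"
  shows "smooth_on U f"
proof -
  have "P (fold pd \<alpha>s f)" for \<alpha>s
    using assms(1) by (induction \<alpha>s arbitrary: f) (auto intro: assms(3))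
  then show ?thesis
    unfolding smooth_on_def using assms(2) by blast
qed

lemma smooth_on_subset: "smooth_on U f \<Longrightarrow> V \<subseteq> U \<Longrightarrow> smooth_on V f"
  unfolding smooth_on_def by blast

lemma smooth_on_has_derivative:
  fixes f :: "real^4 \<Rightarrow> real"
  assumes "smooth_on U f" "x \<in> U"
  shows "(f has_derivative (\<lambda>h. \<Sum>\<alpha>\<in>UNIV. h$\<alpha> * pd \<alpha> f x)) (at x)"
proof -
  let ?D = "frechet_derivative f (at x)"
  have D: "(f has_derivative ?D) (at x)"
    using smooth_onD(1)[OF assms] frechet_derivative_works by blast
  then interpret linear ?D
    using has_derivative_linear by blast
  have "?D h = (\<Sum>\<alpha>\<in>UNIV. h$\<alpha> * pd \<alpha> f x)" for h
  proof -
    have "?D h = ?D (\<Sum>\<alpha>\<in>UNIV. h$\<alpha> *\<^sub>R axis \<alpha> 1)"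
      by (simp add: basis_expansion[of h, unfolded scalar_mult_eq_scaleR])
    also have "\<dots> = (\<Sum>\<alpha>\<in>UNIV. h$\<alpha> * pd \<alpha> f x)"
      by (simp add: sum scale pd_def)
    finally show ?thesis .
  qed
  then have "?D = (\<lambda>h. \<Sum>\<alpha>\<in>UNIV. h$\<alpha> * pd \<alpha> f x)" by auto
  with D show ?thesis by simp
qed

lemma smooth_on_continuous_on:
  assumes "smooth_on U f"
  shows "continuous_on U f"
  using smooth_onD(1)[OF assms]
  by (meson continuous_at_imp_continuous_on differentiable_imp_continuous_within)

text \<open>The class of products of two smooth functions is not closed under \<open>pd\<close>, but
  the algebra generated by the smooth functions is. The rule \<open>cong\<close> is there because
  the Leibniz rule holds only on \<open>U\<close>, while \<open>pd\<close> may be anything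
  elsewhere.\<close>

inductive smooth_alg :: "(real^4) set \<Rightarrow> (real^4 \<Rightarrow> real) \<Rightarrow> bool" for U where
  base: "smooth_on U f \<Longrightarrow> smooth_alg U f"
| add: "smooth_alg U f \<Longrightarrow> smooth_alg U g \<Longrightarrow> smooth_alg U (\<lambda>x. f x + g x)"
| mult: "smooth_alg U f \<Longrightarrow> smooth_alg U g \<Longrightarrow> smooth_alg U (\<lambda>x. f x * g x)"
| cong: "smooth_alg U f \<Longrightarrow> (\<And>x. x \<in> U \<Longrightarrow> g x = f x) \<Longrightarrow> smooth_alg U g"

lemma pd_add:
  assumes "f differentiable (at x)" "g differentiable (at x)"
  shows "pd \<alpha> (\<lambda>x. f x + g x) x = pd \<alpha> f x + pd \<alpha> g x"
proof -
  have "((\<lambda>x. f x + g x) has_derivative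
      (\<lambda>h. frechet_derivative f (at x) h + frechet_derivative g (at x) h)) (at x)"
    using assms unfolding frechet_derivative_works by (rule has_derivative_add)
  from pd_eqI[OF this, of \<alpha>] show ?thesis by (simp add: pd_def)
qed

lemma pd_mult:
  fixes f g :: "real^4 \<Rightarrow> real"
  assumes "f differentiable (at x)" "g differentiable (at x)"
  shows "pd \<alpha> (\<lambda>x. f x * g x) x = pd \<alpha> f x * g x + f x * pd \<alpha> g x"
proof -
  have "((\<lambda>x. f x * g x) has_derivative
      (\<lambda>h. f x * frechet_derivative g (at x) h + frechet_derivative f (at x) h * g x)) (at x)"
    using assms unfolding frechet_derivative_works by (rule has_derivative_mult)
  from pd_eqI[OF this, of \<alpha>] show ?thesis by (simp add: pd_def)
qed

lemma smooth_alg_closed: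
  assumes "open U" "smooth_alg U f"
  shows "(\<forall>x\<in>U. f differentiable (at x)) \<and> (\<forall>\<alpha>. smooth_alg U (pd \<alpha> f))"
  using assms(2)
proof induction
  case (base f)
  then show ?case using smooth_onD smooth_alg.base by blast
next
  case (add f g)
  then have "smooth_alg U (\<lambda>x. pd \<alpha> f x + pd \<alpha> g x)" for \<alpha>
    by (simp add: smooth_alg.add)
  then have "smooth_alg U (pd \<alpha> (\<lambda>x. f x + g x))" for \<alpha>
    by (rule smooth_alg.cong) (simp add: pd_add add)
  with add show ?case by (auto intro: differentiable_add)
next
  case (mult f g)
  then have "smooth_alg U (\<lambda>x. pd \<alpha> f x * g x + f x * pd \<alpha> g x)" for \<alpha>
    by (simp add: smooth_alg.add smooth_alg.mult)
  then have "smooth_alg U (pd \<alpha> (\<lambda>x. f x * g x))" for \<alpha>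
    by (rule smooth_alg.cong) (simp add: pd_mult mult)
  with mult show ?case by (auto intro: differentiable_mult)
next
  case (cong f g)
  have "smooth_alg U (pd \<alpha> f)" for \<alpha> using cong.IH by blast
  then have "smooth_alg U (pd \<alpha> g)" for \<alpha>
    by (rule smooth_alg.cong) (erule pd_cong[OF assms(1)], erule cong.hyps(2))
  moreover have "g differentiable (at x)" if "x \<in> U" for x
  proof -
    have "f differentiable (at x)" using cong.IH that by simp
    then obtain D where "(f has_derivative D) (at x)"
      unfolding differentiable_def ..
    then have "(g has_derivative D) (at x)"
      by (rule has_derivative_transform_within_open[OF _ assms(1) that]) (simp add: cong.hyps)
    then show ?thesis unfolding differentiable_def by blast
  qed
  ultimately show ?case by blast
qed

lemma smooth_alg_imp_smooth: "open U \<Longrightarrow> smooth_alg U f \<Longrightarrow> smooth_on U f"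
  using smooth_alg_closed by (blast intro: smooth_on_coinduct[where P = "smooth_alg U"])

lemma smooth_on_const: "smooth_on U (\<lambda>x. c::real)"
proof (rule smooth_on_coinduct[where P = "\<lambda>f. \<exists>c::real. f = (\<lambda>x. c)"])
  fix g :: "real^4 \<Rightarrow> real" and \<alpha> assume "\<exists>c. g = (\<lambda>x. c)"
  then show "\<exists>c. pd \<alpha> g = (\<lambda>x. c)"
    by (auto intro!: exI[of _ 0] simp: pd_def frechet_derivative_const)
qed auto

lemma pd_coord: "pd \<alpha> (\<lambda>x. x$i) x = (if \<alpha> = i then 1 else 0::real)"
proof -
  have "((\<lambda>x::real^4. x$i) has_derivative (\<lambda>h. h$i)) (at x)"
    by (intro bounded_linear_imp_has_derivative bounded_linear_vec_nth)
  from pd_eqI[OF this, of \<alpha>] show ?thesis by (simp add: axis_def)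
qed

lemma smooth_on_coord: "smooth_on U (\<lambda>x. x$i)"
proof (rule smooth_on_coinduct[where P = "\<lambda>f. f = (\<lambda>x. x$i) \<or> (\<exists>c::real. f = (\<lambda>x. c))"])
  fix g :: "real^4 \<Rightarrow> real" and \<alpha> assume "g = (\<lambda>x. x$i) \<or> (\<exists>c. g = (\<lambda>x. c))"
  then show "pd \<alpha> g = (\<lambda>x. x$i) \<or> (\<exists>c. pd \<alpha> g = (\<lambda>x. c))"
  proof
    assume "g = (\<lambda>x. x$i)"
    then have "pd \<alpha> g = (\<lambda>x. if \<alpha> = i then 1 else 0)" using pd_coord by blast
    then show ?thesis by blast
  next
    assume "\<exists>c. g = (\<lambda>x. c)"
    then have "pd \<alpha> g = (\<lambda>x. 0)" by (auto simp: pd_def frechet_derivative_const)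
    then show ?thesis by blast
  qed
next
  fix g :: "real^4 \<Rightarrow> real" and x assume "g = (\<lambda>x. x$i) \<or> (\<exists>c. g = (\<lambda>x. c))"
  moreover have "(\<lambda>x::real^4. x$i) differentiable at x"
    by (intro bounded_linear_imp_differentiable bounded_linear_vec_nth)
  ultimately show "g differentiable at x" by auto
qed auto

context
  fixes U :: "(real^4) set"
  assumes U: "open U"
begin

lemma smooth_on_cong:
  "smooth_on U f \<Longrightarrow> (\<And>x. x \<in> U \<Longrightarrow> g x = (f x::real)) \<Longrightarrow> smooth_on U g"
  by (meson U smooth_alg.base smooth_alg.cong smooth_alg_imp_smooth)

lemma smooth_on_add: "smooth_on U f \<Longrightarrow> smooth_on U g \<Longrightarrow> smooth_on U (\<lambda>x. f x + g x::real)"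
  by (simp add: U smooth_alg.add smooth_alg.base smooth_alg_imp_smooth)

lemma smooth_on_mult: "smooth_on U f \<Longrightarrow> smooth_on U g \<Longrightarrow> smooth_on U (\<lambda>x. f x * g x::real)"
  by (simp add: U smooth_alg.mult smooth_alg.base smooth_alg_imp_smooth)

lemma smooth_on_diff:
  assumes "smooth_on U f" "smooth_on U g"
  shows "smooth_on U (\<lambda>x. f x - g x::real)"
  using smooth_on_add[OF assms(1) smooth_on_mult[OF smooth_on_const[of U "-1"] assms(2)]] by simp

lemma smooth_on_sum:
  assumes "\<And>i. i \<in> I \<Longrightarrow> smooth_on U (f i)"
  shows "smooth_on U (\<lambda>x. \<Sum>i\<in>I. f i x::real)"
  using assms by (induction I rule: infinite_finite_induct) (auto intro: smooth_on_add smooth_on_const)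

end

section \<open>Symmetry of second derivatives\<close>

lemma smooth_line_deriv:
  fixes f :: "real^4 \<Rightarrow> real"
  assumes "smooth_on U f" "x + s *\<^sub>R axis \<alpha> 1 \<in> U"
  shows "((\<lambda>s. f (x + s *\<^sub>R axis \<alpha> 1)) has_real_derivative pd \<alpha> f (x + s *\<^sub>R axis \<alpha> 1)) (at s)"
proof -
  let ?y = "x + s *\<^sub>R axis \<alpha> 1" and ?F = "\<lambda>h. \<Sum>\<beta>\<in>UNIV. h$\<beta> * pd \<beta> f (x + s *\<^sub>R axis \<alpha> 1)"
  have "((\<lambda>s. x + s *\<^sub>R axis \<alpha> 1) has_derivative (\<lambda>h. h *\<^sub>R axis \<alpha> 1)) (at s)"
    by (auto intro!: derivative_eq_intros)
  from has_derivative_compose[OF this smooth_on_has_derivative[OF assms]]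
  have "((\<lambda>s. f (x + s *\<^sub>R axis \<alpha> 1)) has_derivative (\<lambda>h. ?F (h *\<^sub>R axis \<alpha> 1))) (at s)" .
  moreover have "?F (h *\<^sub>R axis \<alpha> 1) = pd \<alpha> f ?y * h" for h
  proof -
    have "?F (h *\<^sub>R axis \<alpha> 1) = (\<Sum>\<beta>\<in>UNIV. if \<beta> = \<alpha> then pd \<alpha> f ?y * h else 0)"
      by (rule sum.cong) (auto simp: axis_def)
    then show ?thesis by simp
  qed
  ultimately show ?thesis
    by (simp add: has_field_derivative_def)
qed

text \<open>The mean value theorem in direction \<alpha> and after that in direction \<beta>. The
  second difference on the left is symmetric in \<alpha> and \<beta>, the derivative on the right is
  not known to be; \<open>pd_commute\<close> exploits this.\<close>

lemma second_difference:
  fixes f :: "real^4 \<Rightarrow> real"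
  assumes f: "smooth_on (ball x r) f" and h: "0 < h" "2 * h < r"
  shows "\<exists>y\<in>ball x (2*h). f (x + h *\<^sub>R axis \<alpha> 1 + h *\<^sub>R axis \<beta> 1) - f (x + h *\<^sub>R axis \<alpha> 1)
     - f (x + h *\<^sub>R axis \<beta> 1) + f x = h * h * pd \<beta> (pd \<alpha> f) y"
proof -
  let ?a = "axis \<alpha> 1 :: real^4" and ?b = "axis \<beta> 1 :: real^4"
  have inb: "x + s *\<^sub>R ?a + t *\<^sub>R ?b \<in> ball x (2*e)" if "\<bar>s\<bar> \<le> e" "\<bar>t\<bar> < e" for s t e
  proof -
    have "norm (s *\<^sub>R ?a + t *\<^sub>R ?b) < 2 * e"
      using that norm_triangle_ineq[of "s *\<^sub>R ?a" "t *\<^sub>R ?b"] by (simp add: norm_axis_1)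
    then show ?thesis
      by (simp only: mem_ball dist_norm add.assoc norm_minus_commute[of x]) simp
  qed
  \<comment> \<open>\<open>inb\<close> asks for one strict bound, so the closed square of side h is
    placed into a slightly larger one.\<close>
  obtain e where e: "h < e" "2 * e < r" using h by (metis dense field_sum_of_halves less_divide_eq_numeral1(1) mult.commute)
  have inr: "x + s *\<^sub>R ?a + t *\<^sub>R ?b \<in> ball x r" if "\<bar>s\<bar> \<le> h" "\<bar>t\<bar> \<le> h" for s t
    using inb[of s e t] that e by auto
  let ?p = "\<lambda>s. f (x + s *\<^sub>R ?a + h *\<^sub>R ?b) - f (x + s *\<^sub>R ?a)"
  have "\<exists>s. 0 < s \<and> s < h \<and> ?p h - ?p 0 = (h - 0) * (pd \<alpha> f (x + s *\<^sub>R ?a + h *\<^sub>R ?b) - pd \<alpha> f (x + s *\<^sub>R ?a))"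
  proof (rule MVT2[OF h(1)])
    fix s assume s: "0 \<le> s" "s \<le> h"
    have 1: "x + h *\<^sub>R ?b + s *\<^sub>R ?a \<in> ball x r" "x + s *\<^sub>R ?a \<in> ball x r"
      using inr[of s h] inr[of s 0] s by (auto simp: algebra_simps)
    show "(?p has_real_derivative pd \<alpha> f (x + s *\<^sub>R ?a + h *\<^sub>R ?b) - pd \<alpha> f (x + s *\<^sub>R ?a)) (at s)"
      using DERIV_diff[OF smooth_line_deriv[OF f 1(1)] smooth_line_deriv[OF f 1(2)]]
      by (simp add: add.commute add.left_commute)
  qed
  then obtain s where s: "0 < s" "s < h" and
    eq: "?p h - ?p 0 = h * (pd \<alpha> f (x + s *\<^sub>R ?a + h *\<^sub>R ?b) - pd \<alpha> f (x + s *\<^sub>R ?a))" by auto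
  let ?g = "\<lambda>t. pd \<alpha> f (x + s *\<^sub>R ?a + t *\<^sub>R ?b)"
  have "\<exists>t. 0 < t \<and> t < h \<and> ?g h - ?g 0 = (h - 0) * pd \<beta> (pd \<alpha> f) (x + s *\<^sub>R ?a + t *\<^sub>R ?b)"
  proof (rule MVT2[OF h(1)])
    fix t assume "0 \<le> t" "t \<le> h"
    then have "x + s *\<^sub>R ?a + t *\<^sub>R ?b \<in> ball x r" using inr[of s t] s by auto
    then show "(?g has_real_derivative pd \<beta> (pd \<alpha> f) (x + s *\<^sub>R ?a + t *\<^sub>R ?b)) (at t)"
      by (rule smooth_line_deriv[OF smooth_onD(2)[OF f]])
  qed
  then obtain t where t: "0 < t" "t < h" and "?g h - ?g 0 = h * pd \<beta> (pd \<alpha> f) (x + s *\<^sub>R ?a + t *\<^sub>R ?b)" by auto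
  then have "?p h - ?p 0 = h * h * pd \<beta> (pd \<alpha> f) (x + s *\<^sub>R ?a + t *\<^sub>R ?b)" using eq by simp
  moreover have "x + s *\<^sub>R ?a + t *\<^sub>R ?b \<in> ball x (2*h)" using inb[of s h t] s t by auto
  ultimately show ?thesis by (auto intro!: bexI)
qed

text \<open>Both mixed derivatives attain the same value, the second difference divided by h^2, at
  points within 2 h of x; continuity at x leaves no room for a difference.\<close>

lemma pd_commute:
  fixes f :: "real^4 \<Rightarrow> real"
  assumes U: "open U" and f: "smooth_on U f" and x: "x \<in> U"
  shows "pd \<alpha> (pd \<beta> f) x = pd \<beta> (pd \<alpha> f) x"
proof (rule ccontr)
  define e where "e = \<bar>pd \<alpha> (pd \<beta> f) x - pd \<beta> (pd \<alpha> f) x\<bar> / 2"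
  assume "\<not> ?thesis"
  then have e: "e > 0" unfolding e_def by auto
  obtain r where r: "r > 0" "ball x r \<subseteq> U" using U x openE by blast
  have fr: "smooth_on (ball x r) f" using f r smooth_on_subset by blast
  have c: "isCont (pd \<alpha> (pd \<beta> f)) x" for \<alpha> \<beta>
    by (rule continuous_on_interior[OF smooth_on_continuous_on[OF smooth_onD(2)[OF smooth_onD(2)[OF f]]]])
       (use U x in \<open>simp add: interior_open\<close>)
  obtain d1 d2 where d: "d1 > 0" "d2 > 0"
    and d1: "\<And>y. dist y x < d1 \<Longrightarrow> dist (pd \<alpha> (pd \<beta> f) y) (pd \<alpha> (pd \<beta> f) x) < e"
    and d2: "\<And>y. dist y x < d2 \<Longrightarrow> dist (pd \<beta> (pd \<alpha> f) y) (pd \<beta> (pd \<alpha> f) x) < e"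
    using c e unfolding continuous_at_eps_delta by metis
  define h where "h = min (min d1 d2) r / 4"
  have h: "h > 0" "2*h < r" "2*h < d1" "2*h < d2" using d r unfolding h_def by auto
  obtain y where y: "y \<in> ball x (2*h)" and ye: "f (x + h *\<^sub>R axis \<alpha> 1 + h *\<^sub>R axis \<beta> 1) - f (x + h *\<^sub>R axis \<alpha> 1)
     - f (x + h *\<^sub>R axis \<beta> 1) + f x = h * h * pd \<beta> (pd \<alpha> f) y"
    using second_difference[OF fr h(1,2), of \<alpha> \<beta>] by auto
  obtain z where z: "z \<in> ball x (2*h)" and ze: "f (x + h *\<^sub>R axis \<beta> 1 + h *\<^sub>R axis \<alpha> 1) - f (x + h *\<^sub>R axis \<beta> 1)
     - f (x + h *\<^sub>R axis \<alpha> 1) + f x = h * h * pd \<alpha> (pd \<beta> f) z"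
    using second_difference[OF fr h(1,2), of \<beta> \<alpha>] by auto
  have eq: "x + h *\<^sub>R axis \<beta> 1 + h *\<^sub>R axis \<alpha> 1 = x + h *\<^sub>R axis \<alpha> 1 + h *\<^sub>R axis \<beta> 1"
    by (simp add: algebra_simps)
  have "h * h * pd \<alpha> (pd \<beta> f) z = h * h * pd \<beta> (pd \<alpha> f) y"
    using ye ze unfolding eq by linarith
  then have "pd \<alpha> (pd \<beta> f) z = pd \<beta> (pd \<alpha> f) y" using h by simp
  moreover have "dist z x < d1" "dist y x < d2" using y z h by (auto simp: dist_commute)
  ultimately show False
    using d1[of z] d2[of y] unfolding e_def dist_real_def by (smt (verit) field_sum_of_halves)
qed

section \<open>Quaternionic vector fields\<close>

text \<open>Hamilton's product, with component 1 as real part. The fields given by the three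
  imaginary units span every tangent space of a sphere about 0, so that no charts are
  needed.\<close>

definition qm :: "real^4 \<Rightarrow> real^4 \<Rightarrow> real^4" where
  "qm p x = vector [p$1*x$1 - p$2*x$2 - p$3*x$3 - p$4*x$4, p$1*x$2 + p$2*x$1 + p$3*x$4 - p$4*x$3,
     p$1*x$3 - p$2*x$4 + p$3*x$1 + p$4*x$2, p$1*x$4 + p$2*x$3 - p$3*x$2 + p$4*x$1]"

lemma vector_4':
  "(vector [a,b,c,d] :: 'a::zero^4)$1 = a" "(vector [a,b,c,d] :: 'a^4)$2 = b"
  "(vector [a,b,c,d] :: 'a^4)$3 = c" "(vector [a,b,c,d] :: 'a^4)$4 = d"
  unfolding vector_def by simp_all

lemma qm_nth [simp]:
  "qm p x $ 1 = p$1*x$1 - p$2*x$2 - p$3*x$3 - p$4*x$4"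
  "qm p x $ 2 = p$1*x$2 + p$2*x$1 + p$3*x$4 - p$4*x$3"
  "qm p x $ 3 = p$1*x$3 - p$2*x$4 + p$3*x$1 + p$4*x$2"
  "qm p x $ 4 = p$1*x$4 + p$2*x$3 - p$3*x$2 + p$4*x$1"
  unfolding qm_def by (simp_all only: vector_4')

definition Xf :: "real^4 \<Rightarrow> (real^4 \<Rightarrow> real) \<Rightarrow> real^4 \<Rightarrow> real" where
  "Xf p f x = (\<Sum>\<alpha>\<in>UNIV. qm p x $ \<alpha> * pd \<alpha> f x)"

abbreviation qb :: "4 \<Rightarrow> real^4" where "qb k \<equiv> axis k 1"
abbreviation Df :: "(real^4 \<Rightarrow> real) \<Rightarrow> real^4 \<Rightarrow> real" where "Df \<equiv> Xf (qb 1)"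

definition Sf :: "(real^4 \<Rightarrow> real) \<Rightarrow> real^4 \<Rightarrow> real" where
  "Sf f x = - (Xf (qb 2) (Xf (qb 2) f) x + Xf (qb 3) (Xf (qb 3) f) x + Xf (qb 4) (Xf (qb 4) f) x)"

lemma four_neq [simp]: "(1::4) \<noteq> 2" "(1::4) \<noteq> 3" "(1::4) \<noteq> 4" "(2::4) \<noteq> 3" "(2::4) \<noteq> 4" "(3::4) \<noteq> 4"
  "(2::4) \<noteq> 1" "(3::4) \<noteq> 1" "(4::4) \<noteq> 1" "(3::4) \<noteq> 2" "(4::4) \<noteq> 2" "(4::4) \<noteq> 3"
  by simp_all

lemma vec4_eq_iff: "x = y \<longleftrightarrow> x$1 = y$1 \<and> x$2 = y$2 \<and> x$3 = y$3 \<and> x$4 = (y::real^4)$4"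
  by (simp add: vec_eq_iff forall_4)

lemma norm4: "(norm (x::real^4))\<^sup>2 = (x$1)\<^sup>2 + (x$2)\<^sup>2 + (x$3)\<^sup>2 + (x$4)\<^sup>2"
  unfolding power2_norm_eq_inner inner_vec_def sum_4 by (simp add: power2_eq_square)

lemma norm_qm: "norm (qm p x) = norm p * norm x"
proof -
  have "(norm (qm p x))\<^sup>2 = (norm p * norm x)\<^sup>2"
    unfolding power_mult_distrib norm4 by simp algebra
  then show ?thesis by (simp add: power2_eq_iff_nonneg)
qed

lemma qm_assoc: "qm p (qm q x) = qm (qm p q) x"
  unfolding vec4_eq_iff qm_nth by (intro conjI; algebra)

lemma qm_one [simp]: "qm (qb 1) x = x" "qm x (qb 1) = x"
  unfolding vec4_eq_iff qm_nth by (simp_all add: axis_def)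

lemma linear_qm: "linear (qm p)" "linear (\<lambda>p. qm p x)"
  by (unfold linear_iff vec4_eq_iff qm_nth) (simp_all add: algebra_simps)

lemma qm_simps:
  "qm p (x + y) = qm p x + qm p y" "qm (p + q) x = qm p x + qm q x"
  "qm p (c *\<^sub>R x) = c *\<^sub>R qm p x" "qm (c *\<^sub>R p) x = c *\<^sub>R qm p x"
  "qm (p - q) x = qm p x - qm q x" "qm p (- x) = - qm p x" "qm (- p) x = - qm p x" "qm 0 x = 0"
  unfolding vec4_eq_iff qm_nth by (simp_all add: algebra_simps)

lemma orthogonal_qm: "norm p = 1 \<Longrightarrow> orthogonal_transformation (qm p)"
  and orthogonal_qm': "norm x = 1 \<Longrightarrow> orthogonal_transformation (\<lambda>p. qm p x)"
  by (simp_all add: orthogonal_transformation linear_qm norm_qm)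

lemma axis_sum: "(\<Sum>a\<in>UNIV. axis \<alpha> 1 $ a * c a) = (c (\<alpha>::'n::finite)::real)"
proof -
  have "(\<Sum>a\<in>UNIV. axis \<alpha> 1 $ a * c a) = (\<Sum>a\<in>UNIV. if a = \<alpha> then c a else 0)"
    by (rule sum.cong) (auto simp: axis_def)
  then show ?thesis by simp
qed

lemma Xf_4: "Xf p f x = qm p x $ 1 * pd 1 f x + qm p x $ 2 * pd 2 f x + qm p x $ 3 * pd 3 f x
    + qm p x $ 4 * pd 4 f x"
  unfolding Xf_def by (simp add: sum_4)

lemma Xf_linear: "Xf p f x = p$1 * Df f x + p$2 * Xf (qb 2) f x + p$3 * Xf (qb 3) f x + p$4 * Xf (qb 4) f x"
  unfolding Xf_4 qm_nth by (simp add: axis_def algebra_simps)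

lemma Xf_eqI:
  assumes "(f has_derivative D) (at x)"
  shows "Xf p f x = D (qm p x)"
proof -
  interpret linear D using assms has_derivative_linear by blast
  have "D (qm p x) = D (\<Sum>\<alpha>\<in>UNIV. qm p x$\<alpha> *\<^sub>R axis \<alpha> 1)"
    by (simp only: basis_expansion[of "qm p x", unfolded scalar_mult_eq_scaleR])
  then show ?thesis
    unfolding Xf_def pd_eqI[OF assms] by (simp add: sum scale)
qed

lemma Xf_const: "Xf p (\<lambda>x. c) x = 0"
  unfolding Xf_4 by (simp add: pd_def frechet_derivative_const)

lemma Xf_coord: "Xf p (\<lambda>x. x$i) x = qm p x $ i"
proof -
  have "((\<lambda>x::real^4. x$i) has_derivative (\<lambda>h. h$i)) (at x)"
    by (intro bounded_linear_imp_has_derivative bounded_linear_vec_nth)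
  from Xf_eqI[OF this] show ?thesis .
qed

context
  fixes U :: "(real^4) set"
  assumes U: "open U"
begin

lemma Xf_cong: "(\<And>y. y \<in> U \<Longrightarrow> f y = g y) \<Longrightarrow> x \<in> U \<Longrightarrow> Xf p f x = Xf p g x"
  unfolding Xf_def using pd_cong[OF U] by (metis (no_types, lifting) sum.cong)

lemma smooth_qm: "smooth_on U (\<lambda>x. qm p x $ \<alpha>)"
proof -
  have "\<forall>\<alpha>. smooth_on U (\<lambda>x. qm p x $ \<alpha>)"
    unfolding forall_4 qm_nth
    by (intro conjI smooth_on_add[OF U] smooth_on_diff[OF U] smooth_on_mult[OF U] smooth_on_const smooth_on_coord)
  then show ?thesis by blast
qed

lemma smooth_Xf: "smooth_on U f \<Longrightarrow> smooth_on U (Xf p f)"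
  unfolding Xf_def[abs_def]
  by (intro smooth_on_sum[OF U] smooth_on_mult[OF U] smooth_qm smooth_onD(2))

lemma smooth_Sf: "smooth_on U f \<Longrightarrow> smooth_on U (Sf f)"
  unfolding Sf_def[abs_def]
  by (rule smooth_on_cong[OF U smooth_on_mult[OF U smooth_on_const[of U "-1"]
       smooth_on_add[OF U smooth_on_add[OF U]]]])
     (auto intro!: smooth_Xf)

lemma Xf_add:
  assumes "smooth_on U f" "smooth_on U g" "x \<in> U"
  shows "Xf p (\<lambda>x. f x + g x) x = Xf p f x + Xf p g x"
  by (simp add: Xf_def pd_add smooth_onD(1)[OF assms(1,3)] smooth_onD(1)[OF assms(2,3)]
      distrib_left sum.distrib)

lemma Xf_mult:
  assumes "smooth_on U f" "smooth_on U g" "x \<in> U"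
  shows "Xf p (\<lambda>x. f x * g x) x = Xf p f x * g x + f x * Xf p g x"
  by (simp add: Xf_def pd_mult smooth_onD(1)[OF assms(1,3)] smooth_onD(1)[OF assms(2,3)]
      distrib_left sum.distrib sum_distrib_left sum_distrib_right mult_ac)

lemma Xf_cmult:
  assumes "smooth_on U f" "x \<in> U"
  shows "Xf p (\<lambda>x. c * f x) x = c * Xf p f x"
  by (subst Xf_mult[OF smooth_on_const assms]) (simp add: Xf_const)

lemma Xf_diff:
  assumes "smooth_on U f" "smooth_on U g" "x \<in> U"
  shows "Xf p (\<lambda>x. f x - g x) x = Xf p f x - Xf p g x"
  using Xf_add[OF assms(1) smooth_on_mult[OF U smooth_on_const[of U "-1"] assms(2)] assms(3)]
    Xf_cmult[OF assms(2,3), of p "-1"] by simp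

text \<open>The second order part of \<open>Xf p (Xf q f)\<close> is symmetric, so commutators of the fields are
  governed by commutators of quaternions.\<close>

lemma Xf_Xf:
  assumes f: "smooth_on U f" and x: "x \<in> U"
  shows "Xf p (Xf q f) x = (\<Sum>\<alpha>\<in>UNIV. \<Sum>\<beta>\<in>UNIV. qm p x $ \<alpha> * qm q x $ \<beta> * pd \<alpha> (pd \<beta> f) x) + Xf (qm q p) f x"
proof -
  have "pd \<alpha> (Xf q f) x = (\<Sum>\<beta>\<in>UNIV. qm q (axis \<alpha> 1) $ \<beta> * pd \<beta> f x + qm q x $ \<beta> * pd \<alpha> (pd \<beta> f) x)" for \<alpha>
  proof -
    have "((\<lambda>x. qm q x $ \<beta>) has_derivative (\<lambda>h. qm q h $ \<beta>)) (at x)" for \<beta>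
      by (rule has_derivative_compose[OF bounded_linear_imp_has_derivative
            bounded_linear_imp_has_derivative[OF bounded_linear_vec_nth]])
         (simp add: linear_qm linear_conv_bounded_linear[symmetric])
    moreover have "(pd \<beta> f has_derivative (\<lambda>h. \<Sum>\<alpha>\<in>UNIV. h$\<alpha> * pd \<alpha> (pd \<beta> f) x)) (at x)" for \<beta>
      by (rule smooth_on_has_derivative[OF smooth_onD(2)[OF f] x])
    ultimately have "(Xf q f has_derivative (\<lambda>h. \<Sum>\<beta>\<in>UNIV. qm q x $ \<beta> * (\<Sum>\<alpha>\<in>UNIV. h$\<alpha> * pd \<alpha> (pd \<beta> f) x) +
        qm q h $ \<beta> * pd \<beta> f x)) (at x)"
      unfolding Xf_def[abs_def] by (intro has_derivative_sum has_derivative_mult)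
    from pd_eqI[OF this] show ?thesis
      unfolding axis_sum by (simp only: add.commute)
  qed
  then have "Xf p (Xf q f) x = (\<Sum>\<alpha>\<in>UNIV. \<Sum>\<beta>\<in>UNIV. qm p x $ \<alpha> * (qm q (axis \<alpha> 1) $ \<beta> * pd \<beta> f x + qm q x $ \<beta> * pd \<alpha> (pd \<beta> f) x))"
    unfolding Xf_def[of p "Xf q f"] by (simp add: sum_distrib_left)
  also have "\<dots> = (\<Sum>\<alpha>\<in>UNIV. \<Sum>\<beta>\<in>UNIV. qm p x $ \<alpha> * qm q x $ \<beta> * pd \<alpha> (pd \<beta> f) x)
      + (\<Sum>\<alpha>\<in>UNIV. \<Sum>\<beta>\<in>UNIV. qm p x $ \<alpha> * qm q (axis \<alpha> 1) $ \<beta> * pd \<beta> f x)"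
    by (simp add: algebra_simps sum.distrib)
  also have "(\<Sum>\<alpha>\<in>UNIV. \<Sum>\<beta>\<in>UNIV. qm p x $ \<alpha> * qm q (axis \<alpha> 1) $ \<beta> * pd \<beta> f x) = Xf (qm q p) f x"
    unfolding Xf_4 qm_assoc[symmetric] by (simp add: sum_4 axis_def algebra_simps)
  finally show ?thesis .
qed

lemma Xf_commutator:
  assumes f: "smooth_on U f" and x: "x \<in> U"
  shows "Xf p (Xf q f) x = Xf q (Xf p f) x + Xf (qm q p - qm p q) f x"
proof -
  have "(\<Sum>\<alpha>\<in>UNIV. \<Sum>\<beta>\<in>UNIV. qm p x $ \<alpha> * qm q x $ \<beta> * pd \<alpha> (pd \<beta> f) x)
    = (\<Sum>\<beta>\<in>UNIV. \<Sum>\<alpha>\<in>UNIV. qm q x $ \<beta> * qm p x $ \<alpha> * pd \<beta> (pd \<alpha> f) x)"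
    by (subst sum.swap, intro sum.cong refl, subst pd_commute[OF U f x]) simp
  moreover have "Xf (qm q p - qm p q) f x = Xf (qm q p) f x - Xf (qm p q) f x"
    by (simp add: Xf_def qm_simps left_diff_distrib sum_subtractf)
  ultimately show ?thesis using Xf_Xf[OF f x, of p q] Xf_Xf[OF f x, of q p] by simp
qed

lemma D_X_commute: "smooth_on U f \<Longrightarrow> x \<in> U \<Longrightarrow> Df (Xf p f) x = Xf p (Df f) x"
  using Xf_commutator[of f x "qb 1" p] by (simp add: Xf_def[of 0] qm_simps)

lemma Xf_Sf:
  assumes f: "smooth_on U f" and x: "x \<in> U"
  shows "Xf p (Sf f) x = - (Xf p (Xf (qb 2) (Xf (qb 2) f)) x + Xf p (Xf (qb 3) (Xf (qb 3) f)) x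
    + Xf p (Xf (qb 4) (Xf (qb 4) f)) x)"
proof -
  let ?g = "\<lambda>x. Xf (qb 2) (Xf (qb 2) f) x + Xf (qb 3) (Xf (qb 3) f) x + Xf (qb 4) (Xf (qb 4) f) x"
  have "smooth_on U ?g" by (intro smooth_on_add[OF U] smooth_Xf f)
  then have "Xf p (\<lambda>x. -1 * ?g x) x = -1 * Xf p ?g x" using x by (rule Xf_cmult)
  moreover have "Sf f = (\<lambda>x. -1 * ?g x)" by (auto simp: Sf_def)
  ultimately show ?thesis
    using f x by (simp add: Xf_add smooth_Xf smooth_on_add[OF U])
qed

text \<open>\<open>[X_p, X_k] = X_(c k)\<close>, and the matrix formed by the \<open>c k\<close> is
  antisymmetric on the imaginary units; in the sum over k the terms
  \<open>X_k X_(c k) + X_(c k) X_k\<close> cancel. S is the Casimir operator of these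
  fields.\<close>

lemma X_S_commute:
  assumes f: "smooth_on U f" and x: "x \<in> U"
  shows "Xf p (Sf f) x = Sf (Xf p f) x"
proof -
  define c where "c = (\<lambda>k. qm (qb k) p - qm p (qb k))"
  have 1: "Xf p (Xf (qb k) (Xf (qb k) f)) x
      = Xf (qb k) (Xf (qb k) (Xf p f)) x + Xf (qb k) (Xf (c k) f) x + Xf (c k) (Xf (qb k) f) x" for k
  proof -
    have "Xf p (Xf (qb k) (Xf (qb k) f)) x = Xf (qb k) (Xf p (Xf (qb k) f)) x + Xf (c k) (Xf (qb k) f) x"
      unfolding c_def by (rule Xf_commutator[OF smooth_Xf[OF f] x])
    also have "Xf (qb k) (Xf p (Xf (qb k) f)) x = Xf (qb k) (\<lambda>x. Xf (qb k) (Xf p f) x + Xf (c k) f x) x"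
      unfolding c_def by (rule Xf_cong[OF Xf_commutator[OF f] x])
    also have "\<dots> = Xf (qb k) (Xf (qb k) (Xf p f)) x + Xf (qb k) (Xf (c k) f) x"
      using f x by (simp add: Xf_add smooth_Xf)
    finally show ?thesis .
  qed
  have 2: "Xf q (Xf (c k) f) x = c k$1 * Xf q (Df f) x + c k$2 * Xf q (Xf (qb 2) f) x
      + c k$3 * Xf q (Xf (qb 3) f) x + c k$4 * Xf q (Xf (qb 4) f) x" for q k
  proof -
    have s: "smooth_on U (\<lambda>x. a * Xf r f x)" for a r
      by (intro smooth_on_mult[OF U] smooth_on_const smooth_Xf f)
    have "Xf (c k) f = (\<lambda>x. c k$1 * Df f x + c k$2 * Xf (qb 2) f x + c k$3 * Xf (qb 3) f x + c k$4 * Xf (qb 4) f x)"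
      by (rule ext) (rule Xf_linear)
    then show ?thesis
      using x by (simp add: Xf_add Xf_cmult smooth_Xf[OF f] s smooth_on_add[OF U])
  qed
  have 3: "Xf (c k) g x = c k$1 * Df g x + c k$2 * Xf (qb 2) g x + c k$3 * Xf (qb 3) g x + c k$4 * Xf (qb 4) g x" for g k
    by (rule Xf_linear)
  have c: "c 2$1 = 0" "c 2$2 = 0" "c 2$3 = -2 * p$4" "c 2$4 = 2 * p$3"
    "c 3$1 = 0" "c 3$2 = 2 * p$4" "c 3$3 = 0" "c 3$4 = -2 * p$2"
    "c 4$1 = 0" "c 4$2 = -2 * p$3" "c 4$3 = 2 * p$2" "c 4$4 = 0"
    unfolding c_def vector_minus_component qm_nth by (simp_all add: axis_def)
  show ?thesis
    unfolding Xf_Sf[OF f x] Sf_def[of "Xf p f"] 1 2 3 c by simp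
qed

text \<open>\<open>S\<close> is minus the Laplacian of the unit sphere.\<close>

lemma lap_polar:
  assumes f: "smooth_on U f" and x: "x \<in> U"
  shows "(norm x)\<^sup>2 * (\<Sum>\<alpha>\<in>UNIV. pd \<alpha> (pd \<alpha> f) x) = Df (Df f) x + 2 * Df f x - Sf f x"
proof -
  let ?H = "\<lambda>p. \<Sum>\<alpha>\<in>UNIV. \<Sum>\<beta>\<in>UNIV. qm p x $ \<alpha> * qm p x $ \<beta> * pd \<alpha> (pd \<beta> f) x"
  have "qm (qb 2) (qb 2) = - qb 1" "qm (qb 3) (qb 3) = - qb 1" "qm (qb 4) (qb 4) = - qb 1"
    unfolding vec4_eq_iff qm_nth by (simp_all add: axis_def)
  moreover have "Xf (- p) f x = - Xf p f x" for p
    by (simp add: Xf_def qm_simps sum_negf)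
  \<comment> \<open>Imaginary units square to -1, so the first order parts add up to D + 2 D - 3 D =
    0 and only second derivatives remain.\<close>
  ultimately have "Df (Df f) x + 2 * Df f x - Sf f x = ?H (qb 1) + ?H (qb 2) + ?H (qb 3) + ?H (qb 4)"
    unfolding Sf_def by (simp add: Xf_Xf[OF f x])
  \<comment> \<open>The vectors \<open>qm (qb k) x\<close> are orthogonal of length
    \<open>norm x\<close>, so summing the Hessian over this frame gives a multiple of its
    trace.\<close>
  also have "\<dots> = (norm x)\<^sup>2 * (\<Sum>\<alpha>\<in>UNIV. pd \<alpha> (pd \<alpha> f) x)"
    unfolding sum_4 norm4 qm_nth
    using pd_commute[OF U f x, of 2 1] pd_commute[OF U f x, of 3 1] pd_commute[OF U f x, of 4 1]
      pd_commute[OF U f x, of 3 2] pd_commute[OF U f x, of 4 2] pd_commute[OF U f x, of 4 3]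
    by (simp add: axis_def algebra_simps power2_eq_square)
  finally show ?thesis by simp
qed

lemma grad_polar:
  "(norm x)\<^sup>2 * (\<Sum>\<alpha>\<in>UNIV. (pd \<alpha> f x)\<^sup>2) = (\<Sum>k\<in>UNIV. (Xf (qb k) f x)\<^sup>2)"
  unfolding sum_4 norm4 Xf_4 qm_nth by (simp add: axis_def algebra_simps power2_eq_square)

end

section \<open>Averages over spheres\<close>

text \<open>Radial projection of the uniform probability on the ball, that is, normalised surface
  measure. It rests on the same identity as \<open>ang_int\<close>, from which it differs by the
  factor 4 vol(B_1).\<close>

definition sph :: "(real^4) measure" where
  "sph = distr (uniform_measure lborel (ball 0 1)) borel (\<lambda>y. y /\<^sub>R norm y)"

abbreviation S3 :: "(real^4) set" where "S3 \<equiv> sphere 0 1"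

text \<open>The cut-off to \<open>S3\<close> only removes a null set, by \<open>AE_sph\<close>, and
  makes continuity on the sphere alone sufficient for integrability.\<close>

definition sint :: "(real^4 \<Rightarrow> real) \<Rightarrow> real" where
  "sint g = set_lebesgue_integral sph S3 g"

definition sm :: "(real^4 \<Rightarrow> real) \<Rightarrow> real \<Rightarrow> real" where
  "sm f t = sint (\<lambda>\<theta>. f (exp t *\<^sub>R \<theta>))"

section \<open>Rotation invariance of the sphere measure\<close>

lemma distr_lborel_orthogonal:
  fixes R :: "real^4 \<Rightarrow> real^4"
  assumes R: "orthogonal_transformation R"
  shows "distr lborel borel R = lborel"
proof (rule lborel_eqI[symmetric])
  have RI: "orthogonal_transformation (inv R)"
    using R orthogonal_transformation_inv by blast
  have m: "R \<in> borel_measurable borel"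
    using R by (simp add: borel_measurable_continuous_onI linear_continuous_on
        orthogonal_transformation_linear linear_conv_bounded_linear[symmetric])
  fix l u :: "real^4" assume lu: "\<And>b. b \<in> Basis \<Longrightarrow> l \<bullet> b \<le> u \<bullet> b"
  have v: "R -` box l u = inv R ` box l u"
    using R by (simp add: bij_vimage_eq_inv_image orthogonal_transformation_bij)
  have "emeasure (distr lborel borel R) (box l u) = emeasure lborel (R -` box l u)"
    using m by (simp add: emeasure_distr)
  also have "\<dots> = emeasure lebesgue (R -` box l u)"
    using m by (simp add: measurable_sets_borel)
  also have "\<dots> = ennreal (measure lebesgue (inv R ` box l u))"
    unfolding v using measurable_orthogonal_image[OF RI, of "box l u"]
    by (simp add: emeasure_eq_measure2 fmeasurableD2)
  also have "\<dots> = ennreal (measure lebesgue (box l u))"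
    using measure_orthogonal_image[OF RI, of "box l u"] by simp
  also have "\<dots> = (\<Prod>b\<in>Basis. (u - l) \<bullet> b)"
    using lu by (simp add: measure_def)
  finally show "emeasure (distr lborel borel R) (box l u) = (\<Prod>b\<in>Basis. (u - l) \<bullet> b)" .
qed simp

lemma normalize_measurable [measurable]: "(\<lambda>y::real^4. y /\<^sub>R norm y) \<in> borel_measurable borel"
  by measurable

lemma emeasure_ball_pos: "emeasure lborel (ball (0::real^4) 1) \<noteq> 0" "emeasure lborel (ball (0::real^4) 1) \<noteq> \<infinity>"
  by (simp_all add: emeasure_ball unit_ball_vol_pos less_imp_neq[symmetric])

lemma sets_sph [simp, measurable_cong]: "sets sph = sets borel" "space sph = UNIV"
  unfolding sph_def by simp_all

lemma emeasure_sph: "emeasure sph UNIV = 1"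
proof -
  have "emeasure (uniform_measure lborel (ball (0::real^4) 1)) UNIV = 1"
    using emeasure_ball_pos by (simp add: emeasure_uniform_measure ennreal_divide_self top.not_eq_extremum)
  then show ?thesis
    unfolding sph_def by (subst emeasure_distr) (simp_all add: measurable_cong_sets[OF sets_uniform_measure refl])
qed

interpretation sph: finite_measure sph
  by standard (simp add: emeasure_sph)

lemma AE_sph: "AE \<theta> in sph. \<theta> \<in> S3"
proof -
  have "AE y in uniform_measure lborel (ball 0 1). (y::real^4) /\<^sub>R norm y \<in> S3"
  proof (rule AE_uniform_measureI)
    have "AE y in lborel. (y::real^4) \<noteq> 0" by (rule AE_lborel_singleton)
    then show "AE y in lborel. (y::real^4) \<in> ball 0 1 \<longrightarrow> y /\<^sub>R norm y \<in> S3"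
      by eventually_elim simp
  qed simp
  then show ?thesis
    unfolding sph_def by (subst AE_distr_iff) (simp_all add: measurable_cong_sets[OF sets_uniform_measure refl])
qed

text \<open>R preserves the uniform measure on the ball and commutes with the projection y /
  |y|.\<close>

lemma distr_sph_orthogonal:
  assumes R: "orthogonal_transformation R"
  shows "distr sph borel R = sph"
proof -
  let ?U = "uniform_measure lborel (ball (0::real^4) 1)"
  have m [measurable]: "R \<in> borel_measurable borel"
    using R by (simp add: borel_measurable_continuous_onI linear_continuous_on
        orthogonal_transformation_linear linear_conv_bounded_linear[symmetric])
  have "distr ?U borel R = ?U"
  proof (rule measure_eqI)
    fix A assume "A \<in> sets (distr ?U borel R)"
    then have A [measurable]: "A \<in> sets borel" by simp
    have *: "ball 0 1 \<inter> R -` A = R -` (ball 0 1 \<inter> A)"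
      using R by (auto simp: orthogonal_transformation_norm)
    have "emeasure (distr ?U borel R) A = emeasure lborel (ball 0 1 \<inter> R -` A) / emeasure lborel (ball (0::real^4) 1)"
      by (subst emeasure_distr) (simp_all add: measurable_cong_sets[OF sets_uniform_measure refl] emeasure_uniform_measure measurable_sets_borel[OF m A])
    also have "emeasure lborel (ball 0 1 \<inter> R -` A) = emeasure (distr lborel borel R) (ball 0 1 \<inter> A)"
      unfolding * by (simp add: emeasure_distr)
    also have "\<dots> = emeasure lborel (ball 0 1 \<inter> A)"
      by (simp add: distr_lborel_orthogonal R)
    finally show "emeasure (distr ?U borel R) A = emeasure ?U A"
      by (simp add: emeasure_uniform_measure)
  qed simp
  note inv = this
  have "distr sph borel R = distr ?U borel (R \<circ> (\<lambda>y. y /\<^sub>R norm y))"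
    unfolding sph_def by (subst distr_distr) (simp_all add: measurable_cong_sets[OF sets_uniform_measure refl])
  also have "R \<circ> (\<lambda>y. y /\<^sub>R norm y) = (\<lambda>y. y /\<^sub>R norm y) \<circ> R"
    using R by (auto simp: orthogonal_transformation_norm orthogonal_transformation_linear linear_cmul)
  also have "distr ?U borel ((\<lambda>y. y /\<^sub>R norm y) \<circ> R) = distr (distr ?U borel R) borel (\<lambda>y. y /\<^sub>R norm y)"
    by (subst distr_distr) (simp_all add: measurable_cong_sets[OF sets_uniform_measure refl])
  finally show ?thesis unfolding inv sph_def .
qed

lemma sint_integrable:
  fixes g :: "real^4 \<Rightarrow> real"
  assumes "continuous_on S3 g"
  shows "set_integrable sph S3 g"
proof -
  obtain B where "\<forall>y \<in> g ` S3. norm y \<le> B"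
    using compact_imp_bounded[OF compact_continuous_image[OF assms compact_sphere]]
    unfolding bounded_iff ..
  then have B: "\<bar>g \<theta>\<bar> \<le> B" if "\<theta> \<in> S3" for \<theta> using that by auto
  have "(\<lambda>\<theta>. indicator S3 \<theta> *\<^sub>R g \<theta>) \<in> borel_measurable sph"
    using borel_measurable_continuous_on_indicator[OF _ assms] by simp
  then show ?thesis
    unfolding set_integrable_def
    by (rule sph.integrable_const_bound[where B=B, rotated]) (rule AE_mp[OF AE_sph AE_I2], auto simp: B)
qed

lemma sint_cong: "(\<And>\<theta>. \<theta> \<in> S3 \<Longrightarrow> f \<theta> = g \<theta>) \<Longrightarrow> sint f = sint g"
  unfolding sint_def by (rule set_lebesgue_integral_cong) auto

lemma sint_add: "continuous_on S3 f \<Longrightarrow> continuous_on S3 g \<Longrightarrow> sint (\<lambda>\<theta>. f \<theta> + g \<theta>) = sint f + sint g"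
  unfolding sint_def by (intro set_integral_add sint_integrable)

lemma sint_cmult: "sint (\<lambda>\<theta>. c * f \<theta>) = c * sint f"
  unfolding sint_def by simp

lemma sint_const: "sint (\<lambda>\<theta>. c) = c"
proof -
  have "sint (\<lambda>\<theta>. c) = (LINT \<theta>|sph. c)"
    unfolding sint_def set_lebesgue_integral_def
  proof (rule integral_cong_AE)
    have [measurable]: "S3 \<in> sets borel" by (simp add: borel_closed)
    show "(\<lambda>x. indicat_real S3 x *\<^sub>R c) \<in> borel_measurable sph" by measurable
  qed (auto intro: AE_mp[OF AE_sph AE_I2])
  then show ?thesis by (simp add: measure_def emeasure_sph)
qed

lemma sint_mono:
  assumes "continuous_on S3 f" "continuous_on S3 g" "\<And>\<theta>. \<theta> \<in> S3 \<Longrightarrow> f \<theta> \<le> g \<theta>"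
  shows "sint f \<le> sint g"
  unfolding sint_def by (intro set_integral_mono sint_integrable assms)

lemma sint_orthogonal:
  assumes R: "orthogonal_transformation R" and g: "continuous_on S3 g"
  shows "sint (\<lambda>\<theta>. g (R \<theta>)) = sint g"
proof -
  have m [measurable]: "R \<in> borel_measurable borel"
    using R by (simp add: borel_measurable_continuous_onI linear_continuous_on
        orthogonal_transformation_linear linear_conv_bounded_linear[symmetric])
  have gm: "(\<lambda>\<theta>. indicator S3 \<theta> *\<^sub>R g \<theta>) \<in> borel_measurable borel"
    by (rule borel_measurable_continuous_on_indicator[OF _ g]) (simp add: borel_closed)
  have "sint g = (LINT \<theta>|distr sph borel R. indicator S3 \<theta> *\<^sub>R g \<theta>)"
    unfolding distr_sph_orthogonal[OF R] sint_def set_lebesgue_integral_def ..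
  also have "\<dots> = (LINT \<theta>|sph. indicator S3 (R \<theta>) *\<^sub>R g (R \<theta>))"
    by (rule integral_distr[OF _ gm]) simp
  also have "\<dots> = sint (\<lambda>\<theta>. g (R \<theta>))"
    unfolding sint_def set_lebesgue_integral_def
    using R by (simp add: indicator_def orthogonal_transformation_norm)
  finally show ?thesis by simp
qed

text \<open>The difference quotients are bounded by the maximum of \<open>F'\<close> on a compact
  neighbourhood of {s} x S^3, so that dominated convergence applies along sequences.\<close>

lemma sint_deriv:
  fixes F F' :: "real \<Rightarrow> real^4 \<Rightarrow> real"
  assumes s: "a < s" "s < b"
    and der: "\<And>r \<theta>. r \<in> {a<..<b} \<Longrightarrow> \<theta> \<in> S3 \<Longrightarrow> ((\<lambda>r. F r \<theta>) has_real_derivative F' r \<theta>) (at r)"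
    and F: "\<And>r. r \<in> {a<..<b} \<Longrightarrow> continuous_on S3 (F r)"
    and F': "continuous_on ({a<..<b} \<times> S3) (\<lambda>(r, \<theta>). F' r \<theta>)"
  shows "((\<lambda>r. sint (F r)) has_real_derivative sint (F' s)) (at s)"
proof -
  define e where "e = min (s - a) (b - s) / 2"
  have e: "e > 0" "a < s - e" "s + e < b"
    using s unfolding e_def by (auto simp: min_def field_simps)
  let ?K = "{s-e..s+e} \<times> S3"
  have "compact ((\<lambda>(r, \<theta>). F' r \<theta>) ` ?K)"
    using e by (intro compact_continuous_image[OF continuous_on_subset[OF F']] compact_Times) auto
  then have "bounded ((\<lambda>(r, \<theta>). F' r \<theta>) ` ?K)" by (rule compact_imp_bounded)
  then obtain B where B0: "\<forall>y \<in> (\<lambda>(r, \<theta>). F' r \<theta>) ` ?K. norm y \<le> B"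
    unfolding bounded_iff ..
  have B: "\<bar>F' r \<theta>\<bar> \<le> B" if "r \<in> {s-e..s+e}" "\<theta> \<in> S3" for r \<theta>
    using B0 that by force
  have lip: "\<bar>F r \<theta> - F s \<theta>\<bar> \<le> B * \<bar>r - s\<bar>" if r: "r \<in> {s-e..s+e}" and t: "\<theta> \<in> S3" for r \<theta>
  proof -
    have "norm (F r \<theta> - F s \<theta>) \<le> B * norm (r - s)"
    proof (rule field_differentiable_bound[of "{s-e..s+e}" "\<lambda>r. F r \<theta>" "\<lambda>r. F' r \<theta>"])
      show "((\<lambda>r. F r \<theta>) has_field_derivative F' z \<theta>) (at z within {s-e..s+e})" if "z \<in> {s-e..s+e}" for z
        using der[of z \<theta>] t that e by (auto intro: has_field_derivative_at_within)
    qed (use B t r e in auto)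
    then show ?thesis by simp
  qed
  have F's: "continuous_on S3 (F' s)"
    by (rule continuous_on_compose2[OF F', of _ "\<lambda>\<theta>. (s, \<theta>)", simplified]) (use s in \<open>auto intro!: continuous_intros\<close>)
  have "((\<lambda>r. (sint (F r) - sint (F s)) / (r - s)) \<longlongrightarrow> sint (F' s)) (at s)"
    unfolding tendsto_at_iff_sequentially
  proof (intro allI impI)
    fix X assume X: "\<forall>i. X i \<in> UNIV - {s}" "X \<longlonglongrightarrow> s"
    then have "\<forall>\<^sub>F n in sequentially. dist (X n) s < e" using e tendstoD by blast
    then obtain N where N: "\<And>n. n \<ge> N \<Longrightarrow> dist (X n) s < e" unfolding eventually_sequentially by blast
    \<comment> \<open>A tail of the sequence, so that every term lies where the Lipschitz bound is
      available.\<close>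
    define Y where "Y n = X (n + N)" for n
    have Y: "Y n \<in> {s-e..s+e}" "Y n \<noteq> s" for n
      using N[of "n+N"] X(1) unfolding Y_def by (auto simp: dist_real_def abs_real_def split: if_splits)
    have Ys: "Y \<longlonglongrightarrow> s" unfolding Y_def using X(2) LIMSEQ_ignore_initial_segment by blast
    have Fc: "continuous_on S3 (F r)" if "r \<in> {s-e..s+e}" for r using F e that by auto
    define G where "G n \<theta> = (F (Y n) \<theta> - F s \<theta>) / (Y n - s)" for n \<theta>
    have G: "sint (G n) = (sint (F (Y n)) - sint (F s)) / (Y n - s)" for n
    proof -
      have "sint (G n) = sint (\<lambda>\<theta>. (1 / (Y n - s)) * (F (Y n) \<theta> + (-1) * F s \<theta>))"
        by (rule sint_cong) (simp add: G_def)
      also have "\<dots> = (sint (F (Y n)) - sint (F s)) / (Y n - s)"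
        unfolding sint_cmult
        by (subst sint_add[OF Fc[OF Y(1)] continuous_on_mult[OF continuous_on_const Fc]])
           (use e in \<open>simp_all only: sint_cmult, auto\<close>)
      finally show ?thesis .
    qed
    have "(\<lambda>n. LINT \<theta>|sph. indicator S3 \<theta> *\<^sub>R G n \<theta>) \<longlonglongrightarrow> (LINT \<theta>|sph. indicator S3 \<theta> *\<^sub>R F' s \<theta>)"
    proof (rule integral_dominated_convergence[where w="\<lambda>\<theta>. B"])
      show "(\<lambda>\<theta>. indicator S3 \<theta> *\<^sub>R F' s \<theta>) \<in> borel_measurable sph"
        using borel_measurable_continuous_on_indicator[OF _ F's] by simp
      show "(\<lambda>\<theta>. indicator S3 \<theta> *\<^sub>R G n \<theta>) \<in> borel_measurable sph" for n
      proof -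
        have "continuous_on S3 (G n)"
          unfolding G_def[abs_def] using Y(2)[of n] e
          by (intro continuous_on_divide continuous_on_diff Fc Y(1) continuous_on_const) auto
        from borel_measurable_continuous_on_indicator[OF _ this] show ?thesis by simp
      qed
      show "integrable sph (\<lambda>\<theta>. B)" by simp
      show "AE \<theta> in sph. (\<lambda>n. indicator S3 \<theta> *\<^sub>R G n \<theta>) \<longlonglongrightarrow> indicator S3 \<theta> *\<^sub>R F' s \<theta>"
      proof (intro AE_I2)
        fix \<theta>
        show "(\<lambda>n. indicator S3 \<theta> *\<^sub>R G n \<theta>) \<longlonglongrightarrow> indicator S3 \<theta> *\<^sub>R F' s \<theta>"
        proof (cases "\<theta> \<in> S3")
          case True
          have "((\<lambda>r. (F r \<theta> - F s \<theta>) / (r - s)) \<longlongrightarrow> F' s \<theta>) (at s)"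
            using der[of s \<theta>] s True unfolding has_field_derivative_iff by simp
          then have "(\<lambda>n. G n \<theta>) \<longlonglongrightarrow> F' s \<theta>"
            unfolding tendsto_at_iff_sequentially G_def using Y(2) Ys by (auto simp: o_def)
          then show ?thesis using True by simp
        qed simp
      qed
      show "AE \<theta> in sph. norm (indicator S3 \<theta> *\<^sub>R G n \<theta>) \<le> B" for n
      proof (rule AE_mp[OF AE_sph AE_I2], intro impI)
        fix \<theta> assume "\<theta> \<in> S3"
        then show "norm (indicator S3 \<theta> *\<^sub>R G n \<theta>) \<le> B"
          using lip[OF Y(1), of \<theta> n] Y(2)[of n] by (simp add: G_def divide_le_eq)
      qed
    qed
    then have "(\<lambda>n. (sint (F (X (n+N))) - sint (F s)) / (X (n+N) - s)) \<longlonglongrightarrow> sint (F' s)"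
      unfolding set_lebesgue_integral_def[symmetric] sint_def[symmetric] G Y_def .
    then show "((\<lambda>r. (sint (F r) - sint (F s)) / (r - s)) \<circ> X) \<longlonglongrightarrow> sint (F' s)"
      unfolding o_def by (rule LIMSEQ_offset)
  qed
  then show ?thesis unfolding has_field_derivative_iff .
qed

section \<open>Spherical means on shells and their derivatives\<close>

definition shell :: "real \<Rightarrow> real \<Rightarrow> (real^4) set" where
  "shell a b = {x. exp a < norm x \<and> norm x < exp b}"

lemma open_shell [simp]: "open (shell a b)"
  unfolding shell_def by (intro open_Collect_conj open_Collect_less continuous_intros)

lemma in_shell: "t \<in> {a<..<b} \<Longrightarrow> \<theta> \<in> S3 \<Longrightarrow> exp t *\<^sub>R \<theta> \<in> shell a b"
  unfolding shell_def by simp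

lemma qm_shell: "norm p = 1 \<Longrightarrow> x \<in> shell a b \<Longrightarrow> qm p x \<in> shell a b"
  unfolding shell_def by (simp add: norm_qm)

lemma smooth_chain:
  fixes f :: "real^4 \<Rightarrow> real"
  assumes "smooth_on U f" "\<gamma> s \<in> U" "(\<gamma> has_vector_derivative qm p (\<gamma> s)) (at s)"
  shows "((\<lambda>s. f (\<gamma> s)) has_real_derivative Xf p f (\<gamma> s)) (at s)"
proof -
  note D = smooth_on_has_derivative[OF assms(1,2)]
  have "((\<lambda>s. f (\<gamma> s)) has_derivative (\<lambda>h. \<Sum>\<alpha>\<in>UNIV. (h *\<^sub>R qm p (\<gamma> s))$\<alpha> * pd \<alpha> f (\<gamma> s))) (at s)"
    by (rule has_derivative_compose[OF assms(3)[unfolded has_vector_derivative_def] D])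
  moreover have "(\<Sum>\<alpha>\<in>UNIV. (h *\<^sub>R qm p (\<gamma> s))$\<alpha> * pd \<alpha> f (\<gamma> s)) = Xf p f (\<gamma> s) * h" for h
    by (simp add: Xf_def sum_distrib_left sum_distrib_right mult_ac)
  ultimately show ?thesis unfolding has_field_derivative_def by simp
qed

text \<open>The one-parameter group exp (s v) of a unit imaginary quaternion v; its left action is
  the flow of \<open>Xf v\<close>.\<close>

definition rot :: "real^4 \<Rightarrow> real \<Rightarrow> real^4" where
  "rot v s = cos s *\<^sub>R qb 1 + sin s *\<^sub>R v"

definition unit_im :: "real^4 \<Rightarrow> bool" where
  "unit_im v \<longleftrightarrow> v$1 = 0 \<and> norm v = 1"

lemma unit_im_sq: "unit_im v \<Longrightarrow> (v$2)\<^sup>2 + (v$3)\<^sup>2 + (v$4)\<^sup>2 = 1"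
  using norm4[of v] unfolding unit_im_def by simp

lemma norm_rot:
  assumes "unit_im v" shows "norm (rot v s) = 1"
proof -
  have "(norm (rot v s))\<^sup>2 = (cos s)\<^sup>2 + (sin s)\<^sup>2 * ((v$2)\<^sup>2 + (v$3)\<^sup>2 + (v$4)\<^sup>2)"
    using assms unfolding norm4 rot_def unit_im_def
    by (simp add: axis_def power_mult_distrib algebra_simps)
  then have "(norm (rot v s))\<^sup>2 = 1" unfolding unit_im_sq[OF assms] by simp
  then show ?thesis by (metis norm_ge_zero power2_eq_1_iff neg_0_le_iff_le not_one_le_zero)
qed

lemma qm_im_sq: "unit_im v \<Longrightarrow> qm v v = - qb 1"
  using unit_im_sq[of v] unfolding unit_im_def vec4_eq_iff qm_nth
  by (simp add: axis_def power2_eq_square algebra_simps)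

lemma rot_deriv:
  assumes "unit_im v"
  shows "((\<lambda>s. qm (rot v s) x) has_vector_derivative qm v (qm (rot v s) x)) (at s)"
proof -
  have 1: "(\<lambda>s. qm (rot v s) x) = (\<lambda>s. cos s *\<^sub>R x + sin s *\<^sub>R qm v x)"
    by (auto simp: rot_def qm_simps)
  have 2: "qm v (qm (rot v s) x) = - sin s *\<^sub>R x + cos s *\<^sub>R qm v x"
    using qm_im_sq[OF assms] by (simp add: rot_def qm_simps qm_assoc)
  show ?thesis unfolding 1 2
    by (auto intro!: derivative_eq_intros simp: has_real_derivative_iff_has_vector_derivative[symmetric])
qed

lemma rot_add: "unit_im v \<Longrightarrow> qm (rot v r) (rot v s) = rot v (r + s)"
  using qm_im_sq[of v] unfolding rot_def
  by (simp add: qm_simps cos_add sin_add algebra_simps)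

text \<open>The class of all compositions of smooth functions with \<open>qm p\<close> is closed
  under \<open>pd\<close>, because the chain rule for a linear map has constant
  coefficients.\<close>

lemma smooth_qm_comp:
  fixes f :: "real^4 \<Rightarrow> real"
  assumes "smooth_on (shell a b) f" "norm p = 1"
  shows "smooth_on (shell a b) (\<lambda>x. f (qm p x))"
proof -
  let ?P = "\<lambda>g::real^4 \<Rightarrow> real. \<exists>h. smooth_on (shell a b) h \<and> (\<forall>x\<in>shell a b. g x = h (qm p x))"
  have D: "(g has_derivative (\<lambda>v. \<Sum>\<beta>\<in>UNIV. qm p v $ \<beta> * pd \<beta> h (qm p x))) (at x)"
    if "smooth_on (shell a b) h" "\<forall>x\<in>shell a b. g x = h (qm p x)" "x \<in> shell a b" for g h x
  proof -
    have "(qm p has_derivative qm p) (at x)"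
      by (rule bounded_linear_imp_has_derivative) (simp add: linear_qm linear_conv_bounded_linear[symmetric])
    from has_derivative_compose[OF this smooth_on_has_derivative[OF that(1) qm_shell[OF assms(2) that(3)]]]
    show ?thesis
      by (rule has_derivative_transform_within_open[OF _ open_shell that(3)]) (use that(2) in auto)
  qed
  show ?thesis
  proof (rule smooth_on_coinduct[where P = ?P])
    show "?P (\<lambda>x. f (qm p x))" using assms by blast
  next
    fix g :: "real^4 \<Rightarrow> real" and x assume "?P g" "x \<in> shell a b"
    then show "g differentiable (at x)" using D unfolding differentiable_def by blast
  next
    fix g :: "real^4 \<Rightarrow> real" and \<alpha> assume "?P g"
    then obtain h where h: "smooth_on (shell a b) h" "\<forall>x\<in>shell a b. g x = h (qm p x)" by blast
    have "smooth_on (shell a b) (\<lambda>y. \<Sum>\<beta>\<in>UNIV. qm p (axis \<alpha> 1) $ \<beta> * pd \<beta> h y)"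
      by (intro smooth_on_sum smooth_on_mult smooth_on_const smooth_onD(2)[OF h(1)] open_shell)
    then show "?P (pd \<alpha> g)"
      using pd_eqI[OF D[OF h]] by blast
  qed
qed

lemma shell_cont:
  assumes "smooth_on (shell a b) f" "t \<in> {a<..<b}"
  shows "continuous_on S3 (\<lambda>\<theta>. f (exp t *\<^sub>R \<theta>))"
  by (rule continuous_on_compose2[OF smooth_on_continuous_on[OF assms(1)]])
     (auto intro!: continuous_intros in_shell assms)

lemma sm_cong: "(\<And>x. x \<in> shell a b \<Longrightarrow> f x = g x) \<Longrightarrow> t \<in> {a<..<b} \<Longrightarrow> sm f t = sm g t"
  unfolding sm_def by (rule sint_cong) (auto simp: in_shell)

lemma sm_add: "smooth_on (shell a b) f \<Longrightarrow> smooth_on (shell a b) g \<Longrightarrow> t \<in> {a<..<b} \<Longrightarrow>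
    sm (\<lambda>x. f x + g x) t = sm f t + sm g t"
  unfolding sm_def by (rule sint_add) (rule shell_cont; assumption)+

lemma sm_cmult: "sm (\<lambda>x. c * f x) t = c * sm f t"
  unfolding sm_def by (rule sint_cmult)

lemma sm_diff: "smooth_on (shell a b) f \<Longrightarrow> smooth_on (shell a b) g \<Longrightarrow> t \<in> {a<..<b} \<Longrightarrow>
    sm (\<lambda>x. f x - g x) t = sm f t - sm g t"
  using sm_add[of a b f "\<lambda>x. -1 * g x" t] sm_cmult[of "-1" g t]
    smooth_on_mult[OF open_shell smooth_on_const[of _ "-1"], of a b g] by simp

lemma sm_mono: "smooth_on (shell a b) f \<Longrightarrow> smooth_on (shell a b) g \<Longrightarrow> t \<in> {a<..<b} \<Longrightarrow>
    (\<And>x. x \<in> shell a b \<Longrightarrow> f x \<le> g x) \<Longrightarrow> sm f t \<le> sm g t"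
  unfolding sm_def by (rule sint_mono[OF shell_cont shell_cont]) (blast intro: in_shell)+

lemma sm_const: "sm (\<lambda>x. c) t = c"
  unfolding sm_def by (rule sint_const)

lemma sm_nonneg: "smooth_on (shell a b) f \<Longrightarrow> t \<in> {a<..<b} \<Longrightarrow>
    (\<And>x. x \<in> shell a b \<Longrightarrow> 0 \<le> f x) \<Longrightarrow> 0 \<le> sm f t"
  using sm_mono[OF smooth_on_const[of _ 0], of a b f t] by (simp add: sm_const)

lemma sm_sum: "(\<And>i. i \<in> I \<Longrightarrow> smooth_on (shell a b) (f i)) \<Longrightarrow> t \<in> {a<..<b} \<Longrightarrow>
    sm (\<lambda>x. \<Sum>i\<in>I. f i x) t = (\<Sum>i\<in>I. sm (f i) t)"
  by (induction I rule: infinite_finite_induct) (auto simp: sm_const sm_add[where a=a and b=b] smooth_on_sum)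

lemma sm_deriv:
  assumes f: "smooth_on (shell a b) f" and t: "t \<in> {a<..<b}"
  shows "(sm f has_real_derivative sm (Df f) t) (at t)"
  unfolding sm_def
proof (rule sint_deriv)
  show "a < t" "t < b" using t by auto
  show "((\<lambda>r. f (exp r *\<^sub>R \<theta>)) has_real_derivative Df f (exp r *\<^sub>R \<theta>)) (at r)"
    if "r \<in> {a<..<b}" "\<theta> \<in> S3" for r \<theta>
    by (rule smooth_chain[where \<gamma>="\<lambda>r. exp r *\<^sub>R \<theta>", OF f in_shell[OF that]])
       (auto intro!: derivative_eq_intros simp: has_real_derivative_iff_has_vector_derivative[symmetric])
  show "continuous_on S3 (\<lambda>\<theta>. f (exp r *\<^sub>R \<theta>))" if "r \<in> {a<..<b}" for r
    by (rule shell_cont[OF f that])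
  have "continuous_on ({a<..<b} \<times> S3) (\<lambda>z. Df f (exp (fst z) *\<^sub>R snd z))"
    by (rule continuous_on_compose2[OF smooth_on_continuous_on[OF smooth_Xf[OF open_shell f]]])
       (auto intro!: continuous_intros in_shell)
  then show "continuous_on ({a<..<b} \<times> S3) (\<lambda>(r, \<theta>). Df f (exp r *\<^sub>R \<theta>))"
    by (simp add: case_prod_unfold)
qed

lemma sm_rot: "norm p = 1 \<Longrightarrow> smooth_on (shell a b) f \<Longrightarrow> t \<in> {a<..<b} \<Longrightarrow> sm (\<lambda>x. f (qm p x)) t = sm f t"
  unfolding sm_def
  using sint_orthogonal[OF orthogonal_qm, of p "\<lambda>\<theta>. f (exp t *\<^sub>R \<theta>)"]
  by (simp add: qm_simps shell_cont)

lemma sm_rot_deriv: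
  assumes f: "smooth_on (shell a b) f" and g: "smooth_on (shell a b) g" and t: "t \<in> {a<..<b}"
    and v: "unit_im v"
  shows "((\<lambda>s. sm (\<lambda>x. f (qm (rot v s) x) * g x) t) has_real_derivative
    sm (\<lambda>x. Xf v f (qm (rot v s) x) * g x) t) (at s)"
  unfolding sm_def
proof (rule sint_deriv)
  show "s - 1 < s" "s < s + 1" by auto
  note in_sh = qm_shell[OF norm_rot[OF v] in_shell[OF t]]
  show "((\<lambda>r. f (qm (rot v r) (exp t *\<^sub>R \<theta>)) * g (exp t *\<^sub>R \<theta>)) has_real_derivative
     Xf v f (qm (rot v r) (exp t *\<^sub>R \<theta>)) * g (exp t *\<^sub>R \<theta>)) (at r)" if "\<theta> \<in> S3" for r \<theta>
    by (rule DERIV_cmult_right,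
        rule smooth_chain[where \<gamma>="\<lambda>r. qm (rot v r) (exp t *\<^sub>R \<theta>)", OF f in_sh[OF that] rot_deriv[OF v]])
  show "continuous_on S3 (\<lambda>\<theta>. f (qm (rot v r) (exp t *\<^sub>R \<theta>)) * g (exp t *\<^sub>R \<theta>))" for r
    using shell_cont[OF smooth_on_mult[OF open_shell smooth_qm_comp[OF f norm_rot[OF v]] g] t] .
  have "continuous_on ({s-1<..<s+1} \<times> S3) (\<lambda>z. Xf v f (cos (fst z) *\<^sub>R (exp t *\<^sub>R snd z) + sin (fst z) *\<^sub>R qm v (exp t *\<^sub>R snd z)))"
    using in_sh
    by (intro continuous_on_compose2[OF smooth_on_continuous_on[OF smooth_Xf[OF open_shell f]]]
         continuous_intros linear_continuous_on_compose[OF _ linear_qm(1)])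
       (auto simp: rot_def qm_simps scaleR_right_distrib mult.commute)
  moreover have "continuous_on ({s-1<..<s+1} \<times> S3) (\<lambda>z. g (exp t *\<^sub>R snd z))"
    by (rule continuous_on_compose2[OF shell_cont[OF g t]]) (auto intro!: continuous_intros)
  ultimately show "continuous_on ({s-1<..<s+1} \<times> S3) (\<lambda>(r, \<theta>). Xf v f (qm (rot v r) (exp t *\<^sub>R \<theta>)) * g (exp t *\<^sub>R \<theta>))"
    by (simp add: case_prod_unfold rot_def qm_simps continuous_on_mult scaleR_right_distrib mult.commute)
qed

text \<open>Rotation invariance makes the mean constant along the flow of \<open>Xf v\<close>; the
  claim is its derivative at 0. This is the divergence theorem on spheres and the source of all
  angular integrations by parts.\<close>

lemma sm_X:
  assumes f: "smooth_on (shell a b) f" and t: "t \<in> {a<..<b}" and v: "unit_im v"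
  shows "sm (Xf v f) t = 0"
proof -
  have "((\<lambda>s. sm (\<lambda>x. f (qm (rot v s) x) * 1) t) has_real_derivative sm (\<lambda>x. Xf v f (qm (rot v 0) x) * 1) t) (at 0)"
    by (rule sm_rot_deriv[OF f smooth_on_const t v])
  moreover have "(\<lambda>s. sm (\<lambda>x. f (qm (rot v s) x) * 1) t) = (\<lambda>s. sm f t)"
    using sm_rot[OF norm_rot[OF v] f t] by simp
  ultimately have "((\<lambda>s. sm f t) has_real_derivative sm (Xf v f) t) (at 0)"
    by (simp add: rot_def)
  then show ?thesis using DERIV_unique DERIV_const by blast
qed

lemma unit_im_qb [simp]: "unit_im (qb 2)" "unit_im (qb 3)" "unit_im (qb 4)"
  unfolding unit_im_def by (simp_all add: norm_axis_1) (simp_all add: axis_def)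

section \<open>A Wirtinger inequality along the quaternion rotations\<close>

text \<open>Sturm comparison. The Wronskian of d with sin (w (r - s)) does not increase in s while
  that sine is nonnegative, that is, for w r \<le> pi; it starts at 0 and ends at w d(r).\<close>

lemma sine_comparison:
  fixes d e h :: "real \<Rightarrow> real"
  assumes w: "w > 0" "w * r \<le> pi" "r \<ge> 0"
    and d: "\<And>s. (d has_real_derivative e s) (at s)" "\<And>s. (e has_real_derivative h s) (at s)"
    and le: "\<And>s. h s + w\<^sup>2 * d s \<le> 0" and z: "d 0 = 0" "e 0 = 0"
  shows "d r \<le> 0"
proof -
  let ?\<phi> = "\<lambda>s. e s * sin (w * (r - s)) + w * d s * cos (w * (r - s))"
  have "?\<phi> r \<le> ?\<phi> 0"
  proof (rule DERIV_nonpos_imp_nonincreasing[OF w(3)])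
    fix s assume s: "0 \<le> s" "s \<le> r"
    have "(?\<phi> has_real_derivative (h s + w\<^sup>2 * d s) * sin (w * (r - s))) (at s)"
      by (auto intro!: derivative_eq_intros d simp: algebra_simps power2_eq_square)
    moreover have "sin (w * (r - s)) \<ge> 0"
    proof (rule sin_ge_zero)
      show "0 \<le> w * (r - s)" using s w by simp
      have "w * (r - s) \<le> w * r" using s w by (intro mult_left_mono) auto
      then show "w * (r - s) \<le> pi" using w by linarith
    qed
    ultimately show "\<exists>y. (?\<phi> has_real_derivative y) (at s) \<and> y \<le> 0"
      using le[of s] mult_nonpos_nonneg by blast
  qed
  then have "w * d r \<le> 0" using z by simp
  then show ?thesis using w(1) by (simp add: mult_le_0_iff)
qed

lemma sin_less_arg:
  assumes "0 < x" "x < pi"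
  shows "sin x < (x::real)"
proof -
  have "\<exists>z>0. z < x \<and> (x - sin x) - (0 - sin 0) = (x - 0) * (1 - cos z)"
    by (rule MVT2[OF assms(1)]) (auto intro!: derivative_eq_intros)
  then obtain z where z: "0 < z" "z < x" "x - sin x = x * (1 - cos z)" by auto
  have "cos z < cos 0" using z assms by (intro cos_monotone_0_pi) auto
  then have "x * (1 - cos z) > 0" using assms by simp
  then show ?thesis using z by simp
qed

text \<open>The derivative of the shifted integral in r is a difference of values of g one period
  apart.\<close>

lemma periodic_integral_shift:
  fixes g :: "real \<Rightarrow> real"
  assumes g: "continuous_on UNIV g" and per: "\<And>x. g (x + T) = g x" and T: "T > 0"
  shows "integral {-T/2..T/2} (\<lambda>s. g (s + r)) = integral {-T/2..T/2} g"
proof -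
  \<comment> \<open>Large enough that the antiderivative \<open>G\<close> covers every shift by at
    most |r|.\<close>
  define M where "M = \<bar>r\<bar> + T"
  define G where "G x = integral {-M..x} g" for x
  have c: "continuous_on A g" for A using g continuous_on_subset by blast
  have G: "(G has_real_derivative g x) (at x)" if "-M < x" "x < M" for x
  proof -
    have "(G has_real_derivative g x) (at x within {-M..M})"
      unfolding G_def by (rule integral_has_real_derivative[OF c]) (use that in auto)
    then show ?thesis using that by (simp add: at_within_Icc_at)
  qed
  have ftc: "integral {-T/2..T/2} (\<lambda>s. g (s + y)) = G (T/2 + y) - G (-T/2 + y)" if "\<bar>y\<bar> \<le> \<bar>r\<bar>" for y
  proof (rule integral_unique, rule fundamental_theorem_of_calculus)
    show "- T / 2 \<le> T / 2" using T by simp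
    fix s assume s: "s \<in> {- T / 2..T / 2}"
    have "-M < s + y" "s + y < M" using s that T unfolding M_def by auto
    then have "((\<lambda>s. G (s + y)) has_real_derivative g (s + y) * 1) (at s)"
      by (intro DERIV_chain2[OF G] derivative_eq_intros) auto
    then show "((\<lambda>s. G (s + y)) has_vector_derivative g (s + y)) (at s within {- T / 2..T / 2})"
      by (simp add: has_real_derivative_iff_has_vector_derivative has_vector_derivative_at_within)
  qed
  have "\<exists>c. \<forall>y\<in>{-\<bar>r\<bar>..\<bar>r\<bar>}. G (T/2 + y) - G (-T/2 + y) = c"
  proof (rule has_derivative_zero_constant)
    fix y assume y: "y \<in> {-\<bar>r\<bar>..\<bar>r\<bar>}"
    have "((\<lambda>y. G (T/2 + y) - G (-T/2 + y)) has_real_derivative g (T/2 + y) * 1 - g (-T/2 + y) * 1) (at y)"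
      using y T by (intro DERIV_diff DERIV_chain2[OF G] derivative_eq_intros) (auto simp: M_def)
    moreover have "g (T/2 + y) = g (-T/2 + y)" using per[of "-T/2 + y"] by (simp add: algebra_simps)
    ultimately show "((\<lambda>y. G (T/2 + y) - G (-T/2 + y)) has_derivative (\<lambda>h. 0)) (at y within {-\<bar>r\<bar>..\<bar>r\<bar>})"
      unfolding has_field_derivative_def
      by (auto intro!: has_derivative_at_withinI elim!: has_derivative_eq_rhs)
  qed simp
  then obtain c where "\<forall>y\<in>{-\<bar>r\<bar>..\<bar>r\<bar>}. G (T/2 + y) - G (-T/2 + y) = c" ..
  moreover have "r \<in> {-\<bar>r\<bar>..\<bar>r\<bar>}" "0 \<in> {-\<bar>r\<bar>..\<bar>r\<bar>}" by (auto simp: abs_if)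
  ultimately have "G (T/2 + r) - G (-T/2 + r) = c" "G (T/2 + 0) - G (-T/2 + 0) = c" by blast+
  then have "G (T/2 + r) - G (-T/2 + r) = G (T/2 + 0) - G (-T/2 + 0)" by simp
  then show ?thesis using ftc[of r] ftc[of 0] by simp
qed

section \<open>Autocorrelation along a rotation and the sharp Wirtinger constant\<close>

context
  fixes a b t :: real
  assumes t: "t \<in> {a<..<b}"
begin

definition "ip f g = sm (\<lambda>x. f x * g x) t"
text \<open>The autocorrelation of f along the flow of \<open>Xf v\<close>. Its second derivative in
  s is \<open>- au v (Xf v f)\<close>, so the inequality becomes a statement on even functions of
  one real variable, and no Fourier series enter.\<close>

definition "au v f s = sm (\<lambda>x. f (qm (rot v s) x) * f x) t"

lemma sm_comp_swap:
  assumes "smooth_on (shell a b) f" "smooth_on (shell a b) g" "unit_im v"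
  shows "sm (\<lambda>x. f (qm (rot v s) x) * g x) t = sm (\<lambda>x. f x * g (qm (rot v (-s)) x)) t"
proof -
  have "sm (\<lambda>x. f (qm (rot v s) x) * g x) t
     = sm (\<lambda>x. (\<lambda>x. f x * g (qm (rot v (-s)) x)) (qm (rot v s) x)) t"
    by (simp add: qm_assoc rot_add assms) (simp add: rot_def)
  also have "\<dots> = sm (\<lambda>x. f x * g (qm (rot v (-s)) x)) t"
    by (rule sm_rot[OF norm_rot[OF assms(3)] smooth_on_mult[OF open_shell assms(1)
          smooth_qm_comp[OF assms(2) norm_rot[OF assms(3)]]] t])
  finally show ?thesis .
qed

lemma au_even: "smooth_on (shell a b) f \<Longrightarrow> unit_im v \<Longrightarrow> au v f (- s) = au v f s"
  using sm_comp_swap[of f f v s] unfolding au_def by (simp add: mult.commute)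

lemma au_0: "au v f 0 = ip f f"
  unfolding au_def ip_def rot_def by simp

definition "au1 v f s = sm (\<lambda>x. Xf v f (qm (rot v s) x) * f x) t"

lemma au_deriv:
  assumes "smooth_on (shell a b) f" "unit_im v"
  shows "(au v f has_real_derivative au1 v f s) (at s)"
  unfolding au_def au1_def by (rule sm_rot_deriv[OF assms(1,1) t assms(2)])

lemma au1_deriv:
  assumes f: "smooth_on (shell a b) f" and v: "unit_im v"
  shows "(au1 v f has_real_derivative - au v (Xf v f) s) (at s)"
proof -
  note Xs = smooth_Xf[OF open_shell f, of v]
  have "((\<lambda>s. sm (\<lambda>x. f (qm (rot v s) x) * Xf v f x) t) has_real_derivative
       sm (\<lambda>x. Xf v f (qm (rot v (-s)) x) * Xf v f x) t) (at (-s))"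
    by (rule sm_rot_deriv[OF f Xs t v])
  then have "((\<lambda>s. sm (\<lambda>x. f (qm (rot v (-s)) x) * Xf v f x) t) has_real_derivative
       sm (\<lambda>x. Xf v f (qm (rot v (-s)) x) * Xf v f x) t * (-1)) (at s)"
    by (rule DERIV_chain2) (auto intro!: derivative_eq_intros)
  moreover have "(\<lambda>s. sm (\<lambda>x. f (qm (rot v (-s)) x) * Xf v f x) t) = au1 v f"
    unfolding au1_def using sm_comp_swap[OF Xs f v] by (simp add: mult.commute)
  ultimately show ?thesis
    using au_even[OF Xs v, of s] by (simp add: au_def)
qed

lemma au1_0: "smooth_on (shell a b) f \<Longrightarrow> unit_im v \<Longrightarrow> au1 v f 0 = 0"
proof -
  assume f: "smooth_on (shell a b) f" and v: "unit_im v"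
  have "sm (Xf v (\<lambda>x. f x * f x)) t = 0"
    by (rule sm_X[OF smooth_on_mult[OF open_shell f f] t v])
  moreover have "sm (Xf v (\<lambda>x. f x * f x)) t = sm (\<lambda>x. 2 * (Xf v f x * f x)) t"
    by (rule sm_cong[OF _ t]) (simp add: Xf_mult[OF open_shell f f])
  ultimately show "au1 v f 0 = 0" unfolding au1_def rot_def by (simp add: sm_cmult)
qed

text \<open>Increments have mean zero along the orbits of a periodic rotation, as Wirtinger's
  inequality requires; \<open>au_incr\<close> expresses this as a second difference of
  \<open>au\<close>.\<close>

definition incr :: "real^4 \<Rightarrow> (real^4 \<Rightarrow> real) \<Rightarrow> real \<Rightarrow> real^4 \<Rightarrow> real" where
  "incr v f s = (\<lambda>x. f (qm (rot v s) x) - f x)"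

lemma smooth_incr: "smooth_on (shell a b) f \<Longrightarrow> unit_im v \<Longrightarrow> smooth_on (shell a b) (incr v f s)"
  unfolding incr_def by (intro smooth_on_diff open_shell smooth_qm_comp norm_rot)

lemma Xf_rot:
  assumes "smooth_on (shell a b) f" "unit_im v" "x \<in> shell a b"
  shows "Xf v (\<lambda>x. f (qm (rot v s) x)) x = Xf v f (qm (rot v s) x)"
proof -
  have "(qm (rot v s) has_derivative qm (rot v s)) (at x)"
    by (rule bounded_linear_imp_has_derivative) (simp add: linear_qm linear_conv_bounded_linear[symmetric])
  from has_derivative_compose[OF this smooth_on_has_derivative[OF assms(1) qm_shell[OF norm_rot[OF assms(2)] assms(3)]]]
  have "Xf v (\<lambda>x. f (qm (rot v s) x)) x = (\<Sum>\<alpha>\<in>UNIV. qm (rot v s) (qm v x) $ \<alpha> * pd \<alpha> f (qm (rot v s) x))"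
    by (rule Xf_eqI)
  moreover have "qm (rot v s) (qm v x) = qm v (qm (rot v s) x)"
    unfolding qm_assoc rot_def by (simp add: qm_simps)
  ultimately show ?thesis by (simp add: Xf_def)
qed

lemma au_incr:
  assumes f: "smooth_on (shell a b) f" and v: "unit_im v"
  shows "au v (incr v f r) s = 2 * au v f s - au v f (s + r) - au v f (s - r)"
proof -
  have c: "smooth_on (shell a b) (\<lambda>x. f (qm (rot v s) x))" for s
    by (intro smooth_qm_comp norm_rot f v)
  have sw: "sm (\<lambda>x. f (qm (rot v s) x) * f (qm (rot v r) x)) t = au v f (s - r)" for s
    using sm_comp_swap[OF c[of s] f v, of "-r"] unfolding au_def
    by (simp add: qm_assoc rot_add v)
  have "au v (incr v f r) s = sm (\<lambda>x. (f (qm (rot v (r + s)) x) * f (qm (rot v r) x) - f (qm (rot v (r + s)) x) * f x)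
      - (f (qm (rot v s) x) * f (qm (rot v r) x) - f (qm (rot v s) x) * f x)) t"
    unfolding au_def incr_def by (simp add: qm_assoc rot_add v algebra_simps)
  also have "\<dots> = (sm (\<lambda>x. f (qm (rot v (r + s)) x) * f (qm (rot v r) x)) t - au v f (r + s))
     - (sm (\<lambda>x. f (qm (rot v s) x) * f (qm (rot v r) x)) t - au v f s)"
    unfolding au_def
    by (simp only: sm_diff[OF smooth_on_diff[OF open_shell smooth_on_mult[OF open_shell c c] smooth_on_mult[OF open_shell c f]]
         smooth_on_diff[OF open_shell smooth_on_mult[OF open_shell c c] smooth_on_mult[OF open_shell c f]] t]
         sm_diff[OF smooth_on_mult[OF open_shell c c] smooth_on_mult[OF open_shell c f] t])
  finally show ?thesis unfolding sw by (simp add: add.commute)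
qed

lemma ip_nonneg: "smooth_on (shell a b) f \<Longrightarrow> ip f f \<ge> 0"
  unfolding ip_def by (rule sm_nonneg[OF smooth_on_mult[OF open_shell] t]) auto

lemma au_le:
  assumes f: "smooth_on (shell a b) f" and v: "unit_im v"
  shows "au v f s \<le> au v f 0"
  using ip_nonneg[OF smooth_incr[OF f v, of s]] au_incr[OF f v, of s 0] au_even[OF f v, of s]
    au_0[of v "incr v f s"] by simp

definition per :: "real^4 \<Rightarrow> real \<Rightarrow> (real^4 \<Rightarrow> real) \<Rightarrow> bool" where
  "per v T f \<longleftrightarrow> smooth_on (shell a b) f \<and> (\<forall>x\<in>shell a b. f (qm (rot v T) x) = f x)"

lemma per_au:
  assumes "per v T f" "unit_im v" shows "au v f (s + T) = au v f s"
  unfolding au_def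
proof (rule sm_cong[OF _ t])
  fix x assume "x \<in> shell a b"
  then have "f (qm (rot v T) (qm (rot v s) x)) = f (qm (rot v s) x)"
    using assms qm_shell[OF norm_rot[OF assms(2)]] unfolding per_def by blast
  then show "f (qm (rot v (s + T)) x) * f x = f (qm (rot v s) x) * f x"
    by (simp add: qm_assoc rot_add assms(2) add.commute)
qed

lemma per_incr:
  assumes p: "per v T f" and v: "unit_im v" shows "per v T (incr v f r)"
  unfolding per_def
proof (intro conjI ballI)
  show "smooth_on (shell a b) (incr v f r)" using assms smooth_incr per_def by blast
  fix x assume x: "x \<in> shell a b"
  have "f (qm (rot v T) (qm (rot v r) x)) = f (qm (rot v r) x)" "f (qm (rot v T) x) = f x"
    using p x qm_shell[OF norm_rot[OF v]] unfolding per_def by blast+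
  then show "incr v f r (qm (rot v T) x) = incr v f r x"
    by (simp add: incr_def qm_assoc rot_add v add.commute)
qed

lemma au_Xf_incr:
  assumes f: "smooth_on (shell a b) f" and v: "unit_im v"
  shows "au v (Xf v (incr v f r)) s = au v (incr v (Xf v f) r) s"
  unfolding au_def
proof (rule sm_cong[OF _ t])
  have 1: "Xf v (incr v f r) x = incr v (Xf v f) r x" if "x \<in> shell a b" for x
    unfolding incr_def
    by (subst Xf_diff[OF open_shell smooth_qm_comp[OF f norm_rot[OF v]] f that]) (simp add: Xf_rot[OF f v that])
  fix x assume "x \<in> shell a b"
  then show "Xf v (incr v f r) (qm (rot v s) x) * Xf v (incr v f r) x =
      incr v (Xf v f) r (qm (rot v s) x) * incr v (Xf v f) r x"
    using 1 qm_shell[OF norm_rot[OF v]] by simp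
qed

text \<open>By \<open>au_incr\<close> at 0 the two differences are half the squared norms of an
  increment of f and of an increment of its derivative. So this is Wirtinger's inequality with
  constant l, tested on increments.\<close>

definition wirt :: "real^4 \<Rightarrow> real \<Rightarrow> real \<Rightarrow> bool" where
  "wirt v T l \<longleftrightarrow> (\<forall>f r. per v T f \<longrightarrow> l * (au v f 0 - au v f r) \<le> au v (Xf v f) 0 - au v (Xf v f) r)"

text \<open>The difference d of the two sides vanishes to first order at r = 0, and
  \<open>wirt\<close> says precisely that d'' + w^2 d \<le> 0; \<open>sine_comparison\<close>
  concludes.\<close>

lemma wirt_bound:
  assumes W: "wirt v T (w\<^sup>2)" and w: "w > 0" "w * r \<le> pi" "r \<ge> 0" and f: "per v T f" and v: "unit_im v"
  shows "au v f 0 - au v f r \<le> au v (Xf v f) 0 * (1 - cos (w * r)) / w\<^sup>2"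
proof -
  let ?N = "au v (Xf v f) 0"
  have sf: "smooth_on (shell a b) f" using f per_def by blast
  have "(au v f 0 - au v f r) - ?N * (1 - cos (w * r)) / w\<^sup>2 \<le> 0"
  proof (rule sine_comparison[OF w, where e = "\<lambda>s. - au1 v f s - ?N * sin (w * s) / w"
        and h = "\<lambda>s. au v (Xf v f) s - ?N * cos (w * s)"])
    show "((\<lambda>r. au v f 0 - au v f r - ?N * (1 - cos (w * r)) / w\<^sup>2) has_real_derivative
       - au1 v f s - ?N * sin (w * s) / w) (at s)" for s
      using w by (auto intro!: derivative_eq_intros au_deriv[OF sf v] simp: power2_eq_square)
    show "((\<lambda>s. - au1 v f s - ?N * sin (w * s) / w) has_real_derivative
       au v (Xf v f) s - ?N * cos (w * s)) (at s)" for s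
      using w by (auto intro!: derivative_eq_intros au1_deriv[OF sf v])
    show "au v (Xf v f) s - ?N * cos (w * s) + w\<^sup>2 * (au v f 0 - au v f s - ?N * (1 - cos (w * s)) / w\<^sup>2) \<le> 0" for s
    proof -
      have "w\<^sup>2 * (au v f 0 - au v f s) \<le> ?N - au v (Xf v f) s"
        using W f unfolding wirt_def by blast
      moreover have "w\<^sup>2 * (au v f 0 - au v f s - ?N * (1 - cos (w * s)) / w\<^sup>2)
          = w\<^sup>2 * (au v f 0 - au v f s) - ?N * (1 - cos (w * s))"
        using w by (simp add: field_simps)
      ultimately show ?thesis by (simp add: right_diff_distrib)
    qed
  qed (simp_all add: au1_0[OF sf v])
  then show ?thesis by simp
qed

lemma wirt_mono:
  assumes "wirt v T l" "l' \<le> l" "unit_im v" shows "wirt v T l'"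
  unfolding wirt_def
proof (intro allI impI)
  fix f r assume f: "per v T f"
  then have "au v f r \<le> au v f 0" using au_le assms(3) per_def by blast
  then have "l' * (au v f 0 - au v f r) \<le> l * (au v f 0 - au v f r)"
    using assms(2) by (simp add: mult_right_mono)
  then show "l' * (au v f 0 - au v f r) \<le> au v (Xf v f) 0 - au v (Xf v f) r"
    using assms(1) f unfolding wirt_def by (meson order_trans)
qed

text \<open>For an increment k of f the autocorrelation integrates to zero over a period. Averaging
  \<open>bd\<close> for k over r thus bounds the squared norm of k by K times that of its
  derivative.\<close>

lemma wirt_improve:
  assumes T: "T > 0" and v: "unit_im v" and K: "K > 0"
    and I: "(B has_integral K * T) {-T/2..T/2}"
    and bd: "\<And>f r. per v T f \<Longrightarrow> \<bar>r\<bar> \<le> T/2 \<Longrightarrow> au v f 0 - au v f r \<le> au v (Xf v f) 0 * B r"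
  shows "wirt v T (1 / K)"
  unfolding wirt_def
proof (intro allI impI)
  fix f r assume f: "per v T f"
  then have sf: "smooth_on (shell a b) f" using per_def by blast
  let ?k = "incr v f r" let ?I = "integral {-T/2..T/2}"
  have auc: "continuous_on UNIV (au v g)" if "smooth_on (shell a b) g" for g
    using au_deriv[OF that v] DERIV_isCont continuous_at_imp_continuous_on by blast
  have cs: "continuous_on {-T/2..T/2} (\<lambda>s. au v g (s + y))" if "smooth_on (shell a b) g" for g y
    by (rule continuous_on_compose2[OF auc[OF that]]) (auto intro!: continuous_intros)
  have int [simp]: "(\<lambda>s. au v f (s + y)) integrable_on {-T/2..T/2}" for y
    by (rule integrable_continuous_real[OF cs[OF sf]])
  have int0 [simp]: "au v g integrable_on {-T/2..T/2}" if "smooth_on (shell a b) g" for g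
    using integrable_continuous_real[OF cs[OF that, of 0]] by simp
  have sh: "((\<lambda>s. au v f (s + y)) has_integral ?I (au v f)) {-T/2..T/2}" for y
    using integrable_integral[OF int[of y]] periodic_integral_shift[OF auc[OF sf] per_au[OF f v] T, of y]
    by simp
  have "((\<lambda>s. 2 * au v f s - au v f (s + r) - au v f (s + (-r))) has_integral
      2 * ?I (au v f) - ?I (au v f) - ?I (au v f)) {-T/2..T/2}"
    using sh[of 0] by (intro has_integral_diff has_integral_mult_right sh) simp
  then have k0: "?I (au v ?k) = 0"
    unfolding au_incr[OF sf v, abs_def] by (simp add: integral_unique)
  have "?I (\<lambda>s. au v ?k 0 - au v ?k s) \<le> ?I (\<lambda>s. au v (Xf v ?k) 0 * B s)"
  proof (rule integral_le)
    show "(\<lambda>s. au v (Xf v ?k) 0 * B s) integrable_on {-T/2..T/2}"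
      using I by (intro integrable_on_mult_right) auto
    show "(\<lambda>s. au v ?k 0 - au v ?k s) integrable_on {-T/2..T/2}"
      by (intro integrable_diff int0[OF smooth_incr[OF sf v]] integrable_const_ivl)
    show "au v ?k 0 - au v ?k s \<le> au v (Xf v ?k) 0 * B s" if "s \<in> {-T/2..T/2}" for s
      using that by (intro bd per_incr[OF f v]) auto
  qed
  moreover have "?I (\<lambda>s. au v ?k 0 - au v ?k s) = T * au v ?k 0"
    using T k0 by (subst integral_diff[OF integrable_const_ivl int0[OF smooth_incr[OF sf v]]]) simp
  moreover have "?I (\<lambda>s. au v (Xf v ?k) 0 * B s) = au v (Xf v ?k) 0 * (K * T)"
    using I by (simp add: integral_unique)
  ultimately have "T * au v ?k 0 \<le> T * (au v (Xf v ?k) 0 * K)" by (simp only: mult_ac)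
  then have "au v ?k 0 \<le> au v (Xf v ?k) 0 * K" using T by (simp only: mult_le_cancel_left_pos)
  then show "1 / K * (au v f 0 - au v f r) \<le> au v (Xf v f) 0 - au v (Xf v f) r"
    using au_incr[OF sf v, of r 0] au_even[OF sf v, of r] au_Xf_incr[OF sf v, of r 0]
      au_incr[OF smooth_Xf[OF open_shell sf] v, of v r 0] au_even[OF smooth_Xf[OF open_shell sf] v, of v r] K
    by (simp add: divide_le_eq left_diff_distrib)
qed

text \<open>A starting constant. The second derivative of \<open>au\<close> is smallest at 0, which
  gives the comparison function r^2 / 2, of mean T^2 / 24 over a period.\<close>

lemma wirt_pos:
  assumes T: "T > 0" and v: "unit_im v"
  shows "wirt v T (24 / T\<^sup>2)"
proof -
  have I: "((\<lambda>r. r\<^sup>2 / 2) has_integral (T\<^sup>2 / 24) * T) {-T/2..T/2}"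
  proof -
    have "((\<lambda>r. r\<^sup>2 / 2) has_integral ((T/2)^3/6 - (-T/2)^3/6)) {-T/2..T/2}"
      using T by (intro fundamental_theorem_of_calculus)
        (auto intro!: derivative_eq_intros simp: has_real_derivative_iff_has_vector_derivative[symmetric] power2_eq_square)
    then show ?thesis by (simp add: power2_eq_square power3_eq_cube mult_ac)
  qed
  have bd: "au v f 0 - au v f r \<le> au v (Xf v f) 0 * (r\<^sup>2 / 2)" if f: "smooth_on (shell a b) f" and r: "r \<ge> 0" for f r
  proof -
    let ?N = "au v (Xf v f) 0"
    have 1: "- au1 v f s - ?N * s \<le> 0" if "s \<ge> 0" for s
    proof -
      have "- au1 v f s - ?N * s \<le> - au1 v f 0 - ?N * 0"
      proof (rule DERIV_nonpos_imp_nonincreasing[OF that])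
        fix x :: real
        have "((\<lambda>s. - au1 v f s - ?N * s) has_real_derivative au v (Xf v f) x - ?N) (at x)"
          by (auto intro!: derivative_eq_intros au1_deriv[OF f v])
        then show "\<exists>y. ((\<lambda>s. - au1 v f s - ?N * s) has_real_derivative y) (at x) \<and> y \<le> 0"
          using au_le[OF smooth_Xf[OF open_shell f] v, of v x] by fastforce
      qed
      then show ?thesis by (simp add: au1_0[OF f v])
    qed
    have "au v f 0 - au v f r - ?N * (r\<^sup>2 / 2) \<le> au v f 0 - au v f 0 - ?N * (0\<^sup>2 / 2)"
    proof (rule DERIV_nonpos_imp_nonincreasing[OF r])
      fix x :: real assume "0 \<le> x"
      moreover have "((\<lambda>r. au v f 0 - au v f r - ?N * (r\<^sup>2 / 2)) has_real_derivative - au1 v f x - ?N * x) (at x)"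
        by (auto intro!: derivative_eq_intros au_deriv[OF f v])
      ultimately show "\<exists>y. ((\<lambda>r. au v f 0 - au v f r - ?N * (r\<^sup>2 / 2)) has_real_derivative y) (at x) \<and> y \<le> 0"
        using 1 by blast
    qed
    then show ?thesis by simp
  qed
  have "wirt v T (1 / (T\<^sup>2 / 24))"
  proof (rule wirt_improve[OF T v _ I])
    fix f r assume "per v T f"
    then have f: "smooth_on (shell a b) f" using per_def by blast
    show "au v f 0 - au v f r \<le> au v (Xf v f) 0 * (r\<^sup>2 / 2)"
      using bd[OF f, of r] bd[OF f, of "-r"] au_even[OF f v, of r] by (cases "r \<ge> 0") auto
  qed (use T in simp)
  then show ?thesis by simp
qed

text \<open>K is the mean over a period of (1 - cos (w r)) / w^2, the bound of
  \<open>wirt_bound\<close>. For w T / 2 < pi it lies below 1 / w^2, so that the constant w^2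
  improves to 1 / K.\<close>

lemma wirt_step:
  assumes T: "T > 0" and v: "unit_im v" and w: "w > 0" "w * (T/2) \<le> pi" and W: "wirt v T (w\<^sup>2)"
    and K: "K = (1 - sin (w * (T/2)) / (w * (T/2))) / w\<^sup>2" "K > 0"
  shows "wirt v T (1 / K)"
proof (rule wirt_improve[OF T v K(2)])
  have "((\<lambda>r. (1 - cos (w * r)) / w\<^sup>2) has_integral
      ((T/2 - sin (w * (T/2)) / w) / w\<^sup>2 - (-T/2 - sin (w * (-T/2)) / w) / w\<^sup>2)) {-T/2..T/2}"
    using T w by (intro fundamental_theorem_of_calculus)
      (auto intro!: derivative_eq_intros simp: has_real_derivative_iff_has_vector_derivative[symmetric] power2_eq_square)
  moreover have "(T/2 - sin (w * (T/2)) / w) / w\<^sup>2 - (-T/2 - sin (w * (-T/2)) / w) / w\<^sup>2 = K * T"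
    using T w by (simp add: K field_simps)
  ultimately show "((\<lambda>r. (1 - cos (w * r)) / w\<^sup>2) has_integral K * T) {-T/2..T/2}" by simp
next
  fix f r assume f: "per v T f" and r: "\<bar>r\<bar> \<le> T/2"
  have "w * \<bar>r\<bar> \<le> w * (T/2)" using r w by (intro mult_left_mono) auto
  then have "w * \<bar>r\<bar> \<le> pi" using w(2) by (rule order_trans)
  then have "au v f 0 - au v f \<bar>r\<bar> \<le> au v (Xf v f) 0 * (1 - cos (w * \<bar>r\<bar>)) / w\<^sup>2"
    by (rule wirt_bound[OF W w(1) _ abs_ge_zero f v])
  moreover have "au v f \<bar>r\<bar> = au v f r" "cos (w * \<bar>r\<bar>) = cos (w * r)"
    using f au_even[OF _ v, of f r] unfolding per_def by (auto simp: abs_if)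
  ultimately show "au v f 0 - au v f r \<le> au v (Xf v f) 0 * ((1 - cos (w * r)) / w\<^sup>2)" by simp
qed

text \<open>The best constant is a fixed point of the improvement, hence the sharp one.\<close>

lemma wirtinger:
  assumes T: "T > 0" and v: "unit_im v"
  shows "wirt v T ((2 * pi / T)\<^sup>2)"
proof -
  define M where "M = (2 * pi / T)\<^sup>2"
  define L where "L = {l \<in> {0..M}. wirt v T l}"
  define m where "m = Sup L"
  have "0 \<in> L" using wirt_mono[OF wirt_pos[OF T v] _ v, of 0] unfolding L_def M_def by simp
  moreover have bd: "bdd_above L" unfolding L_def by (rule bdd_aboveI[of _ M]) auto
  moreover have "min M (24 / T\<^sup>2) \<in> L"
    using wirt_mono[OF wirt_pos[OF T v] _ v, of "min M (24 / T\<^sup>2)"] T unfolding L_def M_def by simp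
  ultimately have "min M (24 / T\<^sup>2) \<le> m" unfolding m_def by (intro cSup_upper)
  then have m: "m > 0" using T unfolding M_def by (auto simp: min_def split: if_splits)
     (meson T divide_pos_pos less_le_trans pi_gt_zero zero_less_numeral zero_less_power mult_pos_pos)+
  have mM: "m \<le> M" unfolding m_def by (rule cSup_least) (use \<open>0 \<in> L\<close> in \<open>auto simp: L_def\<close>)
  \<comment> \<open>The supremum is attained, since for each f and r the condition on the constant
    is closed.\<close>
  have Wm: "wirt v T m"
    unfolding wirt_def
  proof (intro allI impI)
    fix f r assume f: "per v T f"
    let ?b = "au v f 0 - au v f r" and ?N = "au v (Xf v f) 0 - au v (Xf v f) r"
    have b: "?b \<ge> 0" using au_le[OF _ v] f unfolding per_def by simp
    have l: "l * ?b \<le> ?N" if "l \<in> L" for l using that f unfolding L_def wirt_def by blast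
    show "m * ?b \<le> ?N"
    proof (cases "?b = 0")
      case False
      then have "m \<le> ?N / ?b"
        unfolding m_def using b l \<open>0 \<in> L\<close> by (intro cSup_least) (auto simp: pos_le_divide_eq)
      then show ?thesis using b False by (simp add: pos_le_divide_eq)
    qed (use l[OF \<open>0 \<in> L\<close>] in simp)
  qed
  \<comment> \<open>For m < M the argument y lies strictly between 0 and pi, where sin y > 0; the
    improved constant 1 / K then exceeds m, against maximality.\<close>
  have "m = M"
  proof (rule ccontr)
    assume "m \<noteq> M"
    then have mM': "m < M" using mM by simp
    define w where "w = sqrt m"
    define y where "y = w * (T/2)"
    define K where "K = (1 - sin (w * (T/2)) / (w * (T/2))) / w\<^sup>2"
    have w: "w > 0" "w\<^sup>2 = m" using m unfolding w_def by auto
    have "w < 2 * pi / T"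
      using mM' T w unfolding M_def by (intro power_less_imp_less_base[of w 2]) auto
    then have y: "0 < y" "y < pi" using T w by (auto simp: y_def field_simps)
    then have "sin y > 0" "sin y < y" by (auto simp: sin_gt_zero intro: sin_less_arg)
    then have 1: "0 < sin y / y" "sin y / y < 1" using y by auto
    have K: "K = (1 - sin y / y) / m" unfolding K_def y_def w(2) ..
    then have Kp: "K > 0" using 1 m by simp
    have "1 / K > m" using 1 m Kp by (simp add: K less_divide_eq)
    have "wirt v T (1 / K)"
      using wirt_step[OF T v w(1) _ _ K_def Kp] Wm w(2) y unfolding y_def by simp
    then have "min M (1 / K) \<in> L"
      using wirt_mono[of v T "1/K" "min M (1/K)"] v m mM Kp unfolding L_def by auto
    then have "min M (1 / K) \<le> m" unfolding m_def by (rule cSup_upper[OF _ bd])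
    then show False using \<open>1 / K > m\<close> mM' by auto
  qed
  then show ?thesis using Wm unfolding M_def by simp
qed

lemma rotation_bound_full:
  assumes f: "smooth_on (shell a b) f" and v: "unit_im v" and r: "0 \<le> r" "r \<le> pi"
  shows "au v f 0 - au v f r \<le> au v (Xf v f) 0 * (1 - cos r)"
proof -
  have "per v (2 * pi) f" using f unfolding per_def rot_def by simp
  then show ?thesis
    using wirt_bound[of v "2*pi" 1 r f] wirtinger[of "2*pi" v] v r by simp
qed

text \<open>\<open>rot v pi\<close> is -1, so an even function has period pi along every rotation,
  and the sharp constant rises from 1 to 4.\<close>

lemma rotation_bound_even:
  assumes f: "smooth_on (shell a b) f" and e: "\<And>x. x \<in> shell a b \<Longrightarrow> f (- x) = f x"
    and v: "unit_im v" and r: "0 \<le> r" "r \<le> pi/2"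
  shows "2 * (au v f 0 - au v f r) \<le> au v (Xf v f) 0 * (sin r)\<^sup>2"
proof -
  have "per v pi f" using f e unfolding per_def rot_def by (simp add: qm_simps)
  then have "au v f 0 - au v f r \<le> au v (Xf v f) 0 * (1 - cos (2 * r)) / 2\<^sup>2"
    using wirt_bound[of v pi 2 r f] wirtinger[of pi v] v r by simp
  moreover have "1 - cos (2 * r) = 2 * (sin r)\<^sup>2" by (simp add: cos_double_sin)
  ultimately have "au v f 0 - au v f r \<le> au v (Xf v f) 0 * (2 * (sin r)\<^sup>2) / 2\<^sup>2" by simp
  moreover have "au v (Xf v f) 0 * (2 * (sin r)\<^sup>2) / 2\<^sup>2 = au v (Xf v f) 0 * (sin r)\<^sup>2 / 2" by simp
  ultimately have "au v f 0 - au v f r \<le> au v (Xf v f) 0 * (sin r)\<^sup>2 / 2" by (rule ord_le_eq_trans)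
  then show ?thesis by (subst mult.commute) (simp only: le_divide_eq_numeral1)
qed

end

section \<open>The spectral gap on the sphere\<close>

lemma sint_param_cont:
  fixes F :: "real^4 \<Rightarrow> real^4 \<Rightarrow> real"
  assumes F: "continuous_on (S3 \<times> S3) (\<lambda>(q, \<theta>). F q \<theta>)"
  shows "continuous_on S3 (\<lambda>q. sint (F q))"
proof -
  have "compact ((\<lambda>(q, \<theta>). F q \<theta>) ` (S3 \<times> S3))"
    by (intro compact_continuous_image[OF F] compact_Times) auto
  then have "bounded ((\<lambda>(q, \<theta>). F q \<theta>) ` (S3 \<times> S3))" by (rule compact_imp_bounded)
  then obtain B where B0: "\<forall>y\<in>(\<lambda>(q, \<theta>). F q \<theta>) ` (S3 \<times> S3). norm y \<le> B"
    unfolding bounded_iff ..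
  have B: "\<bar>F q \<theta>\<bar> \<le> B" if "q \<in> S3" "\<theta> \<in> S3" for q \<theta>
    using B0 that by force
  have c1: "continuous_on S3 (F q)" if "q \<in> S3" for q
    using continuous_on_compose2[OF F, of S3 "\<lambda>\<theta>. (q, \<theta>)"] that by (force intro!: continuous_intros)
  have c2: "continuous_on S3 (\<lambda>q. F q \<theta>)" if "\<theta> \<in> S3" for \<theta>
    using continuous_on_compose2[OF F, of S3 "\<lambda>q. (q, \<theta>)"] that by (force intro!: continuous_intros)
  show ?thesis
    unfolding continuous_on_sequentially
  proof (intro allI ballI impI, elim conjE)
    fix X q assume q: "q \<in> S3" and X: "\<forall>n. X n \<in> S3" "X \<longlonglongrightarrow> q"
    have "(\<lambda>n. LINT \<theta>|sph. indicator S3 \<theta> *\<^sub>R F (X n) \<theta>) \<longlonglongrightarrow> (LINT \<theta>|sph. indicator S3 \<theta> *\<^sub>R F q \<theta>)"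
    proof (rule integral_dominated_convergence[where w="\<lambda>\<theta>. B"])
      show "(\<lambda>\<theta>. indicator S3 \<theta> *\<^sub>R F q \<theta>) \<in> borel_measurable sph"
        using borel_measurable_continuous_on_indicator[OF _ c1[OF q]] by simp
      show "(\<lambda>\<theta>. indicator S3 \<theta> *\<^sub>R F (X n) \<theta>) \<in> borel_measurable sph" for n
        using borel_measurable_continuous_on_indicator[OF _ c1] X by simp
      show "AE \<theta> in sph. (\<lambda>n. indicator S3 \<theta> *\<^sub>R F (X n) \<theta>) \<longlonglongrightarrow> indicator S3 \<theta> *\<^sub>R F q \<theta>"
      proof (intro AE_I2)
        fix \<theta>
        show "(\<lambda>n. indicator S3 \<theta> *\<^sub>R F (X n) \<theta>) \<longlonglongrightarrow> indicator S3 \<theta> *\<^sub>R F q \<theta>"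
        proof (cases "\<theta> \<in> S3")
          case True
          then have "((\<lambda>q. F q \<theta>) \<circ> X) \<longlonglongrightarrow> F q \<theta>"
            using c2[OF True] X q unfolding continuous_on_sequentially by blast
          then show ?thesis using True by (simp add: o_def)
        qed simp
      qed
      show "AE \<theta> in sph. norm (indicator S3 \<theta> *\<^sub>R F (X n) \<theta>) \<le> B" for n
        using B X by (intro AE_mp[OF AE_sph AE_I2]) auto
    qed simp
    then show "((\<lambda>q. sint (F q)) \<circ> X) \<longlonglongrightarrow> sint (F q)"
      unfolding sint_def set_lebesgue_integral_def o_def .
  qed
qed

lemma sint_swap:
  fixes F :: "real^4 \<Rightarrow> real^4 \<Rightarrow> real"
  assumes F: "continuous_on (S3 \<times> S3) (\<lambda>(q, \<theta>). F q \<theta>)"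
  shows "sint (\<lambda>q. sint (F q)) = sint (\<lambda>\<theta>. sint (\<lambda>q. F q \<theta>))"
proof -
  interpret P: pair_sigma_finite sph sph ..
  interpret PF: finite_measure "sph \<Otimes>\<^sub>M sph"
    by (intro finite_measure_pair_measure sph.finite_measure_axioms)
  let ?G = "\<lambda>z. indicator (S3 \<times> S3) z *\<^sub>R (\<lambda>(q, \<theta>). F q \<theta>) z"
  have "compact ((\<lambda>(q, \<theta>). F q \<theta>) ` (S3 \<times> S3))"
    by (intro compact_continuous_image[OF F] compact_Times) auto
  then have "bounded ((\<lambda>(q, \<theta>). F q \<theta>) ` (S3 \<times> S3))" by (rule compact_imp_bounded)
  then obtain B where B0: "\<forall>y\<in>(\<lambda>(q, \<theta>). F q \<theta>) ` (S3 \<times> S3). norm y \<le> B"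
    unfolding bounded_iff ..
  have B: "\<bar>F q \<theta>\<bar> \<le> B" if "q \<in> S3" "\<theta> \<in> S3" for q \<theta>
    using B0 that by force
  have B': "0 \<le> B" using B[of "qb 1" "qb 1"] by (simp add: norm_axis_1)
  have "?G \<in> borel_measurable borel"
    by (rule borel_measurable_continuous_on_indicator[OF _ F]) (simp add: borel_closed closed_Times)
  then have "?G \<in> borel_measurable (sph \<Otimes>\<^sub>M sph)"
    by (simp add: measurable_cong_sets[OF sets_pair_measure_cong[OF sets_sph(1) sets_sph(1)] refl] borel_prod)
  then have int: "integrable (sph \<Otimes>\<^sub>M sph) ?G"
    by (rule PF.integrable_const_bound[where B=B, rotated]) (auto intro!: AE_I2 simp: indicator_def B B')
  have "(LINT q|sph. LINT \<theta>|sph. ?G (q, \<theta>)) = (LINT \<theta>|sph. LINT q|sph. ?G (q, \<theta>))"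
    by (rule P.Fubini_integral[symmetric]) (use int in \<open>simp add: case_prod_unfold\<close>)
  moreover have "(LINT q|sph. LINT \<theta>|sph. ?G (q, \<theta>)) = sint (\<lambda>q. sint (F q))"
    unfolding sint_def set_lebesgue_integral_def
    by (simp add: indicator_times mult.assoc)
  moreover have "(LINT \<theta>|sph. LINT q|sph. ?G (q, \<theta>)) = sint (\<lambda>\<theta>. sint (\<lambda>q. F q \<theta>))"
    unfolding sint_def set_lebesgue_integral_def
    by (simp add: indicator_times mult.assoc mult.left_commute)
  ultimately show ?thesis by simp
qed

lemma sint_minus: "sint (\<lambda>\<theta>. - f \<theta>) = - sint f"
  using sint_cmult[of "-1" f] by simp

lemma sint_diff:
  assumes "continuous_on S3 f" "continuous_on S3 g"
  shows "sint (\<lambda>\<theta>. f \<theta> - g \<theta>) = sint f - sint g"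
  using sint_add[OF assms(1) continuous_on_minus[OF assms(2)]] by (simp add: sint_minus)

lemma sint_lincomb:
  fixes c :: "'i::finite \<Rightarrow> real"
  assumes "\<And>j. continuous_on S3 (g j)"
  shows "sint (\<lambda>\<theta>. \<Sum>j\<in>UNIV. c j * g j \<theta>) = (\<Sum>j\<in>UNIV. c j * sint (g j))"
proof -
  have "sint (\<lambda>\<theta>. \<Sum>j\<in>I. c j * g j \<theta>) = (\<Sum>j\<in>I. c j * sint (g j))" if "finite I" for I
    using that by (induction I) (auto simp: sint_const sint_add sint_cmult assms continuous_on_sum continuous_on_mult)
  then show ?thesis by simp
qed

lemma sint_odd:
  assumes "continuous_on S3 g" "\<And>\<theta>. \<theta> \<in> S3 \<Longrightarrow> g (- \<theta>) = - g \<theta>"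
  shows "sint g = 0"
proof -
  have "sint (\<lambda>\<theta>. g (- \<theta>)) = sint g"
    by (rule sint_orthogonal[OF _ assms(1)]) (simp add: orthogonal_transformation_neg orthogonal_transformation_id)
  moreover have "sint (\<lambda>\<theta>. g (- \<theta>)) = - sint g"
    using sint_cmult[of "-1" g] sint_cong[of "\<lambda>\<theta>. g (- \<theta>)" "\<lambda>\<theta>. -1 * g \<theta>"] assms(2) by simp
  ultimately show ?thesis by simp
qed

section \<open>Moments of the coordinates on the sphere\<close>

definition flip :: "4 \<Rightarrow> real^4 \<Rightarrow> real^4" where
  "flip i x = (\<chi> j. if j = i then - x$j else x$j)"

lemma flip_nth [simp]: "flip i x $ j = (if j = i then - x$j else x$j)"
  unfolding flip_def by simp

lemma orthogonal_flip: "orthogonal_transformation (flip i)"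
proof -
  have "(norm (flip i x))\<^sup>2 = (norm x)\<^sup>2" for x unfolding norm4 by simp
  then have "norm (flip i x) = norm x" for x by (simp add: power2_eq_iff_nonneg)
  moreover have "linear (flip i)" by (simp add: linear_iff vec_eq_iff)
  ultimately show ?thesis unfolding orthogonal_transformation by simp
qed

lemma sint_flip:
  assumes "continuous_on S3 g" "\<And>\<theta>. g (flip i \<theta>) = - g \<theta>"
  shows "sint g = 0"
  using sint_orthogonal[OF orthogonal_flip assms(1), of i] sint_cmult[of "-1" g] assms(2) by simp

lemma sint_X:
  assumes f: "smooth_on (shell (-1) 1) f" and k: "unit_im k"
  shows "sint (Xf k f) = 0"
  using sm_X[OF f _ k, of 0] by (simp add: sm_def)

lemma coord_cont [continuous_intros]: "continuous_on A (\<lambda>x::real^4. x$i)"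
  by (intro continuous_intros)

lemma S3_sum: "x \<in> S3 \<Longrightarrow> (x$1)\<^sup>2 + (x$2)\<^sup>2 + (x$3)\<^sup>2 + (x$4)\<^sup>2 = 1"
  using norm4[of x] by simp

text \<open>By \<open>sint_X\<close> the means of \<open>X_k (x_1 x_k) = x_1^2 - x_k^2\<close> and
  of \<open>X_k (x_1^3 x_k) = x_1^4 - 3 x_1^2 x_k^2\<close> vanish.\<close>

lemma moment_pair:
  assumes k: "k \<in> {2,3,4}"
  shows "sint (\<lambda>x. (x$k)\<^sup>2) = sint (\<lambda>x. (x$1)\<^sup>2)" "3 * sint (\<lambda>x. (x$1)\<^sup>2 * (x$k)\<^sup>2) = sint (\<lambda>x. (x$1)^4)"
proof -
  let ?U = "shell (-1) 1"
  have q: "qm (qb k) x $ 1 = - x$k" "qm (qb k) x $ k = x$1" for x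
    using k by (auto simp: axis_def)
  have u: "unit_im (qb k)" using k by auto
  have U: "x \<in> ?U" if "x \<in> S3" for x using that by (simp add: shell_def)
  note sc = smooth_on_coord[of ?U]
  note s2 = smooth_on_mult[OF open_shell sc sc]
  note s3 = smooth_on_mult[OF open_shell sc s2]
  have 1: "Xf (qb k) (\<lambda>x. x$1 * x$k) x = (x$1)\<^sup>2 - (x$k)\<^sup>2" if "x \<in> S3" for x
    by (subst Xf_mult[OF open_shell sc sc U[OF that]]) (simp add: Xf_coord q power2_eq_square del: qm_nth)
  have "0 = sint (\<lambda>x. (x$1)\<^sup>2 - (x$k)\<^sup>2)"
    using sint_X[OF smooth_on_mult[OF open_shell smooth_on_coord smooth_on_coord] u, of 1 k]
      sint_cong[OF 1] by simp
  also have "\<dots> = sint (\<lambda>x. (x$1)\<^sup>2) - sint (\<lambda>x. (x$k)\<^sup>2)"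
    by (rule sint_diff) (intro continuous_intros)+
  finally show "sint (\<lambda>x. (x$k)\<^sup>2) = sint (\<lambda>x. (x$1)\<^sup>2)" by simp
  have 2: "Xf (qb k) (\<lambda>x. x$1 * (x$1 * x$1) * x$k) x = (x$1)^4 - 3 * ((x$1)\<^sup>2 * (x$k)\<^sup>2)" if "x \<in> S3" for x
    by (simp add: Xf_mult[OF open_shell s3 sc U[OF that]] Xf_mult[OF open_shell sc s2 U[OF that]]
        Xf_mult[OF open_shell sc sc U[OF that]] Xf_coord q del: qm_nth) algebra
  have "0 = sint (\<lambda>x. (x$1)^4 - 3 * ((x$1)\<^sup>2 * (x$k)\<^sup>2))"
    using sint_X[OF smooth_on_mult[OF open_shell smooth_on_mult[OF open_shell smooth_on_coord
       smooth_on_mult[OF open_shell smooth_on_coord smooth_on_coord]] smooth_on_coord] u, of 1 1 1 k]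
      sint_cong[OF 2] by simp
  also have "\<dots> = sint (\<lambda>x. (x$1)^4) - 3 * sint (\<lambda>x. (x$1)\<^sup>2 * (x$k)\<^sup>2)"
    unfolding sint_cmult[symmetric] by (rule sint_diff) (intro continuous_intros)+
  finally show "3 * sint (\<lambda>x. (x$1)\<^sup>2 * (x$k)\<^sup>2) = sint (\<lambda>x. (x$1)^4)" by simp
qed

lemma moments:
  "sint (\<lambda>x. (x$1)\<^sup>2) = 1/4" "sint (\<lambda>x. (x$1)^4) = 1/8"
proof -
  have "1 = sint (\<lambda>x. (x$1)\<^sup>2 + (x$2)\<^sup>2 + (x$3)\<^sup>2 + (x$4)\<^sup>2)"
    using sint_cong[of "\<lambda>x. (x$1)\<^sup>2 + (x$2)\<^sup>2 + (x$3)\<^sup>2 + (x$4)\<^sup>2" "\<lambda>x. 1"] S3_sum by (simp add: sint_const)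
  also have "\<dots> = 4 * sint (\<lambda>x. (x$1)\<^sup>2)"
    by (simp add: sint_add continuous_intros moment_pair)
  finally show 2: "sint (\<lambda>x. (x$1)\<^sup>2) = 1/4" by simp
  have "sint (\<lambda>x. (x$1)\<^sup>2) = sint (\<lambda>x. (x$1)^4 + (x$1)\<^sup>2 * (x$2)\<^sup>2 + (x$1)\<^sup>2 * (x$3)\<^sup>2 + (x$1)\<^sup>2 * (x$4)\<^sup>2)"
  proof (rule sint_cong)
    fix x :: "real^4" assume "x \<in> S3"
    then have "(x$1)\<^sup>2 = (x$1)\<^sup>2 * ((x$1)\<^sup>2 + (x$2)\<^sup>2 + (x$3)\<^sup>2 + (x$4)\<^sup>2)" using S3_sum by simp
    then show "(x$1)\<^sup>2 = (x$1)^4 + (x$1)\<^sup>2 * (x$2)\<^sup>2 + (x$1)\<^sup>2 * (x$3)\<^sup>2 + (x$1)\<^sup>2 * (x$4)\<^sup>2"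
      by (simp add: distrib_left power2_eq_square power4_eq_xxxx)
  qed
  also have "\<dots> = 2 * sint (\<lambda>x. (x$1)^4)"
    using moment_pair(2)[of 2] moment_pair(2)[of 3] moment_pair(2)[of 4]
    by (simp add: sint_add continuous_intros)
  finally show "sint (\<lambda>x. (x$1)^4) = 1/8" using 2 by simp
qed

lemma moment_mixed: "i \<noteq> j \<Longrightarrow> sint (\<lambda>x. x$i * x$j) = 0"
  by (rule sint_flip[where i=i]) (auto intro!: continuous_intros)

lemma moment_sq: "sint (\<lambda>x. (x$i)\<^sup>2) = 1/4"
proof -
  have "\<forall>i::4. sint (\<lambda>x. (x$i)\<^sup>2) = 1/4" unfolding forall_4 using moment_pair(1) moments(1) by simp
  then show ?thesis by blast
qed

section \<open>Correlations of a function with its rotations\<close>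

lemma rot_form:
  assumes q: "q \<in> S3"
  obtains v r where "unit_im v" "0 \<le> r" "r \<le> pi" "q = rot v r" "q - q$1 *\<^sub>R qb 1 = sin r *\<^sub>R v" "q$1 = cos r"
proof -
  have q1: "\<bar>q$1\<bar> \<le> 1" using component_le_norm_cart[of q 1] q by simp
  define r where "r = arccos (q$1)"
  have r: "0 \<le> r" "r \<le> pi" "cos r = q$1"
    using q1 unfolding r_def by (auto simp: arccos_lbound arccos_ubound abs_le_iff)
  define p where "p = q - q$1 *\<^sub>R qb 1"
  have p: "p$1 = 0" "p$2 = q$2" "p$3 = q$3" "p$4 = q$4" unfolding p_def by (simp_all add: axis_def)
  have "(norm p)\<^sup>2 = 1 - (cos r)\<^sup>2" using S3_sum[OF q] unfolding norm4 p r by simp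
  then have np: "norm p = sin r"
    using sin_ge_zero[OF r(1,2)] by (simp add: sin_squared_eq[symmetric] power2_eq_iff_nonneg)
  show ?thesis
  proof (cases "sin r = 0")
    case True
    then have "p = 0" using np by simp
    \<comment> \<open>For q = 1 and q = -1 every axis serves.\<close>
    then show ?thesis
      using r True unit_im_qb(1) by (intro that[of "qb 2" r]) (auto simp: rot_def p_def)
  next
    case False
    define v where "v = p /\<^sub>R sin r"
    have "unit_im v" using False np sin_ge_zero[OF r(1,2)] unfolding unit_im_def v_def by (simp add: p)
    moreover have pv: "p = sin r *\<^sub>R v" using False unfolding v_def by simp
    moreover have "q = rot v r" unfolding rot_def pv[symmetric] r p_def by simp
    ultimately show ?thesis using r by (intro that[of v r]) (auto simp: p_def)
  qed
qed

lemma qm_expand: "qm p x = p$1 *\<^sub>R x + p$2 *\<^sub>R qm (qb 2) x + p$3 *\<^sub>R qm (qb 3) x + p$4 *\<^sub>R qm (qb 4) x"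
  unfolding vec4_eq_iff vector_add_component vector_scaleR_component qm_nth by (simp add: axis_def)

lemma Xf_scale: "Xf (c *\<^sub>R v) f x = c * Xf v f x"
  by (simp add: Xf_def qm_simps sum_distrib_left mult_ac)

context
  fixes a b t :: real
  assumes t: "t \<in> {a<..<b}"
begin

abbreviation "ipt \<equiv> ip t"

text \<open>Every unit quaternion lies on a one-parameter group, so the one-dimensional inequality
  bounds this for all q, while averages over q against polynomials in q are spectral quantities of
  f.\<close>

definition corr :: "(real^4 \<Rightarrow> real) \<Rightarrow> real^4 \<Rightarrow> real" where
  "corr f q = sm (\<lambda>x. f (qm q x) * f x) t"

text \<open>For \<open>q = rot v r\<close> this is (sin r)^2 times the energy of f along v. It is
  polynomial in q, which v and r are not, and can be averaged by moments.\<close>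

definition Qf :: "(real^4 \<Rightarrow> real) \<Rightarrow> real^4 \<Rightarrow> real" where
  "Qf f q = ipt (Xf (q - q$1 *\<^sub>R qb 1) f) (Xf (q - q$1 *\<^sub>R qb 1) f)"

definition cmp :: "(real^4 \<Rightarrow> real) \<Rightarrow> 4 \<Rightarrow> real" where
  "cmp f j = sint (\<lambda>\<theta>. f (exp t *\<^sub>R \<theta>) * \<theta>$j)"

definition en :: "(real^4 \<Rightarrow> real) \<Rightarrow> real" where
  "en f = ipt (Xf (qb 2) f) (Xf (qb 2) f) + ipt (Xf (qb 3) f) (Xf (qb 3) f) + ipt (Xf (qb 4) f) (Xf (qb 4) f)"

text \<open>The factor 1 + cos r turns the 1 - cos r of \<open>rotation_bound_full\<close> into (sin
  r)^2. For even f the one-dimensional bound covers r \<le> pi/2, and replacing q by -q covers the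
  rest.\<close>

lemma corr_bounds:
  assumes f: "smooth_on (shell a b) f" and q: "q \<in> S3"
  shows "(1 + q$1) * (ipt f f - corr f q) \<le> Qf f q"
    and "(\<And>x. x \<in> shell a b \<Longrightarrow> f (- x) = f x) \<Longrightarrow> 2 * (ipt f f - corr f q) \<le> Qf f q"
proof -
  have main: "(1 + q$1) * (ipt f f - corr f q) \<le> Qf f q"
    "(\<And>x. x \<in> shell a b \<Longrightarrow> f (- x) = f x) \<Longrightarrow> q$1 \<ge> 0 \<Longrightarrow> 2 * (ipt f f - corr f q) \<le> Qf f q" if q: "q \<in> S3" for q
  proof -
    obtain v r where v: "unit_im v" and r: "0 \<le> r" "r \<le> pi" "q = rot v r"
      and s: "q - q$1 *\<^sub>R qb 1 = sin r *\<^sub>R v" "q$1 = cos r"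
      using rot_form[OF q] by metis
    have Q: "Qf f q = (sin r)\<^sup>2 * au t v (Xf v f) 0"
      unfolding Qf_def s(1) au_0[OF t] ip_def[OF t] Xf_scale
      by (simp add: sm_cmult[symmetric] power2_eq_square mult_ac)
    have d: "ipt f f - corr f q = au t v f 0 - au t v f r"
      using au_0[OF t, of v f] by (simp add: corr_def r(3) au_def[OF t])
    have "(1 + cos r) * (au t v f 0 - au t v f r) \<le> (1 + cos r) * (au t v (Xf v f) 0 * (1 - cos r))"
      by (rule mult_left_mono[OF rotation_bound_full[OF t f v r(1,2)]]) (use cos_ge_minus_one[of r] in linarith)
    also have "\<dots> = (sin r)\<^sup>2 * au t v (Xf v f) 0"
      unfolding sin_squared_eq by (simp add: power2_eq_square algebra_simps)
    finally show "(1 + q$1) * (ipt f f - corr f q) \<le> Qf f q" unfolding Q d s(2) .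
    assume e: "\<And>x. x \<in> shell a b \<Longrightarrow> f (- x) = f x" and "q$1 \<ge> 0"
    then have "r \<le> pi/2"
      using r s(2) cos_monotone_0_pi[of "pi/2" r] by (cases "r \<le> pi/2") auto
    from rotation_bound_even[OF t f e v r(1) this]
    show "2 * (ipt f f - corr f q) \<le> Qf f q" unfolding Q d by (simp only: mult.commute)
  qed
  show "(1 + q$1) * (ipt f f - corr f q) \<le> Qf f q" by (rule main(1)[OF q])
  assume e: "\<And>x. x \<in> shell a b \<Longrightarrow> f (- x) = f x"
  show "2 * (ipt f f - corr f q) \<le> Qf f q"
  proof (cases "q$1 \<ge> 0")
    case True then show ?thesis using main(2)[OF q e] by blast
  next
    case False
    have "corr f (- q) = corr f q"
      unfolding corr_def by (rule sm_cong[OF _ t]) (use e qm_shell q in \<open>simp add: qm_simps\<close>)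
    moreover have "Qf f (- q) = Qf f q"
      using Xf_scale[of "-1" "q - q$1 *\<^sub>R qb 1" f] unfolding Qf_def ip_def[OF t] by simp
    ultimately show ?thesis using main(2)[of "- q", OF _ e] q False by simp
  qed
qed

lemma corr_cont:
  fixes f :: "real^4 \<Rightarrow> real"
  assumes f: "smooth_on (shell a b) f"
  shows "continuous_on (S3 \<times> S3) (\<lambda>(q, \<theta>). f (qm q (exp t *\<^sub>R \<theta>)) * f (exp t *\<^sub>R \<theta>))"
proof -
  have q: "continuous_on A (\<lambda>z. qm (fst z) (exp t *\<^sub>R snd z))" for A
    by (subst qm_expand) (intro continuous_intros linear_continuous_on_compose[OF _ linear_qm(1)])
  have "continuous_on (S3 \<times> S3) (\<lambda>z. f (qm (fst z) (exp t *\<^sub>R snd z)))"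
    by (rule continuous_on_compose2[OF smooth_on_continuous_on[OF f] q])
       (use t in \<open>auto intro!: qm_shell in_shell\<close>)
  moreover have "continuous_on (S3 \<times> S3) (\<lambda>z. f (exp t *\<^sub>R snd z))"
    by (rule continuous_on_compose2[OF shell_cont[OF f t]]) (auto intro!: continuous_intros)
  ultimately show ?thesis unfolding case_prod_unfold by (rule continuous_on_mult)
qed

lemma corr_eq: "corr f q = sint (\<lambda>\<theta>. f (qm q (exp t *\<^sub>R \<theta>)) * f (exp t *\<^sub>R \<theta>))"
  unfolding corr_def sm_def ..

lemma corr_cont1: "smooth_on (shell a b) f \<Longrightarrow> continuous_on S3 (corr f)"
  using sint_param_cont[OF corr_cont] unfolding corr_eq[abs_def] by simp

text \<open>For fixed \<theta> the point \<open>qm q \<theta>\<close> is uniformly distributed when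
  q is, so averaging over q decouples the two factors.\<close>

lemma sint_corr:
  assumes f: "smooth_on (shell a b) f"
  shows "sint (corr f) = (sm f t)\<^sup>2"
proof -
  have "sint (corr f) = sint (\<lambda>\<theta>. sint (\<lambda>q. f (qm q (exp t *\<^sub>R \<theta>)) * f (exp t *\<^sub>R \<theta>)))"
    unfolding corr_eq[abs_def] by (rule sint_swap[OF corr_cont[OF f]])
  also have "\<dots> = sint (\<lambda>\<theta>. sm f t * f (exp t *\<^sub>R \<theta>))"
  proof (rule sint_cong)
    fix \<theta> :: "real^4" assume \<theta>: "\<theta> \<in> S3"
    have "sint (\<lambda>q. f (qm q (exp t *\<^sub>R \<theta>))) = sm f t"
      using sint_orthogonal[OF orthogonal_qm'[of \<theta>] shell_cont[OF f t]] \<theta> by (simp add: sm_def qm_simps)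
    then show "sint (\<lambda>q. f (qm q (exp t *\<^sub>R \<theta>)) * f (exp t *\<^sub>R \<theta>)) = sm f t * f (exp t *\<^sub>R \<theta>)"
      using sint_cmult[of "f (exp t *\<^sub>R \<theta>)" "\<lambda>q. f (qm q (exp t *\<^sub>R \<theta>))"] by (simp add: mult.commute)
  qed
  also have "\<dots> = (sm f t)\<^sup>2" by (simp add: sint_cmult sm_def power2_eq_square)
  finally show ?thesis .
qed

lemma qm_real_part: "\<theta> \<in> S3 \<Longrightarrow> q$1 = (\<Sum>j\<in>UNIV. \<theta>$j * qm q \<theta> $ j)"
  using S3_sum[of \<theta>] unfolding sum_4 qm_nth by simp algebra

text \<open>The same decoupling, once the real part of q is written as the inner product of \<theta>
  with \<open>qm q \<theta>\<close>.\<close>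

lemma sint_corr_linear:
  assumes f: "smooth_on (shell a b) f"
  shows "sint (\<lambda>q. q$1 * corr f q) = (\<Sum>j\<in>UNIV. (cmp f j)\<^sup>2)"
proof -
  note c = corr_cont[OF f]
  have c2: "continuous_on (S3 \<times> S3) (\<lambda>(q, \<theta>). q$1 * (f (qm q (exp t *\<^sub>R \<theta>)) * f (exp t *\<^sub>R \<theta>)))"
    using c by (auto intro!: continuous_intros simp: case_prod_unfold)
  have fj: "continuous_on S3 (\<lambda>\<theta>. f (exp t *\<^sub>R \<theta>) * \<theta>$j)" for j
    by (intro continuous_intros shell_cont[OF f t])
  have "sint (\<lambda>q. q$1 * corr f q) = sint (\<lambda>\<theta>. sint (\<lambda>q. q$1 * (f (qm q (exp t *\<^sub>R \<theta>)) * f (exp t *\<^sub>R \<theta>))))"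
    unfolding corr_eq[abs_def] sint_cmult[symmetric] by (rule sint_swap[OF c2])
  also have "\<dots> = sint (\<lambda>\<theta>. \<Sum>j\<in>UNIV. cmp f j * (f (exp t *\<^sub>R \<theta>) * \<theta>$j))"
  proof (rule sint_cong)
    fix \<theta> :: "real^4" assume \<theta>: "\<theta> \<in> S3"
    define g where "g y = (\<Sum>j\<in>UNIV. (f (exp t *\<^sub>R \<theta>) * \<theta>$j) * (f (exp t *\<^sub>R y) * y$j))" for y
    have g: "continuous_on S3 g" unfolding g_def by (intro continuous_intros fj)
    have "sint (\<lambda>q. q$1 * (f (qm q (exp t *\<^sub>R \<theta>)) * f (exp t *\<^sub>R \<theta>))) = sint (\<lambda>q. g (qm q \<theta>))"
      unfolding g_def qm_real_part[OF \<theta>] by (simp add: qm_simps sum_distrib_left sum_distrib_right mult_ac)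
    also have "\<dots> = sint g"
      by (rule sint_orthogonal[OF orthogonal_qm' g]) (use \<theta> in simp)
    also have "\<dots> = (\<Sum>j\<in>UNIV. cmp f j * (f (exp t *\<^sub>R \<theta>) * \<theta>$j))"
      unfolding g_def sint_lincomb[OF fj] cmp_def[symmetric] by (simp add: mult.commute)
    finally show "sint (\<lambda>q. q$1 * (f (qm q (exp t *\<^sub>R \<theta>)) * f (exp t *\<^sub>R \<theta>))) = \<dots>" .
  qed
  also have "\<dots> = (\<Sum>j\<in>UNIV. (cmp f j)\<^sup>2)"
    unfolding sint_lincomb[OF fj] cmp_def[symmetric] by (simp add: power2_eq_square)
  finally show ?thesis .
qed

lemma Qf_expand:
  assumes f: "smooth_on (shell a b) f"
  shows "Qf f q = (q$2)\<^sup>2 * ipt (Xf (qb 2) f) (Xf (qb 2) f) + (q$3)\<^sup>2 * ipt (Xf (qb 3) f) (Xf (qb 3) f)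
     + (q$4)\<^sup>2 * ipt (Xf (qb 4) f) (Xf (qb 4) f) + 2 * (q$2 * q$3) * ipt (Xf (qb 2) f) (Xf (qb 3) f)
     + 2 * (q$2 * q$4) * ipt (Xf (qb 2) f) (Xf (qb 4) f) + 2 * (q$3 * q$4) * ipt (Xf (qb 3) f) (Xf (qb 4) f)"
proof -
  let ?X = "\<lambda>k. Xf (qb k) f"
  have s: "smooth_on (shell a b) (\<lambda>x. c * (?X j x * ?X k x))" for c j k
    by (intro smooth_on_mult open_shell smooth_on_const smooth_Xf f)
  have "Qf f q = sm (\<lambda>x. (q$2)\<^sup>2 * (?X 2 x * ?X 2 x) + (q$3)\<^sup>2 * (?X 3 x * ?X 3 x) + (q$4)\<^sup>2 * (?X 4 x * ?X 4 x)
      + 2 * (q$2 * q$3) * (?X 2 x * ?X 3 x) + 2 * (q$2 * q$4) * (?X 2 x * ?X 4 x) + 2 * (q$3 * q$4) * (?X 3 x * ?X 4 x)) t"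
    unfolding Qf_def ip_def[OF t]
    by (subst Xf_linear, subst (2) Xf_linear)
       (simp add: axis_def algebra_simps power2_eq_square)
  then show ?thesis
    by (simp only: sm_add[OF _ s t] smooth_on_add[OF open_shell] s sm_cmult ip_def[OF t])
qed

text \<open>The average of \<open>corr_bounds(2)\<close> over q: the correlations average to the
  squared mean, 0, and \<open>Qf f\<close> to \<open>en f / 4\<close>. The constant 8 is the
  eigenvalue of degree two.\<close>

lemma gap_even:
  assumes f: "smooth_on (shell a b) f" and e: "\<And>x. x \<in> shell a b \<Longrightarrow> f (- x) = f x" and z: "sm f t = 0"
  shows "8 * ipt f f \<le> en f"
proof -
  let ?I = "\<lambda>j k. ipt (Xf (qb j) f) (Xf (qb k) f)"
  have cQ: "continuous_on S3 (Qf f)"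
    unfolding Qf_expand[OF f, abs_def] by (intro continuous_intros)
  have "sint (\<lambda>q. 2 * (ipt f f - corr f q)) \<le> sint (Qf f)"
    by (rule sint_mono) (use corr_bounds(2)[OF f _ e] cQ in \<open>auto intro!: continuous_intros corr_cont1[OF f]\<close>)
  moreover have "sint (\<lambda>q. 2 * (ipt f f - corr f q)) = 2 * ipt f f"
    unfolding sint_cmult using sint_corr[OF f] z
    by (subst sint_diff) (auto intro!: continuous_intros corr_cont1[OF f] simp: sint_const)
  moreover have "sint (Qf f) = en f / 4"
  proof -
    have "Qf f = (\<lambda>q. ?I 2 2 * (q$2)\<^sup>2 + ?I 3 3 * (q$3)\<^sup>2 + ?I 4 4 * (q$4)\<^sup>2 + 2 * ?I 2 3 * (q$2 * q$3)
        + 2 * ?I 2 4 * (q$2 * q$4) + 2 * ?I 3 4 * (q$3 * q$4))"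
      by (rule ext) (simp add: Qf_expand[OF f])
    then show ?thesis
      by (simp only: sint_add continuous_intros sint_cmult moment_sq moment_mixed[OF four_neq(4)]
          moment_mixed[OF four_neq(5)] moment_mixed[OF four_neq(6)])
         (simp add: en_def)
  qed
  ultimately show ?thesis by simp
qed

text \<open>For odd f the correlation is odd in q, so only odd powers of \<open>q$1\<close> pair
  with it. The weight \<open>?s\<close> is nonnegative on [-1, 1] and chosen such that
  \<open>?s q * (1 + q$1)\<close> has no cubic term: it equals 1 + 5 x + 7 x^2 - 3 x^4. Only the
  linear moment remains, and \<open>sint_corr_linear\<close> knows it.\<close>

lemma gap_odd:
  assumes f: "smooth_on (shell a b) f" and o: "\<And>x. x \<in> shell a b \<Longrightarrow> f (- x) = - f x"
  shows "19/8 * ipt f f - 5 * (\<Sum>j\<in>UNIV. (cmp f j)\<^sup>2) \<le> 3/8 * en f"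
proof -
  let ?I = "\<lambda>j k. ipt (Xf (qb j) f) (Xf (qb k) f)"
  let ?s = "\<lambda>q::real^4. 1 + 4 * q$1 + 3 * (q$1)\<^sup>2 - 3 * (q$1)^3"
  have s_nonneg: "0 \<le> ?s q" if "q \<in> S3" for q
  proof -
    have q1: "\<bar>q$1\<bar> \<le> 1" using component_le_norm_cart[of q 1] that by simp
    show ?thesis
    proof (cases "q$1 \<ge> 0")
      case True
      then have "(q$1)\<^sup>2 * (1 - q$1) \<ge> 0" using q1 by simp
      then show ?thesis using True by (simp add: power2_eq_square power3_eq_cube algebra_simps)
    next
      case False
      define x where "x = - q$1"
      have x: "0 \<le> x" using False x_def by simp
      \<comment> \<open>An explicit certificate for 1 - 4 x + 3 x^2 + 3 x^3 > 0, whose minimum on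
        the half line lies close to 2/5.\<close>
      have "0 \<le> 3 * ((x - 2/5)\<^sup>2 * (x + 4/5)) + 3 * (x - 32/75)\<^sup>2 + 131/1875" using x by simp
      also have "\<dots> = 1 - 4 * x + 3 * x\<^sup>2 + 3 * x^3"
        by (simp add: power2_eq_square power3_eq_cube field_simps)
      finally show ?thesis by (simp add: x_def)
    qed
  qed
  have cc: "continuous_on S3 (corr f)" by (rule corr_cont1[OF f])
  have cQ: "continuous_on S3 (Qf f)"
    unfolding Qf_expand[OF f, abs_def] by (intro continuous_intros)
  have odd: "corr f (- q) = - corr f q" if "q \<in> S3" for q
  proof -
    have "corr f (- q) = sm (\<lambda>x. -1 * (f (qm q x) * f x)) t"
      unfolding corr_def by (rule sm_cong[OF _ t]) (use o qm_shell that in \<open>simp add: qm_simps\<close>)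
    then show ?thesis by (simp only: sm_cmult corr_def)
  qed
  have "sint (\<lambda>q. ?s q * ((1 + q$1) * (ipt f f - corr f q))) \<le> sint (\<lambda>q. ?s q * Qf f q)"
    by (rule sint_mono) (auto intro!: continuous_intros cc cQ mult_left_mono corr_bounds(1)[OF f] s_nonneg)
  moreover have "sint (\<lambda>q. ?s q * ((1 + q$1) * (ipt f f - corr f q)))
      = 19/8 * ipt f f - 5 * (\<Sum>j\<in>UNIV. (cmp f j)\<^sup>2)"
  proof -
    let ?e = "\<lambda>q::real^4. (1 + 7 * (q$1)\<^sup>2 - 3 * (q$1)^4) * corr f q"
    have z: "sint ?e = 0"
      by (rule sint_odd) (auto intro!: continuous_intros cc simp: odd)
    have z1: "sint (\<lambda>q. q$1) = 0"
      by (rule sint_odd) (auto intro!: continuous_intros)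
    have "(\<lambda>q. ?s q * ((1 + q$1) * (ipt f f - corr f q)))
       = (\<lambda>q. ipt f f + 5 * ipt f f * q$1 + 7 * ipt f f * (q$1)\<^sup>2 - 3 * ipt f f * (q$1)^4 - ?e q - 5 * (q$1 * corr f q))"
      by (rule ext) algebra
    moreover have "sint (\<lambda>q. ipt f f + 5 * ipt f f * q$1 + 7 * ipt f f * (q$1)\<^sup>2 - 3 * ipt f f * (q$1)^4 - ?e q - 5 * (q$1 * corr f q))
       = ipt f f + 5 * ipt f f * 0 + 7 * ipt f f * (1/4) - 3 * ipt f f * (1/8) - 0 - 5 * (\<Sum>j\<in>UNIV. (cmp f j)\<^sup>2)"
      by (subst sint_diff sint_add; (intro continuous_intros cc)?; simp only: sint_const sint_cmult z z1 moments sint_corr_linear[OF f])+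
    ultimately show ?thesis by simp
  qed
  moreover have "sint (\<lambda>q. ?s q * Qf f q) = 3/8 * en f"
  proof -
    let ?r = "\<lambda>q::real^4. 2 * ?I 2 3 * (q$2 * q$3) + 2 * ?I 2 4 * (q$2 * q$4) + 2 * ?I 3 4 * (q$3 * q$4)"
    let ?d = "\<lambda>q::real^4. ?I 2 2 * (q$2)\<^sup>2 + ?I 3 3 * (q$3)\<^sup>2 + ?I 4 4 * (q$4)\<^sup>2"
    have Q: "Qf f q = ?d q + ?r q" for q by (simp add: Qf_expand[OF f])
    have cr: "continuous_on S3 ?r" "continuous_on S3 ?d" by (intro continuous_intros)+
    have o1: "sint (\<lambda>q. (4 * q$1 - 3 * (q$1)^3) * (?d q + ?r q)) = 0"
      by (rule sint_odd) (auto intro!: continuous_intros simp: power2_eq_square power3_eq_cube algebra_simps)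
    have m0: "sint (\<lambda>q. (1 + 3 * (q$1)\<^sup>2) * (q$j * q$k)) = 0" if "j \<noteq> k" "j \<noteq> 1" for j k
      by (rule sint_flip[where i=j]) (use that in \<open>auto intro!: continuous_intros\<close>)
    have o2: "sint (\<lambda>q. (1 + 3 * (q$1)\<^sup>2) * ?r q) = 0"
    proof -
      have "(\<lambda>q. (1 + 3 * (q$1)\<^sup>2) * ?r q) = (\<lambda>q. 2 * ?I 2 3 * ((1 + 3 * (q$1)\<^sup>2) * (q$2 * q$3))
          + 2 * ?I 2 4 * ((1 + 3 * (q$1)\<^sup>2) * (q$2 * q$4)) + 2 * ?I 3 4 * ((1 + 3 * (q$1)\<^sup>2) * (q$3 * q$4)))"
        by (rule ext) (simp add: algebra_simps)
      then show ?thesis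
        by (simp only: sint_add continuous_intros sint_cmult m0[OF four_neq(4) four_neq(7)]
          m0[OF four_neq(5) four_neq(7)] m0[OF four_neq(6) four_neq(8)])
    qed
    have m: "sint (\<lambda>q. (1 + 3 * (q$1)\<^sup>2) * (q$k)\<^sup>2) = 3/8" if "k \<in> {2,3,4}" for k
    proof -
      have "sint (\<lambda>q. (1 + 3 * (q$1)\<^sup>2) * (q$k)\<^sup>2) = sint (\<lambda>q. (q$k)\<^sup>2 + 3 * ((q$1)\<^sup>2 * (q$k)\<^sup>2))"
        by (rule sint_cong) (simp add: algebra_simps)
      also have "\<dots> = sint (\<lambda>q. (q$k)\<^sup>2) + 3 * sint (\<lambda>q. (q$1)\<^sup>2 * (q$k)\<^sup>2)"
        unfolding sint_cmult[symmetric] by (rule sint_add) (intro continuous_intros)+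
      finally show ?thesis using moment_pair(2)[OF that] by (simp add: moment_sq moments)
    qed
    have "(\<lambda>q. (1 + 3 * (q$1)\<^sup>2) * ?d q) = (\<lambda>q. ?I 2 2 * ((1 + 3 * (q$1)\<^sup>2) * (q$2)\<^sup>2)
       + ?I 3 3 * ((1 + 3 * (q$1)\<^sup>2) * (q$3)\<^sup>2) + ?I 4 4 * ((1 + 3 * (q$1)\<^sup>2) * (q$4)\<^sup>2))"
      by (rule ext) (simp add: algebra_simps)
    then have o3: "sint (\<lambda>q. (1 + 3 * (q$1)\<^sup>2) * ?d q) = ?I 2 2 * (3/8) + ?I 3 3 * (3/8) + ?I 4 4 * (3/8)"
      by (simp only: sint_add continuous_intros sint_cmult m insert_iff simp_thms)
    have "(\<lambda>q. ?s q * Qf f q) = (\<lambda>q. (1 + 3 * (q$1)\<^sup>2) * ?d q + (1 + 3 * (q$1)\<^sup>2) * ?r q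
       + (4 * q$1 - 3 * (q$1)^3) * (?d q + ?r q))"
      unfolding Q by (rule ext) algebra
    then have "sint (\<lambda>q. ?s q * Qf f q) = sint (\<lambda>q. (1 + 3 * (q$1)\<^sup>2) * ?d q) + sint (\<lambda>q. (1 + 3 * (q$1)\<^sup>2) * ?r q)
       + sint (\<lambda>q. (4 * q$1 - 3 * (q$1)^3) * (?d q + ?r q))"
      by (simp only: sint_add continuous_intros cr)
    then show ?thesis unfolding o1 o2 o3 by (simp add: en_def)
  qed
  ultimately show ?thesis by simp
qed

text \<open>The functions 2 \<theta>_j are orthonormal, so the best linear approximation has the
  coefficients \<open>4 * cmp f j\<close>.\<close>

lemma bessel:
  assumes f: "smooth_on (shell a b) f"
  shows "4 * (\<Sum>j\<in>UNIV. (cmp f j)\<^sup>2) \<le> ipt f f"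
proof -
  let ?g = "\<lambda>\<theta>. f (exp t *\<^sub>R \<theta>)"
  have g: "continuous_on S3 ?g" by (rule shell_cont[OF f t])
  let ?l = "\<lambda>\<theta>::real^4. \<Sum>j\<in>UNIV. 4 * cmp f j * \<theta>$j"
  have 1: "sint (\<lambda>\<theta>. \<theta>$i * \<theta>$j) = (if i = j then 1/4 else 0)" for i j
    using moment_sq[of i] moment_mixed[of i j] by (auto simp: power2_eq_square)
  have 2: "sint (\<lambda>\<theta>. \<Sum>j\<in>UNIV. 4 * cmp f j * (?g \<theta> * \<theta>$j)) = (\<Sum>j\<in>UNIV. 4 * cmp f j * cmp f j)"
    unfolding cmp_def by (rule sint_lincomb) (intro continuous_intros g)
  have "sint (\<lambda>\<theta>. \<Sum>i\<in>UNIV. 4 * cmp f i * (\<Sum>j\<in>UNIV. 4 * cmp f j * (\<theta>$i * \<theta>$j)))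
     = (\<Sum>i\<in>UNIV. 4 * cmp f i * sint (\<lambda>\<theta>. \<Sum>j\<in>UNIV. 4 * cmp f j * (\<theta>$i * \<theta>$j)))"
    by (rule sint_lincomb) (intro continuous_intros)
  also have "\<dots> = (\<Sum>i\<in>UNIV. 4 * cmp f i * (\<Sum>j\<in>UNIV. 4 * cmp f j * (if i = j then 1/4 else 0)))"
    by (subst sint_lincomb) (intro continuous_intros, simp only: 1)
  also have "\<dots> = (\<Sum>i\<in>UNIV. 4 * cmp f i * cmp f i)"
    by (rule sum.cong) (simp_all add: if_distrib[where f="\<lambda>z. _ * z"] cong: if_cong)
  finally have 3: "sint (\<lambda>\<theta>. \<Sum>i\<in>UNIV. 4 * cmp f i * (\<Sum>j\<in>UNIV. 4 * cmp f j * (\<theta>$i * \<theta>$j)))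
     = (\<Sum>i\<in>UNIV. 4 * cmp f i * cmp f i)" .
  have "0 \<le> sint (\<lambda>\<theta>. (?g \<theta> - ?l \<theta>)\<^sup>2)"
    using sint_mono[of "\<lambda>\<theta>. 0" "\<lambda>\<theta>. (?g \<theta> - ?l \<theta>)\<^sup>2"] by (simp add: sint_const continuous_intros g)
  also have "(\<lambda>\<theta>. (?g \<theta> - ?l \<theta>)\<^sup>2) = (\<lambda>\<theta>. ?g \<theta> * ?g \<theta> - 2 * (\<Sum>j\<in>UNIV. 4 * cmp f j * (?g \<theta> * \<theta>$j))
      + (\<Sum>i\<in>UNIV. 4 * cmp f i * (\<Sum>j\<in>UNIV. 4 * cmp f j * (\<theta>$i * \<theta>$j))))"
  proof
    fix \<theta>
    have a: "?l \<theta> * ?l \<theta> = (\<Sum>i\<in>UNIV. 4 * cmp f i * (\<Sum>j\<in>UNIV. 4 * cmp f j * (\<theta>$i * \<theta>$j)))"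
      by (simp add: sum_distrib_left sum_distrib_right mult_ac)
    have b: "?g \<theta> * ?l \<theta> = (\<Sum>j\<in>UNIV. 4 * cmp f j * (?g \<theta> * \<theta>$j))"
      by (simp add: sum_distrib_left mult_ac)
    show "(?g \<theta> - ?l \<theta>)\<^sup>2 = ?g \<theta> * ?g \<theta> - 2 * (\<Sum>j\<in>UNIV. 4 * cmp f j * (?g \<theta> * \<theta>$j))
      + (\<Sum>i\<in>UNIV. 4 * cmp f i * (\<Sum>j\<in>UNIV. 4 * cmp f j * (\<theta>$i * \<theta>$j)))"
      unfolding a[symmetric] b[symmetric] by (simp add: power2_eq_square algebra_simps)
  qed
  also have "sint \<dots> = ipt f f - 2 * (\<Sum>j\<in>UNIV. 4 * cmp f j * cmp f j) + (\<Sum>i\<in>UNIV. 4 * cmp f i * cmp f i)"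
  proof -
    let ?B = "\<lambda>\<theta>. \<Sum>j\<in>UNIV. 4 * cmp f j * (?g \<theta> * \<theta>$j)"
    let ?C = "\<lambda>\<theta>::real^4. \<Sum>i\<in>UNIV. 4 * cmp f i * (\<Sum>j\<in>UNIV. 4 * cmp f j * (\<theta>$i * \<theta>$j))"
    have A: "continuous_on S3 (\<lambda>\<theta>. ?g \<theta> * ?g \<theta>)" by (intro continuous_on_mult g)
    have B: "continuous_on S3 (\<lambda>\<theta>. 2 * ?B \<theta>)"
      by (intro continuous_on_mult continuous_on_sum g continuous_on_const coord_cont)
    have C: "continuous_on S3 ?C" by (intro continuous_on_mult continuous_on_sum continuous_on_const coord_cont)
    have "sint (\<lambda>\<theta>. ?g \<theta> * ?g \<theta> - 2 * ?B \<theta> + ?C \<theta>) = sint (\<lambda>\<theta>. ?g \<theta> * ?g \<theta>) - sint (\<lambda>\<theta>. 2 * ?B \<theta>) + sint ?C"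
      by (simp only: sint_add[OF continuous_on_diff[OF A B] C] sint_diff[OF A B])
    then show ?thesis unfolding 2 3 sint_cmult by (simp only: ip_def[OF t] sm_def)
  qed
  finally have b: "0 \<le> ipt f f - 2 * (\<Sum>j\<in>UNIV. 4 * cmp f j * cmp f j) + (\<Sum>i\<in>UNIV. 4 * cmp f i * cmp f i)" .
  have "(\<Sum>j\<in>UNIV. 4 * cmp f j * cmp f j) = 4 * (\<Sum>j\<in>UNIV. (cmp f j)\<^sup>2)"
    by (simp add: sum_distrib_left power2_eq_square mult.assoc)
  with b show ?thesis by simp
qed

lemma ip_parity:
  assumes "smooth_on (shell a b) g" "smooth_on (shell a b) h" "\<And>x. x \<in> shell a b \<Longrightarrow> g (- x) = g x" "\<And>x. x \<in> shell a b \<Longrightarrow> h (- x) = - h x"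
  shows "ipt g h = 0"
proof -
  have "ipt g h = sm (\<lambda>x. g (qm (- qb 1) x) * h (qm (- qb 1) x)) t"
    unfolding ip_def[OF t]
    using sm_rot[of "- qb 1", OF _ smooth_on_mult[OF open_shell assms(1,2)] t] by (simp add: norm_axis_1)
  also have "\<dots> = sm (\<lambda>x. -1 * (g x * h x)) t"
    by (rule sm_cong[OF _ t]) (simp add: assms qm_simps)
  finally show ?thesis unfolding sm_cmult ip_def[OF t] by simp
qed

lemma ip_add:
  assumes "smooth_on (shell a b) f" "smooth_on (shell a b) g"
  shows "ipt (\<lambda>x. f x + g x) (\<lambda>x. f x + g x) = ipt f f + 2 * ipt f g + ipt g g"
proof -
  note m = smooth_on_mult[OF open_shell]
  have "ipt (\<lambda>x. f x + g x) (\<lambda>x. f x + g x) = sm (\<lambda>x. f x * f x + 2 * (f x * g x) + g x * g x) t"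
    unfolding ip_def[OF t] by (simp add: algebra_simps)
  also have "\<dots> = ipt f f + 2 * ipt f g + ipt g g"
    unfolding ip_def[OF t] sm_cmult[symmetric]
    by (simp only: sm_add[OF _ _ t] smooth_on_add[OF open_shell] m assms smooth_on_const)
  finally show ?thesis .
qed

lemma Xf_neg:
  assumes "smooth_on (shell a b) f" "x \<in> shell a b" "unit_im v"
  shows "Xf v (\<lambda>x. f (- x)) x = Xf v f (- x)"
  using Xf_rot[OF t assms(1,3,2), of pi] by (simp add: rot_def qm_simps)

text \<open>Mean zero functions orthogonal to the linear ones satisfy \<open>S \<ge> 6\<close>; on the linear ones \<open>S = 3\<close>.\<close>

lemma gap:
  assumes f: "smooth_on (shell a b) f" and z: "sm f t = 0"
  shows "6 * ipt f f - 12 * (\<Sum>j\<in>UNIV. (cmp f j)\<^sup>2) \<le> en f"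
proof -
  let ?n = "\<lambda>x. f (- x)"
  define e where "e = (\<lambda>x. 1/2 * f x + 1/2 * ?n x)"
  define h where "h = (\<lambda>x. 1/2 * f x - 1/2 * ?n x)"
  have n: "smooth_on (shell a b) ?n"
    using smooth_qm_comp[OF f, of "- qb 1"] by (simp add: qm_simps norm_axis_1)
  have e: "smooth_on (shell a b) e" and h: "smooth_on (shell a b) h"
    unfolding e_def h_def
    by (intro smooth_on_add smooth_on_diff smooth_on_mult open_shell smooth_on_const f n)+
  have fe: "f = (\<lambda>x. e x + h x)" unfolding e_def h_def by simp
  have ev: "e (- x) = e x" and od: "h (- x) = - h x" for x unfolding e_def h_def by simp_all
  have ze: "sm e t = 0"
  proof -
    have "sm ?n t = sm f t" using sm_rot[of "- qb 1", OF _ f t] by (simp add: qm_simps norm_axis_1)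
    then show ?thesis
      unfolding e_def using z sm_cmult[of "1/2" f t] sm_cmult[of "1/2" ?n t]
      by (subst sm_add[OF smooth_on_mult[OF open_shell smooth_on_const f] smooth_on_mult[OF open_shell smooth_on_const n] t])
         linarith
  qed
  have X: "Xf (qb k) f x = Xf (qb k) e x + Xf (qb k) h x" if "x \<in> shell a b" for k x
    unfolding fe by (rule Xf_add[OF open_shell e h that])
  have Xe: "Xf (qb k) e (- x) = Xf (qb k) e x" and Xo: "Xf (qb k) h (- x) = - Xf (qb k) h x"
    if "x \<in> shell a b" "unit_im (qb k)" for k x
  proof -
    show "Xf (qb k) e (- x) = Xf (qb k) e x"
      using Xf_neg[OF e that] by (simp add: ev)
    have "Xf (qb k) (\<lambda>x. -1 * h x) x = -1 * Xf (qb k) h x" by (rule Xf_cmult[OF open_shell h that(1)])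
    then show "Xf (qb k) h (- x) = - Xf (qb k) h x"
      using Xf_neg[OF h that] by (simp add: od)
  qed
  have ip: "ipt f f = ipt e e + ipt h h"
    using ip_add[OF e h] ip_parity[OF e h ev od] unfolding fe by simp
  have ipX: "ipt (Xf (qb k) f) (Xf (qb k) f) = ipt (Xf (qb k) e) (Xf (qb k) e) + ipt (Xf (qb k) h) (Xf (qb k) h)"
    if "unit_im (qb k)" for k
  proof -
    have "ipt (Xf (qb k) f) (Xf (qb k) f) = ipt (\<lambda>x. Xf (qb k) e x + Xf (qb k) h x) (\<lambda>x. Xf (qb k) e x + Xf (qb k) h x)"
      unfolding ip_def[OF t] by (rule sm_cong[OF _ t]) (simp add: X)
    then show ?thesis
      using ip_add[OF smooth_Xf[OF open_shell e] smooth_Xf[OF open_shell h], of "qb k" "qb k"]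
        ip_parity[OF smooth_Xf[OF open_shell e] smooth_Xf[OF open_shell h], of "qb k" "qb k"] Xe Xo that
      by simp
  qed
  have en: "en f = en e + en h" unfolding en_def by (simp add: ipX)
  have c: "cmp f j = cmp h j" for j
  proof -
    have cc: "continuous_on S3 (\<lambda>\<theta>. e (exp t *\<^sub>R \<theta>) * \<theta>$j)" "continuous_on S3 (\<lambda>\<theta>. h (exp t *\<^sub>R \<theta>) * \<theta>$j)"
      by (intro continuous_intros shell_cont[OF e t] shell_cont[OF h t])+
    have "cmp e j = 0"
      unfolding cmp_def by (rule sint_odd[OF cc(1)]) (simp add: ev)
    moreover have "cmp f j = cmp e j + cmp h j"
      unfolding cmp_def fe using sint_add[OF cc] by (simp add: algebra_simps)
    ultimately show ?thesis by simp
  qed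
  have "8 * ipt e e \<le> en e" by (rule gap_even[OF e ev ze])
  moreover have "19/8 * ipt h h - 5 * (\<Sum>j\<in>UNIV. (cmp h j)\<^sup>2) \<le> 3/8 * en h" by (rule gap_odd[OF h od])
  moreover have "4 * (\<Sum>j\<in>UNIV. (cmp h j)\<^sup>2) \<le> ipt h h" by (rule bessel[OF h])
  moreover have "0 \<le> ipt e e" by (rule ip_nonneg[OF t e])
  moreover have "6 * (A + B) - 12 * C \<le> D + E"
    if "8 * A \<le> D" "19/8 * B - 5 * C \<le> 3/8 * E" "4 * C \<le> B" "0 \<le> A" for A B C D E :: real
  proof -
    \<comment> \<open>The odd estimate reads 19/3 B - 40/3 C \<le> E; its excess (B - 4 C) / 3 over
      the claim is nonnegative by Bessel.\<close>
    have "6 * B - 12 * C \<le> E" using that(2,3) by linarith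
    moreover have "6 * A \<le> D" using that(1,4) by linarith
    ultimately show ?thesis by simp
  qed
  ultimately show ?thesis unfolding ip en c by blast
qed

end

section \<open>Energy identities\<close>

text \<open>|x|^4 times the bilaplacian, see \<open>Pf_bilaplacian\<close>: the product of D^2 - 2 D
  - S and D^2 + 2 D - S, where the sign change of 2 D comes from moving |x|^2 past D.\<close>

definition Pf :: "(real^4 \<Rightarrow> real) \<Rightarrow> real^4 \<Rightarrow> real" where
  "Pf u x = Df (Df (Df (Df u))) x - 2 * Sf (Df (Df u)) x + Sf (Sf u) x - 4 * Df (Df u) x"

definition pf :: "(real^4 \<Rightarrow> real) \<Rightarrow> real^4 \<Rightarrow> real" where
  "pf u x = Df (Df u) x + 2 * Df u x - Sf u x"

text \<open>The energy identities are needed for the full inner product and again for the one off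
  the first mode. The axioms collect what the two share: compatibility with D and symmetry of
  S.\<close>

locale sphere_form =
  fixes a b :: real and B :: "(real^4 \<Rightarrow> real) \<Rightarrow> (real^4 \<Rightarrow> real) \<Rightarrow> real \<Rightarrow> real"
  assumes B_lin: "\<lbrakk>smooth_on (shell a b) f; smooth_on (shell a b) g; smooth_on (shell a b) h; t \<in> {a<..<b}\<rbrakk> \<Longrightarrow>
      B (\<lambda>x. c * f x + d * g x) h t = c * B f h t + d * B g h t"
    and B_sym: "B f g t = B g f t"
    and B_cong: "\<lbrakk>\<And>x. x \<in> shell a b \<Longrightarrow> f x = f' x; t \<in> {a<..<b}\<rbrakk> \<Longrightarrow> B f g t = B f' g t"
    and B_pos: "\<lbrakk>smooth_on (shell a b) f; t \<in> {a<..<b}\<rbrakk> \<Longrightarrow> 0 \<le> B f f t"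
    and B_deriv: "\<lbrakk>smooth_on (shell a b) f; smooth_on (shell a b) g; t \<in> {a<..<b}\<rbrakk> \<Longrightarrow>
      (B f g has_real_derivative B (Df f) g t + B f (Df g) t) (at t)"
    and B_S: "\<lbrakk>smooth_on (shell a b) f; smooth_on (shell a b) g; t \<in> {a<..<b}\<rbrakk> \<Longrightarrow> B (Sf f) g t = B f (Sf g) t"
begin

abbreviation "V \<equiv> shell a b"

lemma B_lin2: "\<lbrakk>smooth_on V f; smooth_on V g; smooth_on V h; t \<in> {a<..<b}\<rbrakk> \<Longrightarrow>
      B h (\<lambda>x. c * f x + d * g x) t = c * B h f t + d * B h g t"
  by (simp only: B_sym[of h "\<lambda>x. c * f x + d * g x"] B_sym[of h f] B_sym[of h g] B_lin)

lemma B_cong2: "\<lbrakk>\<And>x. x \<in> V \<Longrightarrow> g x = g' x; t \<in> {a<..<b}\<rbrakk> \<Longrightarrow> B f g t = B f g' t"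
  by (subst (1 2) B_sym) (rule B_cong)

lemma B_quad:
  assumes "smooth_on V f" "smooth_on V g" "t \<in> {a<..<b}"
  shows "0 \<le> c\<^sup>2 * B f f t + 2 * c * d * B f g t + d\<^sup>2 * B g g t"
proof -
  let ?h = "\<lambda>x. c * f x + d * g x"
  have h: "smooth_on V ?h"
    by (intro smooth_on_add smooth_on_mult open_shell smooth_on_const assms)
  have "B ?h ?h t = c * (c * B f f t + d * B f g t) + d * (c * B g f t + d * B g g t)"
    using B_lin[OF assms(1,2) h assms(3)] B_lin2[OF assms(1,2) assms(1) assms(3)] B_lin2[OF assms(1,2) assms(2) assms(3)]
    by simp
  then show ?thesis
    using B_pos[OF h assms(3)] B_sym[of g f t] by (simp add: power2_eq_square algebra_simps)
qed

context
  fixes u :: "real^4 \<Rightarrow> real"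
  assumes u: "smooth_on V u"
begin

lemmas Ds = smooth_Xf[OF open_shell] smooth_Sf[OF open_shell]

definition "b00 = B u u"
definition "b01 = B u (Df u)"
definition "b02 = B u (Df (Df u))"
definition "b03 = B u (Df (Df (Df u)))"
definition "b11 = B (Df u) (Df u)"
definition "b12 = B (Df u) (Df (Df u))"
definition "b22 = B (Df (Df u)) (Df (Df u))"
definition "s00 = B u (Sf u)"
definition "s01 = B u (Sf (Df u))"
definition "s11 = B (Df u) (Sf (Df u))"
definition "S2 = B (Sf u) (Sf u)"
definition "uP = B u (Pf u)"

lemma b_derivs:
  assumes t: "t \<in> {a<..<b}"
  shows "(b00 has_real_derivative 2 * b01 t) (at t)"
    "(b01 has_real_derivative b11 t + b02 t) (at t)"
    "(b02 has_real_derivative b12 t + b03 t) (at t)"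
    "(b11 has_real_derivative 2 * b12 t) (at t)"
    "(b12 has_real_derivative b22 t + B (Df u) (Df (Df (Df u))) t) (at t)"
    "(b03 has_real_derivative B (Df u) (Df (Df (Df u))) t + B u (Df (Df (Df (Df u)))) t) (at t)"
    "(s00 has_real_derivative 2 * s01 t) (at t)"
    "(s01 has_real_derivative s11 t + B u (Sf (Df (Df u))) t) (at t)"
proof -
  note d = B_deriv[OF _ _ t]
  have DS: "B f (Df (Sf g)) t = B f (Sf (Df g)) t" if "smooth_on V g" for f g
    by (rule B_cong2[OF _ t]) (rule X_S_commute[OF open_shell that])
  have s: "B (Df u) (Sf u) t = B u (Sf (Df u)) t"
    using B_S[OF Ds(1)[OF u] u t] B_sym by metis
  show "(b00 has_real_derivative 2 * b01 t) (at t)"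
    unfolding b00_def b01_def using d[OF u u] by (simp add: B_sym[of "Df u" u])
  show "(b01 has_real_derivative b11 t + b02 t) (at t)"
    unfolding b01_def b02_def b11_def by (rule d) (intro Ds u)+
  show "(b02 has_real_derivative b12 t + b03 t) (at t)"
    unfolding b02_def b12_def b03_def by (rule d) (intro Ds u)+
  show "(b11 has_real_derivative 2 * b12 t) (at t)"
    unfolding b11_def b12_def using d[OF Ds(1)[OF u, of "qb 1"] Ds(1)[OF u, of "qb 1"]] by (simp add: B_sym[of "Df (Df u)" "Df u"])
  show "(b12 has_real_derivative b22 t + B (Df u) (Df (Df (Df u))) t) (at t)"
    unfolding b12_def b22_def by (rule d) (intro Ds u)+
  show "(b03 has_real_derivative B (Df u) (Df (Df (Df u))) t + B u (Df (Df (Df (Df u)))) t) (at t)"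
    unfolding b03_def by (rule d) (intro Ds u)+
  show "(s00 has_real_derivative 2 * s01 t) (at t)"
    unfolding s00_def s01_def using d[OF u Ds(2)[OF u]] DS[OF u] s by simp
  show "(s01 has_real_derivative s11 t + B u (Sf (Df (Df u))) t) (at t)"
    unfolding s01_def s11_def using d[OF u Ds(2)[OF Ds(1)[OF u, of "qb 1"]]] DS[OF Ds(1)[OF u, of "qb 1"]] by simp
qed

lemma uP_eq:
  assumes t: "t \<in> {a<..<b}"
  shows "uP t = B u (Df (Df (Df (Df u)))) t - 2 * B u (Sf (Df (Df u))) t + S2 t - 4 * b02 t"
proof -
  let ?D4 = "Df (Df (Df (Df u)))" and ?SD = "Sf (Df (Df u))" and ?SS = "Sf (Sf u)" and ?D2 = "Df (Df u)"
  have 1: "smooth_on V (\<lambda>x. 1 * ?D4 x + (-2) * ?SD x)" "smooth_on V (\<lambda>x. 1 * ?SS x + (-4) * ?D2 x)"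
    by (intro smooth_on_add smooth_on_mult open_shell smooth_on_const Ds u)+
  have "Pf u = (\<lambda>x. 1 * (\<lambda>x. 1 * ?D4 x + (-2) * ?SD x) x + 1 * (\<lambda>x. 1 * ?SS x + (-4) * ?D2 x) x)"
    by (auto simp: Pf_def)
  then have "uP t = 1 * B u (\<lambda>x. 1 * ?D4 x + (-2) * ?SD x) t + 1 * B u (\<lambda>x. 1 * ?SS x + (-4) * ?D2 x) t"
    unfolding uP_def by (simp only: B_lin2[OF 1 u t])
  also have "\<dots> = 1 * (1 * B u ?D4 t + (-2) * B u ?SD t) + 1 * (1 * B u ?SS t + (-4) * B u ?D2 t)"
    by (subst (1 2) B_lin2[OF _ _ u t]; intro Ds u refl)
  also have "B u ?SS t = S2 t"
    unfolding S2_def using B_S[OF u Ds(2)[OF u] t] by simp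
  finally show ?thesis by (simp add: b02_def)
qed

text \<open>The test of \<open>Pf u\<close> with \<phi> u. \<open>\<Theta>\<close> accumulates the
  boundary terms of all integrations by parts and vanishes because \<phi> and three derivatives do.
  Stated as one integral equal to 0, it can be added under an integral, after which integrands are
  compared pointwise.\<close>

lemma form_identity:
  fixes \<phi> \<phi>1 \<phi>2 \<phi>3 \<phi>4 :: "real \<Rightarrow> real"
  assumes T: "a < l" "l \<le> r" "r < b"
    and \<phi>: "\<And>t. (\<phi> has_real_derivative \<phi>1 t) (at t)" "\<And>t. (\<phi>1 has_real_derivative \<phi>2 t) (at t)"
      "\<And>t. (\<phi>2 has_real_derivative \<phi>3 t) (at t)" "\<And>t. (\<phi>3 has_real_derivative \<phi>4 t) (at t)"
    and z: "\<phi> l = 0" "\<phi>1 l = 0" "\<phi>2 l = 0" "\<phi>3 l = 0" "\<phi> r = 0" "\<phi>1 r = 0" "\<phi>2 r = 0" "\<phi>3 r = 0"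
  shows "((\<lambda>t. \<phi> t * uP t - (\<phi> t * (b22 t + 2 * s11 t + S2 t + 4 * b11 t) - 2 * \<phi>2 t * b11 t
      - \<phi>2 t * s00 t + (\<phi>4 t / 2 - 2 * \<phi>2 t) * b00 t)) has_integral 0) {l..r}"
proof -
  define \<Theta> where "\<Theta> t = \<phi> t * b03 t - \<phi> t * b12 t - \<phi>1 t * b02 t + \<phi>1 t * b11 t + \<phi>2 t * b01 t
     - \<phi>3 t * b00 t / 2 + \<phi>1 t * s00 t - 2 * \<phi> t * s01 t + 2 * \<phi>1 t * b00 t - 4 * \<phi> t * b01 t" for t
  have "((\<lambda>t. \<phi> t * uP t - (\<phi> t * (b22 t + 2 * s11 t + S2 t + 4 * b11 t) - 2 * \<phi>2 t * b11 t
      - \<phi>2 t * s00 t + (\<phi>4 t / 2 - 2 * \<phi>2 t) * b00 t)) has_integral \<Theta> r - \<Theta> l) {l..r}"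
  proof (rule fundamental_theorem_of_calculus[OF T(2)])
    fix t assume "t \<in> {l..r}"
    then have t: "t \<in> {a<..<b}" using T by auto
    have "(\<Theta> has_real_derivative \<phi> t * uP t - (\<phi> t * (b22 t + 2 * s11 t + S2 t + 4 * b11 t) - 2 * \<phi>2 t * b11 t
      - \<phi>2 t * s00 t + (\<phi>4 t / 2 - 2 * \<phi>2 t) * b00 t)) (at t)"
      unfolding \<Theta>_def[abs_def] uP_eq[OF t]
      by (rule derivative_eq_intros \<phi> b_derivs[OF t] refl | simp)+ (simp add: algebra_simps)
    then show "(\<Theta> has_vector_derivative \<phi> t * uP t - (\<phi> t * (b22 t + 2 * s11 t + S2 t + 4 * b11 t) - 2 * \<phi>2 t * b11 t
      - \<phi>2 t * s00 t + (\<phi>4 t / 2 - 2 * \<phi>2 t) * b00 t)) (at t within {l..r})"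
      by (simp add: has_real_derivative_iff_has_vector_derivative has_vector_derivative_at_within)
  qed
  moreover have "\<Theta> r = 0" "\<Theta> l = 0" unfolding \<Theta>_def z by simp_all
  ultimately show ?thesis by simp
qed

text \<open>Holds for every weight because the second derivative of \<open>b00\<close> is 2
  (\<open>b02\<close> + \<open>b11\<close>). It says nothing about the equation and serves as a free
  term that trades \<open>b11\<close> against \<open>b02\<close> and \<open>b00\<close>.\<close>

lemma null_identity:
  fixes \<beta> \<beta>1 \<beta>2 :: "real \<Rightarrow> real"
  assumes T: "a < l" "l \<le> r" "r < b"
    and \<beta>: "\<And>t. (\<beta> has_real_derivative \<beta>1 t) (at t)" "\<And>t. (\<beta>1 has_real_derivative \<beta>2 t) (at t)"
    and z: "\<beta> l = 0" "\<beta>1 l = 0" "\<beta> r = 0" "\<beta>1 r = 0"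
  shows "((\<lambda>t. \<beta> t * b02 t + \<beta> t * b11 t - \<beta>2 t / 2 * b00 t) has_integral 0) {l..r}"
proof -
  define \<Theta> where "\<Theta> t = \<beta> t * b01 t - \<beta>1 t * b00 t / 2" for t
  have "((\<lambda>t. \<beta> t * b02 t + \<beta> t * b11 t - \<beta>2 t / 2 * b00 t) has_integral \<Theta> r - \<Theta> l) {l..r}"
  proof (rule fundamental_theorem_of_calculus[OF T(2)])
    fix t assume "t \<in> {l..r}"
    then have t: "t \<in> {a<..<b}" using T by auto
    have "(\<Theta> has_real_derivative \<beta> t * b02 t + \<beta> t * b11 t - \<beta>2 t / 2 * b00 t) (at t)"
      unfolding \<Theta>_def[abs_def]
      by (rule derivative_eq_intros \<beta> b_derivs[OF t] refl | simp)+ (simp add: algebra_simps)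
    then show "(\<Theta> has_vector_derivative \<beta> t * b02 t + \<beta> t * b11 t - \<beta>2 t / 2 * b00 t) (at t within {l..r})"
      by (simp add: has_real_derivative_iff_has_vector_derivative has_vector_derivative_at_within)
  qed
  moreover have "\<Theta> r = 0" "\<Theta> l = 0" unfolding \<Theta>_def z by simp_all
  ultimately show ?thesis by simp
qed

lemma b_cont:
  assumes "a < l" "r < b"
  shows "continuous_on {l..r} b00" "continuous_on {l..r} b11" "continuous_on {l..r} b22" "continuous_on {l..r} b02"
    "continuous_on {l..r} s00" "continuous_on {l..r} s11" "continuous_on {l..r} S2" "continuous_on {l..r} uP"
proof -
  have c: "continuous_on {l..r} (B f g)" if "smooth_on V f" "smooth_on V g" for f g
  proof (rule continuous_at_imp_continuous_on, intro ballI)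
    fix t assume "t \<in> {l..r}"
    then have "t \<in> {a<..<b}" using assms by auto
    from DERIV_isCont[OF B_deriv[OF that this]] show "isCont (B f g) t" .
  qed
  have "smooth_on V (Pf u)"
    unfolding Pf_def[abs_def] by (intro smooth_on_diff smooth_on_add smooth_on_mult open_shell smooth_on_const Ds u)
  then show "continuous_on {l..r} b00" "continuous_on {l..r} b11" "continuous_on {l..r} b22" "continuous_on {l..r} b02"
    "continuous_on {l..r} s00" "continuous_on {l..r} s11" "continuous_on {l..r} S2" "continuous_on {l..r} uP"
    unfolding b00_def b11_def b22_def b02_def s00_def s11_def S2_def uP_def by (intro c Ds u; simp add: u)+
qed

end

end

lemma smooth_Pf: "smooth_on (shell a b) u \<Longrightarrow> smooth_on (shell a b) (Pf u)"
  unfolding Pf_def[abs_def]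
  by (intro smooth_on_diff smooth_on_add smooth_on_mult open_shell smooth_on_const smooth_Xf smooth_Sf)

lemma smooth_pf: "smooth_on (shell a b) u \<Longrightarrow> smooth_on (shell a b) (pf u)"
  unfolding pf_def[abs_def]
  by (intro smooth_on_diff smooth_on_add smooth_on_mult open_shell smooth_on_const smooth_Xf smooth_Sf)

section \<open>The full inner product and the one off the first mode\<close>

definition B0 :: "(real^4 \<Rightarrow> real) \<Rightarrow> (real^4 \<Rightarrow> real) \<Rightarrow> real \<Rightarrow> real" where
  "B0 f g t = sm (\<lambda>x. f x * g x) t"

lemma B0_X_parts:
  assumes f: "smooth_on (shell a b) f" and g: "smooth_on (shell a b) g" and t: "t \<in> {a<..<b}" and v: "unit_im v"
  shows "B0 (Xf v f) g t = - B0 f (Xf v g) t"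
proof -
  have "0 = sm (Xf v (\<lambda>x. f x * g x)) t"
    by (rule sm_X[OF smooth_on_mult[OF open_shell f g] t v, symmetric])
  also have "\<dots> = sm (\<lambda>x. Xf v f x * g x + f x * Xf v g x) t"
    by (rule sm_cong[OF _ t]) (rule Xf_mult[OF open_shell f g])
  also have "\<dots> = B0 (Xf v f) g t + B0 f (Xf v g) t"
    unfolding B0_def
    by (rule sm_add[OF _ _ t]) (intro smooth_on_mult open_shell smooth_Xf f g)+
  finally show ?thesis by simp
qed

lemma B0_S:
  assumes f: "smooth_on (shell a b) f" and g: "smooth_on (shell a b) g" and t: "t \<in> {a<..<b}"
  shows "B0 f (Sf g) t = B0 (Xf (qb 2) f) (Xf (qb 2) g) t + B0 (Xf (qb 3) f) (Xf (qb 3) g) t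
    + B0 (Xf (qb 4) f) (Xf (qb 4) g) t"
proof -
  let ?q = "\<lambda>k x. f x * Xf (qb k) (Xf (qb k) g) x"
  have q: "smooth_on (shell a b) (?q k)" for k by (intro smooth_on_mult open_shell smooth_Xf f g)
  have "B0 f (Sf g) t = sm (\<lambda>x. -1 * (?q 2 x + ?q 3 x + ?q 4 x)) t"
    unfolding B0_def Sf_def by (rule sm_cong[OF _ t]) (simp add: algebra_simps)
  also have "\<dots> = - (B0 f (Xf (qb 2) (Xf (qb 2) g)) t + B0 f (Xf (qb 3) (Xf (qb 3) g)) t + B0 f (Xf (qb 4) (Xf (qb 4) g)) t)"
    unfolding sm_cmult B0_def
    by (simp only: sm_add[OF smooth_on_add[OF open_shell q q] q t] sm_add[OF q q t]) simp
  finally show ?thesis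
    by (simp add: B0_X_parts[OF f smooth_Xf[OF open_shell g] t])
qed

lemma B0_S_sym:
  "\<lbrakk>smooth_on (shell a b) f; smooth_on (shell a b) g; t \<in> {a<..<b}\<rbrakk> \<Longrightarrow> B0 (Sf f) g t = B0 f (Sf g) t"
  using B0_S[of a b f g t] B0_S[of a b g f t] by (simp add: B0_def mult.commute)

lemma B0_lin:
  assumes "smooth_on (shell a b) f" "smooth_on (shell a b) g" "smooth_on (shell a b) h" "t \<in> {a<..<b}"
  shows "B0 (\<lambda>x. c * f x + d * g x) h t = c * B0 f h t + d * B0 g h t"
proof -
  have "B0 (\<lambda>x. c * f x + d * g x) h t = sm (\<lambda>x. c * (f x * h x) + d * (g x * h x)) t"
    unfolding B0_def by (simp add: algebra_simps)
  also have "\<dots> = sm (\<lambda>x. c * (f x * h x)) t + sm (\<lambda>x. d * (g x * h x)) t"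
    by (rule sm_add[OF _ _ assms(4)]) (intro smooth_on_mult open_shell smooth_on_const assms)+
  finally show ?thesis by (simp add: sm_cmult B0_def)
qed

lemma B0_deriv:
  assumes "smooth_on (shell a b) f" "smooth_on (shell a b) g" "t \<in> {a<..<b}"
  shows "(B0 f g has_real_derivative B0 (Df f) g t + B0 f (Df g) t) (at t)"
proof -
  have "sm (Df (\<lambda>x. f x * g x)) t = sm (\<lambda>x. Df f x * g x + f x * Df g x) t"
    by (rule sm_cong[OF _ assms(3)]) (rule Xf_mult[OF open_shell assms(1,2)])
  also have "\<dots> = B0 (Df f) g t + B0 f (Df g) t"
    unfolding B0_def by (rule sm_add[OF _ _ assms(3)]) (intro smooth_on_mult open_shell smooth_Xf assms)+
  finally show ?thesis
    using sm_deriv[OF smooth_on_mult[OF open_shell assms(1,2)] assms(3)] unfolding B0_def[abs_def] by simp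
qed

interpretation B0: sphere_form a b B0 for a b
proof
  show "B0 f g t = B0 f' g t" if "\<And>x. x \<in> shell a b \<Longrightarrow> f x = f' x" "t \<in> {a<..<b}" for f f' g t
    unfolding B0_def by (rule sm_cong[OF _ that(2)]) (simp add: that(1))
  show "0 \<le> B0 f f t" if "smooth_on (shell a b) f" "t \<in> {a<..<b}" for f t
    unfolding B0_def by (rule sm_nonneg[OF smooth_on_mult[OF open_shell that(1,1)] that(2)]) simp
  show "B0 f g t = B0 g f t" for f g t by (simp add: B0_def mult.commute)
qed (rule B0_lin B0_deriv B0_S_sym; assumption)+

text \<open>The factor exp (-t) rescales x_j to the unit sphere; with it the coefficient commutes
  with D.\<close>

definition cm :: "(real^4 \<Rightarrow> real) \<Rightarrow> 4 \<Rightarrow> real \<Rightarrow> real" where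
  "cm f j t = exp (- t) * sm (\<lambda>x. f x * x$j) t"

lemma cm_eq_cmp: "t \<in> {a<..<b} \<Longrightarrow> cm f j t = cmp t f j"
proof -
  assume t: "t \<in> {a<..<b}"
  have "sm (\<lambda>x. f x * x$j) t = sint (\<lambda>\<theta>. exp t * (f (exp t *\<^sub>R \<theta>) * \<theta>$j))"
    unfolding sm_def by (rule sint_cong) simp
  then show ?thesis unfolding cm_def cmp_def[OF t] sint_cmult by (simp add: exp_minus field_simps)
qed

lemma cm_eq_B0: "cm f j t = exp (- t) * B0 f (\<lambda>x. x$j) t"
  unfolding cm_def B0_def ..

lemma cm_deriv:
  assumes f: "smooth_on (shell a b) f" and t: "t \<in> {a<..<b}"
  shows "(cm f j has_real_derivative cm (Df f) j t) (at t)"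
proof -
  have D: "Df (\<lambda>x. x$j) = (\<lambda>x. x$j)" by (rule ext) (simp add: Xf_coord)
  have "((\<lambda>t. exp (- t) * B0 f (\<lambda>x. x$j) t) has_real_derivative
     - exp (- t) * B0 f (\<lambda>x. x$j) t + exp (- t) * (B0 (Df f) (\<lambda>x. x$j) t + B0 f (Df (\<lambda>x. x$j)) t)) (at t)"
    by (auto intro!: derivative_eq_intros B0_deriv[OF f smooth_on_coord t])
  then show ?thesis unfolding cm_eq_B0[abs_def] D by (simp add: algebra_simps)
qed

text \<open>S is symmetric, and \<open>X_k^2 = -1\<close> on linear functions makes the coordinates
  eigenfunctions with eigenvalue 3.\<close>

lemma cm_S:
  assumes f: "smooth_on (shell a b) f" and t: "t \<in> {a<..<b}"
  shows "cm (Sf f) j t = 3 * cm f j t"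
proof -
  have sq: "qm (qb k) (qm (qb k) x) = - x" if "unit_im (qb k)" for k x
    using qm_im_sq[OF that] by (simp add: qm_assoc qm_simps)
  have X: "Xf (qb k) (Xf (qb k) (\<lambda>x. x$j)) x = - x$j" if "unit_im (qb k)" for k x
  proof -
    have "Xf (qb k) (\<lambda>x. x$j) = (\<lambda>x. qm (qb k) x $ j)" by (rule ext) (rule Xf_coord)
    moreover have "((\<lambda>x. qm (qb k) x $ j) has_derivative (\<lambda>h. qm (qb k) h $ j)) (at x)"
      by (rule has_derivative_compose[OF bounded_linear_imp_has_derivative
            bounded_linear_imp_has_derivative[OF bounded_linear_vec_nth]])
         (simp add: linear_qm linear_conv_bounded_linear[symmetric])
    ultimately show ?thesis using Xf_eqI sq[OF that] by (metis (no_types, lifting) vector_uminus_component)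
  qed
  have S: "Sf (\<lambda>x. x$j) x = 3 * x$j" for x
    unfolding Sf_def X[OF unit_im_qb(1)] X[OF unit_im_qb(2)] X[OF unit_im_qb(3)] by simp
  have "B0 (Sf f) (\<lambda>x. x$j) t = B0 f (\<lambda>x. 3 * x$j) t"
    using B0_S_sym[OF f smooth_on_coord t, of j] S by presburger
  also have "\<dots> = 3 * B0 f (\<lambda>x. x$j) t"
    unfolding B0_def using sm_cmult[of 3 "\<lambda>x. f x * x$j" t] by (simp add: mult.left_commute)
  finally show ?thesis unfolding cm_eq_B0 by simp
qed

lemma cm_lin:
  assumes "smooth_on (shell a b) f" "smooth_on (shell a b) g" "t \<in> {a<..<b}"
  shows "cm (\<lambda>x. c * f x + d * g x) j t = c * cm f j t + d * cm g j t"
  unfolding cm_eq_B0 B0_lin[OF assms(1,2) smooth_on_coord assms(3)] by (simp add: algebra_simps)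

lemma cm_cong: "(\<And>x. x \<in> shell a b \<Longrightarrow> f x = g x) \<Longrightarrow> t \<in> {a<..<b} \<Longrightarrow> cm f j t = cm g j t"
  unfolding cm_eq_B0 using B0.B_cong by metis

text \<open>The inner product of the components orthogonal to the coordinates; the 4 normalises
  \<theta>_j, whose squared norm is 1/4.\<close>

definition B1 :: "(real^4 \<Rightarrow> real) \<Rightarrow> (real^4 \<Rightarrow> real) \<Rightarrow> real \<Rightarrow> real" where
  "B1 f g t = B0 f g t - 4 * (\<Sum>j\<in>UNIV. cm f j t * cm g j t)"

interpretation B1: sphere_form a b B1 for a b
proof
  fix f g h :: "real^4 \<Rightarrow> real" and t c d :: real
  show "B1 f g t = B1 g f t" unfolding B1_def by (simp add: B0.B_sym[of f] mult.commute)
  assume t: "t \<in> {a<..<b}"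
  {
    fix f' assume "\<And>x. x \<in> shell a b \<Longrightarrow> f x = f' x"
    then show "B1 f g t = B1 f' g t"
      unfolding B1_def using B0.B_cong[of a b f f' t g] cm_cong[of a b f f' t] t by simp
  }
  assume f: "smooth_on (shell a b) f"
  show "0 \<le> B1 f f t"
    using bessel[OF t f] unfolding B1_def B0_def ip_def[OF t] cm_eq_cmp[OF t] by (simp add: power2_eq_square)
  assume g: "smooth_on (shell a b) g"
  show "(B1 f g has_real_derivative B1 (Df f) g t + B1 f (Df g) t) (at t)"
    unfolding B1_def[abs_def]
    by (rule derivative_eq_intros B0_deriv[OF f g t] cm_deriv[OF f t] cm_deriv[OF g t] refl)+
       (simp add: sum.distrib algebra_simps)
  show "B1 (Sf f) g t = B1 f (Sf g) t"
    unfolding B1_def cm_S[OF f t] cm_S[OF g t] B0_S_sym[OF f g t] by (simp add: mult_ac)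
  assume h: "smooth_on (shell a b) h"
  show "B1 (\<lambda>x. c * f x + d * g x) h t = c * B1 f h t + d * B1 g h t"
    unfolding B1_def B0_lin[OF f g h t] cm_lin[OF f g t]
    by (simp add: algebra_simps sum.distrib sum_distrib_left)
qed

section \<open>Polar coordinates\<close>

abbreviation "V4 \<equiv> measure lborel (ball (0::real^4) 1)"

definition lnx :: "real^4 \<Rightarrow> real" where "lnx x = ln (norm x)"

lemma lnx_measurable [measurable]: "lnx \<in> borel_measurable borel"
  unfolding lnx_def[abs_def] by measurable

lemma emeasure_scale4:
  assumes c: "c > 0" and A: "A \<in> sets borel"
  shows "emeasure lborel ((\<lambda>x::real^4. c *\<^sub>R x) -` A) * ennreal (c^4) = emeasure lborel A"
proof -
  have "lborel = density (distr lborel borel (\<lambda>x::real^4. 0 + c *\<^sub>R x)) (\<lambda>_. \<bar>c\<bar> ^ DIM(real^4))"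
    by (rule lborel_affine) (use c in simp)
  then have "emeasure lborel A = emeasure (density (distr lborel borel (\<lambda>x::real^4. c *\<^sub>R x)) (\<lambda>_. ennreal (c^4))) A"
    using c by simp
  also have "\<dots> = ennreal (c^4) * emeasure (distr lborel borel (\<lambda>x::real^4. c *\<^sub>R x)) A"
    using A by (subst emeasure_density_const) auto
  also have "emeasure (distr lborel borel (\<lambda>x::real^4. c *\<^sub>R x)) A = emeasure lborel ((\<lambda>x. c *\<^sub>R x) -` A)"
    using A by (subst emeasure_distr) auto
  finally show ?thesis by (simp add: mult.commute)
qed

text \<open>At t = 0 this is how \<open>sph\<close> is made, and dilation by exp t multiplies
  volumes by exp (4 t).\<close>

lemma emeasure_cone:
  assumes B: "B \<in> sets borel"
  shows "emeasure lborel {x::real^4. x \<noteq> 0 \<and> lnx x < t \<and> x /\<^sub>R norm x \<in> B} = ennreal (exp (4 * t)) * (ennreal V4 * emeasure sph B)"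
proof -
  let ?C = "\<lambda>t. {x::real^4. x \<noteq> 0 \<and> lnx x < t \<and> x /\<^sub>R norm x \<in> B}"
  have [measurable]: "?C t \<in> sets borel" for t using B by measurable
  have V: "ennreal V4 = emeasure lborel (ball (0::real^4) 1)"
    using emeasure_ball_pos by (simp add: measure_def top.not_eq_extremum)
  have "emeasure sph B = emeasure (uniform_measure lborel (ball (0::real^4) 1)) ((\<lambda>y. y /\<^sub>R norm y) -` B)"
    unfolding sph_def using B by (subst emeasure_distr) (simp_all add: measurable_cong_sets[OF sets_uniform_measure refl])
  also have "\<dots> = emeasure lborel (ball 0 1 \<inter> (\<lambda>y. y /\<^sub>R norm y) -` B) / ennreal V4"
    unfolding V using measurable_sets_borel[OF normalize_measurable B] by (subst emeasure_uniform_measure) auto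
  finally have "ennreal V4 * emeasure sph B = emeasure lborel (ball (0::real^4) 1 \<inter> (\<lambda>y. y /\<^sub>R norm y) -` B)"
    unfolding V using emeasure_ball_pos by (simp add: ennreal_times_divide mult.commute[of "emeasure lborel (ball 0 1)"] ennreal_mult_divide_eq)
  also have "\<dots> = emeasure lborel (?C 0)"
  proof (rule emeasure_eq_AE)
    show "AE x in lborel. x \<in> ball (0::real^4) 1 \<inter> (\<lambda>y. y /\<^sub>R norm y) -` B \<longleftrightarrow> x \<in> ?C 0"
      using AE_lborel_singleton[of "0::real^4"] by eventually_elim (auto simp: lnx_def)
    show "ball (0::real^4) 1 \<inter> (\<lambda>y. y /\<^sub>R norm y) -` B \<in> sets lborel"
      using measurable_sets_borel[OF normalize_measurable B] by auto
  qed simp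
  finally have 0: "ennreal V4 * emeasure sph B = emeasure lborel (?C 0)" .
  have "(\<lambda>x. exp t *\<^sub>R x) -` ?C t = ?C 0"
  proof -
    have "inverse (exp t * n) * exp t = inverse n" for n :: real by (simp add: field_simps inverse_eq_divide)
    then have n: "(exp t *\<^sub>R x) /\<^sub>R norm (exp t *\<^sub>R x) = x /\<^sub>R norm x" for x :: "real^4"
      by (simp only: norm_scaleR scaleR_scaleR abs_exp_cancel)
    show ?thesis unfolding vimage_def mem_Collect_eq n by (auto simp: lnx_def ln_mult)
  qed
  then have "emeasure lborel (?C t) = emeasure lborel (?C 0) * ennreal (exp t ^ 4)"
    using emeasure_scale4[of "exp t" "?C t"] by simp
  then show ?thesis unfolding 0 by (simp add: exp_of_nat_mult[symmetric] mult.commute)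
qed

lemma nn_integral_exp4: "(\<integral>\<^sup>+s\<in>{..<t}. ennreal (4 * exp (4 * s)) \<partial>lborel) = ennreal (exp (4 * t))"
proof -
  have "(\<integral>\<^sup>+s. ennreal (4 * exp (- (4 * s))) * indicator {-t..} s \<partial>lborel) = ennreal (0 - (- exp (- (4 * (-t)))))"
  proof (rule nn_integral_FTC_atLeast[where F="\<lambda>s. - exp (- (4 * s))"])
    have "LIM s at_top. - (4 * s :: real) :> at_bot"
      by (rule filterlim_compose[OF filterlim_uminus_at_bot_at_top])
         (rule filterlim_tendsto_pos_mult_at_top[OF tendsto_const _ filterlim_ident], simp)
    from filterlim_compose[OF exp_at_bot this] have "((\<lambda>s::real. exp (- (4 * s))) \<longlongrightarrow> 0) at_top" .
    from tendsto_minus[OF this] show "((\<lambda>s::real. - exp (- (4 * s))) \<longlongrightarrow> 0) at_top" by simp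
  qed (auto intro!: derivative_eq_intros)
  moreover have "(\<integral>\<^sup>+s. ennreal (4 * exp (4 * s)) * indicator {..t} s \<partial>lborel)
     = (\<integral>\<^sup>+s. ennreal (4 * exp (- (4 * s))) * indicator {-t..} s \<partial>lborel)"
    by (subst nn_integral_real_affine[where c="-1" and t=0]) (auto intro!: nn_integral_cong simp: indicator_def)
  ultimately have "(\<integral>\<^sup>+s. ennreal (4 * exp (4 * s)) * indicator {..t} s \<partial>lborel) = ennreal (exp (4 * t))" by simp
  moreover have "(\<integral>\<^sup>+s\<in>{..<t}. ennreal (4 * exp (4 * s)) \<partial>lborel) = (\<integral>\<^sup>+s. ennreal (4 * exp (4 * s)) * indicator {..t} s \<partial>lborel)"
    by (rule nn_integral_cong_AE) (use AE_lborel_singleton[of t] in \<open>eventually_elim, auto simp: indicator_def\<close>)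
  ultimately show ?thesis by simp
qed

text \<open>It suffices to compare the two measures on cones.\<close>

lemma polar_distr:
  "density lborel (\<lambda>s. ennreal V4 * ennreal (4 * exp (4 * s))) \<Otimes>\<^sub>M sph =
    distr lborel (borel \<Otimes>\<^sub>M borel) (\<lambda>x::real^4. (lnx x, x /\<^sub>R norm x))" (is "?M \<Otimes>\<^sub>M _ = ?R")
proof (rule pair_measure_eqI)
  show "sigma_finite_measure ?M"
    by (subst sigma_finite_measure.sigma_finite_iff_density_finite[OF sigma_finite_lborel])
       (auto simp: ennreal_mult_eq_top_iff)
  show "sigma_finite_measure sph" by (rule sph.sigma_finite_measure_axioms)
  show "sets (?M \<Otimes>\<^sub>M sph) = sets ?R" by (simp cong: sets_pair_measure_cong)
  fix A :: "real set" and B assume A: "A \<in> sets ?M" and B: "B \<in> sets sph"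
  then have [measurable]: "A \<in> sets borel" "B \<in> sets borel" by auto
  let ?N = "density ?M (\<lambda>s. emeasure sph B)"
  let ?K = "distr (density lborel (indicator ((\<lambda>y::real^4. y /\<^sub>R norm y) -` B))) borel lnx"
  have pre [measurable]: "(\<lambda>y::real^4. y /\<^sub>R norm y) -` B \<in> sets borel"
    by (rule measurable_sets_borel[OF normalize_measurable]) simp
  have K: "emeasure ?K X = emeasure lborel {x::real^4. x \<noteq> 0 \<and> lnx x \<in> X \<and> x /\<^sub>R norm x \<in> B}" if [measurable]: "X \<in> sets borel" for X
  proof -
    have "emeasure ?K X = emeasure lborel ((\<lambda>y::real^4. y /\<^sub>R norm y) -` B \<inter> lnx -` X)"
      by (subst emeasure_distr)
         (simp_all add: emeasure_restricted pre measurable_sets_borel[OF lnx_measurable])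
    also have "\<dots> = emeasure lborel {x::real^4. x \<noteq> 0 \<and> lnx x \<in> X \<and> x /\<^sub>R norm x \<in> B}"
    proof (rule emeasure_eq_AE)
      show "AE x in lborel. x \<in> (\<lambda>y::real^4. y /\<^sub>R norm y) -` B \<inter> lnx -` X \<longleftrightarrow> x \<in> {x. x \<noteq> 0 \<and> lnx x \<in> X \<and> x /\<^sub>R norm x \<in> B}"
        using AE_lborel_singleton[of "0::real^4"] by eventually_elim auto
    qed (auto intro!: measurable_sets_borel[of lnx])
    finally show ?thesis .
  qed
  have N: "emeasure ?N X = emeasure ?M X * emeasure sph B" if "X \<in> sets borel" for X
    using that by (simp add: emeasure_density_const mult.commute)
  have Mt: "emeasure ?M {..<t} = ennreal V4 * ennreal (exp (4 * t))" for t
    by (simp add: emeasure_density nn_integral_exp4[symmetric] nn_integral_cmult mult.assoc)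
  \<comment> \<open>For fixed B both sides are measures on the line; the half lines form a generator
    stable under intersection, and there \<open>emeasure_cone\<close> applies.\<close>
  have "?N = ?K"
  proof (rule measure_eqI_generator_eq[where \<Omega>=UNIV and E = "range lessThan" and A = "\<lambda>n. {..<real n}"])
    show "Int_stable (range (lessThan :: real \<Rightarrow> _))"
    proof -
      have "{..<s} \<inter> {..<t} = {..<min s t}" for s t :: real by auto
      then show ?thesis unfolding Int_stable_def by auto
    qed
    show "emeasure ?N X = emeasure ?K X" if XX: "X \<in> range lessThan" for X
    proof -
      obtain t where X: "X = {..<t}" using XX by auto
      show ?thesis unfolding X using K[of "{..<t}"] N[of "{..<t}"] emeasure_cone[of B t] Mt
        by (simp add: mult_ac)
    qed
    show "sets ?N = sigma_sets UNIV (range lessThan)" "sets ?K = sigma_sets UNIV (range lessThan)"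
      by (simp_all add: borel_Iio)
    show "(\<Union>n. {..<real n}) = UNIV" by (auto intro: reals_Archimedean2)
    show "emeasure ?N {..<real n} \<noteq> \<infinity>" for n
      using N[of "{..<real n}"] Mt by (simp add: ennreal_mult_eq_top_iff sph.emeasure_finite)
  qed auto
  then have "emeasure ?M A * emeasure sph B = emeasure ?K A" using N[of A] by simp
  also have "\<dots> = emeasure lborel {x::real^4. x \<noteq> 0 \<and> lnx x \<in> A \<and> x /\<^sub>R norm x \<in> B}" by (rule K) simp
  also have "\<dots> = emeasure ?R (A \<times> B)"
  proof -
    have "emeasure ?R (A \<times> B) = emeasure lborel ((\<lambda>y::real^4. y /\<^sub>R norm y) -` B \<inter> lnx -` A)"
      by (subst emeasure_distr) (auto intro!: arg_cong[where f="emeasure lborel"])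
    also have "\<dots> = emeasure lborel {x::real^4. x \<noteq> 0 \<and> lnx x \<in> A \<and> x /\<^sub>R norm x \<in> B}"
    proof (rule emeasure_eq_AE)
      show "AE x in lborel. x \<in> (\<lambda>y::real^4. y /\<^sub>R norm y) -` B \<inter> lnx -` A \<longleftrightarrow> x \<in> {x. x \<noteq> 0 \<and> lnx x \<in> A \<and> x /\<^sub>R norm x \<in> B}"
        using AE_lborel_singleton[of "0::real^4"] by eventually_elim auto
    qed (auto intro!: measurable_sets_borel[of lnx])
    finally show ?thesis by simp
  qed
  finally show "emeasure ?M A * emeasure sph B = emeasure ?R (A \<times> B)" .
qed

lemma nn_integral_integral_lborel_interval:
  fixes f :: "real \<Rightarrow> real"
  assumes f: "continuous_on {l..r} f" and nn: "\<And>s. s \<in> {l..r} \<Longrightarrow> 0 \<le> f s" and lr: "l \<le> r"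
  shows "(\<integral>\<^sup>+s. ennreal (f s) * indicator {l..r} s \<partial>lborel) = ennreal (integral {l..r} f)"
proof -
  have i: "set_integrable lborel {l..r} f" using f borel_integrable_atLeastAtMost' by blast
  have "(\<integral>\<^sup>+s. ennreal (f s) * indicator {l..r} s \<partial>lborel) = (\<integral>\<^sup>+s. ennreal (indicator {l..r} s *\<^sub>R f s) \<partial>lborel)"
    by (rule nn_integral_cong) (auto simp: indicator_def)
  also have "\<dots> = ennreal (LINT s:{l..r}|lborel. f s)"
    unfolding set_lebesgue_integral_def using i nn
    by (intro nn_integral_eq_integral) (auto simp: set_integrable_def indicator_def)
  also have "(LINT s:{l..r}|lborel. f s) = integral {l..r} f"
    by (rule set_borel_integral_eq_integral(2)[OF i])
  finally show ?thesis .
qed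

text \<open>The weight |x|^(-4) cancels the Jacobian exp (4 s), so that no weight in s is left; 4
  \<open>V4\<close> is the area of the unit sphere.\<close>

lemma shell_integral:
  fixes f :: "real^4 \<Rightarrow> real"
  assumes lr: "a < l" "l \<le> r" "r < b" and f: "smooth_on (shell a b) f" and nn: "\<And>x. x \<in> shell a b \<Longrightarrow> 0 \<le> f x"
    and A: "A = {x. exp l \<le> norm x \<and> norm x < exp r}"
  shows "set_lebesgue_integral lborel A (\<lambda>x. norm x powr (-4) * f x) = 4 * V4 * integral {l..r} (sm f)"
proof -
  have Ab [measurable]: "A \<in> sets borel" unfolding A by measurable
  have Ax: "x \<in> A \<longleftrightarrow> x \<noteq> 0 \<and> l \<le> lnx x \<and> lnx x < r" for x
  proof (cases "x = 0")
    case False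
    then have "exp (lnx x) = norm x" unfolding lnx_def by simp
    then show ?thesis unfolding A using False by (metis (no_types, lifting) exp_le_cancel_iff exp_less_cancel_iff mem_Collect_eq)
  qed (use exp_gt_zero[of l] in \<open>simp add: A not_le\<close>)
  have As: "A \<subseteq> shell a b"
  proof
    fix x assume "x \<in> A"
    moreover have "exp a < exp l" "exp r < exp b" using lr by simp_all
    ultimately show "x \<in> shell a b" unfolding A shell_def mem_Collect_eq by linarith
  qed
  define h where "h x = indicator A x *\<^sub>R f x" for x
  have hm [measurable]: "h \<in> borel_measurable borel"
    unfolding h_def[abs_def]
    by (rule borel_measurable_continuous_on_indicator[OF Ab continuous_on_subset[OF smooth_on_continuous_on[OF f] As]])
  have h0: "0 \<le> h x" for x unfolding h_def using nn As by (auto simp: indicator_def)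
  let ?P = "\<lambda>x::real^4. (lnx x, x /\<^sub>R norm x)"
  define k where "k z = exp (-4 * fst z) * h (exp (fst z) *\<^sub>R snd z)" for z :: "real \<times> (real^4)"
  have km [measurable]: "k \<in> borel_measurable (borel \<Otimes>\<^sub>M borel)"
    unfolding k_def[abs_def] by measurable
  have kP: "k (?P x) = norm x powr (-4) * h x" if "x \<noteq> 0" for x
    using that by (simp add: k_def lnx_def powr_def)
  have int0: "AE x in lborel. k (?P x) = norm x powr (-4) * h x"
    using AE_lborel_singleton[of "0::real^4"] by eventually_elim (rule kP)
  have smc: "continuous_on {l..r} (sm f)"
    using lr by (intro continuous_at_imp_continuous_on ballI DERIV_isCont[OF sm_deriv[OF f]]) auto
  have inner: "(\<integral>\<^sup>+\<theta>. ennreal (k (s, \<theta>)) \<partial>sph) = ennreal (exp (-4 * s) * (indicator {l..<r} s * sm f s))" for s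
  proof (cases "s \<in> {l..<r}")
    case True
    then have s: "s \<in> {a<..<b}" using lr by auto
    have inA: "exp s *\<^sub>R \<theta> \<in> A" if "\<theta> \<in> S3" for \<theta> using that True unfolding A by auto
    have i: "set_integrable sph S3 (\<lambda>\<theta>. f (exp s *\<^sub>R \<theta>))" by (rule sint_integrable[OF shell_cont[OF f s]])
    have "(\<integral>\<^sup>+\<theta>. ennreal (k (s, \<theta>)) \<partial>sph) = (\<integral>\<^sup>+\<theta>. ennreal (exp (-4 * s)) * ennreal (indicator S3 \<theta> *\<^sub>R f (exp s *\<^sub>R \<theta>)) \<partial>sph)"
      by (rule nn_integral_cong_AE, rule AE_mp[OF AE_sph AE_I2])
         (use inA in \<open>auto simp: k_def h_def ennreal_mult'\<close>)
    also have "\<dots> = ennreal (exp (-4 * s)) * (\<integral>\<^sup>+\<theta>. ennreal (indicator S3 \<theta> *\<^sub>R f (exp s *\<^sub>R \<theta>)) \<partial>sph)"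
      using i by (intro nn_integral_cmult) (simp add: set_integrable_def)
    also have "(\<integral>\<^sup>+\<theta>. ennreal (indicator S3 \<theta> *\<^sub>R f (exp s *\<^sub>R \<theta>)) \<partial>sph) = ennreal (sm f s)"
      unfolding sm_def sint_def set_lebesgue_integral_def
      using i nn in_shell[OF s] by (intro nn_integral_eq_integral) (auto simp: set_integrable_def indicator_def)
    finally show ?thesis using True by (simp add: ennreal_mult')
  next
    case False
    have "k (s, \<theta>) = 0" if "\<theta> \<in> S3" for \<theta>
      using that False unfolding k_def h_def A by (auto simp: indicator_def not_le not_less)
    then have "(\<integral>\<^sup>+\<theta>. ennreal (k (s, \<theta>)) \<partial>sph) = (\<integral>\<^sup>+\<theta>. 0 \<partial>sph)"
      by (intro nn_integral_cong_AE AE_mp[OF AE_sph AE_I2]) auto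
    then show ?thesis using False by simp
  qed
  have sm0: "0 \<le> sm f s" if "s \<in> {l..r}" for s
    using that lr nn by (intro sm_nonneg[OF f]) auto
  have I0: "0 \<le> integral {l..r} (sm f)"
    by (rule integral_nonneg[OF integrable_continuous_real[OF smc]]) (rule sm0)
  have "(\<integral>\<^sup>+x. ennreal (norm x powr (-4) * h x) \<partial>lborel) = (\<integral>\<^sup>+x. ennreal (k (?P x)) \<partial>lborel)"
    by (rule nn_integral_cong_AE) (use int0 in \<open>eventually_elim, simp\<close>)
  also have "\<dots> = (\<integral>\<^sup>+z. ennreal (k z) \<partial>distr lborel (borel \<Otimes>\<^sub>M borel) ?P)"
    by (subst nn_integral_distr) auto
  also have "\<dots> = (\<integral>\<^sup>+s. \<integral>\<^sup>+\<theta>. ennreal (k (s, \<theta>)) \<partial>sph \<partial>density lborel (\<lambda>s. ennreal V4 * ennreal (4 * exp (4 * s))))"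
    unfolding polar_distr[symmetric]
    by (rule sph.nn_integral_fst[symmetric])
       (simp add: measurable_cong_sets[OF sets_pair_measure_cong[OF sets_density sets_sph(1)] refl] measurable_cong_sets[OF sets_pair_measure_cong[OF sets_lborel sets_sph(1)] refl])
  also have "\<dots> = (\<integral>\<^sup>+s. ennreal V4 * ennreal (4 * exp (4 * s)) * ennreal (exp (-4 * s) * (indicator {l..<r} s * sm f s)) \<partial>lborel)"
  proof -
    have "(\<lambda>s. indicator {l..<r} s *\<^sub>R sm f s) \<in> borel_measurable borel"
      by (rule borel_measurable_continuous_on_indicator) (auto intro: continuous_on_subset[OF smc])
    then show ?thesis unfolding inner by (subst nn_integral_density) auto
  qed
  also have "\<dots> = (\<integral>\<^sup>+s. ennreal (4 * V4 * sm f s) * indicator {l..r} s \<partial>lborel)"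
  proof (rule nn_integral_cong_AE)
    show "AE s in lborel. ennreal V4 * ennreal (4 * exp (4 * s)) * ennreal (exp (-4 * s) * (indicator {l..<r} s * sm f s))
        = ennreal (4 * V4 * sm f s) * indicator {l..r} s"
      using AE_lborel_singleton[of r]
    proof eventually_elim
      case (elim s)
      show ?case
      proof (cases "s \<in> {l..<r}")
        case True
        then have "exp (4 * s) * exp (-4 * s) = (1::real)" "0 \<le> sm f s" using sm0[of s] by (auto simp: exp_add[symmetric])
        then show ?thesis using True
          by (simp add: ennreal_mult'[symmetric] ennreal_mult[symmetric] mult_ac)
      qed (use elim in \<open>auto simp: indicator_def\<close>)
    qed
  qed
  also have "\<dots> = ennreal (integral {l..r} (\<lambda>s. 4 * V4 * sm f s))"
  proof (rule nn_integral_integral_lborel_interval)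
    show "continuous_on {l..r} (\<lambda>s. 4 * V4 * sm f s)" by (intro continuous_intros smc)
    show "0 \<le> 4 * V4 * sm f s" if "s \<in> {l..r}" for s using sm0[OF that] by simp
  qed (use lr in simp)
  finally have "(\<integral>\<^sup>+x. ennreal (norm x powr (-4) * h x) \<partial>lborel) = ennreal (4 * V4 * integral {l..r} (sm f))"
    by simp
  then have "(LINT x|lborel. norm x powr (-4) * h x) = 4 * V4 * integral {l..r} (sm f)"
    using h0 I0 by (subst integral_eq_nn_integral) (auto simp: measure_nonneg)
  moreover have "set_lebesgue_integral lborel A (\<lambda>x. norm x powr (-4) * f x) = (LINT x|lborel. norm x powr (-4) * h x)"
    unfolding set_lebesgue_integral_def h_def by (simp add: mult_ac)
  ultimately show ?thesis by simp
qed

section \<open>The first mode\<close>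

text \<open>Powers of 1 + x \<le> exp x at small x of either sign. The true values are about 6634
  and 20.09; the second bound must stay well below 43 / 2, the factor obtained for the middle
  annulus.\<close>

lemma exp_bounds: "exp (44/5::real) \<ge> 6000" "exp (3::real) \<le> 203/10"
proof -
  have P: "exp (x::real) ^ n = exp (real n * x)" for x n by (simp add: exp_of_nat_mult)
  have "(1 + 1/100) ^ 100 \<le> (exp (1/100::real)) ^ 100" by (intro power_mono exp_ge_add_one_self) auto
  moreover have "(27/10::real) \<le> (101/100) ^ 100" by (simp add: power_divide)
  ultimately have e: "exp (1::real) \<ge> 27/10" unfolding P by simp
  have "(27/10) ^ 8 \<le> (exp (1::real)) ^ 8" using e by (intro power_mono) auto
  moreover have "(2824::real) \<le> (27/10) ^ 8" by (simp add: power_divide)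
  ultimately have 1: "2824 \<le> exp (8::real)" unfolding P by simp
  have "(1 + 1/100) ^ 80 \<le> (exp (1/100::real)) ^ 80" by (intro power_mono exp_ge_add_one_self) auto
  moreover have "(215/100::real) \<le> (101/100) ^ 80" by (simp add: power_divide)
  ultimately have 2: "215/100 \<le> exp (4/5::real)" unfolding P by simp
  have "2824 * (215/100) \<le> exp (8::real) * exp (4/5)" by (rule mult_mono[OF 1 2]) auto
  then show "exp (44/5::real) \<ge> 6000" by (simp add: exp_add[symmetric])
  have "(1 - 1/1000) ^ 10 \<le> (exp (- (1/1000)::real)) ^ 10"
    using exp_ge_add_one_self[of "- (1/1000)"] by (intro power_mono) auto
  moreover have "(99/100::real) + 4/100000 \<le> (1 - 1/1000) ^ 10" by (simp add: power_divide)
  ultimately have 3: "99004/100000 \<le> exp (- (1/100)::real)" unfolding P by simp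
  have "(99004/100000) ^ 10 \<le> (exp (- (1/100)::real)) ^ 10" using 3 by (intro power_mono) auto
  moreover have "(9047/10000::real) \<le> (99004/100000) ^ 10" by (simp add: power_divide)
  ultimately have 4: "9047/10000 \<le> exp (- (1/10)::real)" unfolding P by simp
  have "(9047/10000) ^ 30 \<le> (exp (- (1/10)::real)) ^ 30" using 4 by (intro power_mono) auto
  moreover have "(10/203::real) \<le> (9047/10000) ^ 30" by (simp add: power_divide)
  ultimately have "10/203 \<le> exp (- (3::real))" unfolding P by simp
  then show "exp (3::real) \<le> 203/10" by (simp add: exp_minus field_simps)
qed

lemma psd2:
  fixes \<alpha> \<beta> \<gamma> x y :: real
  assumes "\<alpha> > 0" "\<beta>\<^sup>2 \<le> \<alpha> * \<gamma>"
  shows "0 \<le> \<alpha> * x\<^sup>2 + 2 * \<beta> * x * y + \<gamma> * y\<^sup>2"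
proof -
  have "\<alpha> * (\<alpha> * x\<^sup>2 + 2 * \<beta> * x * y + \<gamma> * y\<^sup>2) = (\<alpha> * x + \<beta> * y)\<^sup>2 + (\<alpha> * \<gamma> - \<beta>\<^sup>2) * y\<^sup>2"
    by (simp add: power2_eq_square algebra_simps)
  also have "\<dots> \<ge> 0" using assms by simp
  finally show ?thesis using assms(1) by (simp add: zero_le_mult_iff)
qed

text \<open>The general solution of c'''' - 10 c'' + 9 c = 0, whose exponents are 1, -1, 3, -3,
  split into an even and an odd part.\<close>

definition hyp :: "real \<Rightarrow> real \<Rightarrow> real \<Rightarrow> real \<Rightarrow> real \<Rightarrow> real" where
  "hyp p q p' q' t = p * cosh t + q * cosh (3 * t) + p' * sinh t + q' * sinh (3 * t)"

text \<open>An antiderivative of the square of \<open>hyp\<close>, see \<open>hypint_deriv\<close>.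
  The terms that mix primed and unprimed coefficients are even in t and drop out on symmetrically
  placed intervals.\<close>

definition hypint :: "real \<Rightarrow> real \<Rightarrow> real \<Rightarrow> real \<Rightarrow> real \<Rightarrow> real" where
  "hypint p q p' q' t = p\<^sup>2 * (sinh (2*t) / 4 + t / 2) + p * q * (sinh (4*t) / 4 + sinh (2*t) / 2) + q\<^sup>2 * (sinh (6*t) / 12 + t / 2)
    + p'\<^sup>2 * (sinh (2*t) / 4 - t / 2) + p' * q' * (sinh (4*t) / 4 - sinh (2*t) / 2) + q'\<^sup>2 * (sinh (6*t) / 12 - t / 2)
    + p * p' * cosh (2*t) / 2 + p * q' * (cosh (4*t) / 4 + cosh (2*t) / 2) + p' * q * (cosh (4*t) / 4 - cosh (2*t) / 2)
    + q * q' * cosh (6*t) / 6"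

lemma hypint_deriv: "(hypint p q p' q' has_real_derivative (hyp p q p' q' t)\<^sup>2) (at t)"
proof -
  have s1: "cosh (2*t) = cosh t * cosh t + sinh t * sinh t" using cosh_add[of t t] by simp
  have s2: "sinh (2*t) = 2 * sinh t * cosh t" using sinh_add[of t t] by simp
  have s3: "cosh (4*t) = cosh (3*t) * cosh t + sinh (3*t) * sinh t" using cosh_add[of "3*t" t] by simp
  have s4: "sinh (4*t) = sinh (3*t) * cosh t + cosh (3*t) * sinh t" using sinh_add[of "3*t" t] by simp
  have s5: "cosh (2*t) = cosh (3*t) * cosh t - sinh (3*t) * sinh t" using cosh_diff[of "3*t" t] by simp
  have s6: "sinh (2*t) = sinh (3*t) * cosh t - cosh (3*t) * sinh t" using sinh_diff[of "3*t" t] by simp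
  have s7: "cosh (6*t) = cosh (3*t) * cosh (3*t) + sinh (3*t) * sinh (3*t)" using cosh_add[of "3*t" "3*t"] by simp
  have s8: "sinh (6*t) = 2 * sinh (3*t) * cosh (3*t)" using sinh_add[of "3*t" "3*t"] by simp
  note s = s1 s2 s3 s4 s5 s6 s7 s8
  have p: "cosh t * cosh t = 1 + sinh t * sinh t" "cosh (3*t) * cosh (3*t) = 1 + sinh (3*t) * sinh (3*t)"
    using hyperbolic_pythagoras[of t] hyperbolic_pythagoras[of "3*t"] by (simp_all add: power2_eq_square)
  have D: "(hypint p q p' q' has_real_derivative
    p\<^sup>2 * (cosh (2*t) / 2 + 1 / 2) + p * q * (cosh (4*t) + cosh (2*t)) + q\<^sup>2 * (cosh (6*t) / 2 + 1 / 2)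
    + p'\<^sup>2 * (cosh (2*t) / 2 - 1 / 2) + p' * q' * (cosh (4*t) - cosh (2*t)) + q'\<^sup>2 * (cosh (6*t) / 2 - 1 / 2)
    + p * p' * sinh (2*t) + p * q' * (sinh (4*t) + sinh (2*t)) + p' * q * (sinh (4*t) - sinh (2*t))
    + q * q' * sinh (6*t)) (at t)"
    unfolding hypint_def[abs_def] by (rule derivative_eq_intros refl | simp)+
  have E1: "cosh (2*t) / 2 + 1 / 2 = (cosh t)\<^sup>2" "cosh (2*t) / 2 - 1 / 2 = (sinh t)\<^sup>2"
    using s(1) p(1) by (simp_all add: power2_eq_square field_simps)
  have E2: "cosh (4*t) + cosh (2*t) = 2 * cosh t * cosh (3*t)" "cosh (4*t) - cosh (2*t) = 2 * sinh t * sinh (3*t)"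
    using s(3,5) by simp_all
  have E3: "cosh (6*t) / 2 + 1 / 2 = (cosh (3*t))\<^sup>2" "cosh (6*t) / 2 - 1 / 2 = (sinh (3*t))\<^sup>2"
    using s(7) p(2) by (simp_all add: power2_eq_square field_simps)
  have E4: "sinh (4*t) + sinh (2*t) = 2 * cosh t * sinh (3*t)" "sinh (4*t) - sinh (2*t) = 2 * sinh t * cosh (3*t)"
    using s(4,6) by simp_all
  have E5: "sinh (6*t) = 2 * cosh (3*t) * sinh (3*t)" using s(8) by simp
  have E6: "sinh (2*t) = 2 * cosh t * sinh t" using s(2) by simp
  have "(hypint p q p' q' has_real_derivative
    p\<^sup>2 * (cosh t)\<^sup>2 + p * q * (2 * cosh t * cosh (3*t)) + q\<^sup>2 * (cosh (3*t))\<^sup>2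
    + p'\<^sup>2 * (sinh t)\<^sup>2 + p' * q' * (2 * sinh t * sinh (3*t)) + q'\<^sup>2 * (sinh (3*t))\<^sup>2
    + p * p' * (2 * cosh t * sinh t) + p * q' * (2 * cosh t * sinh (3*t)) + p' * q * (2 * sinh t * cosh (3*t))
    + q * q' * (2 * cosh (3*t) * sinh (3*t))) (at t)"
    by (rule DERIV_cong[OF D]) (intro arg_cong2[where f="(+)"] arg_cong2[where f="(*)"] refl E1 E2 E3 E4 E5 E6)
  then show ?thesis by (simp add: hyp_def power2_eq_square algebra_simps)
qed

lemma hyp_integral: "l \<le> r \<Longrightarrow> ((\<lambda>t. (hyp p q p' q' t)\<^sup>2) has_integral hypint p q p' q' r - hypint p q p' q' l) {l..r}"
  by (rule fundamental_theorem_of_calculus)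
     (auto intro: has_field_derivative_at_within[OF hypint_deriv] simp: has_real_derivative_iff_has_vector_derivative[symmetric])

text \<open>By symmetry the claim splits into two quadratic forms, in p, q and in p', q'. With X =
  exp (44/5) their entries are close to X/8, X^2/16 and X^3/24, and the determinant is dominated by
  (1/192 - 1/256) X^4.\<close>

lemma hyp_ratio:
  "44 * (hypint p q p' q' (3/2) - hypint p q p' q' (-3/2)) \<le>
    (hypint p q p' q' (-3/2) - hypint p q p' q' (-22/5)) + (hypint p q p' q' (22/5) - hypint p q p' q' (3/2))"
proof -
  define X where "X = exp (44/5::real)"
  define Y where "Y = exp (3::real)"
  have X: "X \<ge> 6000" and Y: "Y \<le> 21" "Y \<ge> 1" using exp_bounds unfolding X_def Y_def by (auto intro: order_trans)
  define s2 where "s2 = sinh (44/5::real)"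
  define s4 where "s4 = sinh (88/5::real)"
  define s6 where "s6 = sinh (132/5::real)"
  define r2 where "r2 = sinh (3::real)"
  define r4 where "r4 = sinh (6::real)"
  define r6 where "r6 = sinh (9::real)"
  have XX: "exp (88/5::real) = X\<^sup>2" "exp (132/5::real) = X^3" "exp (6::real) = Y\<^sup>2" "exp (9::real) = Y^3"
    unfolding X_def Y_def by (simp_all add: exp_of_nat_mult[symmetric])
  have up: "sinh x \<le> exp x / 2" and lo: "x \<ge> 0 \<Longrightarrow> exp x / 2 - 1/2 \<le> sinh x" for x :: real
    by (simp_all add: sinh_field_def field_simps)
  have b: "X/2 - 1/2 \<le> s2" "s2 \<le> X/2" "s4 \<le> X\<^sup>2/2" "X\<^sup>2/2 - 1/2 \<le> s4" "X^3/2 - 1/2 \<le> s6" "r2 \<le> Y/2" "r6 \<le> Y^3/2"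
    "0 \<le> r2" "0 \<le> r4" "r4 \<le> Y\<^sup>2/2"
    unfolding s2_def s4_def s6_def r2_def r4_def r6_def
    using up[of "44/5", folded X_def] lo[of "44/5", folded X_def] up[of "88/5", unfolded XX] lo[of "88/5", unfolded XX]
      lo[of "132/5", unfolded XX] up[of 3, folded Y_def] up[of 9, unfolded XX] up[of 6, unfolded XX] by simp_all
  have Y3: "Y^3 \<le> 9261" "Y\<^sup>2 \<le> 441"
    using power_mono[OF Y(1), of 3] power_mono[OF Y(1), of 2] Y by (simp_all add: power_divide)
  \<comment> \<open>The middle integral enters with 44 + 1 = 45, because the outer ones are
    differences of values at 22/5 and 3/2.\<close>
  define \<alpha> where "\<alpha> = s2/4 + 11/5 - 45/4 * r2 - 135/4"
  define \<beta> where "\<beta> = s4/8 + s2/4 - 45/8 * r4 - 45/4 * r2"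
  define \<gamma> where "\<gamma> = s6/12 + 11/5 - 15/4 * r6 - 135/4"
  define \<alpha>' where "\<alpha>' = s2/4 - 11/5 - 45/4 * r2 + 135/4"
  define \<beta>' where "\<beta>' = s4/8 - s2/4 - 45/8 * r4 + 45/4 * r2"
  define \<gamma>' where "\<gamma>' = s6/12 - 11/5 - 15/4 * r6 + 135/4"
  have al: "\<alpha> \<ge> X/8 - 150" "\<alpha>' \<ge> X/8 - 150" unfolding \<alpha>_def \<alpha>'_def using b(1,6) Y(1) by linarith+
  have ga: "\<gamma> \<ge> X^3/24 - 18000" "\<gamma>' \<ge> X^3/24 - 18000" unfolding \<gamma>_def \<gamma>'_def using b(5,7) Y3(1) by linarith+
  have X2: "X\<^sup>2 \<ge> 36000000" using power_mono[OF X, of 2] by simp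
  have X1: "X\<^sup>2 \<ge> 6000 * X" using X by (simp add: power2_eq_square mult_right_mono)
  have be: "\<beta> \<le> X\<^sup>2/16 + X/8" "\<beta>' \<le> X\<^sup>2/16 + X/8" "0 \<le> \<beta>" "0 \<le> \<beta>'"
    unfolding \<beta>_def \<beta>'_def using b(1-4,6,8-10) Y(1) Y3(2) X X2 X1 by linarith+
  have key: "(X\<^sup>2/16 + X/8)\<^sup>2 \<le> (X/8 - 150) * (X^3/24 - 18000)"
  proof -
    have "(X/8 - 150) * (X^3/24 - 18000) - (X\<^sup>2/16 + X/8)\<^sup>2
      = X^3 * (X/768 - 150/24 - 1/64) - X\<^sup>2/64 - 2250 * X + 2700000"
      by (simp add: power2_eq_square power3_eq_cube field_simps)
    moreover have "X^3 * (X/768 - 150/24 - 1/64) \<ge> X^3 * 1"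
      using X by (intro mult_left_mono) auto
    moreover have "X^3 \<ge> 6000 * X\<^sup>2" using X by (simp add: power2_eq_square power3_eq_cube mult_right_mono)
    moreover have "X\<^sup>2 \<ge> 6000 * X" using X by (simp add: power2_eq_square mult_right_mono)
    ultimately show ?thesis using X2 X by linarith
  qed
  have g0: "0 \<le> X^3/24 - 18000"
    using mult_mono[OF X X2] X by (simp add: power2_eq_square power3_eq_cube)
  have d: "\<beta>\<^sup>2 \<le> \<alpha> * \<gamma>" "\<beta>'\<^sup>2 \<le> \<alpha>' * \<gamma>'"
  proof -
    have "\<beta>\<^sup>2 \<le> (X\<^sup>2/16 + X/8)\<^sup>2" "\<beta>'\<^sup>2 \<le> (X\<^sup>2/16 + X/8)\<^sup>2" using be by (auto intro: power_mono)
    moreover have "(X/8 - 150) * (X^3/24 - 18000) \<le> \<alpha> * \<gamma>" "(X/8 - 150) * (X^3/24 - 18000) \<le> \<alpha>' * \<gamma>'"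
      using al ga X g0 by (auto intro!: mult_mono)
    ultimately show "\<beta>\<^sup>2 \<le> \<alpha> * \<gamma>" "\<beta>'\<^sup>2 \<le> \<alpha>' * \<gamma>'" using key by linarith+
  qed
  have h1: "0 \<le> \<alpha> * p\<^sup>2 + 2 * \<beta> * p * q + \<gamma> * q\<^sup>2" using al X by (intro psd2 d) auto
  have h2: "0 \<le> \<alpha>' * p'\<^sup>2 + 2 * \<beta>' * p' * q' + \<gamma>' * q'\<^sup>2" using al X by (intro psd2 d) auto
  have eq: "(hypint p q p' q' (-3/2) - hypint p q p' q' (-22/5)) + (hypint p q p' q' (22/5) - hypint p q p' q' (3/2))
     - 44 * (hypint p q p' q' (3/2) - hypint p q p' q' (-3/2))
     = 2 * (\<alpha> * p\<^sup>2 + 2 * \<beta> * p * q + \<gamma> * q\<^sup>2) + 2 * (\<alpha>' * p'\<^sup>2 + 2 * \<beta>' * p' * q' + \<gamma>' * q'\<^sup>2)"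
    unfolding hypint_def \<alpha>_def \<beta>_def \<gamma>_def \<alpha>'_def \<beta>'_def \<gamma>'_def s2_def s4_def s6_def r2_def r4_def r6_def
    by (simp add: algebra_simps)
  have nn: "0 \<le> A \<Longrightarrow> 0 \<le> B \<Longrightarrow> 0 \<le> 2 * A + 2 * B" for A B :: real by simp
  have "0 \<le> (hypint p q p' q' (-3/2) - hypint p q p' q' (-22/5)) + (hypint p q p' q' (22/5) - hypint p q p' q' (3/2))
     - 44 * (hypint p q p' q' (3/2) - hypint p q p' q' (-3/2))"
    unfolding eq by (rule nn[OF h1 h2])
  then show ?thesis by (simp only: diff_ge_0_iff_ge)
qed

text \<open>Duhamel's formula with the integrating factor exp (-r t). The L^2 bound comes from
  Young's inequality with a free parameter. Since |r t| \<le> 15, squared exponentials are at most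
  exp 30; this is used twice, and 10 bounds the length of the interval.\<close>

lemma linear_ode_bound:
  fixes w g :: "real \<Rightarrow> real"
  assumes T: "0 \<le> T" and r: "\<bar>r\<bar> \<le> 3" "T \<le> 5"
    and w: "\<And>t. t \<in> {-T..T} \<Longrightarrow> (w has_real_derivative r * w t + g t) (at t)"
    and g: "continuous_on {-T..T} g" and t: "t \<in> {-T..T}"
  shows "(w t - exp (r * t) * w 0)\<^sup>2 \<le> 10 * exp 60 * integral {-T..T} (\<lambda>t. (g t)\<^sup>2)"
proof -
  let ?G = "integral {-T..T} (\<lambda>t. (g t)\<^sup>2)"
  define \<eta> where "\<eta> t = exp (- r * t) * w t" for t
  have \<eta>: "(\<eta> has_real_derivative exp (- r * t) * g t) (at t)" if "t \<in> {-T..T}" for t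
    unfolding \<eta>_def[abs_def]
    by (rule derivative_eq_intros w[OF that] refl | simp)+ (simp add: algebra_simps)
  have ex: "(exp (- r * t))\<^sup>2 \<le> exp 30" if "t \<in> {-T..T}" for t
  proof -
    have "\<bar>r * t\<bar> \<le> 3 * 5" unfolding abs_mult using r T that by (intro mult_mono) auto
    then have "2 * (- r * t) \<le> 30" by (simp add: abs_le_iff)
    then have "exp (2 * (- r * t)) \<le> exp 30" by (simp only: exp_le_cancel_iff)
    then show ?thesis by (simp only: exp_double)
  qed
  have gi: "(\<lambda>t. (g t)\<^sup>2) integrable_on {-T..T}"
    by (intro integrable_continuous_real continuous_intros g)
  have G0: "0 \<le> ?G" by (rule integral_nonneg[OF gi]) simp
  have bd: "\<bar>\<eta> t - \<eta> 0\<bar> \<le> (s * (10 * exp 30) + ?G / s) / 2" if s: "s > 0" for s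
  proof -
    have H: "((\<lambda>t. (s * exp 30 + (g t)\<^sup>2 / s) / 2) has_integral (s * exp 30 * (2 * T) + ?G / s) / 2) {-T..T}"
    proof -
      have "((\<lambda>t. s * exp 30) has_integral (T - (-T)) *\<^sub>R (s * exp 30)) {-T..T}"
        using has_integral_const_real[of "s * exp 30" "-T" T] T by simp
      then have "((\<lambda>t. s * exp 30 + (g t)\<^sup>2 / s) has_integral (T - (-T)) *\<^sub>R (s * exp 30) + ?G / s) {-T..T}"
        by (intro has_integral_add has_integral_divide integrable_integral gi)
      from has_integral_divide[OF this, of 2] show ?thesis by (simp add: algebra_simps)
    qed
    have ptw: "\<bar>exp (- r * t) * g t\<bar> \<le> (s * exp 30 + (g t)\<^sup>2 / s) / 2" if "t \<in> {-T..T}" for t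
    proof -
      have "0 \<le> (s * \<bar>exp (- r * t)\<bar> - \<bar>g t\<bar>)\<^sup>2" by simp
      then have "2 * s * \<bar>exp (- r * t) * g t\<bar> \<le> s\<^sup>2 * (exp (- r * t))\<^sup>2 + (g t)\<^sup>2"
        by (simp add: power2_diff power_mult_distrib abs_mult algebra_simps)
      also have "\<dots> \<le> s\<^sup>2 * exp 30 + (g t)\<^sup>2" using ex[OF that] by (simp add: mult_left_mono)
      finally show ?thesis using s by (simp add: field_simps power2_eq_square)
    qed
    have seg: "\<bar>\<eta> y - \<eta> x\<bar> \<le> (s * exp 30 * (2 * T) + ?G / s) / 2" if "x \<le> y" "{x..y} \<subseteq> {-T..T}" for x y
    proof -
      have f: "((\<lambda>t. exp (- r * t) * g t) has_integral \<eta> y - \<eta> x) {x..y}"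
      proof (rule fundamental_theorem_of_calculus[OF that(1)])
        fix z assume "z \<in> {x..y}"
        then have "z \<in> {-T..T}" using that(2) by blast
        from \<eta>[OF this] show "(\<eta> has_vector_derivative exp (- r * z) * g z) (at z within {x..y})"
          by (simp add: has_real_derivative_iff_has_vector_derivative has_vector_derivative_at_within)
      qed
      have i: "(\<lambda>t. (s * exp 30 + (g t)\<^sup>2 / s) / 2) integrable_on {x..y}"
        by (rule integrable_on_subinterval[OF has_integral_integrable[OF H] that(2)])
      have "norm (integral {x..y} (\<lambda>t. exp (- r * t) * g t)) \<le> integral {x..y} (\<lambda>t. (s * exp 30 + (g t)\<^sup>2 / s) / 2)"
      proof (rule integral_norm_bound_integral[OF has_integral_integrable[OF f] i])
        fix t assume "t \<in> {x..y}"
        then have "t \<in> {-T..T}" using that(2) by blast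
        from ptw[OF this] show "norm (exp (- r * t) * g t) \<le> (s * exp 30 + (g t)\<^sup>2 / s) / 2" by simp
      qed
      then have "norm (\<eta> y - \<eta> x) \<le> integral {x..y} (\<lambda>t. (s * exp 30 + (g t)\<^sup>2 / s) / 2)"
        unfolding integral_unique[OF f] .
      also have "\<dots> \<le> integral {-T..T} (\<lambda>t. (s * exp 30 + (g t)\<^sup>2 / s) / 2)"
        using H that s by (intro integral_subset_le i has_integral_integrable[OF H]) auto
      also have "\<dots> = (s * exp 30 * (2 * T) + ?G / s) / 2" using H by (rule integral_unique)
      finally show ?thesis by simp
    qed
    have "\<bar>\<eta> t - \<eta> 0\<bar> \<le> (s * exp 30 * (2 * T) + ?G / s) / 2"
    proof (cases "t \<ge> 0")
      case True then show ?thesis using seg[of 0 t] t T by auto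
    next
      case False then show ?thesis using seg[of t 0] t T by (auto simp: abs_minus_commute)
    qed
    also have "\<dots> \<le> (s * (10 * exp 30) + ?G / s) / 2"
      using s r mult_mono[of "2 * T" 10 "s * exp 30" "s * exp 30"] T by (simp add: mult_ac)
    finally show ?thesis .
  qed
  have sq: "(\<eta> t - \<eta> 0)\<^sup>2 \<le> 10 * exp 30 * ?G"
  proof (cases "\<eta> t = \<eta> 0")
    case False
    define d where "d = \<bar>\<eta> t - \<eta> 0\<bar>"
    have d: "d > 0" using False d_def by simp
    \<comment> \<open>The free parameter d / (10 exp 30) makes the first term d / 2, which is
      absorbed on the left.\<close>
    have "d \<le> (d / (10 * exp 30) * (10 * exp 30) + ?G / (d / (10 * exp 30))) / 2"
      unfolding d_def[symmetric] using bd[of "d / (10 * exp 30)"] d unfolding d_def by simp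
    then have "d \<le> ?G * (10 * exp 30) / d" by simp
    then show ?thesis using d unfolding d_def by (simp add: field_simps power2_eq_square)
  qed (use G0 in simp)
  have "w t - exp (r * t) * w 0 = exp (r * t) * (\<eta> t - \<eta> 0)"
    unfolding \<eta>_def by (simp add: algebra_simps exp_minus mult_exp_exp)
  then have "(w t - exp (r * t) * w 0)\<^sup>2 = (exp (- r * (- t)))\<^sup>2 * (\<eta> t - \<eta> 0)\<^sup>2" by (simp add: power_mult_distrib)
  also have "\<dots> \<le> exp 30 * (10 * exp 30 * ?G)"
    using ex[of "-t"] t sq by (intro mult_mono) auto
  also have "\<dots> = 10 * exp 60 * ?G" by (simp add: exp_add[symmetric])
  finally show ?thesis .
qed

text \<open>The operator is (D - 1) (D + 1) (D - 3) (D + 3). Each of \<open>w1\<close>,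
  \<open>v1\<close>, \<open>w3\<close>, \<open>v3\<close> applies three of the factors to c, hence
  solves a first order equation with right side g, and c is a combination of the four.\<close>

lemma first_mode:
  fixes c c1 c2 c3 c4 :: "real \<Rightarrow> real"
  assumes d: "\<And>t. t \<in> {-22/5..22/5} \<Longrightarrow> (c has_real_derivative c1 t) (at t)"
    "\<And>t. t \<in> {-22/5..22/5} \<Longrightarrow> (c1 has_real_derivative c2 t) (at t)"
    "\<And>t. t \<in> {-22/5..22/5} \<Longrightarrow> (c2 has_real_derivative c3 t) (at t)"
    "\<And>t. t \<in> {-22/5..22/5} \<Longrightarrow> (c3 has_real_derivative c4 t) (at t)"
    and g: "continuous_on {-22/5..22/5} g" "\<And>t. t \<in> {-22/5..22/5} \<Longrightarrow> c4 t - 10 * c2 t + 9 * c t = g t"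
  shows "42 * integral {-3/2..3/2} (\<lambda>t. (c t)\<^sup>2) \<le>
     integral {-22/5..-3/2} (\<lambda>t. (c t)\<^sup>2) + integral {3/2..22/5} (\<lambda>t. (c t)\<^sup>2)
     + 10^6 * exp 60 * integral {-22/5..22/5} (\<lambda>t. (g t)\<^sup>2)"
proof -
  let ?I = "{-22/5..22/5::real}" and ?G = "integral {-22/5..22/5} (\<lambda>t. (g t)\<^sup>2)"
  define w1 where "w1 t = c3 t + c2 t - 9 * c1 t - 9 * c t" for t
  define v1 where "v1 t = c3 t - c2 t - 9 * c1 t + 9 * c t" for t
  define w3 where "w3 t = c3 t + 3 * c2 t - c1 t - 3 * c t" for t
  define v3 where "v3 t = c3 t - 3 * c2 t - c1 t + 3 * c t" for t
  have dw: "(w1 has_real_derivative 1 * w1 t + g t) (at t)" "(v1 has_real_derivative (-1) * v1 t + g t) (at t)"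
    "(w3 has_real_derivative 3 * w3 t + g t) (at t)" "(v3 has_real_derivative (-3) * v3 t + g t) (at t)" if "t \<in> ?I" for t
    unfolding w1_def[abs_def] v1_def[abs_def] w3_def[abs_def] v3_def[abs_def] g(2)[OF that, symmetric]
    by (rule derivative_eq_intros d[OF that] refl | simp)+
  \<comment> \<open>Partial fractions: v1 - w1 = 18 c - 2 c2 and w3 - v3 = 6 c2 - 6 c.\<close>
  have c_eq: "c t = (v1 t - w1 t) / 16 + (w3 t - v3 t) / 48" for t
    unfolding w1_def v1_def w3_def v3_def by (simp add: field_simps)
  define M where "M = 10 * exp 60 * ?G"
  have I: "?I = {-(22/5)..22/5}" by simp
  note B = linear_ode_bound[of "22/5", folded I, OF _ _ _ _ g(1)]
  have b: "(w1 t - exp (1 * t) * w1 0)\<^sup>2 \<le> M" "(v1 t - exp (-1 * t) * v1 0)\<^sup>2 \<le> M"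
    "(w3 t - exp (3 * t) * w3 0)\<^sup>2 \<le> M" "(v3 t - exp (-3 * t) * v3 0)\<^sup>2 \<le> M" if "t \<in> ?I" for t
    unfolding M_def by (rule B; use dw that in auto)+
  define p where "p = (v1 0 - w1 0) / 16"
  define p' where "p' = - (v1 0 + w1 0) / 16"
  define q where "q = (w3 0 - v3 0) / 48"
  define q' where "q' = (w3 0 + v3 0) / 48"
  define h where "h = hyp p q p' q'"
  have h_eq: "h t = (exp (-1 * t) * v1 0 - exp (1 * t) * w1 0) / 16 + (exp (3 * t) * w3 0 - exp (-3 * t) * v3 0) / 48" for t
    unfolding h_def hyp_def p_def p'_def q_def q'_def cosh_field_def sinh_field_def by (simp add: field_simps)
  have err: "(c t - h t)\<^sup>2 \<le> M" if "t \<in> ?I" for t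
  proof -
    define x1 where "x1 = v1 t - exp (-1 * t) * v1 0"
    define x2 where "x2 = w1 t - exp (1 * t) * w1 0"
    define x3 where "x3 = w3 t - exp (3 * t) * w3 0"
    define x4 where "x4 = v3 t - exp (-3 * t) * v3 0"
    have x: "x1\<^sup>2 \<le> M" "x2\<^sup>2 \<le> M" "x3\<^sup>2 \<le> M" "x4\<^sup>2 \<le> M" using b[OF that] unfolding x1_def x2_def x3_def x4_def by auto
    have "c t - h t = (x1 - x2) / 16 + (x3 - x4) / 48"
      unfolding c_eq h_eq x1_def x2_def x3_def x4_def by (simp add: field_simps)
    moreover have "((x1 - x2) / 16 + (x3 - x4) / 48)\<^sup>2 \<le> x1\<^sup>2 / 4 + x2\<^sup>2 / 4 + x3\<^sup>2 / 4 + x4\<^sup>2 / 4"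
    proof -
      have "(y1 + y2 + y3 + y4)\<^sup>2 \<le> 4 * (y1\<^sup>2 + y2\<^sup>2 + y3\<^sup>2 + y4\<^sup>2)" for y1 y2 y3 y4 :: real
      proof -
        have "4 * (y1\<^sup>2 + y2\<^sup>2 + y3\<^sup>2 + y4\<^sup>2) - (y1 + y2 + y3 + y4)\<^sup>2
          = (y1 - y2)\<^sup>2 + (y1 - y3)\<^sup>2 + (y1 - y4)\<^sup>2 + (y2 - y3)\<^sup>2 + (y2 - y4)\<^sup>2 + (y3 - y4)\<^sup>2"
          by (simp add: power2_eq_square algebra_simps)
        also have "\<dots> \<ge> 0" by (intro add_nonneg_nonneg) simp_all
        finally show ?thesis by simp
      qed
      note sq4 = this
      have e: "(x1 - x2) / 16 + (x3 - x4) / 48 = x1/16 + - x2/16 + x3/48 + - x4/48" by (simp add: field_simps)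
      have "((x1 - x2) / 16 + (x3 - x4) / 48)\<^sup>2 \<le> x1\<^sup>2 / 64 + x2\<^sup>2 / 64 + x3\<^sup>2 / 576 + x4\<^sup>2 / 576"
        unfolding e using sq4[of "x1/16" "- x2/16" "x3/48" "- x4/48"] by (simp add: power_divide)
      moreover have "y\<^sup>2 / 64 \<le> y\<^sup>2 / 4" "y\<^sup>2 / 576 \<le> y\<^sup>2 / 4" for y :: real by simp_all
      ultimately show ?thesis by (meson add_mono order_trans)
    qed
    ultimately show ?thesis using x by simp
  qed
  have cc: "continuous_on ?I c" using d(1) by (meson DERIV_isCont continuous_at_imp_continuous_on)
  have hc: "continuous_on A h" for A
    unfolding h_def hyp_def[abs_def] by (intro continuous_intros)
  have int [simp]: "(\<lambda>t. (c t)\<^sup>2) integrable_on {l..r}" "(\<lambda>t. (h t)\<^sup>2) integrable_on {l..r}" if "-22/5 \<le> l" "r \<le> 22/5" for l r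
    using that by (intro integrable_continuous_real continuous_on_power continuous_on_subset[OF cc] hc; auto)+
  have M0: "0 \<le> M" by (rule order_trans[OF zero_le_power2 err[of 0]]) simp
  \<comment> \<open>Passing from c to the homogeneous solution h and back costs the factor 51/50
    twice, and 44 / (51/50)^2 > 42.\<close>
  have cmp: "integral {l..r} (\<lambda>t. (f t)\<^sup>2) \<le> 51/50 * integral {l..r} (\<lambda>t. (k t)\<^sup>2) + 51 * M * (r - l)"
    if lr: "-22/5 \<le> l" "l \<le> r" "r \<le> 22/5" and fk: "f = c \<and> k = h \<or> f = h \<and> k = c" for l r f k
  proof -
    have i: "(\<lambda>t. (f t)\<^sup>2) integrable_on {l..r}" "(\<lambda>t. (k t)\<^sup>2) integrable_on {l..r}" using fk lr by auto
    have "((\<lambda>t. 51/50 * (k t)\<^sup>2 + 51 * M) has_integral 51/50 * integral {l..r} (\<lambda>t. (k t)\<^sup>2) + (r - l) *\<^sub>R (51 * M)) {l..r}"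
      using has_integral_const_real[of "51 * M" l r] lr
      by (intro has_integral_add has_integral_mult_right integrable_integral i) simp
    moreover have "(f t)\<^sup>2 \<le> 51/50 * (k t)\<^sup>2 + 51 * M" if "t \<in> {l..r}" for t
    proof -
      have "(f t - k t)\<^sup>2 \<le> M" using err[of t] fk that lr by (auto simp: power2_commute)
      moreover have "(f t)\<^sup>2 \<le> 51/50 * (k t)\<^sup>2 + 51 * (f t - k t)\<^sup>2"
      proof -
        have "51/50 * (k t)\<^sup>2 + 51 * (f t - k t)\<^sup>2 - (f t)\<^sup>2 = (51 * k t - 50 * f t)\<^sup>2 / 50"
          by (simp add: power2_eq_square field_simps)
        also have "\<dots> \<ge> 0" by simp
        finally show ?thesis by simp
      qed
      ultimately show ?thesis by linarith
    qed
    ultimately show ?thesis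
      using has_integral_le[OF integrable_integral[OF i(1)]] by (simp add: mult_ac)
  qed
  have hr: "44 * integral {-3/2..3/2} (\<lambda>t. (h t)\<^sup>2) \<le> integral {-22/5..-3/2} (\<lambda>t. (h t)\<^sup>2) + integral {3/2..22/5} (\<lambda>t. (h t)\<^sup>2)"
    unfolding h_def using hyp_ratio[of p q p' q'] by (simp add: integral_unique[OF hyp_integral])
  have 1: "integral {-3/2..3/2} (\<lambda>t. (c t)\<^sup>2) \<le> 51/50 * integral {-3/2..3/2} (\<lambda>t. (h t)\<^sup>2) + 51 * M * (3/2 - (-3/2))"
    by (rule cmp) auto
  have 2: "integral {-22/5..-3/2} (\<lambda>t. (h t)\<^sup>2) \<le> 51/50 * integral {-22/5..-3/2} (\<lambda>t. (c t)\<^sup>2) + 51 * M * (-3/2 - (-22/5))"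
    by (rule cmp) auto
  have 3: "integral {3/2..22/5} (\<lambda>t. (h t)\<^sup>2) \<le> 51/50 * integral {3/2..22/5} (\<lambda>t. (c t)\<^sup>2) + 51 * M * (22/5 - 3/2)"
    by (rule cmp) auto
  have pos: "0 \<le> integral {-22/5..-3/2} (\<lambda>t. (c t)\<^sup>2)" "0 \<le> integral {3/2..22/5} (\<lambda>t. (c t)\<^sup>2)"
    by (intro integral_nonneg; auto)+
  have "42 * integral {-3/2..3/2} (\<lambda>t. (c t)\<^sup>2) \<le>
     integral {-22/5..-3/2} (\<lambda>t. (c t)\<^sup>2) + integral {3/2..22/5} (\<lambda>t. (c t)\<^sup>2) + 10^5 * M"
    using 1 2 3 hr pos M0 by simp
  then show ?thesis unfolding M_def by simp
qed

section \<open>A polynomial weight for the high modes\<close>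

primrec peval :: "real list \<Rightarrow> real \<Rightarrow> real" where
  "peval [] x = 0"
| "peval (c # cs) x = c + x * peval cs x"

text \<open>Horner's scheme with every nested value replaced by a lower bound over [0, h]; only
  rational arithmetic is needed.\<close>

primrec plower :: "real list \<Rightarrow> real \<Rightarrow> real" where
  "plower [] h = 0"
| "plower (c # cs) h = c + min 0 (h * plower cs h)"

primrec pmulx :: "real \<Rightarrow> real \<Rightarrow> real list \<Rightarrow> real list" where
  "pmulx a c [] = [c]"
| "pmulx a c (q # qs) = (c + a * q) # pmulx a q qs"

primrec pshift :: "real list \<Rightarrow> real \<Rightarrow> real list" where
  "pshift [] a = []"
| "pshift (c # cs) a = pmulx a c (pshift cs a)"

text \<open>Between consecutive break points the polynomial is expanded anew at the left one, which
  keeps the Horner bound sharp. The lists of break points used later are finer where the polynomial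
  is small.\<close>

fun pcheck :: "real list \<Rightarrow> real list \<Rightarrow> bool" where
  "pcheck cs (a # b # r) \<longleftrightarrow> 0 \<le> plower (pshift cs a) (b - a) \<and> pcheck cs (b # r)"
| "pcheck cs _ \<longleftrightarrow> True"

lemma plower: "0 \<le> x \<Longrightarrow> x \<le> h \<Longrightarrow> plower cs h \<le> peval cs x"
proof (induction cs)
  case (Cons c cs)
  have "min 0 (h * plower cs h) \<le> x * peval cs x"
  proof (cases "plower cs h \<ge> 0")
    case True
    then have "0 \<le> x * peval cs x" using Cons by auto
    then show ?thesis by simp
  next
    case False
    then have "h * plower cs h \<le> x * plower cs h" using Cons by (simp add: mult_right_mono_neg)
    also have "\<dots> \<le> x * peval cs x" using Cons by (simp add: mult_left_mono)
    finally show ?thesis by simp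
  qed
  then show ?case by simp
qed simp

lemma peval_pmulx: "peval (pmulx a c q) x = c + (x + a) * peval q x"
  by (induction q arbitrary: c) (auto simp: algebra_simps)

lemma peval_pshift: "peval (pshift cs a) x = peval cs (x + a)"
  by (induction cs) (auto simp: peval_pmulx algebra_simps)

lemma pcheck: "pcheck cs ts \<Longrightarrow> ts \<noteq> [] \<Longrightarrow> hd ts \<le> x \<Longrightarrow> x < last ts \<Longrightarrow> 0 \<le> peval cs x"
proof (induction cs ts rule: pcheck.induct)
  case (1 cs a b r)
  show ?case
  proof (cases "x \<le> b")
    case True
    then have "plower (pshift cs a) (b - a) \<le> peval (pshift cs a) (x - a)"
      using 1 by (intro plower) auto
    then show ?thesis using 1 by (simp add: peval_pshift)
  qed (use 1 in auto)
qed auto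

text \<open>The recursion stops at a singleton list without checking its point, so
  \<open>pcheck\<close> leaves out the right end; continuity recovers it.\<close>

lemma pcheck': "pcheck cs ts \<Longrightarrow> ts \<noteq> [] \<Longrightarrow> hd ts \<le> x \<Longrightarrow> x \<le> last ts \<Longrightarrow> hd ts < last ts \<Longrightarrow> 0 \<le> peval cs x"
proof (cases "x = last ts")
  assume *: "pcheck cs ts" "ts \<noteq> []" "hd ts \<le> x" "hd ts < last ts" and x: "x = last ts"
  have c: "continuous_on UNIV (peval cs)"
  proof (induction cs)
    case (Cons c cs) then show ?case by (simp add: continuous_intros)
  qed simp
  have "((\<lambda>y. peval cs y) \<longlongrightarrow> peval cs x) (at_left x)"
    using c by (simp add: continuous_on_def filterlim_at_split)
  moreover have "\<forall>\<^sub>F y in at_left x. 0 \<le> peval cs y"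
    using eventually_at_left_real[OF *(4)] x by (auto elim!: eventually_mono intro!: pcheck[OF *(1,2)])
  ultimately show "0 \<le> peval cs x" by (intro tendsto_lowerbound) auto
qed (use pcheck in auto)

fun padd :: "real list \<Rightarrow> real list \<Rightarrow> real list" where
  "padd [] q = q"
| "padd p [] = p"
| "padd (a # p) (b # q) = (a + b) # padd p q"

primrec psc :: "real \<Rightarrow> real list \<Rightarrow> real list" where
  "psc c [] = []"
| "psc c (a # p) = (c * a) # psc c p"

primrec pmul :: "real list \<Rightarrow> real list \<Rightarrow> real list" where
  "pmul [] q = []"
| "pmul (a # p) q = padd (psc a q) (0 # pmul p q)"

primrec pder :: "real list \<Rightarrow> real list" where
  "pder [] = []"
| "pder (c # cs) = padd cs (0 # pder cs)"

lemma peval_ops [simp]: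
  "peval (padd p q) x = peval p x + peval q x"
  "peval (psc c p) x = c * peval p x"
  "peval (pmul p q) x = peval p x * peval q x"
proof -
  show 1: "peval (padd p q) x = peval p x + peval q x" for p q
    by (induction p q rule: padd.induct) (auto simp: algebra_simps)
  show 2: "peval (psc c p) x = c * peval p x" for c p
    by (induction p) (auto simp: algebra_simps)
  show "peval (pmul p q) x = peval p x * peval q x"
    by (induction p) (auto simp: 1 2 algebra_simps)
qed

lemma peval_deriv: "(peval cs has_real_derivative peval (pder cs) x) (at x)"
proof (induction cs)
  case (Cons c cs)
  have "((\<lambda>x. c + x * peval cs x) has_real_derivative peval cs x + x * peval (pder cs) x) (at x)"
    using Cons by (auto intro!: derivative_eq_intros)
  then show ?case by simp
qed simp

text \<open>The second derivative in \<open>t\<close> of a polynomial in \<open>z = 1 - (2 (t - c) / 9)\<^sup>2\<close>.\<close>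

definition pL :: "real list \<Rightarrow> real list" where
  "pL cs = padd (pmul [16/81, -16/81] (pder (pder cs))) (psc (-8/81) (pder cs))"

text \<open>Vanishes at the ends of the interval of length 9 about c and equals 8/9 at distance 3/2
  from c, where the middle annulus ends.\<close>

definition zt :: "real \<Rightarrow> real \<Rightarrow> real" where "zt c t = 1 - 4/81 * (t - c)\<^sup>2"
definition pw :: "real list \<Rightarrow> real \<Rightarrow> real \<Rightarrow> real" where "pw cs c t = peval cs (zt c t)"
definition pw1 :: "real list \<Rightarrow> real \<Rightarrow> real \<Rightarrow> real" where "pw1 cs c t = peval (pder cs) (zt c t) * (-8/81 * (t - c))"

lemma zt_deriv: "(zt c has_real_derivative -8/81 * (t - c)) (at t)"
  unfolding zt_def[abs_def] by (auto intro!: derivative_eq_intros)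

lemma peval_zt_deriv: "((\<lambda>t. peval cs (zt c t)) has_real_derivative peval (pder cs) (zt c t) * (-8/81 * (t - c))) (at t)"
  by (rule DERIV_chain2[OF peval_deriv zt_deriv])

lemma pw_deriv: "(pw cs c has_real_derivative pw1 cs c t) (at t)"
  unfolding pw_def[abs_def] pw1_def by (rule peval_zt_deriv)

lemma pw1_deriv: "(pw1 cs c has_real_derivative pw (pL cs) c t) (at t)"
proof -
  have "(pw1 cs c has_real_derivative peval (pder (pder cs)) (zt c t) * (-8/81 * (t - c)) * (-8/81 * (t - c))
     + peval (pder cs) (zt c t) * (-8/81)) (at t)"
    unfolding pw1_def[abs_def] by (rule derivative_eq_intros peval_zt_deriv refl | simp)+
  moreover have "peval (pder (pder cs)) (zt c t) * (-8/81 * (t - c)) * (-8/81 * (t - c))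
     + peval (pder cs) (zt c t) * (-8/81) = pw (pL cs) c t"
    unfolding pw_def pL_def zt_def by (simp add: power2_eq_square field_simps)
  ultimately show ?thesis by simp
qed

text \<open>These three coefficient lists were found by numerical optimisation; all that matters are the
  inequalities \<open>grad_coeff_nonneg\<close>, \<open>zero_coeff_outer\<close> and \<open>zero_coeff_inner\<close>.\<close>

definition "phL = ([0, 0, 0, 0, 0, 67/50, -609/100, 358/25, -107/25, -643/25, 2913/100] :: real list)"
definition "beL = ([0, 0, 0, 286/25, -2668/25, 26517/50, -34386/25, 88173/50, -87519/100] :: real list)"
definition "laL = ([0, 0, 0, 0, 149/25, -7911/100, 18891/50, -18838/25, 10689/20] :: real list)"

text \<open>Besides the sign it shows that the weight vanishes on [0, 1] only at z = 0. The power
  z^5 is split off because the Horner bound wants a polynomial that is positive at 0.\<close>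

lemma phL_bound: "0 \<le> z \<Longrightarrow> z \<le> 1 \<Longrightarrow> z^5 / 4 \<le> peval phL z"
proof -
  assume z: "0 \<le> z" "z \<le> 1"
  have "0 \<le> peval [109/100, -609/100, 358/25, -107/25, -643/25, 2913/100] z"
    by (rule pcheck'[where ts = "[0, 1/8, 1/4, 5/8, 1]"]) (use z in simp_all)
  then have "0 \<le> z^5 * peval [109/100, -609/100, 358/25, -107/25, -643/25, 2913/100] z" using z by simp
  then show ?thesis unfolding phL_def by (simp add: algebra_simps eval_nat_numeral)
qed

lemma laL_nonneg: "0 \<le> z \<Longrightarrow> z \<le> 1 \<Longrightarrow> 0 \<le> peval laL z"
proof -
  assume z: "0 \<le> z" "z \<le> 1"
  have "0 \<le> peval [149/25, -7911/100, 18891/50, -18838/25, 10689/20] z"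
    by (rule pcheck'[where ts = "[0, 1/16, 3/32, 1/8, 5/32, 3/16, 7/32, 11/32, 7/16, 1/2, 1]"]) (use z in simp_all)
  then have "0 \<le> z^4 * peval [149/25, -7911/100, 18891/50, -18838/25, 10689/20] z" using z by simp
  then show ?thesis unfolding laL_def by (simp add: algebra_simps eval_nat_numeral)
qed

text \<open>The final coefficient of \<open>b11\<close>: 4 \<phi> from the energy identity, 12
  \<phi> from 2 \<open>s11\<close> \<ge> 12 \<open>b11\<close>, twice the second derivative of
  \<phi> with a minus sign, and \<beta> from the null identity.\<close>

lemma grad_coeff_nonneg:
  assumes z: "0 \<le> z" "z \<le> 1"
  shows "0 \<le> 16 * peval phL z - 2 * peval (pL phL) z + peval beL z"
proof -
  have e: "padd (padd (psc 16 phL) (psc (-2) (pL phL))) beL = [0, 0, 0] @ [1726/2025, -5092/225, 316951/1350, -151306/135, 3540671/1350, -2481047/900, 460184/675, 11652/25, 0]"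
    unfolding phL_def beL_def pL_def by simp
  have "0 \<le> peval [1726/2025, -5092/225, 316951/1350, -151306/135, 3540671/1350, -2481047/900, 460184/675, 11652/25] z"
    by (rule pcheck'[where ts = "[0, 1/32, 1/16, 5/64, 7/64, 13/64, 5/16, 33/64, 39/64, 11/16, 1]"]) (use z in simp_all)
  then have "0 \<le> z * (z * (z * peval [1726/2025, -5092/225, 316951/1350, -151306/135, 3540671/1350, -2481047/900, 460184/675, 11652/25] z))" using z by simp
  also have "\<dots> = peval (padd (padd (psc 16 phL) (psc (-2) (pL phL))) beL) z"
    unfolding e by simp
  finally show ?thesis by simp
qed

text \<open>The discriminant condition of \<open>quadratic_combine\<close> for the coefficient of
  \<open>b00\<close>, where \<open>laL\<close> multiplies the nonnegative quantity
  \<open>s00\<close> - 6 \<open>b00\<close>. The last summand is 1 on the outer annuli and 1 - 43 =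
  -42 on the middle one, which begins at z = 8/9.\<close>

lemma zero_coeff_outer:
  assumes z: "0 \<le> z" "z \<le> 8/9"
  shows "(peval beL z)\<^sup>2 + (peval (pL phL) z + peval laL z)\<^sup>2
    \<le> 4 * peval phL z * (peval (pL (pL phL)) z / 2 - 2 * peval (pL phL) z - peval (pL beL) z / 2 + 6 * peval laL z + 1)"
proof -
  let ?M = "padd (padd (padd (psc (1/2) (pL (pL phL))) (psc (-2) (pL phL))) (padd (psc (-1/2) (pL beL)) (psc 6 laL))) [1]"
  let ?N = "padd (pmul (psc 4 phL) ?M) (padd (psc (-1) (pmul beL beL)) (psc (-1) (pmul (padd (pL phL) laL) (padd (pL phL) laL))))"
  have e: "?N = [0, 0, 0, 0, 0] @ [134/25, -831525853/4100625, 930860104/273375, -44208672473/1366875, 59935422533/303750, -80222850487/97200, 2663368292533/1093500, -1853441606449/364500, 80219437268587/10935000, -18620679117431/2733750, 3492671273531/1093500, 156189313963/405000, -1291716464/1125, 211724208919/911250, 143311832/1125, 0, 0, 0]"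
    unfolding phL_def beL_def laL_def pL_def by simp
  have "0 \<le> peval [134/25, -831525853/4100625, 930860104/273375, -44208672473/1366875, 59935422533/303750, -80222850487/97200, 2663368292533/1093500, -1853441606449/364500, 80219437268587/10935000, -18620679117431/2733750, 3492671273531/1093500, 156189313963/405000, -1291716464/1125, 211724208919/911250, 143311832/1125, 0] z"
    by (rule pcheck'[where ts = "[0, 1/64, 1/32, 3/64, 1/16, 5/64, 1/8, 13/64, 21/64, 33/64, 43/64, 8/9]"]) (use z in simp_all)
  then have "0 \<le> z * (z * (z * (z * (z * peval [134/25, -831525853/4100625, 930860104/273375, -44208672473/1366875, 59935422533/303750, -80222850487/97200, 2663368292533/1093500, -1853441606449/364500, 80219437268587/10935000, -18620679117431/2733750, 3492671273531/1093500, 156189313963/405000, -1291716464/1125, 211724208919/911250, 143311832/1125, 0] z))))" using z by simp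
  also have "\<dots> = peval ?N z"
    unfolding e by simp
  finally show ?thesis by (simp add: power2_eq_square algebra_simps)
qed

lemma zero_coeff_inner:
  assumes z: "8/9 \<le> z" "z \<le> 1"
  shows "(peval beL z)\<^sup>2 + (peval (pL phL) z + peval laL z)\<^sup>2
    \<le> 4 * peval phL z * (peval (pL (pL phL)) z / 2 - 2 * peval (pL phL) z - peval (pL beL) z / 2 + 6 * peval laL z + (-42))"
proof -
  let ?M = "padd (padd (padd (psc (1/2) (pL (pL phL))) (psc (-2) (pL phL))) (padd (psc (-1/2) (pL beL)) (psc 6 laL))) [(-42)]"
  let ?N = "padd (pmul (psc 4 phL) ?M) (padd (psc (-1) (pmul beL beL)) (psc (-1) (pmul (padd (pL phL) laL) (padd (pL phL) laL))))"
  have e: "?N = [0, 0, 0, 0, 0] @ [-5628/25, 3463796822/4100625, 257526544/273375, -43202433773/1366875, 61279163933/303750, -80709857479/97200, 2663368292533/1093500, -1853441606449/364500, 80219437268587/10935000, -18620679117431/2733750, 3492671273531/1093500, 156189313963/405000, -1291716464/1125, 211724208919/911250, 143311832/1125, 0, 0, 0]"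
    unfolding phL_def beL_def laL_def pL_def by simp
  have "0 \<le> peval [-5628/25, 3463796822/4100625, 257526544/273375, -43202433773/1366875, 61279163933/303750, -80709857479/97200, 2663368292533/1093500, -1853441606449/364500, 80219437268587/10935000, -18620679117431/2733750, 3492671273531/1093500, 156189313963/405000, -1291716464/1125, 211724208919/911250, 143311832/1125, 0] z"
    by (rule pcheck'[where ts = "[8/9, 1]"]) (use z in simp_all)
  then have "0 \<le> z * (z * (z * (z * (z * peval [-5628/25, 3463796822/4100625, 257526544/273375, -43202433773/1366875, 61279163933/303750, -80709857479/97200, 2663368292533/1093500, -1853441606449/364500, 80219437268587/10935000, -18620679117431/2733750, 3492671273531/1093500, 156189313963/405000, -1291716464/1125, 211724208919/911250, 143311832/1125, 0] z))))" using z by simp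
  also have "\<dots> = peval ?N z"
    unfolding e by simp
  finally show ?thesis by (simp add: power2_eq_square algebra_simps)
qed

section \<open>Interior estimates\<close>

lemma Xf_lin:
  assumes "smooth_on (shell a b) f" "smooth_on (shell a b) g" "x \<in> shell a b"
  shows "Xf p (\<lambda>x. c * f x + d * g x) x = c * Xf p f x + d * Xf p g x"
  by (simp add: Xf_add[OF open_shell smooth_on_mult[OF open_shell smooth_on_const assms(1)]
        smooth_on_mult[OF open_shell smooth_on_const assms(2)] assms(3)]
      Xf_cmult[OF open_shell assms(1,3)] Xf_cmult[OF open_shell assms(2,3)])

lemma Sf_lin:
  assumes f: "smooth_on (shell a b) f" and g: "smooth_on (shell a b) g" and x: "x \<in> shell a b"
  shows "Sf (\<lambda>x. c * f x + d * g x) x = c * Sf f x + d * Sf g x"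
proof -
  have "Xf p (Xf p (\<lambda>x. c * f x + d * g x)) x = c * Xf p (Xf p f) x + d * Xf p (Xf p g) x" for p
  proof -
    have "Xf p (Xf p (\<lambda>x. c * f x + d * g x)) x = Xf p (\<lambda>x. c * Xf p f x + d * Xf p g x) x"
      by (rule Xf_cong[OF open_shell Xf_lin[OF f g] x])
    also have "\<dots> = c * Xf p (Xf p f) x + d * Xf p (Xf p g) x"
      by (rule Xf_lin[OF smooth_Xf[OF open_shell f] smooth_Xf[OF open_shell g] x])
    finally show ?thesis .
  qed
  then show ?thesis unfolding Sf_def by (simp add: algebra_simps)
qed

lemma pf_lin: "pf u = (\<lambda>x. 1 * (\<lambda>x. 1 * Df (Df u) x + 2 * Df u x) x + (-1) * Sf u x)"
  by (auto simp: pf_def)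

text \<open>S commutes with D, so the two factors multiply like polynomials. Thus
  \<open>pf u\<close> itself solves a second order equation, on which \<open>interior_third\<close>
  rests.\<close>

lemma Pf_factor:
  assumes u: "smooth_on (shell a b) u" and x: "x \<in> shell a b"
  shows "Df (Df (pf u)) x - 2 * Df (pf u) x - Sf (pf u) x = Pf u x"
proof -
  note s = smooth_Xf[OF open_shell] smooth_Sf[OF open_shell]
  have s1: "smooth_on (shell a b) (\<lambda>x. 1 * Df (Df f) x + 2 * Df f x)" if "smooth_on (shell a b) f" for f
    by (intro smooth_on_add smooth_on_mult open_shell smooth_on_const s that)
  have D: "Df (pf f) y = Df (Df (Df f)) y + 2 * Df (Df f) y - Sf (Df f) y" if f: "smooth_on (shell a b) f" and y: "y \<in> shell a b" for f y
    unfolding pf_lin Xf_lin[OF s1[OF f] s(2)[OF f] y] Xf_lin[OF s(1)[OF s(1)[OF f]] s(1)[OF f] y]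
    using X_S_commute[OF open_shell f y, of "qb 1"] by simp
  have S: "Sf (pf u) x = Sf (Df (Df u)) x + 2 * Sf (Df u) x - Sf (Sf u) x"
    unfolding pf_lin Sf_lin[OF s1[OF u] s(2)[OF u] x] Sf_lin[OF s(1)[OF s(1)[OF u]] s(1)[OF u] x] by simp
  have "Df (Df (pf u)) x = Df (pf (Df u)) x"
    by (rule Xf_cong[OF open_shell _ x]) (simp add: D[OF u] pf_def)
  also have "\<dots> = Df (Df (Df (Df u))) x + 2 * Df (Df (Df u)) x - Sf (Df (Df u)) x" by (rule D[OF s(1)[OF u] x])
  finally show ?thesis unfolding S D[OF u x] Pf_def by simp
qed

lemma zt_bounds:
  assumes "t \<in> {t0 - 9/2..t0 + 9/2}" shows "0 \<le> zt t0 t" "zt t0 t \<le> 1"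
proof -
  have "\<bar>t - t0\<bar> \<le> 9/2" using assms by (intro abs_leI) auto
  then have "(t - t0)\<^sup>2 \<le> (9/2)\<^sup>2" by (metis abs_ge_zero power2_abs power_mono)
  then show "0 \<le> zt t0 t" by (simp add: zt_def power2_eq_square)
  show "zt t0 t \<le> 1" by (simp add: zt_def)
qed

lemma zt_ends [simp]: "zt t0 (t0 - 9/2) = 0" "zt t0 (t0 + 9/2) = 0"
  by (simp_all add: zt_def power2_eq_square)

lemma B0_energy_nonneg:
  assumes "smooth_on (shell a b) u" "t \<in> {a<..<b}"
  shows "0 \<le> B0.b00 u t" "0 \<le> B0.b11 u t" "0 \<le> B0.b22 u t" "0 \<le> B0.S2 u t" "0 \<le> B0.s00 u t" "0 \<le> B0.s11 u t"
proof -
  note s = smooth_Xf[OF open_shell] smooth_Sf[OF open_shell]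
  have n: "0 \<le> B0 f f t" if "smooth_on (shell a b) f" for f by (rule B0.B_pos[OF that assms(2)])
  have e: "0 \<le> B0 f (Sf f) t" if "smooth_on (shell a b) f" for f
    unfolding B0_S[OF that that assms(2)] by (intro add_nonneg_nonneg n s that)
  note defs = B0.b00_def[OF assms(1)] B0.b11_def[OF assms(1)] B0.b22_def[OF assms(1)] B0.S2_def[OF assms(1)]
    B0.s00_def[OF assms(1)] B0.s11_def[OF assms(1)]
  show "0 \<le> B0.b00 u t" "0 \<le> B0.b11 u t" "0 \<le> B0.b22 u t" "0 \<le> B0.S2 u t" "0 \<le> B0.s00 u t" "0 \<le> B0.s11 u t"
    unfolding defs by (intro n e s assms)+
qed

definition dens :: "(real^4 \<Rightarrow> real) \<Rightarrow> real \<Rightarrow> real" where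
  "dens u t = B0.b22 u t + B0.s11 u t + B0.S2 u t + B0.b11 u t"

lemma pw_cont: "continuous_on A (pw cs t0)"
  by (meson DERIV_isCont continuous_at_imp_continuous_on pw_deriv)

lemma pf_square:
  assumes u: "smooth_on (shell a b) u" and t: "t \<in> {a<..<b}"
  shows "B0.b00 (pf u) t \<le> 12 * dens u t"
proof -
  note s = smooth_Xf[OF open_shell] smooth_Sf[OF open_shell]
  have "B0.b00 (pf u) t \<le> sm (\<lambda>x. 3 * (Df (Df u) x * Df (Df u) x) + 12 * (Df u x * Df u x) + 3 * (Sf u x * Sf u x)) t"
    unfolding B0.b00_def[OF smooth_pf[OF u]] B0_def
  proof (rule sm_mono[OF _ _ t])
    show "smooth_on (shell a b) (\<lambda>x. pf u x * pf u x)" by (intro smooth_on_mult open_shell smooth_pf u)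
    show "smooth_on (shell a b) (\<lambda>x. 3 * (Df (Df u) x * Df (Df u) x) + 12 * (Df u x * Df u x) + 3 * (Sf u x * Sf u x))"
      by (intro smooth_on_add smooth_on_mult open_shell smooth_on_const s u)
    have "(p + 2 * q - r) * (p + 2 * q - r) \<le> 3 * (p * p) + 12 * (q * q) + 3 * (r * r)" for p q r :: real
    proof -
      have "3 * (p * p) + 12 * (q * q) + 3 * (r * r) - (p + 2 * q - r) * (p + 2 * q - r)
        = (p - 2 * q)\<^sup>2 + (p + r)\<^sup>2 + (2 * q + r)\<^sup>2" by (simp add: power2_eq_square algebra_simps)
      also have "\<dots> \<ge> 0" by simp
      finally show ?thesis by simp
    qed
    then show "pf u x * pf u x \<le> 3 * (Df (Df u) x * Df (Df u) x) + 12 * (Df u x * Df u x) + 3 * (Sf u x * Sf u x)" for x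
      unfolding pf_def .
  qed
  also have "\<dots> = 3 * B0.b22 u t + 12 * B0.b11 u t + 3 * B0.S2 u t"
  proof -
    let ?A = "\<lambda>x. 3 * (Df (Df u) x * Df (Df u) x)" and ?B = "\<lambda>x. 12 * (Df u x * Df u x)"
      and ?C = "\<lambda>x. 3 * (Sf u x * Sf u x)"
    have A: "smooth_on (shell a b) ?A" and B: "smooth_on (shell a b) ?B" and C: "smooth_on (shell a b) ?C"
      by (intro smooth_on_mult open_shell smooth_on_const s u)+
    show ?thesis
      using sm_add[OF smooth_on_add[OF open_shell A B] C t] sm_add[OF A B t]
      unfolding B0.b22_def[OF u] B0.b11_def[OF u] B0.S2_def[OF u] B0_def sm_cmult by simp
  qed
  also have "\<dots> \<le> 12 * dens u t"
    unfolding dens_def using B0_energy_nonneg[OF u t] by simp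
  finally show ?thesis .
qed

context
  fixes a b t0 :: real
  assumes ab: "a < t0 - 9/2" "t0 + 9/2 < b"
begin

abbreviation "Iv \<equiv> {t0 - 9/2..t0 + 9/2}"

lemma Iv_sub: "t \<in> Iv \<Longrightarrow> t \<in> {a<..<b}" using ab by auto

text \<open>The test with z^4 u. Differentiating the cutoff yields \<open>b11\<close> with weight
  z^2 only, which z^4 \<open>dens\<close> does not dominate; the null identity with weight z^2
  replaces it by \<open>b02\<close>, and this splits between z^4 \<open>b22\<close> and
  \<open>b00\<close>.\<close>

lemma interior_second:
  assumes u: "smooth_on (shell a b) u"
  shows "integral Iv (\<lambda>t. zt t0 t ^ 4 * dens u t)
     \<le> 2 * integral Iv (\<lambda>t. zt t0 t ^ 4 * B0.uP u t) + 120 * integral Iv (B0.b00 u)"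
proof -
  let ?z = "zt t0" and ?P4 = "[0,0,0,0,1] :: real list" and ?P2 = "[0,0,1] :: real list"
  let ?J1 = "\<lambda>t. pw ?P4 t0 t * B0.uP u t - (pw ?P4 t0 t * (B0.b22 u t + 2 * B0.s11 u t + B0.S2 u t + 4 * B0.b11 u t)
     - 2 * pw (pL ?P4) t0 t * B0.b11 u t - pw (pL ?P4) t0 t * B0.s00 u t
     + (pw (pL (pL ?P4)) t0 t / 2 - 2 * pw (pL ?P4) t0 t) * B0.b00 u t)"
  let ?J2 = "\<lambda>t. pw ?P2 t0 t * B0.b02 u t + pw ?P2 t0 t * B0.b11 u t - pw (pL ?P2) t0 t / 2 * B0.b00 u t"
  have J1: "(?J1 has_integral 0) Iv"
    by (rule B0.form_identity[OF u ab(1) _ ab(2) pw_deriv pw1_deriv pw_deriv pw1_deriv])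
       (simp_all add: pw_def pw1_def pL_def)
  have J2: "(?J2 has_integral 0) Iv"
    by (rule B0.null_identity[OF u ab(1) _ ab(2) pw_deriv pw1_deriv])
       (simp_all add: pw_def pw1_def pL_def)
  note c = B0.b_cont[OF u ab]
  have zc: "continuous_on Iv ?z" unfolding zt_def[abs_def] by (intro continuous_intros)
  have i1: "((\<lambda>t. ?z t ^ 4 * B0.uP u t) has_integral integral Iv (\<lambda>t. ?z t ^ 4 * B0.uP u t)) Iv"
    by (intro integrable_integral integrable_continuous_real continuous_intros zc c)
  have i2: "(B0.b00 u has_integral integral Iv (B0.b00 u)) Iv"
    by (intro integrable_integral integrable_continuous_real c)
  have i3: "((\<lambda>t. ?z t ^ 4 * dens u t) has_integral integral Iv (\<lambda>t. ?z t ^ 4 * dens u t)) Iv"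
    unfolding dens_def by (intro integrable_integral integrable_continuous_real continuous_intros zc c)
  have "((\<lambda>t. 2 * (?z t ^ 4 * B0.uP u t) + 120 * B0.b00 u t - 2 * ?J1 t + 12 * ?J2 t) has_integral
      2 * integral Iv (\<lambda>t. ?z t ^ 4 * B0.uP u t) + 120 * integral Iv (B0.b00 u) - 2 * 0 + 12 * 0) Iv"
    by (intro has_integral_add has_integral_diff has_integral_mult_right i1 i2 J1 J2)
  then have main: "((\<lambda>t. 2 * (?z t ^ 4 * B0.uP u t) + 120 * B0.b00 u t - 2 * ?J1 t + 12 * ?J2 t) has_integral
      2 * integral Iv (\<lambda>t. ?z t ^ 4 * B0.uP u t) + 120 * integral Iv (B0.b00 u)) Iv" by simp
  show ?thesis
  proof (rule has_integral_le[OF i3 main])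
    fix t assume t: "t \<in> Iv"
    note tt = Iv_sub[OF t]
    define z where "z = ?z t"
    have z: "0 \<le> z" "z \<le> 1" using zt_bounds[OF t] unfolding z_def by auto
    \<comment> \<open>The second derivative of z^4 in t is z^2 m.\<close>
    define m where "m = 64/27 - 224/81 * z"
    have m: "-1 \<le> m" "m \<le> 3" using z unfolding m_def by auto
    have m2: "m\<^sup>2 \<le> 9"
    proof -
      have "\<bar>m\<bar> \<le> 3" using m by auto
      then have "\<bar>m\<bar>\<^sup>2 \<le> 3\<^sup>2" by (rule power_mono) simp
      then show ?thesis by simp
    qed
    have p4: "pw ?P4 t0 t = z^4" unfolding pw_def z_def[symmetric] by (simp add: eval_nat_numeral)
    have p42: "pw (pL ?P4) t0 t = z\<^sup>2 * m"
      unfolding pw_def z_def[symmetric] pL_def m_def by (simp add: power2_eq_square field_simps)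
    have p2: "pw ?P2 t0 t = z\<^sup>2" unfolding pw_def z_def[symmetric] by (simp add: power2_eq_square)
    have p22: "pw (pL ?P2) t0 t \<le> 1"
      unfolding pw_def z_def[symmetric] pL_def using z by (simp add: field_simps)
    have p44: "pw (pL (pL ?P4)) t0 t \<ge> -2"
    proof -
      have "0 \<le> peval (padd [2] (pL (pL ?P4))) z"
        by (rule pcheck'[where ts="[0,1/4,1/2,3/4,1]"]) (use z in \<open>simp_all add: pL_def\<close>)
      then show ?thesis unfolding pw_def z_def[symmetric] by simp
    qed
    define e0 where "e0 = B0.b00 u t"
    define e1 where "e1 = B0.b11 u t"
    define e2 where "e2 = B0.b22 u t"
    define k where "k = B0.b02 u t"
    define s0 where "s0 = B0.s00 u t"
    define s1 where "s1 = B0.s11 u t"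
    define S where "S = B0.S2 u t"
    define P where "P = B0.uP u t"
    have nn: "0 \<le> e0" "0 \<le> e1" "0 \<le> e2" "0 \<le> S" "0 \<le> s1"
      unfolding e0_def e1_def e2_def S_def s1_def using B0_energy_nonneg[OF u tt] by auto
    note sm = smooth_Xf[OF open_shell] smooth_Sf[OF open_shell]
    have q1: "0 \<le> z^4 * e2 + 12 * z\<^sup>2 * k + 36 * e0"
      using B0.B_quad[OF sm(1)[OF sm(1)[OF u]] u tt, of "z\<^sup>2" "qb 1" "qb 1" 6]
      unfolding e2_def k_def e0_def B0.b22_def[OF u] B0.b02_def[OF u] B0.b00_def[OF u]
      by (simp add: B0.B_sym[of "Df (Df u)" u])
    have q2: "0 \<le> z^4 * S - 2 * (z\<^sup>2 * m) * s0 + m\<^sup>2 * e0"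
      using B0.B_quad[OF sm(2)[OF u] u tt, of "z\<^sup>2" "- m"]
      unfolding S_def s0_def e0_def B0.S2_def[OF u] B0.s00_def[OF u] B0.b00_def[OF u]
      by (simp add: B0.B_sym[of "Sf u" u] mult.assoc)
    have q3: "0 \<le> (12 * z\<^sup>2 - 4 * (z\<^sup>2 * m)) * e1"
    proof -
      have "12 * z\<^sup>2 - 4 * (z\<^sup>2 * m) = 4 * z\<^sup>2 * (3 - m)" by (simp add: algebra_simps)
      then show ?thesis using m nn by simp
    qed
    have q4: "0 \<le> (120 - 36 - m\<^sup>2 + pw (pL (pL ?P4)) t0 t - 4 * (z\<^sup>2 * m) - 6 * pw (pL ?P2) t0 t) * e0"
    proof -
      have "z\<^sup>2 * m \<le> z\<^sup>2 * 3" using m by (intro mult_left_mono) auto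
      moreover have "z\<^sup>2 \<le> 1" using z by (intro power_le_one)
      ultimately have "z\<^sup>2 * m \<le> 3" by linarith
      then show ?thesis using m2 p44 p22 nn by (intro mult_nonneg_nonneg) auto
    qed
    have q5: "0 \<le> z^4 * s1 * 3" "0 \<le> z^4 * e1 * 7" using z nn by auto
    have "2 * (z^4 * P) + 120 * e0 - 2 * (z^4 * P - (z^4 * (e2 + 2 * s1 + S + 4 * e1) - 2 * (z\<^sup>2 * m) * e1 - (z\<^sup>2 * m) * s0
        + (pw (pL (pL ?P4)) t0 t / 2 - 2 * (z\<^sup>2 * m)) * e0)) + 12 * (z\<^sup>2 * k + z\<^sup>2 * e1 - pw (pL ?P2) t0 t / 2 * e0)
        - z^4 * (e2 + s1 + S + e1)
      = (z^4 * e2 + 12 * z\<^sup>2 * k + 36 * e0) + (z^4 * S - 2 * (z\<^sup>2 * m) * s0 + m\<^sup>2 * e0)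
        + (12 * z\<^sup>2 - 4 * (z\<^sup>2 * m)) * e1
        + (120 - 36 - m\<^sup>2 + pw (pL (pL ?P4)) t0 t - 4 * (z\<^sup>2 * m) - 6 * pw (pL ?P2) t0 t) * e0 + z^4 * s1 * 3 + z^4 * e1 * 7"
      by (simp add: algebra_simps)
    also have "\<dots> \<ge> 0" using q1 q2 q3 q4 q5 by simp
    finally show "?z t ^ 4 * dens u t \<le> 2 * (?z t ^ 4 * B0.uP u t) + 120 * B0.b00 u t - 2 * ?J1 t + 12 * ?J2 t"
      unfolding dens_def p4 p42 p2 e0_def e1_def e2_def k_def s0_def s1_def S_def P_def z_def[symmetric] by simp
  qed
qed

text \<open>Caccioppoli's inequality for p = \<open>pf u\<close>, which satisfies (D^2 - 2 D - S) p
  = \<open>Pf u\<close>. It controls the gradient of the Laplacian, which occurs in the equation but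
  not in \<open>dens\<close>.\<close>

lemma interior_third:
  assumes u: "smooth_on (shell a b) u"
  shows "integral Iv (\<lambda>t. zt t0 t ^ 6 * (B0.b11 (pf u) t + B0.s00 (pf u) t))
     \<le> 72 * integral Iv (\<lambda>t. zt t0 t ^ 4 * dens u t) - integral Iv (\<lambda>t. zt t0 t ^ 6 * B0 (pf u) (Pf u) t)"
proof -
  let ?z = "zt t0" and ?P6 = "[0,0,0,0,0,0,1] :: real list" and ?p = "pf u"
  note p = smooth_pf[OF u]
  note s = smooth_Xf[OF open_shell] smooth_Sf[OF open_shell]
  have J2: "((\<lambda>t. pw ?P6 t0 t * B0.b02 ?p t + pw ?P6 t0 t * B0.b11 ?p t - pw (pL ?P6) t0 t / 2 * B0.b00 ?p t) has_integral 0) Iv"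
    by (rule B0.null_identity[OF p ab(1) _ ab(2) pw_deriv pw1_deriv])
       (simp_all add: pw_def pw1_def pL_def)
  have J3: "((\<lambda>t. pw1 ?P6 t0 t * B0.b00 ?p t + pw ?P6 t0 t * (2 * B0.b01 ?p t)) has_integral
      pw ?P6 t0 (t0 + 9/2) * B0.b00 ?p (t0 + 9/2) - pw ?P6 t0 (t0 - 9/2) * B0.b00 ?p (t0 - 9/2)) Iv"
  proof (rule fundamental_theorem_of_calculus)
    fix t assume "t \<in> Iv"
    from DERIV_mult[OF pw_deriv[of ?P6 t0 t] B0.b_derivs(1)[OF p Iv_sub[OF this]]]
    have "((\<lambda>t. pw ?P6 t0 t * B0.b00 ?p t) has_real_derivative pw1 ?P6 t0 t * B0.b00 ?p t + pw ?P6 t0 t * (2 * B0.b01 ?p t)) (at t)"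
      by (simp add: mult.commute add.commute)
    then show "((\<lambda>t. pw ?P6 t0 t * B0.b00 ?p t) has_vector_derivative pw1 ?P6 t0 t * B0.b00 ?p t + pw ?P6 t0 t * (2 * B0.b01 ?p t)) (at t within Iv)"
      by (simp add: has_real_derivative_iff_has_vector_derivative has_vector_derivative_at_within)
  qed simp
  have pP: "B0 ?p (Pf u) t = B0.b02 ?p t - 2 * B0.b01 ?p t - B0.s00 ?p t" if t: "t \<in> {a<..<b}" for t
  proof -
    have s1: "smooth_on (shell a b) (\<lambda>x. 1 * Df (Df ?p) x + (-2) * Df ?p x)"
      by (intro smooth_on_add smooth_on_mult open_shell smooth_on_const s p)
    have "B0 ?p (Pf u) t = B0 ?p (\<lambda>x. 1 * (\<lambda>x. 1 * Df (Df ?p) x + (-2) * Df ?p x) x + (-1) * Sf ?p x) t"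
      by (rule B0.B_cong2[OF _ t]) (simp add: Pf_factor[OF u, symmetric])
    also have "\<dots> = B0.b02 ?p t - 2 * B0.b01 ?p t - B0.s00 ?p t"
      unfolding B0.B_lin2[OF s1 s(2)[OF p] p t] B0.B_lin2[OF s(1)[OF s(1)[OF p]] s(1)[OF p] p t]
      by (simp add: B0.b02_def[OF p] B0.b01_def[OF p] B0.s00_def[OF p])
    finally show ?thesis .
  qed
  note c = B0.b_cont[OF u ab] and cp = B0.b_cont[OF p ab]
  have zc: "continuous_on Iv ?z" unfolding zt_def[abs_def] by (intro continuous_intros)
  have cpP: "continuous_on Iv (B0 ?p (Pf u))"
    using Iv_sub by (intro continuous_at_imp_continuous_on ballI DERIV_isCont[OF B0_deriv[OF p smooth_Pf[OF u]]])
  have i1: "((\<lambda>t. ?z t ^ 6 * B0 ?p (Pf u) t) has_integral integral Iv (\<lambda>t. ?z t ^ 6 * B0 ?p (Pf u) t)) Iv"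
    by (intro integrable_integral integrable_continuous_real continuous_intros zc cpP)
  have i2: "((\<lambda>t. ?z t ^ 4 * dens u t) has_integral integral Iv (\<lambda>t. ?z t ^ 4 * dens u t)) Iv"
    unfolding dens_def by (intro integrable_integral integrable_continuous_real continuous_intros zc c)
  have i3: "((\<lambda>t. ?z t ^ 6 * (B0.b11 ?p t + B0.s00 ?p t)) has_integral integral Iv (\<lambda>t. ?z t ^ 6 * (B0.b11 ?p t + B0.s00 ?p t))) Iv"
    by (intro integrable_integral integrable_continuous_real continuous_intros zc cp)
  have main: "((\<lambda>t. 72 * (?z t ^ 4 * dens u t) - ?z t ^ 6 * B0 ?p (Pf u) t
     + (pw ?P6 t0 t * B0.b02 ?p t + pw ?P6 t0 t * B0.b11 ?p t - pw (pL ?P6) t0 t / 2 * B0.b00 ?p t)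
     - (pw1 ?P6 t0 t * B0.b00 ?p t + pw ?P6 t0 t * (2 * B0.b01 ?p t))) has_integral
     72 * integral Iv (\<lambda>t. ?z t ^ 4 * dens u t) - integral Iv (\<lambda>t. ?z t ^ 6 * B0 ?p (Pf u) t) + 0 - 0) Iv"
    using J3 by (intro has_integral_add has_integral_diff has_integral_mult_right i1 i2 J2) (simp add: pw_def)
  have "integral Iv (\<lambda>t. ?z t ^ 6 * (B0.b11 ?p t + B0.s00 ?p t))
     \<le> 72 * integral Iv (\<lambda>t. ?z t ^ 4 * dens u t) - integral Iv (\<lambda>t. ?z t ^ 6 * B0 ?p (Pf u) t) + 0 - 0"
  proof (rule has_integral_le[OF i3 main])
    fix t assume t: "t \<in> Iv"
    note tt = Iv_sub[OF t]
    define z where "z = ?z t"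
    have z: "0 \<le> z" "z \<le> 1" using zt_bounds[OF t] unfolding z_def by auto
    have p6: "pw ?P6 t0 t = z^6" unfolding pw_def z_def[symmetric] by (simp add: eval_nat_numeral)
    have z54: "0 \<le> z^5" "z^5 \<le> z^4" using z by (auto intro: power_decreasing)
    have p62: "pw (pL ?P6) t0 t \<le> 6 * z^4"
    proof -
      have "pw (pL ?P6) t0 t = 480/81 * z^4 - 528/81 * z^5"
        unfolding pw_def z_def[symmetric] pL_def by (simp add: eval_nat_numeral field_simps)
      then show ?thesis using z54 zero_le_power[OF z(1), of 4] by linarith
    qed
    have p61: "pw1 ?P6 t0 t \<le> 3 * z^4"
    proof -
      have d: "-8/81 * d \<le> 4/9" if "-(9/2) \<le> d" for d :: real using that by simp
      have "-8/81 * (t - t0) \<le> 4/9" by (rule d) (use t in auto)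
      then have "6 * z^5 * (-8/81 * (t - t0)) \<le> 6 * z^5 * (4/9)" using z54 by (intro mult_left_mono) auto
      moreover have e: "pw1 ?P6 t0 t = 6 * z^5 * (-8/81 * (t - t0))"
        unfolding pw1_def z_def[symmetric] by (simp add: eval_nat_numeral)
      ultimately have "pw1 ?P6 t0 t \<le> 6 * z^5 * (4/9)" by (simp only:)
      then show ?thesis using z54 by linarith
    qed
    \<comment> \<open>The cutoff z^6 contributes at most 3 z^4 through its second derivative and 3
      z^4 through its first; with the 12 of \<open>pf_square\<close> this makes 72.\<close>
    have "pw (pL ?P6) t0 t / 2 * B0.b00 ?p t + pw1 ?P6 t0 t * B0.b00 ?p t \<le> 3 * z^4 * B0.b00 ?p t + 3 * z^4 * B0.b00 ?p t"
      using p62 p61 B0_energy_nonneg(1)[OF p tt] by (intro add_mono mult_right_mono) auto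
    also have "\<dots> = 6 * z^4 * B0.b00 ?p t" by simp
    also have "\<dots> \<le> 6 * z^4 * (12 * dens u t)"
      using pf_square[OF u tt] z by (intro mult_left_mono) auto
    finally show "?z t ^ 6 * (B0.b11 ?p t + B0.s00 ?p t) \<le> 72 * (?z t ^ 4 * dens u t) - ?z t ^ 6 * B0 ?p (Pf u) t
     + (pw ?P6 t0 t * B0.b02 ?p t + pw ?P6 t0 t * B0.b11 ?p t - pw (pL ?P6) t0 t / 2 * B0.b00 ?p t)
     - (pw1 ?P6 t0 t * B0.b00 ?p t + pw ?P6 t0 t * (2 * B0.b01 ?p t))"
      unfolding pP[OF tt] p6 z_def[symmetric] by (simp add: algebra_simps)
  qed
  then show ?thesis by simp
qed

end

section \<open>The high modes\<close>

lemma sm_mono_sphere: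
  assumes "smooth_on (shell a b) f" "smooth_on (shell a b) g" "t \<in> {a<..<b}" "\<And>x. norm x = exp t \<Longrightarrow> f x \<le> g x"
  shows "sm f t \<le> sm g t"
  unfolding sm_def using assms by (intro sint_mono shell_cont) auto

lemma sm_coord: "sm (\<lambda>x. x$j) t = 0"
  unfolding sm_def by (rule sint_odd) (auto intro!: continuous_intros)

text \<open>S = 3 on the first mode, so projecting it out removes 24 times the sum of squares on the
  left and 12 times on the right; the 12 in \<open>gap\<close> makes up the difference.\<close>

lemma gap_B1:
  assumes f: "smooth_on (shell a b) f" and t: "t \<in> {a<..<b}" and z: "sm f t = 0"
  shows "6 * B1 f f t \<le> B1 f (Sf f) t"
proof -
  have "6 * B0 f f t - 12 * (\<Sum>j\<in>UNIV. (cm f j t)\<^sup>2) \<le> B0 f (Sf f) t"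
    using gap[OF t f z] unfolding B0_S[OF f f t] unfolding en_def[OF t] ip_def[OF t] B0_def cm_eq_cmp[OF t] by simp
  moreover have "(\<Sum>j\<in>UNIV. cm f j t * (3 * cm f j t)) = 3 * (\<Sum>j\<in>UNIV. (cm f j t)\<^sup>2)"
    "(\<Sum>j\<in>UNIV. cm f j t * cm f j t) = (\<Sum>j\<in>UNIV. (cm f j t)\<^sup>2)"
    by (simp_all add: power2_eq_square sum_distrib_left mult_ac)
  ultimately show ?thesis
    unfolding B1_def cm_S[OF f t] by (simp add: algebra_simps)
qed

text \<open>The derivative is taken within the closed interval, so that the two ends, beyond which
  the mean is unknown, are included.\<close>

lemma sm_D_zero:
  assumes f: "smooth_on (shell a b) f" and lr: "a < l" "l < r" "r < b" and z: "\<And>t. t \<in> {l..r} \<Longrightarrow> sm f t = 0"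
    and t: "t \<in> {l..r}"
  shows "sm (Df f) t = 0"
proof -
  have "t \<in> {a<..<b}" using t lr by auto
  from sm_deriv[OF f this] have 1: "(sm f has_vector_derivative sm (Df f) t) (at t within {l..r})"
    by (simp add: has_real_derivative_iff_has_vector_derivative has_vector_derivative_at_within)
  have 2: "(sm f has_vector_derivative 0) (at t within {l..r})"
    by (rule has_vector_derivative_transform[OF t _ has_vector_derivative_const[of 0]]) (rule z)
  show ?thesis
    using vector_derivative_unique_within_closed_interval[of l r t "sm f"] 1 2 lr t by simp
qed

text \<open>After multiplication by 4 \<phi> the cross terms in k and s0 are completed to squares,
  which costs \<beta>^2 e0 and m^2 e0.\<close>

lemma quadratic_combine:
  fixes \<phi> \<beta> m M w e0 e2 k s0 S :: real
  assumes p: "0 < \<phi>" and d: "\<beta>\<^sup>2 + m\<^sup>2 \<le> 4 * \<phi> * (M + w)"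
    and q: "0 \<le> (2 * \<phi>)\<^sup>2 * e2 + 2 * (2 * \<phi>) * \<beta> * k + \<beta>\<^sup>2 * e0"
      "0 \<le> (2 * \<phi>)\<^sup>2 * S + 2 * (2 * \<phi>) * (- m) * s0 + (- m)\<^sup>2 * e0" and e: "0 \<le> e0"
  shows "0 \<le> \<phi> * e2 + \<beta> * k + \<phi> * S - m * s0 + (M + w) * e0"
proof -
  have "(\<beta>\<^sup>2 + m\<^sup>2) * e0 \<le> 4 * \<phi> * (M + w) * e0" by (rule mult_right_mono[OF d e])
  then have "0 \<le> 4 * \<phi> * (\<phi> * e2 + \<beta> * k + \<phi> * S - m * s0 + (M + w) * e0)"
    using q by (simp add: power2_eq_square algebra_simps)
  then show ?thesis using p by (simp add: zero_le_mult_iff)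
qed

text \<open>The energy identity with weight \<open>phL\<close> and the null identity with weight
  \<open>beL\<close> are combined such that the integrand dominates 43 times \<open>b00\<close> on
  the middle annulus minus \<open>b00\<close> pointwise. The gap enters through \<open>s00\<close>
  \<ge> 6 \<open>b00\<close> and \<open>s11\<close> \<ge> 6 \<open>b11\<close>.\<close>

lemma high_modes:
  assumes ab: "a < t0 - 9/2" "t0 + 9/2 < b" and u: "smooth_on (shell a b) u" and m0: "\<And>t. t \<in> Iv t0 \<Longrightarrow> sm u t = 0"
  shows "43 * integral {t0 - 3/2..t0 + 3/2} (B1.b00 u) - integral (Iv t0) (B1.b00 u)
    \<le> integral (Iv t0) (\<lambda>t. pw phL t0 t * B1.uP u t)"
proof -
  let ?in = "{t0 - 3/2..t0 + 3/2}"
  let ?J1 = "\<lambda>t. pw phL t0 t * B1.uP u t - (pw phL t0 t * (B1.b22 u t + 2 * B1.s11 u t + B1.S2 u t + 4 * B1.b11 u t)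
     - 2 * pw (pL phL) t0 t * B1.b11 u t - pw (pL phL) t0 t * B1.s00 u t
     + (pw (pL (pL phL)) t0 t / 2 - 2 * pw (pL phL) t0 t) * B1.b00 u t)"
  let ?J2 = "\<lambda>t. pw beL t0 t * B1.b02 u t + pw beL t0 t * B1.b11 u t - pw (pL beL) t0 t / 2 * B1.b00 u t"
  have J1: "(?J1 has_integral 0) (Iv t0)"
    by (rule B1.form_identity[OF u ab(1) _ ab(2) pw_deriv pw1_deriv pw_deriv pw1_deriv])
       (simp_all add: pw_def pw1_def pL_def phL_def)
  have J2: "(?J2 has_integral 0) (Iv t0)"
    by (rule B1.null_identity[OF u ab(1) _ ab(2) pw_deriv pw1_deriv])
       (simp_all add: pw_def pw1_def pL_def beL_def)
  note c = B1.b_cont[OF u ab]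
  have cin: "continuous_on ?in (B1.b00 u)" by (rule continuous_on_subset[OF c(1)]) auto
  have i1: "((\<lambda>t. pw phL t0 t * B1.uP u t) has_integral integral (Iv t0) (\<lambda>t. pw phL t0 t * B1.uP u t)) (Iv t0)"
    by (intro integrable_integral integrable_continuous_real continuous_intros pw_cont c)
  have i2: "(B1.b00 u has_integral integral (Iv t0) (B1.b00 u)) (Iv t0)"
    by (intro integrable_integral integrable_continuous_real c)
  have "(B1.b00 u has_integral integral ?in (B1.b00 u)) ?in"
    by (intro integrable_integral integrable_continuous_real cin)
  then have i3: "((\<lambda>t. if t \<in> ?in then B1.b00 u t else 0) has_integral integral ?in (B1.b00 u)) (Iv t0)"
    by (subst has_integral_restrict) auto
  have L: "((\<lambda>t. 43 * (if t \<in> ?in then B1.b00 u t else 0) - B1.b00 u t) has_integral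
      43 * integral ?in (B1.b00 u) - integral (Iv t0) (B1.b00 u)) (Iv t0)"
    by (intro has_integral_diff has_integral_mult_right i2 i3)
  have "((\<lambda>t. pw phL t0 t * B1.uP u t - ?J1 t + ?J2 t) has_integral
      integral (Iv t0) (\<lambda>t. pw phL t0 t * B1.uP u t) - 0 + 0) (Iv t0)"
    by (intro has_integral_add has_integral_diff i1 J1 J2)
  then have R: "((\<lambda>t. pw phL t0 t * B1.uP u t - ?J1 t + ?J2 t) has_integral
      integral (Iv t0) (\<lambda>t. pw phL t0 t * B1.uP u t)) (Iv t0)" by simp
  show ?thesis
  proof (rule has_integral_le[OF L R])
    fix t assume t: "t \<in> Iv t0"
    note tt = Iv_sub[OF ab t]
    define z where "z = zt t0 t"
    have z: "0 \<le> z" "z \<le> 1" using zt_bounds[OF t] unfolding z_def by auto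
    \<comment> \<open>Minus the weight that the claim puts on \<open>b00\<close>: 42 on the middle
      annulus, -1 outside.\<close>
    define w :: real where "w = (if t \<in> ?in then -42 else 1)"
    have zw: "t \<in> ?in \<and> 8/9 \<le> z \<or> t \<notin> ?in \<and> z \<le> 8/9"
    proof (cases "t \<in> ?in")
      case True
      then have "\<bar>t - t0\<bar> \<le> 3/2" by (intro abs_leI) auto
      then have "(t - t0)\<^sup>2 \<le> (3/2)\<^sup>2" by (metis abs_ge_zero power2_abs power_mono)
      then show ?thesis using True unfolding z_def zt_def by (simp add: power2_eq_square)
    next
      case False
      then have "3/2 \<le> \<bar>t - t0\<bar>" by auto
      then have "(3/2)\<^sup>2 \<le> \<bar>t - t0\<bar>\<^sup>2" by (rule power_mono) simp
      then show ?thesis using False unfolding z_def zt_def by (simp add: power2_eq_square)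
    qed
    define \<phi> where "\<phi> = peval phL z"
    define \<phi>2 where "\<phi>2 = peval (pL phL) z"
    define \<phi>4 where "\<phi>4 = peval (pL (pL phL)) z"
    define \<beta> where "\<beta> = peval beL z"
    define \<beta>2 where "\<beta>2 = peval (pL beL) z"
    define la where "la = peval laL z"
    have w: "\<beta>\<^sup>2 + (\<phi>2 + la)\<^sup>2 \<le> 4 * \<phi> * (\<phi>4 / 2 - 2 * \<phi>2 - \<beta>2 / 2 + 6 * la + w)"
      using zw
    proof
      assume h: "t \<in> ?in \<and> 8/9 \<le> z"
      then have "w = -42" by (simp add: w_def)
      with zero_coeff_inner[OF conjunct2[OF h] z(2)] show ?thesis
        unfolding \<phi>_def \<phi>2_def \<phi>4_def \<beta>_def \<beta>2_def la_def by simp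
    next
      assume h: "t \<notin> ?in \<and> z \<le> 8/9"
      then have "w = 1" unfolding w_def by argo
      with zero_coeff_outer[OF z(1) conjunct2[OF h]] show ?thesis
        unfolding \<phi>_def \<phi>2_def \<phi>4_def \<beta>_def \<beta>2_def la_def by simp
    qed
    define e0 where "e0 = B1.b00 u t"
    define e1 where "e1 = B1.b11 u t"
    define e2 where "e2 = B1.b22 u t"
    define k where "k = B1.b02 u t"
    define s0 where "s0 = B1.s00 u t"
    define s1 where "s1 = B1.s11 u t"
    define S where "S = B1.S2 u t"
    note s = smooth_Xf[OF open_shell] smooth_Sf[OF open_shell]
    have e0: "0 \<le> e0" "0 \<le> e1"
      unfolding e0_def e1_def B1.b00_def[OF u] B1.b11_def[OF u] by (intro B1.B_pos[OF _ tt] s u)+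
    have g0: "6 * e0 \<le> s0"
      unfolding e0_def s0_def B1.b00_def[OF u] B1.s00_def[OF u] by (rule gap_B1[OF u tt m0[OF t]])
    have g1: "6 * e1 \<le> s1"
      unfolding e1_def s1_def B1.b11_def[OF u] B1.s11_def[OF u]
      by (rule gap_B1[OF s(1)[OF u] tt sm_D_zero[OF u ab(1) _ ab(2) m0 t]]) auto
    have \<phi>0: "0 \<le> \<phi>" using phL_bound[OF z] z unfolding \<phi>_def
      by (meson divide_nonneg_nonneg order_trans zero_le_numeral zero_le_power)
    have Q: "0 \<le> \<phi> * e2 + \<beta> * k + \<phi> * S - (\<phi>2 + la) * s0 + (\<phi>4 / 2 - 2 * \<phi>2 - \<beta>2 / 2 + 6 * la + w) * e0"
    proof (cases "\<phi> = 0")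
      \<comment> \<open>Only the ends z = 0 fall here; all weights vanish there and w = 1.\<close>
      case True
      then have "z^5 \<le> 0" using phL_bound[OF z] unfolding \<phi>_def by simp
      then have "z^5 = 0" using z by (simp add: order_antisym)
      then have z0: "z = 0" by simp
      then have "w = 1" using zw unfolding w_def by auto
      moreover have "\<phi>2 = 0" "\<phi>4 = 0" "\<beta> = 0" "\<beta>2 = 0" "la = 0"
        unfolding \<phi>2_def \<phi>4_def \<beta>_def \<beta>2_def la_def z0 by (simp_all add: pL_def phL_def beL_def laL_def)
      ultimately show ?thesis using True e0 by simp
    next
      case False
      show ?thesis
      proof (rule quadratic_combine[OF _ w])
        show "0 < \<phi>" using False \<phi>0 by simp
        show "0 \<le> (2 * \<phi>)\<^sup>2 * e2 + 2 * (2 * \<phi>) * \<beta> * k + \<beta>\<^sup>2 * e0"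
          using B1.B_quad[OF s(1)[OF s(1)[OF u]] u tt, of "2 * \<phi>" "qb 1" "qb 1" \<beta>]
          unfolding e2_def k_def e0_def B1.b22_def[OF u] B1.b02_def[OF u] B1.b00_def[OF u]
          by (simp add: B1.B_sym[of "Df (Df u)" u])
        show "0 \<le> (2 * \<phi>)\<^sup>2 * S + 2 * (2 * \<phi>) * (- (\<phi>2 + la)) * s0 + (- (\<phi>2 + la))\<^sup>2 * e0"
          using B1.B_quad[OF s(2)[OF u] u tt, of "2 * \<phi>" "- (\<phi>2 + la)"]
          unfolding S_def s0_def e0_def B1.S2_def[OF u] B1.s00_def[OF u] B1.b00_def[OF u]
          by (simp only: B1.B_sym[of "Sf u" u])
      qed (rule e0)
    qed
    have q1: "0 \<le> la * (s0 - 6 * e0)"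
      using laL_nonneg[OF z] g0 unfolding la_def by simp
    have q2: "0 \<le> 2 * \<phi> * (s1 - 6 * e1)" using \<phi>0 g1 by simp
    have q3: "0 \<le> (16 * \<phi> - 2 * \<phi>2 + \<beta>) * e1"
      using grad_coeff_nonneg[OF z] e0 unfolding \<phi>_def \<phi>2_def \<beta>_def by simp
    have eq: "\<phi> * (e2 + 2 * s1 + S + 4 * e1) - 2 * \<phi>2 * e1 - \<phi>2 * s0 + (\<phi>4 / 2 - 2 * \<phi>2) * e0
        + (\<beta> * k + \<beta> * e1 - \<beta>2 / 2 * e0) + w * e0
      = (\<phi> * e2 + \<beta> * k + \<phi> * S - (\<phi>2 + la) * s0 + (\<phi>4 / 2 - 2 * \<phi>2 - \<beta>2 / 2 + 6 * la + w) * e0)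
        + la * (s0 - 6 * e0) + 2 * \<phi> * (s1 - 6 * e1) + (16 * \<phi> - 2 * \<phi>2 + \<beta>) * e1"
      by (simp add: field_simps)
    have "0 \<le> \<phi> * (e2 + 2 * s1 + S + 4 * e1) - 2 * \<phi>2 * e1 - \<phi>2 * s0 + (\<phi>4 / 2 - 2 * \<phi>2) * e0
        + (\<beta> * k + \<beta> * e1 - \<beta>2 / 2 * e0) + w * e0"
      unfolding eq by (intro add_nonneg_nonneg Q q1 q2 q3)
    moreover have "43 * (if t \<in> ?in then e0 else 0) - e0 = - w * e0"
      unfolding w_def by simp
    ultimately show "43 * (if t \<in> ?in then B1.b00 u t else 0) - B1.b00 u t \<le> pw phL t0 t * B1.uP u t - ?J1 t + ?J2 t"
      unfolding pw_def z_def[symmetric] e0_def[symmetric] e1_def[symmetric] e2_def[symmetric] k_def[symmetric]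
        s0_def[symmetric] s1_def[symmetric] S_def[symmetric] \<phi>_def[symmetric] \<phi>2_def[symmetric] \<phi>4_def[symmetric]
        \<beta>_def[symmetric] \<beta>2_def[symmetric] by linarith
  qed
qed

text \<open>A scale invariant bound for all local terms of the equation. Third derivatives enter
  only through the gradient of \<open>pf u\<close>, which matches the term with the gradient of the
  Laplacian.\<close>

definition rho :: "(real^4 \<Rightarrow> real) \<Rightarrow> real^4 \<Rightarrow> real" where
  "rho u x = (\<Sum>k\<in>UNIV. (Xf (qb k) (pf u) x)\<^sup>2) + (pf u x)\<^sup>2
     + (\<Sum>j\<in>UNIV. \<Sum>k\<in>UNIV. (Xf (qb j) (Xf (qb k) u) x)\<^sup>2) + (\<Sum>k\<in>UNIV. (Xf (qb k) u x)\<^sup>2) + (u x)\<^sup>2"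

lemma smooth_sq:
  fixes f :: "real^4 \<Rightarrow> real"
  shows "smooth_on (shell a b) f \<Longrightarrow> smooth_on (shell a b) (\<lambda>x. (f x)\<^sup>2)"
  unfolding power2_eq_square by (rule smooth_on_mult[OF open_shell])

lemma smooth_rho: "smooth_on (shell a b) u \<Longrightarrow> smooth_on (shell a b) (rho u)"
  unfolding rho_def[abs_def]
  by (intro smooth_on_add smooth_on_sum open_shell smooth_sq smooth_Xf smooth_pf)

lemma B0_sum_Xf:
  assumes f: "smooth_on (shell a b) f" and t: "t \<in> {a<..<b}"
  shows "(\<Sum>k\<in>UNIV. B0 (Xf (qb k) f) (Xf (qb k) f) t) = B0 (Df f) (Df f) t + B0 f (Sf f) t"
  unfolding sum_4 B0_S[OF f f t] by simp

text \<open>The fields commute with D and S, so the sum of all squared second frame derivatives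
  integrates to the squared norm of (D^2 + S) type terms: \<open>b22\<close> + 2 \<open>s11\<close>
  + \<open>S2\<close>.\<close>

lemma rho_sm:
  assumes u: "smooth_on (shell a b) u" and t: "t \<in> {a<..<b}"
  shows "sm (rho u) t = (B0.b11 (pf u) t + B0.s00 (pf u) t) + B0.b00 (pf u) t
    + (B0.b22 u t + 2 * B0.s11 u t + B0.S2 u t) + (B0.b11 u t + B0.s00 u t) + B0.b00 u t"
proof -
  note s = smooth_Xf[OF open_shell] smooth_Sf[OF open_shell]
  note p = smooth_pf[OF u]
  have sq: "sm (\<lambda>x. (f x)\<^sup>2) t = B0 f f t" for f :: "real^4 \<Rightarrow> real"
    unfolding B0_def power2_eq_square ..
  let ?A = "\<lambda>x. \<Sum>k\<in>UNIV. (Xf (qb k) (pf u) x)\<^sup>2" and ?B = "\<lambda>x. (pf u x)\<^sup>2"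
    and ?C = "\<lambda>x. \<Sum>j\<in>UNIV. \<Sum>k\<in>UNIV. (Xf (qb j) (Xf (qb k) u) x)\<^sup>2" and ?D = "\<lambda>x. \<Sum>k\<in>UNIV. (Xf (qb k) u x)\<^sup>2"
    and ?E = "\<lambda>x. (u x)\<^sup>2"
  have A: "smooth_on (shell a b) ?A" and B: "smooth_on (shell a b) ?B" and C: "smooth_on (shell a b) ?C"
    and D: "smooth_on (shell a b) ?D" and E: "smooth_on (shell a b) ?E"
    by (intro smooth_on_sum open_shell smooth_sq s p u)+
  note AB = smooth_on_add[OF open_shell A B]
  note ABC = smooth_on_add[OF open_shell AB C]
  note ABCD = smooth_on_add[OF open_shell ABC D]
  have 1: "sm (rho u) t = sm ?A t + sm ?B t + sm ?C t + sm ?D t + sm ?E t"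
    unfolding rho_def[abs_def] sm_add[OF ABCD E t] sm_add[OF ABC D t] sm_add[OF AB C t] sm_add[OF A B t] ..
  have "sm ?A t = (\<Sum>k\<in>UNIV. B0 (Xf (qb k) (pf u)) (Xf (qb k) (pf u)) t)"
    unfolding sq[symmetric] by (rule sm_sum[OF _ t]) (intro smooth_sq s p)
  then have a: "sm ?A t = B0.b11 (pf u) t + B0.s00 (pf u) t"
    unfolding B0_sum_Xf[OF p t] B0.b11_def[OF p] B0.s00_def[OF p] .
  have "sm ?D t = (\<Sum>k\<in>UNIV. B0 (Xf (qb k) (u)) (Xf (qb k) (u)) t)"
    unfolding sq[symmetric] by (rule sm_sum[OF _ t]) (intro smooth_sq s u)
  then have d: "sm ?D t = B0.b11 (u) t + B0.s00 (u) t"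
    unfolding B0_sum_Xf[OF u t] B0.b11_def[OF u] B0.s00_def[OF u] .
  have "sm ?C t = (\<Sum>j\<in>UNIV. \<Sum>k\<in>UNIV. B0 (Xf (qb j) (Xf (qb k) u)) (Xf (qb j) (Xf (qb k) u)) t)"
    unfolding sq[symmetric]
    by (subst sm_sum[OF _ t], intro smooth_on_sum open_shell smooth_sq s u,
        rule sum.cong[OF refl], rule sm_sum[OF _ t], intro smooth_sq s u)
  also have "\<dots> = (\<Sum>k\<in>UNIV. \<Sum>j\<in>UNIV. B0 (Xf (qb j) (Xf (qb k) u)) (Xf (qb j) (Xf (qb k) u)) t)"
    by (rule sum.swap)
  also have "\<dots> = (\<Sum>k\<in>UNIV. B0 (Xf (qb k) (Df u)) (Xf (qb k) (Df u)) t + B0 (Xf (qb k) u) (Xf (qb k) (Sf u)) t)"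
  proof (rule sum.cong[OF refl])
    fix k :: 4
    have c: "Df (Xf (qb k) u) x = Xf (qb k) (Df u) x" "Sf (Xf (qb k) u) x = Xf (qb k) (Sf u) x" if "x \<in> shell a b" for x
      using D_X_commute[OF open_shell u that] X_S_commute[OF open_shell u that] by simp_all
    have "(\<Sum>j\<in>UNIV. B0 (Xf (qb j) (Xf (qb k) u)) (Xf (qb j) (Xf (qb k) u)) t)
      = B0 (Df (Xf (qb k) u)) (Df (Xf (qb k) u)) t + B0 (Xf (qb k) u) (Sf (Xf (qb k) u)) t"
      by (rule B0_sum_Xf[OF s(1)[OF u] t])
    also have "B0 (Df (Xf (qb k) u)) (Df (Xf (qb k) u)) t = B0 (Xf (qb k) (Df u)) (Xf (qb k) (Df u)) t"
      unfolding B0_def by (rule sm_cong[OF _ t]) (simp add: c)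
    also have "B0 (Xf (qb k) u) (Sf (Xf (qb k) u)) t = B0 (Xf (qb k) u) (Xf (qb k) (Sf u)) t"
      unfolding B0_def by (rule sm_cong[OF _ t]) (simp add: c)
    finally show "(\<Sum>j\<in>UNIV. B0 (Xf (qb j) (Xf (qb k) u)) (Xf (qb j) (Xf (qb k) u)) t)
      = B0 (Xf (qb k) (Df u)) (Xf (qb k) (Df u)) t + B0 (Xf (qb k) u) (Xf (qb k) (Sf u)) t" .
  qed
  also have "\<dots> = (\<Sum>k\<in>UNIV. B0 (Xf (qb k) (Df u)) (Xf (qb k) (Df u)) t) + (\<Sum>k\<in>UNIV. B0 (Xf (qb k) u) (Xf (qb k) (Sf u)) t)"
    by (rule sum.distrib)
  also have "(\<Sum>k\<in>UNIV. B0 (Xf (qb k) (Df u)) (Xf (qb k) (Df u)) t) = B0.b22 u t + B0.s11 u t"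
    unfolding B0_sum_Xf[OF s(1)[OF u] t] B0.b22_def[OF u] B0.s11_def[OF u] ..
  also have "(\<Sum>k\<in>UNIV. B0 (Xf (qb k) u) (Xf (qb k) (Sf u)) t) = B0 (Df u) (Df (Sf u)) t + B0 u (Sf (Sf u)) t"
    unfolding sum_4 B0_S[OF u s(2)[OF u] t] by simp
  also have "B0 (Df u) (Df (Sf u)) t = B0.s11 u t"
    unfolding B0.s11_def[OF u] B0_def
    by (rule sm_cong[OF _ t]) (simp add: X_S_commute[OF open_shell u])
  also have "B0 u (Sf (Sf u)) t = B0.S2 u t"
    unfolding B0.S2_def[OF u] by (rule B0_S_sym[OF u s(2)[OF u] t, symmetric])
  finally have c: "sm ?C t = B0.b22 u t + 2 * B0.s11 u t + B0.S2 u t" by simp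
  show ?thesis unfolding 1 a c d sq B0.b00_def[OF p] B0.b00_def[OF u] by simp
qed

lemma rho_bound:
  assumes u: "smooth_on (shell a b) u" and t: "t \<in> {a<..<b}"
  shows "sm (rho u) t \<le> (B0.b11 (pf u) t + B0.s00 (pf u) t) + 15 * dens u t + 2 * B0.b00 u t"
proof -
  have "0 \<le> 1\<^sup>2 * B0 (Sf u) (Sf u) t + 2 * 1 * (-1) * B0 (Sf u) u t + (-1)\<^sup>2 * B0 u u t"
    by (rule B0.B_quad[OF smooth_Sf[OF open_shell u] u t])
  then have "2 * B0.s00 u t \<le> B0.S2 u t + B0.b00 u t"
    unfolding B0.S2_def[OF u] B0.s00_def[OF u] B0.b00_def[OF u] by (simp add: B0.B_sym[of "Sf u" u])
  then show ?thesis
    using pf_square[OF u t] B0_energy_nonneg[OF u t] unfolding rho_sm[OF u t] dens_def by simp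
qed

section \<open>The three annuli inequality\<close>

lemma integral_sum_continuous:
  fixes f :: "'k::finite \<Rightarrow> real \<Rightarrow> real"
  assumes "\<And>i. continuous_on {l..r} (f i)"
  shows "integral {l..r} (\<lambda>t. \<Sum>i\<in>UNIV. f i t) = (\<Sum>i\<in>UNIV. integral {l..r} (f i))"
  by (rule integral_sum) (auto intro: integrable_continuous_real assms)

lemma integral_mono_continuous:
  fixes f g :: "real \<Rightarrow> real"
  assumes "continuous_on {l..r} f" "continuous_on {l..r} g" "\<And>t. t \<in> {l..r} \<Longrightarrow> f t \<le> g t"
  shows "integral {l..r} f \<le> integral {l..r} g"
  using assms by (intro integral_le integrable_continuous_real)

lemma integral_nonneg_subset:
  fixes f :: "real \<Rightarrow> real"
  assumes "continuous_on {l..r} f" "l \<le> l'" "r' \<le> r" "\<And>t. t \<in> {l..r} \<Longrightarrow> 0 \<le> f t"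
  shows "integral {l'..r'} f \<le> integral {l..r} f"
  using assms by (intro integral_subset_le integrable_continuous_real)
    (auto intro: continuous_on_subset)

lemma weighted_young:
  fixes c d h g s :: real assumes "0 < s"
  shows "c * d * (h * g) \<le> s / 2 * d\<^sup>2 * (h * h) + c\<^sup>2 / (2 * s) * g\<^sup>2"
proof -
  have "0 \<le> (s * d * h - c * g)\<^sup>2 / (2 * s)" using assms by simp
  also have "\<dots> = s / 2 * d\<^sup>2 * (h * h) + c\<^sup>2 / (2 * s) * g\<^sup>2 - c * d * (h * g)"
    using assms by (simp add: power2_eq_square field_simps)
  finally show ?thesis by simp
qed

text \<open>Constants are orthogonal to the coordinates, so the spherical mean terms do not reach
  the first mode.\<close>

lemma cm_add_const:
  assumes f: "smooth_on (shell a b) f" and t: "t \<in> {a<..<b}"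
  shows "cm (\<lambda>x. f x - m) j t = cm f j t"
proof -
  have "cm (\<lambda>x. 1 * f x + (- m) * 1) j t = 1 * cm f j t + (- m) * cm (\<lambda>x. 1) j t"
    by (rule cm_lin[OF f smooth_on_const t])
  then show ?thesis by (simp add: cm_def[of "\<lambda>x. 1"] sm_coord)
qed

text \<open>S = 3 in \<open>Pf\<close>: -2 * 3 - 4 = -10 and 3^2 = 9.\<close>

lemma cm_Pf:
  assumes u: "smooth_on (shell a b) u" and t: "t \<in> {a<..<b}"
  shows "cm (Pf u) j t = cm (Df (Df (Df (Df u)))) j t - 10 * cm (Df (Df u)) j t + 9 * cm u j t"
proof -
  let ?D4 = "Df (Df (Df (Df u)))" and ?SD = "Sf (Df (Df u))" and ?SS = "Sf (Sf u)" and ?D2 = "Df (Df u)"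
  note s = smooth_Xf[OF open_shell] smooth_Sf[OF open_shell]
  have 1: "smooth_on (shell a b) (\<lambda>x. 1 * ?D4 x + (-2) * ?SD x)" "smooth_on (shell a b) (\<lambda>x. 1 * ?SS x + (-4) * ?D2 x)"
    by (intro smooth_on_add smooth_on_mult open_shell smooth_on_const s u)+
  have "Pf u = (\<lambda>x. 1 * (\<lambda>x. 1 * ?D4 x + (-2) * ?SD x) x + 1 * (\<lambda>x. 1 * ?SS x + (-4) * ?D2 x) x)"
    by (auto simp: Pf_def)
  then have "cm (Pf u) j t = 1 * cm (\<lambda>x. 1 * ?D4 x + (-2) * ?SD x) j t + 1 * cm (\<lambda>x. 1 * ?SS x + (-4) * ?D2 x) j t"
    by (simp only: cm_lin[OF 1 t])
  also have "\<dots> = 1 * (1 * cm ?D4 j t + (-2) * cm ?SD j t) + 1 * (1 * cm ?SS j t + (-4) * cm ?D2 j t)"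
    by (subst (1 2) cm_lin[OF _ _ t]; intro s u refl)
  finally show ?thesis
    by (simp add: cm_S[OF s(1)[OF s(1)[OF u]] t] cm_S[OF s(2)[OF u] t] cm_S[OF u t])
qed

text \<open>Adding the middle integral to both sides of \<open>first_mode\<close> gives the form 43
  times the middle minus the whole, shared with \<open>high_modes\<close>.\<close>

lemma first_mode_shift:
  assumes ab: "a < t0 - 9/2" "t0 + 9/2 < b" and u: "smooth_on (shell a b) u"
  shows "43 * integral {t0 - 3/2..t0 + 3/2} (\<lambda>t. (cm u j t)\<^sup>2) - integral (Iv t0) (\<lambda>t. (cm u j t)\<^sup>2)
    \<le> 10^6 * exp 60 * integral {t0 - 22/5..t0 + 22/5} (\<lambda>t. (cm (Pf u) j t)\<^sup>2)"
proof -
  note s = smooth_Xf[OF open_shell]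
  have ct: "continuous_on {l..r} (cm f j)" if "smooth_on (shell a b) f" "a < l" "r < b" for f l r
  proof (rule continuous_at_imp_continuous_on, intro ballI)
    fix t assume "t \<in> {l..r}"
    then have "t \<in> {a<..<b}" using that by auto
    from DERIV_isCont[OF cm_deriv[OF that(1) this]] show "isCont (cm f j) t" .
  qed
  have d: "((\<lambda>\<tau>. cm f j (\<tau> + t0)) has_real_derivative cm (Df f) j (\<tau> + t0)) (at \<tau>)"
    if "smooth_on (shell a b) f" "\<tau> \<in> {-22/5..22/5}" for f \<tau>
  proof -
    have "\<tau> + t0 \<in> {a<..<b}" using that ab by auto
    from cm_deriv[OF that(1) this] show ?thesis by (simp add: DERIV_shift)
  qed
  have sh: "integral {l..r} (\<lambda>\<tau>. (cm f j (\<tau> + t0))\<^sup>2) = integral {t0 + l..t0 + r} (\<lambda>t. (cm f j t)\<^sup>2)" for f l r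
    using integral_shift_real_ivl[of "t0 + l" t0 "t0 + r" "\<lambda>t. (cm f j t)\<^sup>2"] by simp
  have "continuous_on {-22/5..22/5} (\<lambda>\<tau>. cm (Pf u) j (\<tau> + t0))"
    using ab by (intro continuous_on_compose2[OF ct[OF smooth_Pf[OF u], of "t0 - 9/2" "t0 + 9/2"]] continuous_intros) auto
  note cg = this
  have ode: "cm (Df (Df (Df (Df u)))) j (t + t0) - 10 * cm (Df (Df u)) j (t + t0) + 9 * cm u j (t + t0) = cm (Pf u) j (t + t0)"
    if "t \<in> {-22/5..22/5}" for t
  proof -
    have "t + t0 \<in> {a<..<b}" using ab that by auto
    then show ?thesis by (simp add: cm_Pf[OF u])
  qed
  have "42 * integral {-3/2..3/2} (\<lambda>\<tau>. (cm u j (\<tau> + t0))\<^sup>2) \<le>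
     integral {-22/5..-3/2} (\<lambda>\<tau>. (cm u j (\<tau> + t0))\<^sup>2) + integral {3/2..22/5} (\<lambda>\<tau>. (cm u j (\<tau> + t0))\<^sup>2)
     + 10^6 * exp 60 * integral {-22/5..22/5} (\<lambda>\<tau>. (cm (Pf u) j (\<tau> + t0))\<^sup>2)"
    by (rule first_mode[where c = "\<lambda>\<tau>. cm u j (\<tau> + t0)" and ?c1.0 = "\<lambda>\<tau>. cm (Df u) j (\<tau> + t0)"
          and ?c2.0 = "\<lambda>\<tau>. cm (Df (Df u)) j (\<tau> + t0)" and ?c3.0 = "\<lambda>\<tau>. cm (Df (Df (Df u))) j (\<tau> + t0)"
          and ?c4.0 = "\<lambda>\<tau>. cm (Df (Df (Df (Df u)))) j (\<tau> + t0)" and g = "\<lambda>\<tau>. cm (Pf u) j (\<tau> + t0)"])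
       ((rule d s u cg ode | assumption)+)
  then have fm: "42 * integral {t0 - 3/2..t0 + 3/2} (\<lambda>t. (cm u j t)\<^sup>2) \<le>
     integral {t0 - 22/5..t0 - 3/2} (\<lambda>t. (cm u j t)\<^sup>2) + integral {t0 + 3/2..t0 + 22/5} (\<lambda>t. (cm u j t)\<^sup>2)
     + 10^6 * exp 60 * integral {t0 - 22/5..t0 + 22/5} (\<lambda>t. (cm (Pf u) j t)\<^sup>2)"
    unfolding sh by simp
  have csq: "continuous_on {l..r} (\<lambda>t. (cm u j t)\<^sup>2)" if "a < l" "r < b" for l r
    by (intro continuous_intros ct u that)
  have i: "(\<lambda>t. (cm u j t)\<^sup>2) integrable_on {l..r}" if "a < l" "r < b" for l r
    by (intro integrable_continuous_real csq that)
  have "integral {t0 - 22/5..t0 - 3/2} (\<lambda>t. (cm u j t)\<^sup>2) + integral {t0 - 3/2..t0 + 3/2} (\<lambda>t. (cm u j t)\<^sup>2)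
      = integral {t0 - 22/5..t0 + 3/2} (\<lambda>t. (cm u j t)\<^sup>2)"
    using ab by (intro Henstock_Kurzweil_Integration.integral_combine i) auto
  moreover have "integral {t0 - 22/5..t0 + 3/2} (\<lambda>t. (cm u j t)\<^sup>2) + integral {t0 + 3/2..t0 + 22/5} (\<lambda>t. (cm u j t)\<^sup>2)
      = integral {t0 - 22/5..t0 + 22/5} (\<lambda>t. (cm u j t)\<^sup>2)"
    using ab by (intro Henstock_Kurzweil_Integration.integral_combine i) auto
  moreover have "integral {t0 - 22/5..t0 + 22/5} (\<lambda>t. (cm u j t)\<^sup>2) \<le> integral (Iv t0) (\<lambda>t. (cm u j t)\<^sup>2)"
    by (rule integral_nonneg_subset[OF csq[OF ab]]) auto
  ultimately show ?thesis using fm by linarith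
qed

section \<open>Vector valued densities and the combination of all estimates\<close>

definition mass :: "('k::finite \<Rightarrow> real^4 \<Rightarrow> real) \<Rightarrow> real \<Rightarrow> real" where
  "mass u t = (\<Sum>i\<in>UNIV. B0.b00 (u i) t)"
definition dens_mass :: "('k::finite \<Rightarrow> real^4 \<Rightarrow> real) \<Rightarrow> real \<Rightarrow> real" where
  "dens_mass u t = (\<Sum>i\<in>UNIV. dens (u i) t)"
definition pf_energy :: "('k::finite \<Rightarrow> real^4 \<Rightarrow> real) \<Rightarrow> real \<Rightarrow> real" where
  "pf_energy u t = (\<Sum>i\<in>UNIV. B0.b11 (pf (u i)) t + B0.s00 (pf (u i)) t)"
definition rho_mass :: "('k::finite \<Rightarrow> real^4 \<Rightarrow> real) \<Rightarrow> real \<Rightarrow> real" where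
  "rho_mass u t = (\<Sum>i\<in>UNIV. sm (rho (u i)) t)"
definition first_mass :: "('k::finite \<Rightarrow> real^4 \<Rightarrow> real) \<Rightarrow> real \<Rightarrow> real" where
  "first_mass u t = (\<Sum>i\<in>UNIV. \<Sum>j\<in>UNIV. 4 * (cm (u i) j t)\<^sup>2)"
definition first_rhs :: "('k::finite \<Rightarrow> real^4 \<Rightarrow> real) \<Rightarrow> real \<Rightarrow> real" where
  "first_rhs u t = (\<Sum>i\<in>UNIV. \<Sum>j\<in>UNIV. 4 * (cm (Pf (u i)) j t)\<^sup>2)"

text \<open>The equation enters as \<open>eqn\<close>: on each sphere \<open>Pf u\<close> is within
  s times the root of \<open>rho\<close> of a constant vector M, which holds the spherical mean
  terms. The outermost sphere is left out, because the annuli are half open; the weights vanish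
  there.\<close>

context
  fixes u :: "'k::finite \<Rightarrow> real^4 \<Rightarrow> real" and a b t0 s :: real
  assumes ab: "a < t0 - 9/2" "t0 + 9/2 < b" and s: "0 < s" "s \<le> 1/1000"
    and u: "\<And>i. smooth_on (shell a b) (u i)"
    and mean0: "\<And>i t. t \<in> Iv t0 \<Longrightarrow> sm (u i) t = 0"
    and eqn: "\<And>t. t \<in> Iv t0 \<Longrightarrow> t < t0 + 9/2 \<Longrightarrow> \<exists>M. \<forall>x. norm x = exp t \<longrightarrow>
      (\<Sum>i\<in>UNIV. (Pf (u i) x - M i)\<^sup>2) \<le> s\<^sup>2 * (\<Sum>i\<in>UNIV. rho (u i) x)"
begin

lemma tI: "t \<in> Iv t0 \<Longrightarrow> t \<in> {a<..<b}" by (rule Iv_sub[OF ab])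

lemma cont_sm: "smooth_on (shell a b) f \<Longrightarrow> continuous_on (Iv t0) (sm f)"
  using tI by (intro continuous_at_imp_continuous_on ballI DERIV_isCont[OF sm_deriv])

lemma cont_cm: "smooth_on (shell a b) f \<Longrightarrow> continuous_on (Iv t0) (cm f j)"
  using tI by (intro continuous_at_imp_continuous_on ballI DERIV_isCont[OF cm_deriv])

lemma cont_zt: "continuous_on A (zt t0)"
  unfolding zt_def[abs_def] by (intro continuous_intros)

lemma conts: "continuous_on (Iv t0) (mass u)" "continuous_on (Iv t0) (dens_mass u)" "continuous_on (Iv t0) (pf_energy u)" "continuous_on (Iv t0) (rho_mass u)"
  "continuous_on (Iv t0) (first_mass u)" "continuous_on (Iv t0) (first_rhs u)"
  unfolding mass_def dens_mass_def pf_energy_def rho_mass_def first_mass_def first_rhs_def dens_def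
  by (intro continuous_intros B0.b_cont[OF u ab] B0.b_cont[OF smooth_pf[OF u] ab] cont_sm smooth_rho cont_cm smooth_Pf u)+

lemma nonneg:
  assumes t: "t \<in> Iv t0"
  shows "0 \<le> mass u t" "0 \<le> dens_mass u t" "0 \<le> pf_energy u t" "0 \<le> rho_mass u t" "rho_mass u t \<le> pf_energy u t + 15 * dens_mass u t + 2 * mass u t"
    "(\<Sum>i\<in>UNIV. B0.b00 (pf (u i)) t) \<le> 12 * dens_mass u t"
proof -
  show "0 \<le> mass u t" "0 \<le> dens_mass u t" "0 \<le> pf_energy u t"
    unfolding mass_def dens_mass_def pf_energy_def dens_def
    by (intro sum_nonneg add_nonneg_nonneg B0_energy_nonneg[OF u tI[OF t]] B0_energy_nonneg[OF smooth_pf[OF u] tI[OF t]])+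
  show "0 \<le> rho_mass u t"
    unfolding rho_mass_def
    by (intro sum_nonneg sm_nonneg[OF smooth_rho[OF u] tI[OF t]]) (auto simp: rho_def intro!: add_nonneg_nonneg sum_nonneg)
  have "rho_mass u t \<le> (\<Sum>i\<in>UNIV. (B0.b11 (pf (u i)) t + B0.s00 (pf (u i)) t) + 15 * dens (u i) t + 2 * B0.b00 (u i) t)"
    unfolding rho_mass_def by (intro sum_mono rho_bound[OF u tI[OF t]])
  then show "rho_mass u t \<le> pf_energy u t + 15 * dens_mass u t + 2 * mass u t"
    unfolding pf_energy_def dens_mass_def mass_def by (simp add: sum.distrib sum_distrib_left)
  show "(\<Sum>i\<in>UNIV. B0.b00 (pf (u i)) t) \<le> 12 * dens_mass u t"
    unfolding dens_mass_def sum_distrib_left by (intro sum_mono pf_square[OF u tI[OF t]])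
qed

lemma cross:
  assumes t: "t \<in> Iv t0" and h: "\<And>i. smooth_on (shell a b) (h i)" and h0: "\<And>i. sm (h i) t = 0"
    and e: "t = t0 + 9/2 \<Longrightarrow> c = 0"
  shows "c * d * (\<Sum>i\<in>UNIV. B0 (h i) (Pf (u i)) t) \<le> s / 2 * (d\<^sup>2 * (\<Sum>i\<in>UNIV. B0 (h i) (h i) t) + c\<^sup>2 * rho_mass u t)"
proof (cases "t = t0 + 9/2")
  case True
  have "0 \<le> (\<Sum>i\<in>UNIV. B0 (h i) (h i) t)" by (intro sum_nonneg B0.B_pos[OF h tI[OF t]])
  then show ?thesis using s e[OF True] by simp
next
  case False
  note tt = tI[OF t]
  have lt: "t < t0 + 9/2" using False t by auto
  obtain M where M: "\<And>x. norm x = exp t \<Longrightarrow> (\<Sum>i\<in>UNIV. (Pf (u i) x - M i)\<^sup>2) \<le> s\<^sup>2 * (\<Sum>i\<in>UNIV. rho (u i) x)"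
    using eqn[OF t lt] by blast
  let ?L = "\<lambda>x. c * d * (\<Sum>i\<in>UNIV. h i x * Pf (u i) x - M i * h i x)"
  let ?H = "\<lambda>x. s / 2 * d\<^sup>2 * (\<Sum>i\<in>UNIV. h i x * h i x)" and ?Q = "\<lambda>x. s / 2 * c\<^sup>2 * (\<Sum>i\<in>UNIV. rho (u i) x)"
  have sL: "smooth_on (shell a b) (\<lambda>x. h i x * Pf (u i) x - M i * h i x)" for i
    by (intro smooth_on_diff smooth_on_mult open_shell smooth_on_const h smooth_Pf u)
  have sL': "smooth_on (shell a b) ?L"
    by (intro smooth_on_mult smooth_on_sum open_shell smooth_on_const sL)
  have sH: "smooth_on (shell a b) ?H" and sQ: "smooth_on (shell a b) ?Q"
    by (intro smooth_on_mult smooth_on_sum open_shell smooth_on_const h smooth_rho u)+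
  have "sm ?L t \<le> sm (\<lambda>x. ?H x + ?Q x) t"
  proof (rule sm_mono_sphere[OF sL' smooth_on_add[OF open_shell sH sQ] tt])
    fix x :: "real^4" assume x: "norm x = exp t"
    have "?L x = (\<Sum>i\<in>UNIV. c * d * (h i x * (Pf (u i) x - M i)))"
      by (simp add: sum_distrib_left algebra_simps)
    also have "\<dots> \<le> (\<Sum>i\<in>UNIV. s / 2 * d\<^sup>2 * (h i x * h i x) + c\<^sup>2 / (2 * s) * (Pf (u i) x - M i)\<^sup>2)"
      by (intro sum_mono weighted_young s)
    also have "\<dots> = ?H x + c\<^sup>2 / (2 * s) * (\<Sum>i\<in>UNIV. (Pf (u i) x - M i)\<^sup>2)"
      by (simp only: sum.distrib sum_distrib_left)
    also have "\<dots> \<le> ?H x + c\<^sup>2 / (2 * s) * (s\<^sup>2 * (\<Sum>i\<in>UNIV. rho (u i) x))"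
      using s by (intro add_left_mono mult_left_mono M[OF x]) auto
    also have "\<dots> = ?H x + ?Q x" using s by (simp add: power2_eq_square)
    finally show "?L x \<le> ?H x + ?Q x" .
  qed
  also have "\<dots> = s / 2 * d\<^sup>2 * (\<Sum>i\<in>UNIV. B0 (h i) (h i) t) + s / 2 * c\<^sup>2 * rho_mass u t"
    unfolding sm_add[OF sH sQ tt] sm_cmult rho_mass_def B0_def
    by (simp only: sm_sum[OF smooth_on_mult[OF open_shell h h] tt] sm_sum[OF smooth_rho[OF u] tt])
  also have "sm ?L t = c * d * (\<Sum>i\<in>UNIV. B0 (h i) (Pf (u i)) t)"
  proof -
    have "sm (\<lambda>x. h i x * Pf (u i) x - M i * h i x) t = B0 (h i) (Pf (u i)) t" for i
      using sm_diff[OF smooth_on_mult[OF open_shell h smooth_Pf[OF u]] smooth_on_mult[OF open_shell smooth_on_const h] tt, of i i "M i" i]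
      unfolding sm_cmult B0_def h0 by simp
    then show ?thesis unfolding sm_cmult by (simp only: sm_sum[OF sL tt])
  qed
  finally show ?thesis by (simp add: algebra_simps)
qed

text \<open>Bessel's inequality for \<open>Pf u\<close> - M, whose first mode is that of
  \<open>Pf u\<close>.\<close>

lemma mode_bound:
  assumes t: "t \<in> Iv t0" and lt: "t < t0 + 9/2"
  shows "first_rhs u t \<le> s\<^sup>2 * rho_mass u t"
proof -
  note tt = tI[OF t]
  obtain M where M: "\<And>x. norm x = exp t \<Longrightarrow> (\<Sum>i\<in>UNIV. (Pf (u i) x - M i)\<^sup>2) \<le> s\<^sup>2 * (\<Sum>i\<in>UNIV. rho (u i) x)"
    using eqn[OF t lt] by blast
  let ?g = "\<lambda>i x. Pf (u i) x - M i"
  have g: "smooth_on (shell a b) (?g i)" for i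
    by (intro smooth_on_diff open_shell smooth_on_const smooth_Pf u)
  have "(\<Sum>j\<in>UNIV. 4 * (cm (Pf (u i)) j t)\<^sup>2) \<le> sm (\<lambda>x. (?g i x)\<^sup>2) t" for i
    using B1.B_pos[OF g tt, of i] unfolding B1_def B0_def cm_add_const[OF smooth_Pf[OF u] tt]
    by (simp add: power2_eq_square sum_distrib_left)
  then have "first_rhs u t \<le> (\<Sum>i\<in>UNIV. sm (\<lambda>x. (?g i x)\<^sup>2) t)" unfolding first_rhs_def by (rule sum_mono)
  also have "\<dots> = sm (\<lambda>x. \<Sum>i\<in>UNIV. (?g i x)\<^sup>2) t"
    by (rule sm_sum[OF _ tt, symmetric]) (rule smooth_sq[OF g])
  also have "\<dots> \<le> sm (\<lambda>x. s\<^sup>2 * (\<Sum>i\<in>UNIV. rho (u i) x)) t"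
    by (rule sm_mono_sphere[OF _ _ tt M]) (intro smooth_on_sum smooth_on_mult smooth_on_const open_shell smooth_sq g smooth_rho u)+
  also have "\<dots> = s\<^sup>2 * rho_mass u t"
    unfolding sm_cmult rho_mass_def by (simp only: sm_sum[OF smooth_rho[OF u] tt])
  finally show ?thesis .
qed

text \<open>The powers z^4, z^6, z^8 are staggered so that the cutoff errors of each estimate are
  controlled by the one before. X returns on the right only with the small factor s and is
  absorbed.\<close>

lemma interior:
  "integral (Iv t0) (\<lambda>t. zt t0 t ^ 8 * rho_mass u t) \<le> 12000 * integral (Iv t0) (mass u)"
proof -
  let ?z = "zt t0"
  define Nn where "Nn = integral (Iv t0) (mass u)"
  define X where "X = integral (Iv t0) (\<lambda>t. ?z t ^ 8 * rho_mass u t)"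
  define Q where "Q = integral (Iv t0) (\<lambda>t. ?z t ^ 4 * dens_mass u t)"
  define w where "w = integral (Iv t0) (\<lambda>t. ?z t ^ 6 * pf_energy u t)"
  note cI = continuous_intros cont_zt conts
  note int = integrable_continuous_real
  note cu = B0.b_cont[OF u ab] and cp = B0.b_cont[OF smooth_pf[OF u] ab]
  have nn: "0 \<le> Nn" "0 \<le> X" "0 \<le> Q" "0 \<le> w"
    unfolding Nn_def X_def Q_def w_def
    by (intro integral_nonneg int cI mult_nonneg_nonneg zero_le_power; use nonneg zt_bounds in blast)+
  have cP: "continuous_on (Iv t0) (\<lambda>t. B0 (pf (u i)) (Pf (u i)) t)" for i
    unfolding B0_def by (intro cont_sm smooth_on_mult open_shell smooth_pf smooth_Pf u)
  have 1: "Q \<le> s * (Nn + X) + 120 * Nn"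
  proof -
    have "Q = (\<Sum>i\<in>UNIV. integral (Iv t0) (\<lambda>t. ?z t ^ 4 * dens (u i) t))"
      unfolding Q_def dens_mass_def sum_distrib_left
      by (rule integral_sum_continuous) (unfold dens_def, intro cI cu)
    also have "\<dots> \<le> (\<Sum>i\<in>UNIV. 2 * integral (Iv t0) (\<lambda>t. ?z t ^ 4 * B0.uP (u i) t) + 120 * integral (Iv t0) (B0.b00 (u i)))"
      by (intro sum_mono interior_second[OF ab u])
    also have "\<dots> = 2 * integral (Iv t0) (\<lambda>t. \<Sum>i\<in>UNIV. ?z t ^ 4 * B0.uP (u i) t) + 120 * Nn"
    proof -
      have "integral (Iv t0) (\<lambda>t. \<Sum>i\<in>UNIV. ?z t ^ 4 * B0.uP (u i) t) = (\<Sum>i\<in>UNIV. integral (Iv t0) (\<lambda>t. ?z t ^ 4 * B0.uP (u i) t))"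
        by (rule integral_sum_continuous) (intro cI cu)
      moreover have "Nn = (\<Sum>i\<in>UNIV. integral (Iv t0) (B0.b00 (u i)))"
        unfolding Nn_def mass_def by (rule integral_sum_continuous) (intro cu)
      ultimately show ?thesis by (simp add: sum.distrib sum_distrib_left)
    qed
    also have "integral (Iv t0) (\<lambda>t. \<Sum>i\<in>UNIV. ?z t ^ 4 * B0.uP (u i) t) \<le> integral (Iv t0) (\<lambda>t. s / 2 * (mass u t + ?z t ^ 8 * rho_mass u t))"
    proof (rule integral_mono_continuous)
      fix t assume t: "t \<in> Iv t0"
      have "?z t ^ 4 * 1 * (\<Sum>i\<in>UNIV. B0 (u i) (Pf (u i)) t) \<le> s / 2 * (1\<^sup>2 * (\<Sum>i\<in>UNIV. B0 (u i) (u i) t) + (?z t ^ 4)\<^sup>2 * rho_mass u t)"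
        by (rule cross[OF t u mean0[OF t]]) simp
      then show "(\<Sum>i\<in>UNIV. ?z t ^ 4 * B0.uP (u i) t) \<le> s / 2 * (mass u t + ?z t ^ 8 * rho_mass u t)"
        unfolding B0.uP_def[OF u] mass_def B0.b00_def[OF u] by (simp add: sum_distrib_left power_mult[symmetric])
    qed (intro cI cu)+
    also have "integral (Iv t0) (\<lambda>t. s / 2 * (mass u t + ?z t ^ 8 * rho_mass u t)) = s / 2 * (Nn + X)"
      unfolding Nn_def X_def by (subst integral_mult_right, subst Henstock_Kurzweil_Integration.integral_add) (intro int cI refl)+
    finally show ?thesis by simp
  qed
  have 2: "w \<le> 72 * Q + 6 * s * Q + s / 2 * X"
  proof -
    have "w = (\<Sum>i\<in>UNIV. integral (Iv t0) (\<lambda>t. ?z t ^ 6 * (B0.b11 (pf (u i)) t + B0.s00 (pf (u i)) t)))"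
      unfolding w_def pf_energy_def sum_distrib_left
      by (rule integral_sum_continuous) (intro cI cp)
    also have "\<dots> \<le> (\<Sum>i\<in>UNIV. 72 * integral (Iv t0) (\<lambda>t. ?z t ^ 4 * dens (u i) t)
        - integral (Iv t0) (\<lambda>t. ?z t ^ 6 * B0 (pf (u i)) (Pf (u i)) t))"
      by (intro sum_mono interior_third[OF ab u])
    also have "\<dots> = 72 * Q + integral (Iv t0) (\<lambda>t. \<Sum>i\<in>UNIV. - (?z t ^ 6 * B0 (pf (u i)) (Pf (u i)) t))"
    proof -
      have "integral (Iv t0) (\<lambda>t. \<Sum>i\<in>UNIV. - (?z t ^ 6 * B0 (pf (u i)) (Pf (u i)) t))
          = (\<Sum>i\<in>UNIV. integral (Iv t0) (\<lambda>t. - (?z t ^ 6 * B0 (pf (u i)) (Pf (u i)) t)))"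
        by (rule integral_sum_continuous) (intro cI cP)
      moreover have "Q = (\<Sum>i\<in>UNIV. integral (Iv t0) (\<lambda>t. ?z t ^ 4 * dens (u i) t))"
        unfolding Q_def dens_mass_def sum_distrib_left
        by (rule integral_sum_continuous) (unfold dens_def, intro cI cu)
      ultimately show ?thesis by (simp add: sum_subtractf sum_distrib_left sum_negf)
    qed
    also have "integral (Iv t0) (\<lambda>t. \<Sum>i\<in>UNIV. - (?z t ^ 6 * B0 (pf (u i)) (Pf (u i)) t))
        \<le> integral (Iv t0) (\<lambda>t. 6 * s * (?z t ^ 4 * dens_mass u t) + s / 2 * (?z t ^ 8 * rho_mass u t))"
    proof (rule integral_mono_continuous)
      fix t assume t: "t \<in> Iv t0"
      note sX = smooth_Xf[OF open_shell] smooth_Sf[OF open_shell]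
      have p0: "sm (pf (u i)) t = 0" for i
      proof -
        have D: "sm (Df (u i)) t = 0" if "t \<in> Iv t0" for t
          by (rule sm_D_zero[OF u ab(1) _ ab(2) mean0 that]) auto
        have DD: "sm (Df (Df (u i))) t = 0"
          by (rule sm_D_zero[OF sX(1)[OF u] ab(1) _ ab(2) D t]) auto
        have S: "sm (Sf (u i)) t = 0"
          using B0_S[OF smooth_on_const u tI[OF t], of 1 i] by (simp add: B0_def Xf_const sm_const)
        have s1: "smooth_on (shell a b) (\<lambda>x. 2 * Df (u i) x)" by (intro smooth_on_mult smooth_on_const open_shell sX u)
        show ?thesis
          unfolding pf_def[abs_def] sm_diff[OF smooth_on_add[OF open_shell sX(1)[OF sX(1)[OF u]] s1] sX(2)[OF u] tI[OF t]]
            sm_add[OF sX(1)[OF sX(1)[OF u]] s1 tI[OF t]] sm_cmult by (simp add: D[OF t] DD S)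
      qed
      have "- (?z t ^ 4) * ?z t ^ 2 * (\<Sum>i\<in>UNIV. B0 (pf (u i)) (Pf (u i)) t)
          \<le> s / 2 * ((?z t ^ 2)\<^sup>2 * (\<Sum>i\<in>UNIV. B0 (pf (u i)) (pf (u i)) t) + (- (?z t ^ 4))\<^sup>2 * rho_mass u t)"
        by (rule cross[OF t smooth_pf[OF u] p0]) simp
      also have "\<dots> \<le> s / 2 * ((?z t ^ 2)\<^sup>2 * (12 * dens_mass u t) + (- (?z t ^ 4))\<^sup>2 * rho_mass u t)"
        using nonneg(6)[OF t] s unfolding B0.b00_def[OF smooth_pf[OF u]]
        by (intro mult_left_mono add_right_mono) auto
      also have "\<dots> = 6 * s * (?z t ^ 4 * dens_mass u t) + s / 2 * (?z t ^ 8 * rho_mass u t)"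
        by (simp add: eval_nat_numeral algebra_simps)
      also have "- (?z t ^ 4) * ?z t ^ 2 * (\<Sum>i\<in>UNIV. B0 (pf (u i)) (Pf (u i)) t) = (\<Sum>i\<in>UNIV. - (?z t ^ 6 * B0 (pf (u i)) (Pf (u i)) t))"
        by (simp add: sum_negf sum_distrib_left power_add[symmetric])
      finally show "(\<Sum>i\<in>UNIV. - (?z t ^ 6 * B0 (pf (u i)) (Pf (u i)) t)) \<le> 6 * s * (?z t ^ 4 * dens_mass u t) + s / 2 * (?z t ^ 8 * rho_mass u t)" .
    qed (intro cI cP)+
    also have "integral (Iv t0) (\<lambda>t. 6 * s * (?z t ^ 4 * dens_mass u t) + s / 2 * (?z t ^ 8 * rho_mass u t)) = 6 * s * Q + s / 2 * X"
      unfolding Q_def X_def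
      by (subst Henstock_Kurzweil_Integration.integral_add) (intro int cI, intro int cI, simp only: integral_mult_right)
    finally show ?thesis by simp
  qed
  have 3: "X \<le> w + 15 * Q + 2 * Nn"
  proof -
    have "X \<le> integral (Iv t0) (\<lambda>t. ?z t ^ 6 * pf_energy u t + 15 * (?z t ^ 4 * dens_mass u t) + 2 * mass u t)"
      unfolding X_def
    proof (rule integral_mono_continuous)
      fix t assume t: "t \<in> Iv t0"
      note z = zt_bounds[OF t]
      have "?z t ^ 8 * rho_mass u t \<le> ?z t ^ 8 * (pf_energy u t + 15 * dens_mass u t + 2 * mass u t)"
        using nonneg(5)[OF t] z by (intro mult_left_mono) auto
      also have "\<dots> = ?z t ^ 8 * pf_energy u t + 15 * (?z t ^ 8 * dens_mass u t) + 2 * (?z t ^ 8 * mass u t)" by (simp add: algebra_simps)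
      also have "\<dots> \<le> ?z t ^ 6 * pf_energy u t + 15 * (?z t ^ 4 * dens_mass u t) + 2 * (1 * mass u t)"
        using nonneg[OF t] z by (intro add_mono mult_left_mono mult_right_mono power_decreasing power_le_one) auto
      finally show "?z t ^ 8 * rho_mass u t \<le> ?z t ^ 6 * pf_energy u t + 15 * (?z t ^ 4 * dens_mass u t) + 2 * mass u t" by simp
    qed (intro cI)+
    also have "\<dots> = w + 15 * Q + 2 * Nn"
    proof -
      have "((\<lambda>t. ?z t ^ 6 * pf_energy u t + 15 * (?z t ^ 4 * dens_mass u t) + 2 * mass u t) has_integral w + 15 * Q + 2 * Nn) (Iv t0)"
        unfolding w_def Q_def Nn_def
        by (intro has_integral_add has_integral_mult_right integrable_integral int cI)
      then show ?thesis by (rule integral_unique)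
    qed
    finally show ?thesis .
  qed
  have s': "s * Nn \<le> 1/1000 * Nn" "s * X \<le> 1/1000 * X" "s * Q \<le> 1/1000 * Q"
    using s nn by (intro mult_right_mono; simp)+
  \<comment> \<open>Without s one has Q \<le> 120 Nn, w \<le> 8640 Nn and X \<le> 10442 Nn; the
    margin absorbs the terms with s.\<close>
  have "X \<le> 12000 * Nn"
    using 1 2 3 s' nn by (simp add: algebra_simps)
  then show ?thesis unfolding X_def Nn_def .
qed

text \<open>The mass is the \<open>B1\<close> part plus the first mode. Pairing in \<open>B1\<close>
  subtracts the coordinate components of \<open>Pf u\<close> again, which \<open>mode_bound\<close>
  controls.\<close>

lemma modes:
  fixes X iN :: real
  defines "X \<equiv> integral (Iv t0) (\<lambda>t. zt t0 t ^ 8 * rho_mass u t)" and "iN \<equiv> integral (Iv t0) (mass u)"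
  shows "43 * integral {t0 - 3/2..t0 + 3/2} (mass u) - iN \<le> s * (iN + 2025 * X) + 10^6 * exp 60 * 25^8 * s\<^sup>2 * X"
proof -
  let ?in = "{t0 - 3/2..t0 + 3/2}" and ?z = "zt t0"
  let ?N1 = "\<lambda>t. \<Sum>i\<in>UNIV. B1.b00 (u i) t"
  note cI = continuous_intros cont_zt conts
  note int = integrable_continuous_real
  note c1 = B1.b_cont[OF u ab]
  have sub: "?in \<subseteq> Iv t0" "{t0 - 22/5..t0 + 22/5} \<subseteq> Iv t0" by auto
  have NC: "mass u t = ?N1 t + first_mass u t" for t
    unfolding mass_def first_mass_def B1.b00_def[OF u] B0.b00_def[OF u] B1_def
    by (simp add: sum.distrib[symmetric] sum_distrib_left power2_eq_square)
  have CN: "first_mass u t \<le> mass u t" if t: "t \<in> Iv t0" for t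
    unfolding NC by (simp add: B1.b00_def[OF u] sum_nonneg B1.B_pos[OF u tI[OF t]])
  have high: "43 * integral ?in ?N1 - integral (Iv t0) ?N1 \<le> s * (iN + 2025 * X)"
  proof -
    have "43 * integral ?in ?N1 - integral (Iv t0) ?N1
        = (\<Sum>i\<in>UNIV. 43 * integral ?in (B1.b00 (u i)) - integral (Iv t0) (B1.b00 (u i)))"
    proof -
      have "integral ?in ?N1 = (\<Sum>i\<in>UNIV. integral ?in (B1.b00 (u i)))"
        by (rule integral_sum_continuous) (rule continuous_on_subset[OF c1(1) sub(1)])
      moreover have "integral (Iv t0) ?N1 = (\<Sum>i\<in>UNIV. integral (Iv t0) (B1.b00 (u i)))"
        by (rule integral_sum_continuous) (rule c1)
      ultimately show ?thesis by (simp add: sum_subtractf sum_distrib_left)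
    qed
    also have "\<dots> \<le> (\<Sum>i\<in>UNIV. integral (Iv t0) (\<lambda>t. pw phL t0 t * B1.uP (u i) t))"
      by (intro sum_mono high_modes[OF ab u mean0])
    also have "\<dots> = integral (Iv t0) (\<lambda>t. \<Sum>i\<in>UNIV. pw phL t0 t * B1.uP (u i) t)"
      by (rule integral_sum_continuous[symmetric]) (intro cI c1 pw_cont)
    also have "\<dots> \<le> integral (Iv t0) (\<lambda>t. s * mass u t + 2025 * s * (?z t ^ 8 * rho_mass u t))"
    proof (rule integral_mono_continuous)
      fix t assume t: "t \<in> Iv t0"
      note z = zt_bounds[OF t]
      define \<phi> where "\<phi> = pw phL t0 t"
      have e: "t = t0 + 9/2 \<Longrightarrow> \<phi> = 0" unfolding \<phi>_def pw_def by (simp add: phL_def)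
      have \<phi>0: "0 \<le> \<phi>" using phL_bound[OF z] z unfolding \<phi>_def pw_def
        by (meson divide_nonneg_nonneg order_trans zero_le_numeral zero_le_power)
      \<comment> \<open>45 - \<open>phL\<close> / z^4, so that \<phi>^2 \<le> 45^2 z^8 = 2025 z^8,
        which is the weight of \<open>rho_mass\<close> in X.\<close>
      have "0 \<le> peval [45, -67/50, 609/100, -358/25, 107/25, 643/25, -2913/100] (?z t)"
        by (rule pcheck'[where ts = "[0, 1/2, 1]"]) (use z in simp_all)
      then have "0 \<le> ?z t ^ 4 * peval [45, -67/50, 609/100, -358/25, 107/25, 643/25, -2913/100] (?z t)"
        using z by simp
      then have "\<phi> \<le> 45 * ?z t ^ 4" unfolding \<phi>_def pw_def phL_def by (simp add: algebra_simps eval_nat_numeral)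
      then have "\<phi>\<^sup>2 \<le> (45 * ?z t ^ 4)\<^sup>2" using \<phi>0 by (rule power_mono)
      then have \<phi>2: "\<phi>\<^sup>2 \<le> 2025 * ?z t ^ 8" by (simp add: power_mult_distrib power_mult[symmetric])
      have A: "\<phi> * (\<Sum>i\<in>UNIV. B0 (u i) (Pf (u i)) t) \<le> s / 2 * (mass u t + \<phi>\<^sup>2 * rho_mass u t)"
        using cross[OF t u mean0[OF t] e, of 1] unfolding mass_def B0.b00_def[OF u] by simp
      have "(\<Sum>i\<in>UNIV. \<Sum>j\<in>UNIV. 4 * (\<phi> * 1 * (- cm (u i) j t * cm (Pf (u i)) j t)))
          \<le> (\<Sum>i\<in>UNIV. \<Sum>j\<in>UNIV. 4 * (s / 2 * 1\<^sup>2 * (- cm (u i) j t * - cm (u i) j t) + \<phi>\<^sup>2 / (2 * s) * (cm (Pf (u i)) j t)\<^sup>2))"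
        by (intro sum_mono mult_left_mono weighted_young s) auto
      also have "\<dots> = s / 2 * first_mass u t + \<phi>\<^sup>2 / (2 * s) * first_rhs u t"
        unfolding first_mass_def first_rhs_def by (simp add: sum.distrib sum_distrib_left power2_eq_square algebra_simps)
      also have "\<dots> \<le> s / 2 * mass u t + s / 2 * (\<phi>\<^sup>2 * rho_mass u t)"
      proof (rule add_mono)
        show "s / 2 * first_mass u t \<le> s / 2 * mass u t" using CN[OF t] s by (intro mult_left_mono) auto
        show "\<phi>\<^sup>2 / (2 * s) * first_rhs u t \<le> s / 2 * (\<phi>\<^sup>2 * rho_mass u t)"
        proof (cases "t = t0 + 9/2")
          case False
          then have "\<phi>\<^sup>2 / (2 * s) * first_rhs u t \<le> \<phi>\<^sup>2 / (2 * s) * (s\<^sup>2 * rho_mass u t)"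
            using t s by (intro mult_left_mono mode_bound) auto
          also have "\<dots> = s / 2 * (\<phi>\<^sup>2 * rho_mass u t)" using s by (simp add: power2_eq_square)
          finally show ?thesis .
        qed (use e in simp)
      qed
      finally have Bd: "(\<Sum>i\<in>UNIV. \<Sum>j\<in>UNIV. 4 * (\<phi> * 1 * (- cm (u i) j t * cm (Pf (u i)) j t)))
          \<le> s / 2 * mass u t + s / 2 * (\<phi>\<^sup>2 * rho_mass u t)" .
      have "(\<Sum>i\<in>UNIV. \<phi> * B1.uP (u i) t) = \<phi> * (\<Sum>i\<in>UNIV. B0 (u i) (Pf (u i)) t)
          + (\<Sum>i\<in>UNIV. \<Sum>j\<in>UNIV. 4 * (\<phi> * 1 * (- cm (u i) j t * cm (Pf (u i)) j t)))"
        unfolding B1.uP_def[OF u] B1_def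
        by (simp add: sum_distrib_left sum_subtractf right_diff_distrib sum_negf mult_ac)
      also have "\<dots> \<le> s * mass u t + s * (\<phi>\<^sup>2 * rho_mass u t)"
        using A Bd by (simp add: algebra_simps)
      also have "\<dots> \<le> s * mass u t + s * (2025 * ?z t ^ 8 * rho_mass u t)"
        using \<phi>2 nonneg(4)[OF t] s by (intro add_left_mono mult_left_mono mult_right_mono) auto
      finally show "(\<Sum>i\<in>UNIV. pw phL t0 t * B1.uP (u i) t) \<le> s * mass u t + 2025 * s * (?z t ^ 8 * rho_mass u t)"
        unfolding \<phi>_def by (simp add: mult_ac)
    qed (intro cI c1 pw_cont)+
    also have "\<dots> = s * iN + 2025 * s * X"
    proof -
      have "((\<lambda>t. s * mass u t + 2025 * s * (?z t ^ 8 * rho_mass u t)) has_integral s * iN + 2025 * s * X) (Iv t0)"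
        unfolding iN_def X_def by (intro has_integral_add has_integral_mult_right integrable_integral int cI)
      then show ?thesis by (rule integral_unique)
    qed
    finally show ?thesis by (simp add: algebra_simps)
  qed
  have low: "43 * integral ?in (first_mass u) - integral (Iv t0) (first_mass u) \<le> 10^6 * exp 60 * 25^8 * s\<^sup>2 * X"
  proof -
    let ?I = "{t0 - 22/5..t0 + 22/5}"
    have cc: "continuous_on (Iv t0) (\<lambda>t. 4 * (cm (u i) j t)\<^sup>2)" for i j by (intro continuous_intros cont_cm u)
    have cg: "continuous_on (Iv t0) (\<lambda>t. 4 * (cm (Pf (u i)) j t)\<^sup>2)" for i j by (intro continuous_intros cont_cm smooth_Pf u)
    have S: "integral {l..r} (\<lambda>t. \<Sum>i\<in>UNIV. \<Sum>j\<in>UNIV. 4 * (f i j t)\<^sup>2) = (\<Sum>i\<in>UNIV. \<Sum>j\<in>UNIV. 4 * integral {l..r} (\<lambda>t. (f i j t)\<^sup>2))"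
      if "{l..r} \<subseteq> Iv t0" "\<And>i j. continuous_on (Iv t0) (\<lambda>t. 4 * (f i j t)\<^sup>2)" for f :: "'k \<Rightarrow> 4 \<Rightarrow> real \<Rightarrow> real" and l r
    proof -
      note c = continuous_on_subset[OF that(2,1)]
      show ?thesis
        by (subst integral_sum_continuous, intro continuous_intros c, rule sum.cong[OF refl],
            subst integral_sum_continuous, rule c) simp
    qed
    have "43 * integral ?in (first_mass u) - integral (Iv t0) (first_mass u)
      = (\<Sum>i\<in>UNIV. \<Sum>j\<in>UNIV. 4 * (43 * integral ?in (\<lambda>t. (cm (u i) j t)\<^sup>2) - integral (Iv t0) (\<lambda>t. (cm (u i) j t)\<^sup>2)))"
      unfolding first_mass_def S[OF sub(1) cc] S[OF order_refl cc]
      by (simp add: sum_subtractf sum_distrib_left algebra_simps)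
    also have "\<dots> \<le> (\<Sum>i\<in>UNIV. \<Sum>j\<in>UNIV. 4 * (10^6 * exp 60 * integral ?I (\<lambda>t. (cm (Pf (u i)) j t)\<^sup>2)))"
      by (intro sum_mono mult_left_mono first_mode_shift[OF ab u]) simp
    also have "\<dots> = 10^6 * exp 60 * integral ?I (first_rhs u)"
      unfolding first_rhs_def S[OF sub(2) cg] by (simp add: sum_distrib_left mult_ac)
    also have "\<dots> \<le> 10^6 * exp 60 * (25^8 * s\<^sup>2 * X)"
    proof (rule mult_left_mono)
      have cz: "continuous_on (Iv t0) (\<lambda>t. 25^8 * s\<^sup>2 * (?z t ^ 8 * rho_mass u t))" by (intro cI)
      have "integral ?I (first_rhs u) \<le> integral ?I (\<lambda>t. 25^8 * s\<^sup>2 * (?z t ^ 8 * rho_mass u t))"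
      proof (rule integral_mono_continuous)
        fix t assume t: "t \<in> ?I"
        then have tI: "t \<in> Iv t0" "t < t0 + 9/2" by auto
        have "\<bar>t - t0\<bar> \<le> 22/5" using t by (intro abs_leI) auto
        then have "(t - t0)\<^sup>2 \<le> (22/5)\<^sup>2" by (metis abs_ge_zero power2_abs power_mono)
        \<comment> \<open>At distance 22/5 the value of z is 89/2025 > 1/25. For this lower bound
          the first mode is solved on an interval shorter than the one of length 9.\<close>
        then have "1 \<le> 25 * ?z t" unfolding zt_def by (simp add: power2_eq_square)
        then have "1 \<le> (25 * ?z t) ^ 8" by (rule one_le_power)
        then have "1 * (s\<^sup>2 * rho_mass u t) \<le> (25 * ?z t) ^ 8 * (s\<^sup>2 * rho_mass u t)"
          using nonneg(4)[OF tI(1)] by (intro mult_right_mono) auto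
        with mode_bound[OF tI] show "first_rhs u t \<le> 25^8 * s\<^sup>2 * (?z t ^ 8 * rho_mass u t)"
          by (simp add: power_mult_distrib mult_ac)
      qed (intro continuous_on_subset[OF _ sub(2)] conts cz)+
      also have "\<dots> \<le> integral (Iv t0) (\<lambda>t. 25^8 * s\<^sup>2 * (?z t ^ 8 * rho_mass u t))"
        by (rule integral_nonneg_subset[OF cz]) (use nonneg(4) zt_bounds in auto)
      also have "\<dots> = 25^8 * s\<^sup>2 * X" unfolding X_def by simp
      finally show "integral ?I (first_rhs u) \<le> 25^8 * s\<^sup>2 * X" .
    qed simp
    finally show ?thesis by (simp add: mult_ac)
  qed
  have "integral A (mass u) = integral A ?N1 + integral A (first_mass u)" if "A = ?in \<or> A = Iv t0" for A
  proof -
    have "integral {l..r} (mass u) = integral {l..r} ?N1 + integral {l..r} (first_mass u)" if "{l..r} \<subseteq> Iv t0" for l r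
      unfolding NC[abs_def]
      by (intro Henstock_Kurzweil_Integration.integral_add int continuous_intros continuous_on_subset[OF c1(1) that]
          continuous_on_subset[OF conts(5) that])
    then show ?thesis using that sub by auto
  qed
  then have "integral ?in (mass u) = integral ?in ?N1 + integral ?in (first_mass u)" "iN = integral (Iv t0) ?N1 + integral (Iv t0) (first_mass u)"
    unfolding iN_def by blast+
  then show ?thesis using high low by simp
qed

lemma three_annuli:
  assumes s_eq: "s * (10^10 + 10^13 * 25^8 * exp 60) = 1"
  shows "2 * exp 3 * integral {t0 - 3/2..t0 + 3/2} (mass u) \<le> integral {t0 - 9/2..t0 - 3/2} (mass u) + integral {t0 + 3/2..t0 + 9/2} (mass u)"
proof -
  define X where "X = integral (Iv t0) (\<lambda>t. zt t0 t ^ 8 * rho_mass u t)"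
  define iN where "iN = integral (Iv t0) (mass u)"
  define J where "J = integral {t0 - 3/2..t0 + 3/2} (mass u)"
  define E where "E = 25^8 * exp (60::real)"
  have E0: "0 \<le> E" unfolding E_def by simp
  have iN0: "0 \<le> iN" unfolding iN_def by (intro integral_nonneg integrable_continuous_real conts) (use nonneg in blast)
  have J0: "0 \<le> J" unfolding J_def
    by (intro integral_nonneg integrable_continuous_real continuous_on_subset[OF conts(1)]) (use nonneg in auto)
  have X: "X \<le> 12000 * iN" using interior unfolding X_def iN_def .
  have se: "s * (10^10 + 10^13 * E) = 1" using s_eq unfolding E_def by (simp add: mult.assoc)
  have "43 * J - iN \<le> s * (iN + 2025 * X) + 10^6 * E * s\<^sup>2 * X"
    using modes unfolding J_def iN_def X_def E_def by (simp add: mult_ac)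
  also have "\<dots> \<le> s * (iN + 2025 * (12000 * iN)) + 10^6 * E * (s * 1) * (12000 * iN)"
  proof -
    have "10^6 * E * s\<^sup>2 * X \<le> 10^6 * E * s\<^sup>2 * (12000 * iN)"
      using X E0 by (intro mult_left_mono) auto
    also have "\<dots> \<le> 10^6 * E * (s * 1) * (12000 * iN)"
      unfolding power2_eq_square using s E0 iN0 by (intro mult_right_mono mult_left_mono) auto
    finally show ?thesis using X s by (intro add_mono mult_left_mono add_left_mono) auto
  qed
  \<comment> \<open>The coefficients of s are 24300001 \<le> 10^8 and 12 * 10^9 \<le> 10^11.\<close>
  also have "\<dots> \<le> s * (10^10 + 10^13 * E) * (iN / 100)"
  proof -
    have "0 \<le> s * iN" "0 \<le> s * E * iN" using s E0 iN0 by auto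
    then show ?thesis by (simp add: algebra_simps)
  qed
  also have "\<dots> = iN / 100" unfolding se by simp
  finally have *: "43 * J \<le> 101/100 * iN" by simp
  have i: "(mass u) integrable_on {l..r}" if "{l..r} \<subseteq> Iv t0" for l r
    by (intro integrable_continuous_real continuous_on_subset[OF conts(1) that])
  have "integral {t0 - 9/2..t0 - 3/2} (mass u) + J = integral {t0 - 9/2..t0 + 3/2} (mass u)"
    unfolding J_def by (intro Henstock_Kurzweil_Integration.integral_combine i) auto
  moreover have "integral {t0 - 9/2..t0 + 3/2} (mass u) + integral {t0 + 3/2..t0 + 9/2} (mass u) = iN"
    unfolding iN_def by (intro Henstock_Kurzweil_Integration.integral_combine i) auto
  moreover have "exp 3 * J \<le> 203/10 * J" using exp_bounds J0 by (intro mult_right_mono) auto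
  \<comment> \<open>43 J \<le> 1.01 (J + outer) gives 41.5 J \<le> outer, against 2 e^3 \<le>
    40.6.\<close>
  ultimately show ?thesis using * J0 unfolding J_def[symmetric] by linarith
qed

end

section \<open>From the equation to polar coordinates\<close>

lemma pd_component:
  fixes f :: "real^4 \<Rightarrow> real^'k"
  assumes "f differentiable (at x)"
  shows "pd \<alpha> f x $ i = pd \<alpha> (\<lambda>x. f x $ i) x"
proof -
  have "(f has_derivative frechet_derivative f (at x)) (at x)" using assms frechet_derivative_works by blast
  from pd_eqI[OF bounded_linear.has_derivative[OF bounded_linear_vec_nth this]]
  show ?thesis by (simp add: pd_def)
qed

text \<open>The class of functions that agree on \<Omega> with the i-th component of some smooth map
  is closed under \<open>pd\<close>.\<close>

lemma smooth_component:
  fixes f :: "real^4 \<Rightarrow> real^'k"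
  assumes \<Omega>: "open \<Omega>" and f: "smooth_on \<Omega> f"
  shows "smooth_on \<Omega> (\<lambda>x. f x $ i)"
proof (rule smooth_on_coinduct[where P = "\<lambda>g. \<exists>h::real^4 \<Rightarrow> real^'k. smooth_on \<Omega> h \<and> (\<forall>x\<in>\<Omega>. g x = h x $ i)"])
  fix g :: "real^4 \<Rightarrow> real" and x assume "\<exists>h::real^4 \<Rightarrow> real^'k. smooth_on \<Omega> h \<and> (\<forall>x\<in>\<Omega>. g x = h x $ i)" and x: "x \<in> \<Omega>"
  then obtain h :: "real^4 \<Rightarrow> real^'k" where h: "smooth_on \<Omega> h" "\<And>x. x \<in> \<Omega> \<Longrightarrow> g x = h x $ i" by blast
  have "(h has_derivative frechet_derivative h (at x)) (at x)"
    using smooth_onD(1)[OF h(1) x] frechet_derivative_works by blast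
  from bounded_linear.has_derivative[OF bounded_linear_vec_nth this]
  have "(g has_derivative (\<lambda>v. frechet_derivative h (at x) v $ i)) (at x)"
    by (rule has_derivative_transform_within_open[OF _ \<Omega> x]) (simp add: h)
  then show "g differentiable (at x)" by (rule differentiableI)
next
  fix g :: "real^4 \<Rightarrow> real" and \<alpha> assume "\<exists>h::real^4 \<Rightarrow> real^'k. smooth_on \<Omega> h \<and> (\<forall>x\<in>\<Omega>. g x = h x $ i)"
  then obtain h :: "real^4 \<Rightarrow> real^'k" where h: "smooth_on \<Omega> h" "\<And>x. x \<in> \<Omega> \<Longrightarrow> g x = h x $ i" by blast
  have "pd \<alpha> g x = pd \<alpha> h x $ i" if "x \<in> \<Omega>" for x
    using pd_cong[OF \<Omega> that h(2), of "\<lambda>x. x" \<alpha>] pd_component[OF smooth_onD(1)[OF h(1) that], of \<alpha> i] by simp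
  then show "\<exists>h::real^4 \<Rightarrow> real^'k. smooth_on \<Omega> h \<and> (\<forall>x\<in>\<Omega>. pd \<alpha> g x = h x $ i)"
    using smooth_onD(2)[OF h(1)] by blast
qed (use f in blast)

lemma smooth_vsum:
  fixes f :: "4 \<Rightarrow> real^4 \<Rightarrow> real^'k"
  assumes \<Omega>: "open \<Omega>" and f: "\<And>\<beta>. smooth_on \<Omega> (f \<beta>)"
  shows "smooth_on \<Omega> (\<lambda>x. \<Sum>\<beta>\<in>UNIV. f \<beta> x)"
proof (rule smooth_on_coinduct[where P = "\<lambda>g. \<exists>f::4 \<Rightarrow> real^4 \<Rightarrow> real^'k. (\<forall>\<beta>. smooth_on \<Omega> (f \<beta>)) \<and> (\<forall>x\<in>\<Omega>. g x = (\<Sum>\<beta>\<in>UNIV. f \<beta> x))"])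
  have key: "(g has_derivative (\<lambda>v. \<Sum>\<beta>\<in>UNIV. frechet_derivative (f \<beta>) (at x) v)) (at x)"
    if f: "\<And>\<beta>. smooth_on \<Omega> (f \<beta>)" "\<And>x. x \<in> \<Omega> \<Longrightarrow> g x = (\<Sum>\<beta>\<in>UNIV. f \<beta> x)" and x: "x \<in> \<Omega>"
    for g :: "real^4 \<Rightarrow> real^'k" and f :: "4 \<Rightarrow> real^4 \<Rightarrow> real^'k" and x
  proof -
    have "(f \<beta> has_derivative frechet_derivative (f \<beta>) (at x)) (at x)" for \<beta>
      using smooth_onD(1)[OF f(1) x] frechet_derivative_works by blast
    then have "((\<lambda>x. \<Sum>\<beta>\<in>UNIV. f \<beta> x) has_derivative (\<lambda>v. \<Sum>\<beta>\<in>UNIV. frechet_derivative (f \<beta>) (at x) v)) (at x)"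
      by (intro has_derivative_sum)
    then show ?thesis
      by (rule has_derivative_transform_within_open[OF _ \<Omega> x]) (simp add: f(2))
  qed
  {
    fix g :: "real^4 \<Rightarrow> real^'k" and x assume "\<exists>f::4 \<Rightarrow> real^4 \<Rightarrow> real^'k. (\<forall>\<beta>. smooth_on \<Omega> (f \<beta>)) \<and> (\<forall>x\<in>\<Omega>. g x = (\<Sum>\<beta>\<in>UNIV. f \<beta> x))" and x: "x \<in> \<Omega>"
    then show "g differentiable (at x)" using key differentiableI by metis
  next
    fix g :: "real^4 \<Rightarrow> real^'k" and \<alpha> assume "\<exists>f::4 \<Rightarrow> real^4 \<Rightarrow> real^'k. (\<forall>\<beta>. smooth_on \<Omega> (f \<beta>)) \<and> (\<forall>x\<in>\<Omega>. g x = (\<Sum>\<beta>\<in>UNIV. f \<beta> x))"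
    then obtain f :: "4 \<Rightarrow> real^4 \<Rightarrow> real^'k" where f: "\<And>\<beta>. smooth_on \<Omega> (f \<beta>)" "\<And>x. x \<in> \<Omega> \<Longrightarrow> g x = (\<Sum>\<beta>\<in>UNIV. f \<beta> x)" by blast
    have "pd \<alpha> g x = (\<Sum>\<beta>\<in>UNIV. pd \<alpha> (f \<beta>) x)" if "x \<in> \<Omega>" for x
      using pd_eqI[OF key[OF f that], of \<alpha>] by (simp add: pd_def)
    then show "\<exists>f::4 \<Rightarrow> real^4 \<Rightarrow> real^'k. (\<forall>\<beta>. smooth_on \<Omega> (f \<beta>)) \<and> (\<forall>x\<in>\<Omega>. pd \<alpha> g x = (\<Sum>\<beta>\<in>UNIV. f \<beta> x))"
      using smooth_onD(2)[OF f(1)] by (intro exI[of _ "\<lambda>\<beta>. pd \<alpha> (f \<beta>)"]) auto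
  }
qed (use f in blast)

lemma smooth_lap:
  fixes u :: "real^4 \<Rightarrow> real^'k"
  assumes "open \<Omega>" "smooth_on \<Omega> u" shows "smooth_on \<Omega> (lap u)"
  unfolding lap_def[abs_def] by (intro smooth_vsum smooth_onD(2) assms)

lemma pd2_component:
  fixes u :: "real^4 \<Rightarrow> real^'k"
  assumes \<Omega>: "open \<Omega>" and u: "smooth_on \<Omega> u" and x: "x \<in> \<Omega>"
  shows "pd \<alpha> (pd \<beta> u) x $ i = pd \<alpha> (pd \<beta> (\<lambda>x. u x $ i)) x"
proof -
  have "pd \<alpha> (pd \<beta> u) x $ i = pd \<alpha> (\<lambda>x. pd \<beta> u x $ i) x"
    by (rule pd_component[OF smooth_onD(1)[OF smooth_onD(2)[OF u] x]])
  also have "\<dots> = pd \<alpha> (pd \<beta> (\<lambda>x. u x $ i)) x"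
    by (rule pd_cong[OF \<Omega> x]) (rule pd_component[OF smooth_onD(1)[OF u]])
  finally show ?thesis .
qed

lemma lap_component:
  fixes u :: "real^4 \<Rightarrow> real^'k"
  assumes "open \<Omega>" "smooth_on \<Omega> u" "x \<in> \<Omega>"
  shows "lap u x $ i = (\<Sum>\<alpha>\<in>UNIV. pd \<alpha> (pd \<alpha> (\<lambda>x. u x $ i)) x)"
  unfolding lap_def by (simp add: pd2_component[OF assms])

section \<open>The equation in the quaternion frame\<close>

lemma smooth_normsq: "smooth_on (shell a b) (\<lambda>x. (norm x)\<^sup>2)"
  unfolding norm4 unfolding power2_eq_square by (intro smooth_on_add smooth_on_mult open_shell smooth_on_coord)

lemma Xf_normsq: "Xf p (\<lambda>x. (norm x)\<^sup>2) x = 2 * (x \<bullet> qm p x)"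
proof -
  have "((\<lambda>x::real^4. (norm x)\<^sup>2) has_derivative (\<lambda>h. 2 * (x \<bullet> h))) (at x)"
    unfolding power2_norm_eq_inner by (auto intro!: derivative_eq_intros simp: inner_commute)
  then show ?thesis by (rule Xf_eqI)
qed

lemma Xf_normsq_qb: "Xf (qb k) (\<lambda>x. (norm x)\<^sup>2) x = (if k = 1 then 2 * (norm x)\<^sup>2 else 0)"
proof -
  have "x \<bullet> qm (qb 2) x = 0" "x \<bullet> qm (qb 3) x = 0" "x \<bullet> qm (qb 4) x = 0" "x \<bullet> qm (qb 1) x = (norm x)\<^sup>2"
    unfolding inner_vec_def sum_4 qm_nth norm4 by (simp_all add: axis_def power2_eq_square)
  moreover have "k = 1 \<or> k = 2 \<or> k = 3 \<or> k = 4" by (rule exhaust_4)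
  ultimately show ?thesis unfolding Xf_normsq by auto
qed

lemma Xf_pf:
  assumes L: "smooth_on (shell a b) L" and x: "x \<in> shell a b"
    and p: "\<And>x. x \<in> shell a b \<Longrightarrow> f x = (norm x)\<^sup>2 * L x"
  shows "Xf (qb k) f x = (norm x)\<^sup>2 * (Xf (qb k) L x + (if k = 1 then 2 * L x else 0))"
proof -
  have "Xf (qb k) f x = Xf (qb k) (\<lambda>x. (norm x)\<^sup>2 * L x) x"
    by (rule Xf_cong[OF open_shell p x])
  also have "\<dots> = (if k = 1 then 2 * (norm x)\<^sup>2 else 0) * L x + (norm x)\<^sup>2 * Xf (qb k) L x"
    unfolding Xf_mult[OF open_shell smooth_normsq L x] Xf_normsq_qb ..
  finally show ?thesis by (simp add: algebra_simps)
qed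

text \<open>Multiplication by |x|^2 shifts D by 2 and commutes with the angular fields, so D^2 - 2 D
  - S applied to |x|^2 L is |x|^2 (D^2 + 2 D - S) L.\<close>

lemma Pf_bilaplacian:
  fixes u L :: "real^4 \<Rightarrow> real"
  assumes u: "smooth_on (shell a b) u" and L: "smooth_on (shell a b) L" and x: "x \<in> shell a b"
    and p: "\<And>x. x \<in> shell a b \<Longrightarrow> pf u x = (norm x)\<^sup>2 * L x"
  shows "Pf u x = norm x ^ 4 * (\<Sum>\<alpha>\<in>UNIV. pd \<alpha> (pd \<alpha> L) x)"
proof -
  note s = smooth_Xf[OF open_shell L]
  have D: "Df (pf u) y = (norm y)\<^sup>2 * (Df L y + 2 * L y)" if "y \<in> shell a b" for y
    using Xf_pf[OF L that p, of 1] by simp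
  have s2: "smooth_on (shell a b) (\<lambda>x. 1 * Df L x + 2 * L x)"
    by (intro smooth_on_add smooth_on_mult open_shell smooth_on_const s L)
  have "Df (Df (pf u)) x = (norm x)\<^sup>2 * (Df (\<lambda>x. 1 * Df L x + 2 * L x) x + 2 * (1 * Df L x + 2 * L x))"
    using Xf_pf[OF s2 x, of "Df (pf u)" 1] D by simp
  then have DD: "Df (Df (pf u)) x = (norm x)\<^sup>2 * (Df (Df L) x + 4 * Df L x + 4 * L x)"
    unfolding Xf_lin[OF s L x] by (simp add: algebra_simps)
  have X: "Xf (qb k) (Xf (qb k) (pf u)) x = (norm x)\<^sup>2 * Xf (qb k) (Xf (qb k) L) x" if "k \<noteq> 1" for k
    using Xf_pf[OF s x, of "Xf (qb k) (pf u)" "qb k" k] Xf_pf[OF L _ p, of _ k] that by simp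
  have S: "Sf (pf u) x = (norm x)\<^sup>2 * Sf L x"
    unfolding Sf_def by (simp add: X four_neq algebra_simps)
  have "Pf u x = (norm x)\<^sup>2 * (Df (Df L) x + 2 * Df L x - Sf L x)"
    unfolding Pf_factor[OF u x, symmetric] DD S D[OF x] by (simp add: algebra_simps)
  also have "\<dots> = (norm x)\<^sup>2 * ((norm x)\<^sup>2 * (\<Sum>\<alpha>\<in>UNIV. pd \<alpha> (pd \<alpha> L) x))"
    unfolding lap_polar[OF open_shell L x] ..
  finally show ?thesis by (simp add: power4_eq_xxxx power2_eq_square)
qed

lemma quaternion_frame:
  fixes w :: "4 \<Rightarrow> real"
  shows "(norm x)\<^sup>2 * (\<Sum>\<alpha>\<in>UNIV. (w \<alpha>)\<^sup>2) = (\<Sum>k\<in>UNIV. (\<Sum>\<alpha>\<in>UNIV. qm (qb k) x $ \<alpha> * w \<alpha>)\<^sup>2)"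
  unfolding sum_4 norm4 qm_nth by (simp add: axis_def algebra_simps power2_eq_square)

lemma Xf_unit_bound:
  assumes "norm p = 1"
  shows "(Xf p f x)\<^sup>2 \<le> (\<Sum>k\<in>UNIV. (Xf (qb k) f x)\<^sup>2)"
proof -
  define v :: "real^4" where "v = (\<chi> k. Xf (qb k) f x)"
  have "Xf p f x = p \<bullet> v" unfolding v_def inner_vec_def sum_4 by (subst Xf_linear) simp
  then have "\<bar>Xf p f x\<bar> \<le> norm v" using Cauchy_Schwarz_ineq2[of p v] assms by simp
  then have "\<bar>Xf p f x\<bar>\<^sup>2 \<le> (norm v)\<^sup>2" by (rule power_mono) simp
  then show ?thesis unfolding norm4 sum_4 by (simp add: v_def)
qed

lemma sq_sum_le: "(p + q)\<^sup>2 \<le> 2 * p\<^sup>2 + 2 * q\<^sup>2" for p q :: real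
proof -
  have "2 * p\<^sup>2 + 2 * q\<^sup>2 - (p + q)\<^sup>2 = (p - q)\<^sup>2" by (simp add: power2_eq_square algebra_simps)
  then show ?thesis by (metis diff_ge_0_iff_ge zero_le_power2)
qed

text \<open>The frame identity in both indices. A frame entry of the Hessian is X_j X_k u minus the
  derivative along the product of the two units, again a unit quaternion; 32 = 2 * 16 counts these
  corrections.\<close>

lemma hess_bound:
  fixes u :: "real^4 \<Rightarrow> real"
  assumes u: "smooth_on (shell a b) u" and x: "x \<in> shell a b"
  shows "norm x ^ 4 * (\<Sum>\<alpha>\<in>UNIV. \<Sum>\<beta>\<in>UNIV. (pd \<alpha> (pd \<beta> u) x)\<^sup>2)
    \<le> 2 * (\<Sum>j\<in>UNIV. \<Sum>k\<in>UNIV. (Xf (qb j) (Xf (qb k) u) x)\<^sup>2) + 32 * (\<Sum>k\<in>UNIV. (Xf (qb k) u x)\<^sup>2)"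
proof -
  let ?m = "\<lambda>\<alpha> \<beta>. pd \<alpha> (pd \<beta> u) x"
  have "norm x ^ 4 * (\<Sum>\<alpha>\<in>UNIV. \<Sum>\<beta>\<in>UNIV. (?m \<alpha> \<beta>)\<^sup>2) = (norm x)\<^sup>2 * (\<Sum>\<alpha>\<in>UNIV. (norm x)\<^sup>2 * (\<Sum>\<beta>\<in>UNIV. (?m \<alpha> \<beta>)\<^sup>2))"
    by (simp add: power4_eq_xxxx power2_eq_square sum_distrib_left mult.assoc)
  also have "\<dots> = (norm x)\<^sup>2 * (\<Sum>\<alpha>\<in>UNIV. \<Sum>k\<in>UNIV. (\<Sum>\<beta>\<in>UNIV. qm (qb k) x $ \<beta> * ?m \<alpha> \<beta>)\<^sup>2)"
    unfolding quaternion_frame ..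
  also have "\<dots> = (\<Sum>k\<in>UNIV. (norm x)\<^sup>2 * (\<Sum>\<alpha>\<in>UNIV. (\<Sum>\<beta>\<in>UNIV. qm (qb k) x $ \<beta> * ?m \<alpha> \<beta>)\<^sup>2))"
    unfolding sum_distrib_left by (rule sum.swap)
  also have "\<dots> = (\<Sum>k\<in>UNIV. \<Sum>j\<in>UNIV. (\<Sum>\<alpha>\<in>UNIV. qm (qb j) x $ \<alpha> * (\<Sum>\<beta>\<in>UNIV. qm (qb k) x $ \<beta> * ?m \<alpha> \<beta>))\<^sup>2)"
    unfolding quaternion_frame ..
  also have "\<dots> \<le> (\<Sum>k\<in>UNIV. \<Sum>j\<in>UNIV. 2 * (Xf (qb j) (Xf (qb k) u) x)\<^sup>2 + 2 * (\<Sum>k\<in>UNIV. (Xf (qb k) u x)\<^sup>2))"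
  proof (intro sum_mono)
    fix j k :: 4
    have "(\<Sum>\<alpha>\<in>UNIV. qm (qb j) x $ \<alpha> * (\<Sum>\<beta>\<in>UNIV. qm (qb k) x $ \<beta> * ?m \<alpha> \<beta>))
      = Xf (qb j) (Xf (qb k) u) x + - Xf (qm (qb k) (qb j)) u x"
      unfolding Xf_Xf[OF open_shell u x, of "qb j" "qb k"] by (simp add: sum_distrib_left mult.assoc)
    moreover have "(Xf (qm (qb k) (qb j)) u x)\<^sup>2 \<le> (\<Sum>k\<in>UNIV. (Xf (qb k) u x)\<^sup>2)"
      by (rule Xf_unit_bound) (simp add: norm_qm norm_axis_1)
    ultimately show "(\<Sum>\<alpha>\<in>UNIV. qm (qb j) x $ \<alpha> * (\<Sum>\<beta>\<in>UNIV. qm (qb k) x $ \<beta> * ?m \<alpha> \<beta>))\<^sup>2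
      \<le> 2 * (Xf (qb j) (Xf (qb k) u) x)\<^sup>2 + 2 * (\<Sum>k\<in>UNIV. (Xf (qb k) u x)\<^sup>2)"
      using sq_sum_le[of "Xf (qb j) (Xf (qb k) u) x" "- Xf (qm (qb k) (qb j)) u x"] by simp
  qed
  also have "\<dots> = 2 * (\<Sum>k\<in>UNIV. \<Sum>j\<in>UNIV. (Xf (qb j) (Xf (qb k) u) x)\<^sup>2) + 32 * (\<Sum>k\<in>UNIV. (Xf (qb k) u x)\<^sup>2)"
    by (simp add: sum.distrib sum_distrib_left)
  also have "(\<Sum>k\<in>UNIV. \<Sum>j\<in>UNIV. (Xf (qb j) (Xf (qb k) u) x)\<^sup>2) = (\<Sum>j\<in>UNIV. \<Sum>k\<in>UNIV. (Xf (qb j) (Xf (qb k) u) x)\<^sup>2)"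
    by (rule sum.swap)
  finally show ?thesis .
qed

text \<open>Derivatives of \<open>pf u\<close> = |x|^2 L are |x|^2 times those of L, up to 2
  \<open>pf u\<close> in the radial direction. The constant is 32 from \<open>hess_bound\<close>
  plus 1 for the gradient of u.\<close>

lemma derivatives_le_rho:
  fixes u L :: "real^4 \<Rightarrow> real"
  assumes u: "smooth_on (shell a b) u" and L: "smooth_on (shell a b) L" and x: "x \<in> shell a b"
    and p: "\<And>x. x \<in> shell a b \<Longrightarrow> pf u x = (norm x)\<^sup>2 * L x"
  shows "norm x ^ 6 * (\<Sum>\<alpha>\<in>UNIV. (pd \<alpha> L x)\<^sup>2) + norm x ^ 4 * (\<Sum>\<alpha>\<in>UNIV. \<Sum>\<beta>\<in>UNIV. (pd \<alpha> (pd \<beta> u) x)\<^sup>2)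
    + (norm x)\<^sup>2 * (\<Sum>\<alpha>\<in>UNIV. (pd \<alpha> u x)\<^sup>2) + (u x)\<^sup>2 \<le> 33 * rho u x"
proof -
  have "norm x ^ 6 * (\<Sum>\<alpha>\<in>UNIV. (pd \<alpha> L x)\<^sup>2) = norm x ^ 4 * ((norm x)\<^sup>2 * (\<Sum>\<alpha>\<in>UNIV. (pd \<alpha> L x)\<^sup>2))"
    by (simp add: power_add[symmetric] mult.assoc[symmetric])
  also have "\<dots> = norm x ^ 4 * (\<Sum>k\<in>UNIV. (Xf (qb k) L x)\<^sup>2)" unfolding grad_polar[OF open_shell] ..
  also have "\<dots> = (\<Sum>k\<in>UNIV. ((norm x)\<^sup>2 * Xf (qb k) L x)\<^sup>2)"
    by (simp add: sum_distrib_left power_mult_distrib power_mult[symmetric])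
  also have "\<dots> = (\<Sum>k\<in>UNIV. (Xf (qb k) (pf u) x + (if k = 1 then - 2 * pf u x else 0))\<^sup>2)"
  proof -
    have "Xf (qb k) (pf u) x = (norm x)\<^sup>2 * (Xf (qb k) L x + (if k = 1 then 2 * L x else 0))" for k
      by (rule Xf_pf[OF L x p])
    then show ?thesis by (intro sum.cong refl) (simp add: p[OF x] algebra_simps)
  qed
  also have "\<dots> \<le> (\<Sum>k\<in>UNIV. 2 * (Xf (qb k) (pf u) x)\<^sup>2 + 2 * (if k = 1 then - 2 * pf u x else 0)\<^sup>2)"
    by (intro sum_mono sq_sum_le)
  also have "\<dots> = 2 * (\<Sum>k\<in>UNIV. (Xf (qb k) (pf u) x)\<^sup>2) + 8 * (pf u x)\<^sup>2"
    unfolding sum_4 by (simp add: power_mult_distrib)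
  finally have 1: "norm x ^ 6 * (\<Sum>\<alpha>\<in>UNIV. (pd \<alpha> L x)\<^sup>2) \<le> 2 * (\<Sum>k\<in>UNIV. (Xf (qb k) (pf u) x)\<^sup>2) + 8 * (pf u x)\<^sup>2" .
  have nn: "0 \<le> (\<Sum>k\<in>UNIV. (Xf (qb k) (pf u) x)\<^sup>2)" "0 \<le> (pf u x)\<^sup>2"
    "0 \<le> (\<Sum>j\<in>UNIV. \<Sum>k\<in>UNIV. (Xf (qb j) (Xf (qb k) u) x)\<^sup>2)" "0 \<le> (u x)\<^sup>2"
    by (auto intro!: sum_nonneg)
  show ?thesis
    using 1 hess_bound[OF u x] nn unfolding rho_def grad_polar[OF open_shell] distrib_left by linarith
qed

text \<open>Taking components of the vector integral \<open>ang_int\<close> requires integrability,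
  hence the detour through \<open>?h\<close>, which is cut off outside the sphere and is therefore
  measurable and bounded.\<close>

lemma sm_component_zero:
  fixes u :: "real^4 \<Rightarrow> real^'k"
  assumes u: "\<And>i. smooth_on (shell a b) (\<lambda>x. u x $ i)" and t: "t \<in> {a<..<b}" and z: "ang_int (exp t) u = 0"
  shows "sm (\<lambda>x. u x $ i) t = 0"
proof -
  let ?B = "ball (0::real^4) 1" and ?n = "\<lambda>y::real^4. y /\<^sub>R norm y"
  let ?h = "\<lambda>\<theta>::real^4. indicator S3 \<theta> *\<^sub>R u (exp t *\<^sub>R \<theta>)"
  have cu: "continuous_on S3 (\<lambda>\<theta>. u (exp t *\<^sub>R \<theta>))"
  proof -
    have "continuous_on S3 (\<lambda>\<theta>. \<chi> i. u (exp t *\<^sub>R \<theta>) $ i)"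
      by (intro continuous_on_vec_lambda shell_cont[OF u t])
    then show ?thesis by simp
  qed
  then have hm [measurable]: "?h \<in> borel_measurable borel"
    by (intro borel_measurable_continuous_on_indicator) auto
  have "bounded ((\<lambda>\<theta>. u (exp t *\<^sub>R \<theta>)) ` S3)"
    by (intro compact_imp_bounded compact_continuous_image cu compact_sphere)
  then obtain K where "\<forall>y \<in> (\<lambda>\<theta>. u (exp t *\<^sub>R \<theta>)) ` S3. norm y \<le> K" unfolding bounded_iff by blast
  then have K: "\<And>\<theta>. \<theta> \<in> S3 \<Longrightarrow> norm (u (exp t *\<^sub>R \<theta>)) \<le> K" by blast
  have "norm (?h \<theta>) \<le> max K 0" for \<theta>
    using K[of \<theta>] by (cases "\<theta> \<in> S3") auto
  then have hB: "norm (?h (?n y)) \<le> max K 0" for y by blast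
  have fin: "emeasure lborel ?B < \<infinity>" using emeasure_ball_pos by (simp add: top.not_eq_extremum)
  have m: "(\<lambda>y. ?h (?n y)) \<in> borel_measurable lborel"
    by (subst measurable_cong_sets[OF sets_lborel refl]) (rule measurable_compose[OF normalize_measurable hm])
  have int: "set_integrable lborel ?B (\<lambda>y. ?h (?n y))"
    unfolding set_integrable_def
  proof (rule integrableI_bounded_set_indicator[OF _ m fin])
    show "AE y in lborel. y \<in> ?B \<longrightarrow> norm (?h (?n y)) \<le> max K 0" by (intro AE_I2 impI hB)
  qed simp
  have "set_lebesgue_integral lborel ?B (\<lambda>y. u (exp t *\<^sub>R ?n y)) = set_lebesgue_integral lborel ?B (\<lambda>y. ?h (?n y))"
    unfolding set_lebesgue_integral_def
  proof (rule integral_cong_AE)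
    show m': "(\<lambda>y. indicat_real ?B y *\<^sub>R ?h (?n y)) \<in> borel_measurable lborel"
      by (intro borel_measurable_scaleR m borel_measurable_indicator) simp
    \<comment> \<open>At y = 0 the quotient y / |y| is 0 and the integrand is \<open>u 0\<close>; a
      single point affects neither measurability nor the integral.\<close>
    have "(\<lambda>y. indicat_real ?B y *\<^sub>R u (exp t *\<^sub>R ?n y)) = (\<lambda>y. if y \<in> {0} then u 0 else indicat_real ?B y *\<^sub>R ?h (?n y))"
      by (rule ext) simp
    moreover have "\<dots> \<in> borel_measurable lborel"
      by (rule measurable_If_set[OF _ m']) simp_all
    ultimately show "(\<lambda>y. indicat_real ?B y *\<^sub>R u (exp t *\<^sub>R ?n y)) \<in> borel_measurable lborel" by simp
    show "AE y in lborel. indicat_real ?B y *\<^sub>R u (exp t *\<^sub>R ?n y) = indicat_real ?B y *\<^sub>R ?h (?n y)"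
      using AE_lborel_singleton[of "0::real^4"] by eventually_elim simp
  qed
  then have "set_lebesgue_integral lborel ?B (\<lambda>y. ?h (?n y)) = 0"
    using z unfolding ang_int_def by simp
  then have 0: "(LINT y|lborel. (indicat_real ?B y *\<^sub>R ?h (?n y)) $ i) = 0"
    using integral_bounded_linear[OF bounded_linear_vec_nth int[unfolded set_integrable_def], of i]
    unfolding set_lebesgue_integral_def by simp
  let ?g = "\<lambda>\<theta>. indicat_real S3 \<theta> *\<^sub>R u (exp t *\<^sub>R \<theta>) $ i"
  have gm [measurable]: "?g \<in> borel_measurable borel"
    by (intro borel_measurable_continuous_on_indicator shell_cont[OF u t]) auto
  have "sm (\<lambda>x. u x $ i) t = (LINT y|uniform_measure lborel ?B. ?g (?n y))"
    unfolding sm_def sint_def set_lebesgue_integral_def sph_def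
    by (rule integral_distr[OF _ gm]) simp
  also have "\<dots> = (LINT y|density lborel (\<lambda>y. ennreal (indicat_real ?B y / V4)). ?g (?n y))"
  proof -
    have "emeasure lborel ?B = ennreal V4" using emeasure_ball_pos by (simp add: measure_def top.not_eq_extremum)
    moreover have "V4 > 0" using emeasure_ball_pos by (simp add: measure_def enn2real_positive_iff top.not_eq_extremum zero_less_iff_neq_zero)
    ultimately have "indicator ?B y / emeasure lborel ?B = ennreal (indicat_real ?B y / V4)" for y
      by (simp add: divide_ennreal[symmetric] ennreal_indicator del: divide_ennreal)
    then show ?thesis unfolding uniform_measure_def by simp
  qed
  also have "\<dots> = (LINT y|lborel. (indicat_real ?B y / V4) *\<^sub>R ?g (?n y))"
  proof (rule integral_density)
    show "(\<lambda>y. ?g (?n y)) \<in> borel_measurable lborel"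
      by (subst measurable_cong_sets[OF sets_lborel refl]) (rule measurable_compose[OF normalize_measurable gm])
    show "(\<lambda>y. indicat_real ?B y / V4) \<in> borel_measurable lborel"
      by (intro borel_measurable_divide borel_measurable_indicator borel_measurable_const) simp
  qed auto
  also have "\<dots> = (LINT y|lborel. (1 / V4) * (indicat_real ?B y *\<^sub>R ?h (?n y)) $ i)"
    by (rule Bochner_Integration.integral_cong) auto
  also have "\<dots> = (1 / V4) * (LINT y|lborel. (indicat_real ?B y *\<^sub>R ?h (?n y)) $ i)"
    by (rule integral_mult_right_zero)
  finally show ?thesis unfolding 0 by simp
qed

lemma F_polar:
  fixes u :: "real^4 \<Rightarrow> real^'k"
  assumes u: "\<And>i. smooth_on (shell a b) (\<lambda>x. u x $ i)"
    and ab: "a < - real_of_int j * 3" "- (real_of_int j - 1) * 3 < b"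
  shows "F j u = 4 * V4 * integral {- real_of_int j * 3..- (real_of_int j - 1) * 3} (mass (\<lambda>i x. u x $ i))"
proof -
  let ?l = "- real_of_int j * 3" and ?r = "- (real_of_int j - 1) * 3"
  have "F j u = set_lebesgue_integral lborel (Ann j) (\<lambda>x. norm x powr (-4) * (\<Sum>i\<in>UNIV. (u x $ i)\<^sup>2))"
    unfolding F_def power2_norm_eq_inner inner_vec_def by (simp add: power2_eq_square)
  also have "\<dots> = 4 * V4 * integral {?l..?r} (sm (\<lambda>x. \<Sum>i\<in>UNIV. (u x $ i)\<^sup>2))"
  proof (rule shell_integral[OF ab(1) _ ab(2)])
    show "smooth_on (shell a b) (\<lambda>x. \<Sum>i\<in>UNIV. (u x $ i)\<^sup>2)"
      by (intro smooth_on_sum open_shell smooth_sq u)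
    show "Ann j = {x. exp ?l \<le> norm x \<and> norm x < exp ?r}"
      unfolding Ann_def Lc_def by auto
  qed (auto intro: sum_nonneg)
  also have "integral {?l..?r} (sm (\<lambda>x. \<Sum>i\<in>UNIV. (u x $ i)\<^sup>2)) = integral {?l..?r} (mass (\<lambda>i x. u x $ i))"
  proof (rule Henstock_Kurzweil_Integration.integral_cong)
    fix t assume "t \<in> {?l..?r}"
    then have t: "t \<in> {a<..<b}" using ab by auto
    have "sm (\<lambda>x. \<Sum>i\<in>UNIV. (u x $ i)\<^sup>2) t = (\<Sum>i\<in>UNIV. sm (\<lambda>x. (u x $ i)\<^sup>2) t)"
      by (rule sm_sum[OF smooth_sq[OF u] t])
    then show "sm (\<lambda>x. \<Sum>i\<in>UNIV. (u x $ i)\<^sup>2) t = mass (\<lambda>i x. u x $ i) t"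
      unfolding mass_def B0.b00_def[OF u] B0_def power2_eq_square .
  qed
  finally show ?thesis .
qed

lemma norm_app_le:
  fixes c :: "'t::real_inner^'k"
  shows "norm (app c T) \<le> norm c * norm T"
proof -
  have "(norm (app c T))\<^sup>2 = (\<Sum>i\<in>UNIV. (c $ i \<bullet> T)\<^sup>2)"
    unfolding power2_norm_eq_inner inner_vec_def app_def by (simp add: power2_eq_square)
  also have "\<dots> \<le> (\<Sum>i\<in>UNIV. (norm (c $ i))\<^sup>2 * (norm T)\<^sup>2)"
  proof (rule sum_mono)
    fix i
    have "\<bar>c $ i \<bullet> T\<bar>\<^sup>2 \<le> (norm (c $ i) * norm T)\<^sup>2" by (rule power_mono[OF Cauchy_Schwarz_ineq2]) simp
    then show "(c $ i \<bullet> T)\<^sup>2 \<le> (norm (c $ i))\<^sup>2 * (norm T)\<^sup>2" by (simp add: power_mult_distrib)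
  qed
  also have "\<dots> = (norm c * norm T)\<^sup>2"
    unfolding power_mult_distrib power2_norm_eq_inner[of c] inner_vec_def sum_distrib_right by (simp add: power2_norm_eq_inner)
  finally show ?thesis by (rule power2_le_imp_le) simp
qed

lemma four_sq_le: "(p + q + r + s)\<^sup>2 \<le> 4 * (p\<^sup>2 + q\<^sup>2 + r\<^sup>2 + s\<^sup>2)" for p q r s :: real
  using sq_sum_le[of "p + q" "r + s"] sq_sum_le[of p q] sq_sum_le[of r s] by (simp add: add.assoc)

text \<open>The coefficient bound \<eta> / |x|^j goes with a derivative of order 4 - j, so
  multiplication by |x|^4 leaves \<eta> times scale invariant derivatives. 132 = 4 * 33, the 4 from
  the square of a sum of four terms.\<close>

lemma local_terms_bound:
  fixes u :: "real^4 \<Rightarrow> real^'k"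
  assumes \<Omega>: "open \<Omega>" and sU: "shell a b \<subseteq> \<Omega>" and u: "smooth_on \<Omega> u" and x: "x \<in> shell a b" and \<eta>: "0 \<le> \<eta>"
    and a: "norm a1 \<le> \<eta> / norm x" "norm a2 \<le> \<eta> / norm x ^ 2" "norm a3 \<le> \<eta> / norm x ^ 3" "norm a4 \<le> \<eta> / norm x ^ 4"
  shows "(norm x ^ 4 * norm (app a1 (grad (lap u) x) + app a2 (hess u x) + app a3 (grad u x) + app a4 (u x)))\<^sup>2
    \<le> 132 * \<eta>\<^sup>2 * (\<Sum>i\<in>UNIV. rho (\<lambda>x. u x $ i) x)"
    and "Pf (\<lambda>x. u x $ i) x = norm x ^ 4 * lap (lap u) x $ i"
proof -
  define r where "r = norm x"
  have r: "0 < r" using x exp_gt_zero[of a] unfolding shell_def r_def by (auto intro: less_trans)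
  let ?u = "\<lambda>i x. u x $ i" and ?L = "\<lambda>i x. lap u x $ i"
  have xU: "x \<in> \<Omega>" using x sU by blast
  have su: "smooth_on (shell a b) (?u i)" for i by (rule smooth_on_subset[OF smooth_component[OF \<Omega> u] sU])
  have sL: "smooth_on (shell a b) (?L i)" for i
    by (rule smooth_on_subset[OF smooth_component[OF \<Omega> smooth_lap[OF \<Omega> u]] sU])
  have p: "pf (?u i) y = (norm y)\<^sup>2 * ?L i y" if "y \<in> shell a b" for i y
    unfolding pf_def lap_polar[OF open_shell su that, symmetric]
    using lap_component[OF \<Omega> u] that sU by (simp add: subset_iff)
  show "Pf (?u i) x = norm x ^ 4 * lap (lap u) x $ i"
    unfolding lap_component[OF \<Omega> smooth_lap[OF \<Omega> u] xU] by (rule Pf_bilaplacian[OF su sL x p])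
  let ?T = "app a1 (grad (lap u) x) + app a2 (hess u x) + app a3 (grad u x) + app a4 (u x)"
  define g1 where "g1 = norm (grad (lap u) x)"
  define g2 where "g2 = norm (hess u x)"
  define g3 where "g3 = norm (grad u x)"
  define g4 where "g4 = norm (u x)"
  have "norm ?T \<le> norm a1 * g1 + norm a2 * g2 + norm a3 * g3 + norm a4 * g4"
    unfolding g1_def g2_def g3_def g4_def by (intro norm_triangle_le add_mono norm_app_le)
  also have "\<dots> \<le> \<eta> / r * g1 + \<eta> / r ^ 2 * g2 + \<eta> / r ^ 3 * g3 + \<eta> / r ^ 4 * g4"
    using a unfolding r_def by (intro add_mono mult_right_mono) (simp_all add: g1_def g2_def g3_def g4_def)
  finally have "r ^ 4 * norm ?T \<le> r ^ 4 * (\<eta> / r * g1 + \<eta> / r ^ 2 * g2 + \<eta> / r ^ 3 * g3 + \<eta> / r ^ 4 * g4)"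
    using r by (intro mult_left_mono) auto
  also have "\<dots> = \<eta> * (r ^ 3 * g1 + r ^ 2 * g2 + r * g3 + g4)"
    using r by (simp add: field_simps eval_nat_numeral)
  finally have "(r ^ 4 * norm ?T)\<^sup>2 \<le> (\<eta> * (r ^ 3 * g1 + r ^ 2 * g2 + r * g3 + g4))\<^sup>2"
    using r by (intro power_mono) auto
  also have "\<dots> \<le> \<eta>\<^sup>2 * (4 * ((r ^ 3 * g1)\<^sup>2 + (r ^ 2 * g2)\<^sup>2 + (r * g3)\<^sup>2 + g4\<^sup>2))"
    unfolding power_mult_distrib[of \<eta>] by (intro mult_left_mono four_sq_le) simp
  also have "(r ^ 3 * g1)\<^sup>2 + (r ^ 2 * g2)\<^sup>2 + (r * g3)\<^sup>2 + g4\<^sup>2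
    = (\<Sum>i\<in>UNIV. norm x ^ 6 * (\<Sum>\<alpha>\<in>UNIV. (pd \<alpha> (?L i) x)\<^sup>2) + norm x ^ 4 * (\<Sum>\<alpha>\<in>UNIV. \<Sum>\<beta>\<in>UNIV. (pd \<alpha> (pd \<beta> (?u i)) x)\<^sup>2)
    + (norm x)\<^sup>2 * (\<Sum>\<alpha>\<in>UNIV. (pd \<alpha> (?u i) x)\<^sup>2) + (?u i x)\<^sup>2)"
  proof -
    have G: "(norm (grad f x))\<^sup>2 = (\<Sum>i\<in>UNIV. \<Sum>\<alpha>\<in>UNIV. (pd \<alpha> (\<lambda>x. f x $ i) x)\<^sup>2)"
      if "smooth_on \<Omega> f" for f :: "real^4 \<Rightarrow> real^'k"
      unfolding power2_norm_eq_inner inner_vec_def grad_def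
      by (simp add: pd_component[OF smooth_onD(1)[OF that xU]] power2_eq_square)
    have H: "g2\<^sup>2 = (\<Sum>i\<in>UNIV. \<Sum>\<alpha>\<in>UNIV. \<Sum>\<beta>\<in>UNIV. (pd \<alpha> (pd \<beta> (?u i)) x)\<^sup>2)"
      unfolding power2_norm_eq_inner inner_vec_def hess_def g2_def
      by (simp add: pd2_component[OF \<Omega> u xU] power2_eq_square)
    have V: "g4\<^sup>2 = (\<Sum>i\<in>UNIV. (?u i x)\<^sup>2)"
      unfolding power2_norm_eq_inner inner_vec_def g4_def by (simp add: power2_eq_square)
    have "(r ^ 3 * g1)\<^sup>2 + (r ^ 2 * g2)\<^sup>2 + (r * g3)\<^sup>2 + g4\<^sup>2 = r ^ 6 * g1\<^sup>2 + r ^ 4 * g2\<^sup>2 + r\<^sup>2 * g3\<^sup>2 + g4\<^sup>2"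
      by (simp add: power_mult_distrib power_mult[symmetric])
    then show ?thesis
      unfolding H V unfolding g1_def g3_def G[OF u] G[OF smooth_lap[OF \<Omega> u]]
      by (simp add: sum.distrib sum_distrib_left r_def)
  qed
  also have "\<eta>\<^sup>2 * (4 * \<dots>) \<le> \<eta>\<^sup>2 * (4 * (\<Sum>i\<in>UNIV. 33 * rho (?u i) x))"
    by (intro mult_left_mono sum_mono derivatives_le_rho[OF su sL x p]) auto
  also have "\<dots> = 132 * \<eta>\<^sup>2 * (\<Sum>i\<in>UNIV. rho (?u i) x)"
    unfolding sum_distrib_left[symmetric] by simp
  finally show "(norm x ^ 4 * norm ?T)\<^sup>2 \<le> 132 * \<eta>\<^sup>2 * (\<Sum>i\<in>UNIV. rho (?u i) x)"
    unfolding r_def .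
qed

text \<open>The identities differentiate across the ends of the interval and need an open shell;
  compactness of the closed annulus provides the margin.\<close>

lemma shell_in_open:
  assumes \<Omega>: "open \<Omega>" and l: "l \<le> r" and s: "{x::real^4. exp l \<le> norm x \<and> norm x \<le> exp r} \<subseteq> \<Omega>"
  obtains a b where "a < l" "r < b" "shell a b \<subseteq> \<Omega>"
proof -
  let ?A = "{x::real^4. exp l \<le> norm x \<and> norm x \<le> exp r}"
  have "?A = cball 0 (exp r) - ball 0 (exp l)" by auto
  then have "compact ?A" by (simp add: compact_diff)
  moreover have "?A \<noteq> {}"
    using l by (auto intro!: exI[of _ "exp r *\<^sub>R axis 1 1"] simp: norm_axis_1)
  ultimately obtain e where e: "0 < e" "(\<Union>x\<in>?A. ball x e) \<subseteq> \<Omega>"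
    using compact_subset_open_imp_ball_epsilon_subset[OF _ \<Omega> s] by blast
  define e' where "e' = min (e / 2) (exp l / 2)"
  have e': "0 < e'" "e' < e" "e' < exp l" unfolding e'_def using e exp_gt_zero[of l] by (auto simp: min_def)
  show ?thesis
  proof (rule that[of "ln (exp l - e')" "ln (exp r + e')"])
    show "ln (exp l - e') < l" using e' by (metis diff_gt_0_iff_gt diff_less_eq less_add_same_cancel1 ln_exp ln_less_cancel_iff exp_gt_zero)
    show "r < ln (exp r + e')" using e' by (metis add_pos_pos exp_gt_zero less_add_same_cancel1 ln_exp ln_less_cancel_iff)
    show "shell (ln (exp l - e')) (ln (exp r + e')) \<subseteq> \<Omega>"
    proof
      fix x :: "real^4" assume "x \<in> shell (ln (exp l - e')) (ln (exp r + e'))"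
      then have x: "exp l - e' < norm x" "norm x < exp r + e'"
        unfolding shell_def using e' add_pos_pos[OF exp_gt_zero[of r] e'(1)] by simp_all
      then have x0: "x \<noteq> 0" using e' by auto
      \<comment> \<open>Clamping the radius to [exp l, exp r] gives the nearest point of the closed
        annulus on the same ray.\<close>
      define m where "m = max (exp l) (min (exp r) (norm x))"
      have m: "exp l \<le> m" "m \<le> exp r" "\<bar>m - norm x\<bar> < e"
        unfolding m_def using x e' l by (auto simp: max_def min_def)
      have "0 < m" using m(1) exp_gt_zero[of l] by linarith
      have "norm ((m / norm x) *\<^sub>R x) = m" using x0 \<open>0 < m\<close> by simp
      then have "(m / norm x) *\<^sub>R x \<in> ?A" using m by simp
      moreover have "dist ((m / norm x) *\<^sub>R x) x < e"
      proof -
        have "(m / norm x) *\<^sub>R x - x = ((m - norm x) / norm x) *\<^sub>R x"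
          using x0 by (simp add: diff_divide_distrib scaleR_diff_left)
        then show ?thesis using m(3) x0 by (simp add: dist_norm)
      qed
      ultimately show "x \<in> \<Omega>" using e(2) by (meson UN_I mem_ball subset_iff)
    qed
  qed
qed

lemma three_annuli_F:
  fixes u :: "real^4 \<Rightarrow> real^'k" and l1 l2 i :: int
  assumes s_eq: "s * (10^10 + 10^13 * 25^8 * exp 60) = 1"
    and eq: "approx_biharmonic (s / 12) \<Omega> (\<Union>i\<in>{l2..l1}. Ann i) u a1 a2 a3 a4 b1 b2 b3 b4"
    and sub: "{x. exp (- real_of_int l1 * Lc) \<le> norm x \<and> norm x \<le> exp (- (real_of_int l2 - 1) * Lc)} \<subseteq> \<Omega>"
    and mean0: "\<And>r. r\<in>{exp (- real_of_int l1 * Lc) .. exp (- (real_of_int l2 - 1) * Lc)} \<Longrightarrow> ang_int r u = 0"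
    and i: "l2 < i" "i < l1"
  shows "2 * exp 3 * F i u \<le> F (i - 1) u + F (i + 1) u"
proof -
  \<comment> \<open>The midpoint of annulus i in the variable t = ln |x|, which decreases as i
    grows.\<close>
  define t0 where "t0 = - (real_of_int i - 1/2) * 3"
  have \<Omega>: "open \<Omega>" and u: "smooth_on \<Omega> u" using eq unfolding approx_biharmonic_def by auto
  have il: "real_of_int l2 + 1 \<le> real_of_int i" "real_of_int i + 1 \<le> real_of_int l1" using i by linarith+
  have range: "- real_of_int l1 * Lc \<le> t0 - 9/2" "t0 + 9/2 \<le> - (real_of_int l2 - 1) * Lc"
    unfolding t0_def Lc_def using il by simp_all
  have ann: "{x. exp (t0 - 9/2) \<le> norm x \<and> norm x \<le> exp (t0 + 9/2)} \<subseteq> \<Omega>"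
  proof (rule subset_trans[OF _ sub], rule Collect_mono, rule impI)
    fix x :: "real^4" assume "exp (t0 - 9/2) \<le> norm x \<and> norm x \<le> exp (t0 + 9/2)"
    moreover have "exp (- real_of_int l1 * Lc) \<le> exp (t0 - 9/2)" "exp (t0 + 9/2) \<le> exp (- (real_of_int l2 - 1) * Lc)"
      using range by (simp_all only: exp_le_cancel_iff)
    ultimately show "exp (- real_of_int l1 * Lc) \<le> norm x \<and> norm x \<le> exp (- (real_of_int l2 - 1) * Lc)"
      by linarith
  qed
  have "t0 - 9/2 \<le> t0 + 9/2" by simp
  then obtain a b where ab: "a < t0 - 9/2" "t0 + 9/2 < b" and sU: "shell a b \<subseteq> \<Omega>"
    by (rule shell_in_open[OF \<Omega> _ ann])
  have su: "smooth_on (shell a b) (\<lambda>x. u x $ i)" for i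
    by (rule smooth_on_subset[OF smooth_component[OF \<Omega> u] sU])
  have E: "0 < 25^8 * exp (60::real)" by simp
  have s0: "0 < s"
  proof (rule ccontr)
    assume "\<not> 0 < s"
    then have "s * (10^10 + 10^13 * 25^8 * exp 60) \<le> 0" by (intro mult_nonpos_nonneg) auto
    then show False using s_eq by simp
  qed
  have s1: "s \<le> 1/1000"
  proof -
    have "s * 10^10 \<le> s * (10^10 + 10^13 * 25^8 * exp 60)" using s0 by (intro mult_left_mono) auto
    then show ?thesis unfolding s_eq using s0 by simp
  qed
  have m0: "sm (\<lambda>x. u x $ i) t = 0" if t: "t \<in> Iv t0" for i t
  proof (rule sm_component_zero[OF su Iv_sub[OF ab t]])
    have "- real_of_int l1 * Lc \<le> t" "t \<le> - (real_of_int l2 - 1) * Lc" using t range by auto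
    then show "ang_int (exp t) u = 0" by (intro mean0) (simp only: atLeastAtMost_iff exp_le_cancel_iff)
  qed
  have eqn: "\<exists>M. \<forall>x. norm x = exp t \<longrightarrow>
      (\<Sum>i\<in>UNIV. (Pf (\<lambda>x. u x $ i) x - M i)\<^sup>2) \<le> s\<^sup>2 * (\<Sum>i\<in>UNIV. rho (\<lambda>x. u x $ i) x)"
    if t: "t \<in> Iv t0" "t < t0 + 9/2" for t
  proof -
    \<comment> \<open>The spherical mean terms depend on x only through its norm; multiplied by exp
      t ^ 4 they are the constant M of the abstract setting.\<close>
    define m where "m = (1 / sphere_area (exp t)) *\<^sub>R
          surf_int (exp t) (\<lambda>y. app (b1 y) (grad (lap u) y) + app (b2 y) (hess u y)
                                  + app (b3 y) (grad u y) + app (b4 y) (u y))"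
    show ?thesis
    proof (intro exI[of _ "\<lambda>i. exp t ^ 4 * m $ i"] allI impI)
      fix x :: "real^4" assume nx: "norm x = exp t"
      have xs: "x \<in> shell a b" unfolding shell_def using nx Iv_sub[OF ab t(1)] by simp
      have x\<Omega>: "x \<in> (\<Union>i\<in>{l2..l1}. Ann i)"
      proof -
        have A: "x \<in> Ann j" if "- real_of_int j * 3 \<le> t" "t < - (real_of_int j - 1) * 3" for j
          using that unfolding Ann_def Lc_def by (simp add: nx not_less)
        consider "t < - real_of_int i * 3" | "- real_of_int i * 3 \<le> t" "t < - (real_of_int i - 1) * 3"
          | "- (real_of_int i - 1) * 3 \<le> t" by linarith
        then have "x \<in> Ann (i + 1) \<or> x \<in> Ann i \<or> x \<in> Ann (i - 1)"
        proof cases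
          case 1 then show ?thesis using t unfolding t0_def by (intro disjI1 A) auto
        next
          case 2 then show ?thesis by (intro disjI2 disjI1 A)
        next
          case 3 then show ?thesis using t unfolding t0_def by (intro disjI2 A) auto
        qed
        moreover have "i + 1 \<in> {l2..l1}" "i \<in> {l2..l1}" "i - 1 \<in> {l2..l1}" using i by auto
        ultimately show ?thesis by blast
      qed
      let ?T = "app (a1 x) (grad (lap u) x) + app (a2 x) (hess u x) + app (a3 x) (grad u x) + app (a4 x) (u x)"
      have lap: "lap (lap u) x = ?T + m"
        using eq x\<Omega> unfolding approx_biharmonic_def m_def nx[symmetric] by blast
      have "norm (a1 x) + norm (b1 x) \<le> s / 12 / norm x ^ 1 \<and> norm (a2 x) + norm (b2 x) \<le> s / 12 / norm x ^ 2 \<and>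
          norm (a3 x) + norm (b3 x) \<le> s / 12 / norm x ^ 3 \<and> norm (a4 x) + norm (b4 x) \<le> s / 12 / norm x ^ 4"
        using eq x\<Omega> unfolding approx_biharmonic_def by blast
      then have co: "norm (a1 x) \<le> s / 12 / norm x" "norm (a2 x) \<le> s / 12 / norm x ^ 2"
          "norm (a3 x) \<le> s / 12 / norm x ^ 3" "norm (a4 x) \<le> s / 12 / norm x ^ 4"
        using norm_ge_zero[of "b1 x"] norm_ge_zero[of "b2 x"] norm_ge_zero[of "b3 x"] norm_ge_zero[of "b4 x"]
        by (simp_all only: power_one_right) linarith+
      note B = local_terms_bound[OF \<Omega> sU u xs _ co]
      have s12: "0 \<le> s / 12" using s0 by simp
      have "Pf (\<lambda>x. u x $ i) x - exp t ^ 4 * m $ i = norm x ^ 4 * ?T $ i" for i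
        unfolding B(2)[OF s12] lap nx by (simp add: algebra_simps)
      then have "(\<Sum>i\<in>UNIV. (Pf (\<lambda>x. u x $ i) x - exp t ^ 4 * m $ i)\<^sup>2) = (\<Sum>i\<in>UNIV. (norm x ^ 4 * ?T $ i)\<^sup>2)"
        by simp
      also have "\<dots> = (norm x ^ 4 * norm ?T)\<^sup>2"
        unfolding power_mult_distrib sum_distrib_left[symmetric] power2_norm_eq_inner[of ?T] inner_vec_def
        by (simp add: power2_eq_square)
      also have "\<dots> \<le> 132 * (s / 12)\<^sup>2 * (\<Sum>i\<in>UNIV. rho (\<lambda>x. u x $ i) x)" by (rule B(1)[OF s12])
      also have "\<dots> \<le> s\<^sup>2 * (\<Sum>i\<in>UNIV. rho (\<lambda>x. u x $ i) x)"
      proof (rule mult_right_mono)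
        \<comment> \<open>This fixes \<eta> = s / 12: 132 < 144.\<close>
        show "132 * (s / 12)\<^sup>2 \<le> s\<^sup>2" by (simp add: power_divide)
        show "0 \<le> (\<Sum>i\<in>UNIV. rho (\<lambda>x. u x $ i) x)"
          unfolding rho_def by (intro sum_nonneg add_nonneg_nonneg) auto
      qed
      finally show "(\<Sum>i\<in>UNIV. (Pf (\<lambda>x. u x $ i) x - exp t ^ 4 * m $ i)\<^sup>2) \<le> s\<^sup>2 * (\<Sum>i\<in>UNIV. rho (\<lambda>x. u x $ i) x)" .
    qed
  qed
  let ?N = "mass (\<lambda>i x. u x $ i)"
  have main: "2 * exp 3 * integral {t0 - 3/2..t0 + 3/2} ?N \<le> integral {t0 - 9/2..t0 - 3/2} ?N + integral {t0 + 3/2..t0 + 9/2} ?N"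
    by (rule three_annuli[where u = "\<lambda>i x. u x $ i", OF ab s0 s1 su m0 eqn s_eq])
  have e: "- real_of_int i * 3 = t0 - 3/2" "- (real_of_int i - 1) * 3 = t0 + 3/2"
    "- real_of_int (i + 1) * 3 = t0 - 9/2" "- (real_of_int (i + 1) - 1) * 3 = t0 - 3/2"
    "- real_of_int (i - 1) * 3 = t0 + 3/2" "- (real_of_int (i - 1) - 1) * 3 = t0 + 9/2"
    unfolding t0_def by (simp_all add: algebra_simps)
  have "F i u = 4 * V4 * integral {t0 - 3/2..t0 + 3/2} ?N"
    using F_polar[of a b u i, OF su] ab unfolding e by simp
  moreover have "F (i + 1) u = 4 * V4 * integral {t0 - 9/2..t0 - 3/2} ?N"
    using F_polar[of a b u "i + 1", OF su] ab unfolding e by simp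
  moreover have "F (i - 1) u = 4 * V4 * integral {t0 + 3/2..t0 + 9/2} ?N"
    using F_polar[of a b u "i - 1", OF su] ab unfolding e by simp
  moreover have "4 * V4 * (2 * exp 3 * integral {t0 - 3/2..t0 + 3/2} ?N)
      \<le> 4 * V4 * (integral {t0 - 9/2..t0 - 3/2} ?N + integral {t0 + 3/2..t0 + 9/2} ?N)"
    by (rule mult_left_mono[OF main]) simp
  ultimately show ?thesis by (simp add: algebra_simps)
qed

lemma F_nonneg: "0 \<le> F i u"
  unfolding F_def set_lebesgue_integral_def by (intro integral_nonneg_AE AE_I2) auto

theorem theorem3p3:
  "\<exists>\<eta>0 > 0. \<forall>(l1::int) (l2::int) (U :: (real^4) set) (u :: real^4 \<Rightarrow> real^'k)
      a1 a2 a3 a4 b1 b2 b3 b4.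
     l1 > l2 \<longrightarrow>
     approx_biharmonic \<eta>0 U (\<Union>i\<in>{l2..l1}. Ann i) u a1 a2 a3 a4 b1 b2 b3 b4 \<longrightarrow>
     {x. exp (- real_of_int l1 * Lc) \<le> norm x \<and> norm x \<le> exp (- (real_of_int l2 - 1) * Lc)} \<subseteq> U \<longrightarrow>
     (\<forall>r\<in>{exp (- real_of_int l1 * Lc) .. exp (- (real_of_int l2 - 1) * Lc)}. ang_int r u = 0) \<longrightarrow>
     (\<forall>i. l2 < i \<and> i < l1 \<longrightarrow>
        (F (i + 1) u \<le> exp (- Lc) * F i u \<longrightarrow> F i u \<le> exp (- Lc) * F (i - 1) u) \<and>
        (F (i - 1) u \<le> exp (- Lc) * F i u \<longrightarrow> F i u \<le> exp (- Lc) * F (i + 1) u) \<and>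
        (F i u \<le> exp (- Lc) * F (i - 1) u \<or> F i u \<le> exp (- Lc) * F (i + 1) u))"
proof -
  define K :: real where "K = 10^10 + 10^13 * 25^8 * exp 60"
  have K: "0 < K" unfolding K_def by (intro add_pos_pos mult_pos_pos) auto
  \<comment> \<open>With this s all error terms of \<open>three_annuli\<close> together stay below
    one percent of the total mass.\<close>
  define s where "s = 1 / K"
  have s: "0 < s" "s * (10^10 + 10^13 * 25^8 * exp 60) = 1" using K unfolding s_def K_def[symmetric] by simp_all
  show ?thesis
  proof (intro exI[of _ "s / 12"] conjI[of "s / 12 > 0"] allI impI)
    show "s / 12 > 0" using s by simp
    fix l1 l2 :: int and U :: "(real^4) set" and u :: "real^4 \<Rightarrow> real^'k" and a1 a2 a3 a4 b1 b2 b3 b4 i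
    assume "approx_biharmonic (s / 12) U (\<Union>i\<in>{l2..l1}. Ann i) u a1 a2 a3 a4 b1 b2 b3 b4"
      "{x. exp (- real_of_int l1 * Lc) \<le> norm x \<and> norm x \<le> exp (- (real_of_int l2 - 1) * Lc)} \<subseteq> U"
      "\<forall>r\<in>{exp (- real_of_int l1 * Lc) .. exp (- (real_of_int l2 - 1) * Lc)}. ang_int r u = 0"
      "l2 < i \<and> i < l1"
    then have conv: "2 * exp 3 * F i u \<le> F (i - 1) u + F (i + 1) u"
      by (intro three_annuli_F[OF s(2)]) auto
    define q where "q = exp (- Lc)"
    have q: "0 < q" "q \<le> 1" unfolding q_def Lc_def by simp_all
    have q3: "q * exp 3 = 1" unfolding q_def Lc_def by (simp add: exp_minus)
    define f where "f = F i u"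
    define g where "g = F (i - 1) u"
    define h where "h = F (i + 1) u"
    have "0 \<le> f" unfolding f_def by (rule F_nonneg)
    have "q * (2 * exp 3 * f) \<le> q * (g + h)" using conv q unfolding f_def g_def h_def by (intro mult_left_mono) auto
    moreover have "q * (2 * exp 3 * f) = 2 * ((q * exp 3) * f)" by (simp only: mult_ac)
    ultimately have main: "2 * f \<le> q * g + q * h" unfolding q3 by (simp add: distrib_left)
    \<comment> \<open>If one neighbour is at most q f, its share in 2 f \<le> q g + q h is at most
      f, which leaves f for the other: (a) and (b). In (c) the larger of q g and q h is at least
      f.\<close>
    have small: "q * y \<le> f" if "y \<le> q * f" for y
    proof -
      have "q * y \<le> q * (q * f)" using that q by (intro mult_left_mono) auto
      also have "\<dots> \<le> 1 * (1 * f)" using q \<open>0 \<le> f\<close> by (intro mult_mono) auto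
      finally show ?thesis by simp
    qed
    show "(F (i + 1) u \<le> exp (- Lc) * F i u \<longrightarrow> F i u \<le> exp (- Lc) * F (i - 1) u) \<and>
        (F (i - 1) u \<le> exp (- Lc) * F i u \<longrightarrow> F i u \<le> exp (- Lc) * F (i + 1) u) \<and>
        (F i u \<le> exp (- Lc) * F (i - 1) u \<or> F i u \<le> exp (- Lc) * F (i + 1) u)"
      unfolding q_def[symmetric] f_def[symmetric] g_def[symmetric] h_def[symmetric]
      using main small[of g] small[of h] by linarith
  qed
qed

end
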